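(* Let $n\ge 3$ and fix $\gamma\in(0,1)$. Then there exist constants $c=c(\gamma,n)>0$ and $C=C(\gamma,n)>0$ such that for every open set $\Omega\subset\mathbb{R}^n$ $$c\, r_{\Omega,\gamma}^{-2}\le \lambda(\Omega)\le C\, r_{\Omega,\gamma}^{-2}.$$ Explicitly, these inequalities hold with $$c(\gamma,n)=\frac{\gamma\, n^2(n-2)}{4(n^2-2)N},\qquad C(\gamma,n)=32\,(1-\gamma)^{-2}\kappa^{-3},\qquad \kappa=\min\left\{\frac{1}{4(n-1)},\ \frac{1-\gamma}{2(4n-5)\gamma}\right\},$$ where $N=N(n)$ is a positive integer such that $\mathbb{R}^n$ can be covered by a countable family of closed balls of equal radius with multiplicity at most $N$.
   Context: $B_r$ denotes an open ball of radius $r>0$ in $\mathbb{R}^n$ (with arbitrary center) and $\bar B_r$ its closure. For an open set $\Omega\subset\mathbb{R}^n$, $\lambda(\Omega)$ is the bottom of the spectrum of the Dirichlet Laplacian $-\Delta$ in $\Omega$ (Friedrichs extension of $-\Delta$ on $C_0^\infty(\Omega)$), i.e. $$\lambda(\Omega)=\inf_{u\in C_0^\infty(\Omega),\,u\not\equiv0}\frac{\int_\Omega|\nabla u|^2dx}{\int_\Omega|u|^2dx}.$$ The Wiener capacity of a compact set $F\subset\mathbb{R}^n$ is $$\mathrm{cap}(F)=\inf\left\{\int_{\mathbb{R}^n}|\nabla u|^2dx \;:\; u:\mathbb{R}^n\to\mathbb{R}\text{ Lipschitz with compact support},\ u|_F=1\right\}.$$ For $\gamma\in(0,1)$, a compact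 set $F\subset\bar B_r$ is called $\gamma$-negligible (in $\bar B_r$) if $\mathrm{cap}(F)\le\gamma\,\mathrm{cap}(\bar B_r)$. The interior capacitary radius of $\Omega$ is $$r_{\Omega,\gamma}=\sup\{r>0 : \text{there is a ball } B_r \text{ such that } \bar B_r\setminus\Omega \text{ is } \gamma\text{-negligible in }\bar B_r\}\in[0,\infty].$$ A covering has multiplicity at most $N$ if each point of $\mathbb{R}^n$ lies in at most $N$ of the balls. Conventions: $\infty^{-2}=0$; in the degenerate case $\Omega=\emptyset$, $\lambda(\Omega)=+\infty$, $r_{\Omega,\gamma}=0$ and $0^{-2}=+\infty$. *)

theory Defs
  imports "HOL-Analysis.Analysis"
begin

definition partial_deriv :: "'a::euclidean_space \<Rightarrow> ('a \<Rightarrow> real) \<Rightarrow> 'a \<Rightarrow> real" where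
  "partial_deriv b u x = deriv (\<lambda>t. u (x + t *\<^sub>R b)) 0"

text \<open>
  For a Lipschitz function the gradient exists almost everywhere. At the remaining points
  a component may be an unspecified value, which does not affect integrals.
\<close>

definition gradient :: "('a::euclidean_space \<Rightarrow> real) \<Rightarrow> 'a \<Rightarrow> 'a" where
  "gradient u x = (\<Sum>b\<in>Basis. partial_deriv b u x *\<^sub>R b)"

lemma gradient_eq_GDERIV:
  fixes u :: "'a::euclidean_space \<Rightarrow> real"
  assumes "GDERIV u x :> D"
  shows "gradient u x = D"
proof -
  have pd: "partial_deriv b u x = D \<bullet> b" for b
  proof -
    have u: "(u has_derivative (\<lambda>h. h \<bullet> D)) (at (x + 0 *\<^sub>R b))"
      using assms by (simp add: gderiv_def)
    have l: "((\<lambda>t. x + t *\<^sub>R b) has_derivative (\<lambda>t. t *\<^sub>R b)) (at (0::real))"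
      by (auto intro!: derivative_eq_intros)
    have "((\<lambda>t. u (x + t *\<^sub>R b)) has_derivative (\<lambda>t. (t *\<^sub>R b) \<bullet> D)) (at 0)"
      using has_derivative_compose[OF l u] by simp
    then have "((\<lambda>t. u (x + t *\<^sub>R b)) has_field_derivative (D \<bullet> b)) (at 0)"
      by (simp add: has_field_derivative_def inner_commute mult_commute_abs)
    then show ?thesis
      unfolding partial_deriv_def by (rule DERIV_imp_deriv)
  qed
  show ?thesis
    by (simp add: gradient_def pd euclidean_representation)
qed

primrec C_k :: "nat \<Rightarrow> ('a::euclidean_space \<Rightarrow> real) \<Rightarrow> bool" where
  "C_k 0 u \<longleftrightarrow> continuous_on UNIV u"
| "C_k (Suc k) u \<longleftrightarrow>
     (\<forall>x. u differentiable (at x)) \<and> (\<forall>b\<in>Basis. C_k k (partial_deriv b u))"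

definition has_compact_support :: "('a::euclidean_space \<Rightarrow> real) \<Rightarrow> bool" where
  "has_compact_support u \<longleftrightarrow> compact (closure {x. u x \<noteq> 0})"

text \<open>Elements of \<open>C\<^sub>0\<^sup>\<infinity>(\<Omega>)\<close> are represented by their extensions by zero to the whole space.\<close>

definition test_functions :: "'a::euclidean_space set \<Rightarrow> ('a \<Rightarrow> real) set" where
  "test_functions \<Omega> =
     {u. (\<forall>k. C_k k u) \<and> has_compact_support u \<and> closure {x. u x \<noteq> 0} \<subseteq> \<Omega>}"

text \<open>
  Since values are taken in \<^typ>\<open>ennreal\<close>, the infimum over the empty set is \<open>\<infinity>\<close>,
  so \<open>\<lambda>(\<emptyset>) = \<infinity>\<close>.
\<close>

definition dirichlet_bottom :: "'a::euclidean_space set \<Rightarrow> ennreal" where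
  "dirichlet_bottom \<Omega> =
     (INF u \<in> {u \<in> test_functions \<Omega>. u \<noteq> (\<lambda>_. 0)}.
        (\<integral>\<^sup>+x\<in>\<Omega>. ennreal ((norm (gradient u x))\<^sup>2) \<partial>lborel) /
        (\<integral>\<^sup>+x\<in>\<Omega>. ennreal (\<bar>u x\<bar>\<^sup>2) \<partial>lborel))"

definition capacity :: "'a::euclidean_space set \<Rightarrow> ennreal" where
  "capacity F =
     (INF u \<in> {u. (\<exists>L. L-lipschitz_on UNIV u) \<and> has_compact_support u \<and> (\<forall>x\<in>F. u x = 1)}.
        \<integral>\<^sup>+x. ennreal ((norm (gradient u x))\<^sup>2) \<partial>lborel)"

definition negligible_in_cball ::
    "real \<Rightarrow> 'a::euclidean_space set \<Rightarrow> 'a \<Rightarrow> real \<Rightarrow> bool" where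
  "negligible_in_cball \<gamma> F a r \<longleftrightarrow>
     compact F \<and> F \<subseteq> cball a r \<and> capacity F \<le> ennreal \<gamma> * capacity (cball a r)"

text \<open>In \<^typ>\<open>ennreal\<close> the supremum of the empty set is \<open>0\<close>.\<close>

definition capacitary_radius :: "'a::euclidean_space set \<Rightarrow> real \<Rightarrow> ennreal" where
  "capacitary_radius \<Omega> \<gamma> =
     (SUP r \<in> {r. r > 0 \<and> (\<exists>a. negligible_in_cball \<gamma> (cball a r - \<Omega>) a r)}. ennreal r)"

text \<open>
  The inverse on \<^typ>\<open>ennreal\<close> satisfies \<open>inverse 0 = \<infinity>\<close> and \<open>inverse \<infinity> = 0\<close>,
  which gives the conventions \<open>0\<^sup>-\<^sup>2 = \<infinity>\<close> and \<open>\<infinity>\<^sup>-\<^sup>2 = 0\<close>.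
\<close>

definition two_sided_bound ::
    "real \<Rightarrow> 'a::euclidean_space set \<Rightarrow> real \<Rightarrow> real \<Rightarrow> bool" where
  "two_sided_bound \<gamma> \<Omega> c C \<longleftrightarrow>
     ennreal c * inverse ((capacitary_radius \<Omega> \<gamma>)\<^sup>2) \<le> dirichlet_bottom \<Omega> \<and>
     dirichlet_bottom \<Omega> \<le> ennreal C * inverse ((capacitary_radius \<Omega> \<gamma>)\<^sup>2)"

text \<open>
  The family of balls of common radius \<open>\<rho>\<close> is given by the set \<open>S\<close> of its centres;
  balls of equal radius are distinct exactly when their centres are.
\<close>

definition ball_covering :: "'a::euclidean_space set \<Rightarrow> real \<Rightarrow> nat \<Rightarrow> bool" where
  "ball_covering S \<rho> N \<longleftrightarrow>
     \<rho> > 0 \<and> countable S \<and> (\<Union>a\<in>S. cball a \<rho>) = UNIV \<and>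
     (\<forall>x. finite {a \<in> S. x \<in> cball a \<rho>} \<and> card {a \<in> S. x \<in> cball a \<rho>} \<le> N)"

definition kappa :: "real \<Rightarrow> nat \<Rightarrow> real" where
  "kappa \<gamma> n =
     min (1 / (4 * (real n - 1))) ((1 - \<gamma>) / (2 * (4 * real n - 5) * \<gamma>))"

definition lower_const :: "real \<Rightarrow> nat \<Rightarrow> nat \<Rightarrow> real" where
  "lower_const \<gamma> n N =
     \<gamma> * (real n)\<^sup>2 * (real n - 2) / (4 * ((real n)\<^sup>2 - 2) * real N)"

definition upper_const :: "real \<Rightarrow> nat \<Rightarrow> real" where
  "upper_const \<gamma> n = 32 / ((1 - \<gamma>)\<^sup>2 * (kappa \<gamma> n) ^ 3)"

end

theory Submission
  imports Defs
begin

text \<open>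
  Lower bound. If \<open>u\<close> vanishes on \<open>F \<subseteq> B\<close>, \<open>B\<close> a ball, then \<open>1 - w / k\<close> equals \<open>1\<close> on \<open>F\<close>,
  where \<open>w\<close> is a smooth version of \<open>\<bar>u\<bar>\<close> and \<open>k\<close> its mean on \<open>B\<close>; its Kelvin extension to the whole space bounds \<open>cap F\<close> by integrals over \<open>B\<close>.
  A Poincare inequality on \<open>B\<close>, with a constant obtained from the Maurey-Pisier rotation of Gaussian vectors,
  turns this into \<open>cap F \<integral>\<^sub>B u\<^sup>2 \<le> C \<integral>\<^sub>B \<bar>\<nabla>u\<bar>\<^sup>2\<close>. If the radius of \<open>B\<close> exceeds the capacitary radius, then \<open>F = B - \<Omega>\<close> is
  not negligible, and summing over a covering by such balls gives the bound.

  Upper bound. If \<open>B - \<Omega>\<close> is negligible, the test function is a regularisation of \<open>\<eta> (1 - \<phi>)\<close>, where \<open>\<phi>\<close> almost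
  realises the capacity of \<open>B - \<Omega>\<close> and \<open>\<eta>\<close> is a radial cutoff. An estimate of the mean of \<open>\<phi>\<close> over a spherical
  shell by its energy, sharp for the equilibrium potential, keeps \<open>1 - \<phi>\<close> away from \<open>0\<close> in the mean.
\<close>

section \<open>Partial derivatives of Lipschitz functions\<close>

text \<open>Two demands shape the development. Since \<open>gradient\<close> is assembled from
  partial derivatives of merely Lipschitz functions, their existence almost everywhere, their
  measurability and the vanishing of their integrals are settled first; every later integration by
  parts is this last fact for a field \<open>w(x) k(|x|) x\<close> with a suitable profile
  \<open>k\<close>. Surface integrals never occur: a boundary term is carried as the integral of a
  divergence over the ball. The constants are explicit. A competitor for \<open>capacity\<close>
  lives on the whole space, but the local estimate may use data on the ball only; the Kelvin
  extension costs at most a second copy of the ball energy and a boundary term, and loses nothing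
  for constants. The part of \<open>u\<close> with mean 0 needs a Poincare constant of order
  \<open>1/n\<close>, which appears when the uniform distribution on the ball is seen as a
  projection of a normalised Gaussian vector in \<open>n + 2\<close> variables. In the upper bound
  \<open>kappa\<close> is the relative width of the cutoff layer. The first term of its minimum
  keeps volumes of thin shells comparable to their width, the second keeps the mean of the potential
  on the next shell away from 1 for \<open>\<gamma>\<close> near 1.\<close>

lemma interval_measure_add_complement:
  fixes F :: "real \<Rightarrow> real"
  assumes mono: "\<And>x y. x \<le> y \<Longrightarrow> F x \<le> F y"
    and lip: "\<And>x y. x \<le> y \<Longrightarrow> F y - F x \<le> C * (y - x)"
    and A: "A \<in> sets borel"
  shows "emeasure (interval_measure F) A + emeasure (interval_measure (\<lambda>x. C * x - F x)) A
      = ennreal C * emeasure lborel A"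
proof -
  \<comment> \<open>\<open>?G\<close> is increasing too. The identity lets an upper bound for its
    measure serve as a lower bound for that of \<open>F\<close>, and it makes both measures vanish
    on Lebesgue null sets.\<close>
  let ?G = "\<lambda>x. C * x - F x"
  have C: "0 \<le> C" using mono[of 0 1] lip[of 0 1] by simp
  have "C-lipschitz_on UNIV F"
  proof (rule lipschitz_onI)
    fix x y :: real
    show "dist (F x) (F y) \<le> C * dist x y"
      using mono[of x y] mono[of y x] lip[of x y] lip[of y x] by (auto simp: dist_real_def abs_if)
  qed (use C in simp)
  then have contF: "continuous_on UNIV F" by (rule lipschitz_on_continuous_on)
  then have contG: "continuous_on UNIV ?G" by (intro continuous_intros)
  have cF: "continuous (at_right a) F" and cG: "continuous (at_right a) ?G" for a
    using contF contG by (metis UNIV_I continuous_on_eq_continuous_within continuous_within_subset subset_UNIV)+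
  have monoG: "?G x \<le> ?G y" if "x \<le> y" for x y
    using lip[OF that] by (simp add: algebra_simps)
  let ?f = "\<lambda>A. emeasure (interval_measure F) A + emeasure (interval_measure ?G) A"
  define M where "M = measure_of UNIV (sets borel) ?f"
  have eM: "emeasure M X = ?f X" if "X \<in> sets borel" for X
    unfolding M_def
  proof (rule emeasure_measure_of_sigma)
    show "sigma_algebra UNIV (sets (borel :: real measure))"
      by (metis sets.sigma_algebra_axioms space_borel)
    show "positive (sets borel) ?f" by (simp add: positive_def)
    show "countably_additive (sets borel) ?f"
      unfolding countably_additive_def
    proof (intro allI impI)
      fix B :: "nat \<Rightarrow> real set"
      assume B: "range B \<subseteq> sets borel" "disjoint_family B" "\<Union> (range B) \<in> sets borel"
      have "(\<Sum>i. ?f (B i)) = (\<Sum>i. emeasure (interval_measure F) (B i)) + (\<Sum>i. emeasure (interval_measure ?G) (B i))"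
        by (rule suminf_add[symmetric]) (auto intro: summableI)
      then show "(\<Sum>i. ?f (B i)) = ?f (\<Union> (range B))"
        using B by (simp add: suminf_emeasure)
    qed
  qed (use that in simp)
  have sM: "sets M = sets borel"
    unfolding M_def by (metis sets.sigma_sets_eq sets.space_closed sets_measure_of space_borel)
  \<comment> \<open>On \<open>{a<..b}\<close> the increments of \<open>F\<close> and
    \<open>?G\<close> add up to \<open>C * (b - a)\<close>; the half-open intervals generate the
    Borel sets and are stable under intersection.\<close>
  have "M = density lborel (\<lambda>_. ennreal C)"
  proof (rule measure_eqI_generator_eq[where E="range (\<lambda>(a,b). {a<..b::real})" and \<Omega>=UNIV and A="\<lambda>n. {-real n<..real n}"])
    show "Int_stable (range (\<lambda>(a, b). {a<..b::real}))"
      by (auto simp: Int_stable_def)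
    show "emeasure M X = emeasure (density lborel (\<lambda>_. ennreal C)) X" if Xr: "X \<in> range (\<lambda>(a, b). {a<..b})" for X
    proof -
      obtain ab where "X = (case ab of (a, b) \<Rightarrow> {a<..b})" using Xr by blast
      then obtain a b where X: "X = {a<..b}" by (cases ab) auto
      have "0 \<le> F b - F a" "0 \<le> ?G b - ?G a" if "a \<le> b" using mono[OF that] monoG[OF that] by auto
      moreover have "emeasure (interval_measure F) X = (if a \<le> b then ennreal (F b - F a) else 0)"
          "emeasure (interval_measure ?G) X = (if a \<le> b then ennreal (?G b - ?G a) else 0)"
        unfolding X by (simp_all only: emeasure_interval_measure_Ioc_eq[OF mono cF] emeasure_interval_measure_Ioc_eq[OF monoG cG] if_distrib[of ennreal] ennreal_0)
      ultimately have "?f X = ennreal C * emeasure lborel X"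
        using C unfolding X
        by (auto simp: ennreal_plus[symmetric] ennreal_mult[symmetric] algebra_simps simp del: ennreal_plus)
      then show ?thesis using X by (simp add: eM emeasure_density_const)
    qed
    show "sets M = sigma_sets UNIV (range (\<lambda>(a, b). {a<..b::real}))"
      by (simp add: sM borel_sigma_sets_Ioc)
    show "sets (density lborel (\<lambda>_. ennreal C)) = sigma_sets UNIV (range (\<lambda>(a, b). {a<..b::real}))"
      by (simp add: borel_sigma_sets_Ioc)
    show "(\<Union>n. {- real n<..real n}) = UNIV"
    proof -
      have "\<exists>n. x \<in> {-real n<..real n}" for x :: real
        by (metis (full_types) abs_less_iff greaterThanAtMost_iff less_imp_le minus_less_iff reals_Archimedean2)
      then show ?thesis by auto
    qed
    show "emeasure M {- real i<..real i} \<noteq> \<infinity>" for i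
      by (simp add: eM emeasure_interval_measure_Ioc_eq[OF mono cF] emeasure_interval_measure_Ioc_eq[OF monoG cG])
  qed auto
  then show ?thesis using A eM[OF A] by (simp add: emeasure_density_const)
qed

text \<open>A Vitali argument. Short intervals of slope at most \<open>p\<close> around the points
  of \<open>A\<close>, taken inside an open set only slightly larger than \<open>A\<close>, have a
  disjoint subfamily that covers \<open>A\<close> up to a Lebesgue null set. This remainder is null
  for the measure of \<open>F\<close> as well, and on each interval that measure is the increment of
  \<open>F\<close>.\<close>

lemma interval_measure_le_slope:
  fixes F :: "real \<Rightarrow> real"
  assumes mono: "\<And>x y. x \<le> y \<Longrightarrow> F x \<le> F y"
    and lip: "\<And>x y. x \<le> y \<Longrightarrow> F y - F x \<le> C * (y - x)"
    and A: "A \<in> sets borel" and p: "0 \<le> p"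
    and slope: "\<And>x d. x \<in> A \<Longrightarrow> 0 < d \<Longrightarrow>
      \<exists>s t. s \<le> x \<and> x \<le> t \<and> s < t \<and> t - s < d \<and> F t - F s \<le> p * (t - s)"
  shows "emeasure (interval_measure F) A \<le> ennreal p * emeasure lborel A"
proof (rule ennreal_le_epsilon)
  fix e :: real assume e: "0 < e"
  let ?\<nu> = "interval_measure F"
  have C: "0 \<le> C" using mono[of 0 1] lip[of 0 1] by simp
  have "C-lipschitz_on UNIV F"
  proof (rule lipschitz_onI)
    fix x y :: real
    show "dist (F x) (F y) \<le> C * dist x y"
      using mono[of x y] mono[of y x] lip[of x y] lip[of y x] by (auto simp: dist_real_def abs_if)
  qed (use C in simp)
  then have contF: "continuous_on UNIV F" by (rule lipschitz_on_continuous_on)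
  \<comment> \<open>The summand \<open>1\<close> takes care of \<open>p = 0\<close>.\<close>
  define e' where "e' = e / (p + 1)"
  have e': "0 < e'" "p * e' \<le> e" using e p by (auto simp: e'_def field_simps)
  obtain T where T: "open T" "A \<subseteq> T" "emeasure lebesgue (T - A) < ennreal e'"
    using sets_lebesgue_outer_open[of A e'] A e' by (metis lborelD sets_completionI_sets sets_lborel)
  have TA: "emeasure lborel (T - A) \<le> ennreal e'"
    using T A by (auto simp: order.strict_iff_order)
  \<comment> \<open>An interval is encoded by centre and radius, the form in which the covering
    theorem takes balls.\<close>
  define K where "K = {(c,r). 0 < r \<and> cball c r \<subseteq> T \<and> F (c + r) - F (c - r) \<le> p * (2 * r)}"
  obtain D where D: "countable D" "D \<subseteq> K"
      "pairwise (\<lambda>i j. disjnt (cball (fst i) (snd i)) (cball (fst j) (snd j))) D"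
      "negligible (A - (\<Union>i\<in>D. cball (fst i) (snd i)))"
  proof (rule Vitali_covering_theorem_cballs[where K=K and a=fst and r=snd and S=A])
    show "0 < snd i" if "i \<in> K" for i using that by (auto simp: K_def)
    fix x d :: real assume x: "x \<in> A" and d: "0 < d"
    obtain \<eta> where \<eta>: "\<eta> > 0" "ball x \<eta> \<subseteq> T" using T x by (meson openE subsetD)
    obtain s t where st: "s \<le> x" "x \<le> t" "s < t" "t - s < min d \<eta>" "F t - F s \<le> p * (t - s)"
      using slope[OF x, of "min d \<eta>"] d \<eta> by auto
    let ?i = "((s + t) / 2, (t - s) / 2)"
    have cb: "cball (fst ?i) (snd ?i) = {s..t}"
      by (auto simp: cball_eq_atLeastAtMost field_simps)
    have "{s..t} \<subseteq> ball x \<eta>" using st by (auto simp: dist_real_def)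
    moreover have "fst ?i + snd ?i = t" "fst ?i - snd ?i = s" by (auto simp: field_simps)
    moreover have "2 * snd ?i = t - s" by simp
    ultimately have "?i \<in> K" using st cb \<eta>
      unfolding K_def by (smt (verit) case_prod_beta mem_Collect_eq subset_trans)
    then show "\<exists>i. i \<in> K \<and> x \<in> cball (fst i) (snd i) \<and> snd i < d"
      using st cb by (intro exI[of _ ?i]) auto
  qed
  let ?U = "\<Union>i\<in>D. cball (fst i) (snd i)"
  have U: "?U \<in> sets borel" using D(1) by (intro sets.countable_UN') auto
  have dis: "disjoint_family_on (\<lambda>i. cball (fst i) (snd i)) D"
    using D(3) by (auto simp: disjoint_family_on_def pairwise_def disjnt_def)
  have "emeasure lborel (A - ?U) = 0"
  proof -
    have "A - ?U \<in> null_sets lebesgue" using D(4) by (simp only: negligible_iff_null_sets)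
    moreover have "A - ?U \<in> sets lborel" using A U by (simp only: sets_lborel sets.Diff)
    ultimately have "A - ?U \<in> null_sets lborel" by (simp only: null_sets_completion_iff)
    then show ?thesis by (rule null_setsD1)
  qed
  then have "emeasure ?\<nu> (A - ?U) + emeasure (interval_measure (\<lambda>x. C * x - F x)) (A - ?U) = 0"
    using interval_measure_add_complement[OF mono lip, of "A - ?U"] A U by auto
  then have n0: "emeasure ?\<nu> (A - ?U) = 0" by simp
  have "emeasure ?\<nu> A \<le> emeasure ?\<nu> (?U \<union> (A - ?U))"
    using A U by (intro emeasure_mono) auto
  also have "\<dots> \<le> emeasure ?\<nu> ?U + emeasure ?\<nu> (A - ?U)"
    using A U by (intro emeasure_subadditive) auto
  also have "\<dots> = (\<integral>\<^sup>+i. emeasure ?\<nu> (cball (fst i) (snd i)) \<partial>count_space D)"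
    using n0 dis D(1) by (simp add: emeasure_UN_countable)
  also have "\<dots> \<le> (\<integral>\<^sup>+i. ennreal p * emeasure lborel (cball (fst i) (snd i)) \<partial>count_space D)"
  proof (rule nn_integral_mono)
    fix i assume "i \<in> space (count_space D)"
    then have i: "0 < snd i" "F (fst i + snd i) - F (fst i - snd i) \<le> p * (2 * snd i)"
      using D(2) by (auto simp: K_def)
    have "emeasure ?\<nu> (cball (fst i) (snd i)) = ennreal (F (fst i + snd i) - F (fst i - snd i))"
      using i by (simp add: cball_eq_atLeastAtMost emeasure_interval_measure_Icc mono contF)
    also have "\<dots> \<le> ennreal (p * (2 * snd i))" using i by (intro ennreal_leI)
    also have "\<dots> = ennreal p * emeasure lborel (cball (fst i) (snd i))"
      using i p by (simp add: cball_eq_atLeastAtMost ennreal_mult)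
    finally show "emeasure ?\<nu> (cball (fst i) (snd i)) \<le> ennreal p * emeasure lborel (cball (fst i) (snd i))" .
  qed
  also have "\<dots> = ennreal p * emeasure lborel ?U"
    using dis D(1) by (simp add: emeasure_UN_countable nn_integral_cmult)
  also have "\<dots> \<le> ennreal p * emeasure lborel (A \<union> (T - A))"
  proof -
    have "cball (fst i) (snd i) \<subseteq> T" if "i \<in> D" for i
      using subsetD[OF D(2) that] by (auto simp: K_def)
    then have "?U \<subseteq> A \<union> (T - A)" by blast
    then show ?thesis using T A by (intro mult_left_mono emeasure_mono) auto
  qed
  also have "\<dots> \<le> ennreal p * (emeasure lborel A + ennreal e')"
    using T A TA by (intro mult_left_mono order_trans[OF emeasure_subadditive]) auto
  also have "\<dots> = ennreal p * emeasure lborel A + ennreal (p * e')"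
    using p e' by (simp add: distrib_left ennreal_mult)
  also have "\<dots> \<le> ennreal p * emeasure lborel A + ennreal e"
    using e' by (intro add_left_mono ennreal_leI) auto
  finally show "emeasure ?\<nu> A \<le> ennreal p * emeasure lborel A + ennreal e" .
qed

text \<open>The slope estimate is used twice: for \<open>F\<close> with \<open>p\<close>, and for
  \<open>C * x - F x\<close> with \<open>C - q\<close>, where large slopes of \<open>F\<close> have
  become small ones. Adding up gives \<open>C |A| \<le> (p + C - q) |A|\<close>, and
  \<open>p < q\<close> leaves only \<open>|A| = 0\<close>; finiteness of \<open>|A|\<close> permits
  the cancellation.\<close>

lemma oscillating_slopes_null_aux:
  fixes F :: "real \<Rightarrow> real"
  assumes mono: "\<And>x y. x \<le> y \<Longrightarrow> F x \<le> F y"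
    and lip: "\<And>x y. x \<le> y \<Longrightarrow> F y - F x \<le> C * (y - x)"
    and A: "A \<in> sets borel" and fin: "emeasure lborel A < \<infinity>" and pq: "p < q"
    and slope1: "\<And>x d. x \<in> A \<Longrightarrow> 0 < d \<Longrightarrow>
      \<exists>s t. s \<le> x \<and> x \<le> t \<and> s < t \<and> t - s < d \<and> F t - F s \<le> p * (t - s)"
    and slope2: "\<And>x d. x \<in> A \<Longrightarrow> 0 < d \<Longrightarrow>
      \<exists>s t. s \<le> x \<and> x \<le> t \<and> s < t \<and> t - s < d \<and> q * (t - s) \<le> F t - F s"
  shows "emeasure lborel A = 0"
proof (cases "A = {}")
  case False
  then obtain x where x: "x \<in> A" by auto
  have C: "0 \<le> C" using mono[of 0 1] lip[of 0 1] by simp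
  have p: "0 \<le> p"
  proof -
    obtain s t where "s < t" "F t - F s \<le> p * (t - s)" using slope1[OF x, of 1] by auto
    then have "0 \<le> p * (t - s)" "0 < t - s" using mono[of s t] by auto
    then show ?thesis by (simp add: zero_le_mult_iff)
  qed
  have q: "0 \<le> C - q"
  proof -
    obtain s t where "s < t" "q * (t - s) \<le> F t - F s" using slope2[OF x, of 1] by auto
    then have "0 \<le> (C - q) * (t - s)" "0 < t - s" using lip[of s t] by (auto simp: algebra_simps)
    then show ?thesis by (simp add: zero_le_mult_iff)
  qed
  let ?G = "\<lambda>x. C * x - F x"
  have "ennreal C * emeasure lborel A = emeasure (interval_measure F) A + emeasure (interval_measure ?G) A"
    using interval_measure_add_complement[OF mono lip A] by simp
  also have "\<dots> \<le> ennreal p * emeasure lborel A + ennreal (C - q) * emeasure lborel A"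
  proof (rule add_mono)
    show "emeasure (interval_measure F) A \<le> ennreal p * emeasure lborel A"
      by (rule interval_measure_le_slope[OF mono lip A p slope1])
    show "emeasure (interval_measure ?G) A \<le> ennreal (C - q) * emeasure lborel A"
    proof (rule interval_measure_le_slope[OF _ _ A q])
      show "?G x \<le> ?G y" if "x \<le> y" for x y using lip[OF that] by (simp add: algebra_simps)
      show "?G y - ?G x \<le> C * (y - x)" if "x \<le> y" for x y using mono[OF that] by (simp add: algebra_simps)
      show "\<exists>s t. s \<le> x \<and> x \<le> t \<and> s < t \<and> t - s < d \<and> ?G t - ?G s \<le> (C - q) * (t - s)"
        if xd: "x \<in> A" "0 < d" for x d
      proof -
        obtain s t where "s \<le> x" "x \<le> t" "s < t" "t - s < d" "q * (t - s) \<le> F t - F s"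
          using slope2[OF xd] by auto
        then show ?thesis by (intro exI[of _ s] exI[of _ t]) (auto simp: algebra_simps)
      qed
    qed
  qed
  finally have le: "ennreal C * emeasure lborel A \<le> ennreal p * emeasure lborel A + ennreal (C - q) * emeasure lborel A" .
  obtain l where l: "emeasure lborel A = ennreal l" "0 \<le> l" using fin by (cases "emeasure lborel A") auto
  have "C * l \<le> p * l + (C - q) * l"
    using le C p q l by (simp add: ennreal_mult[symmetric] ennreal_plus[symmetric] del: ennreal_plus)
  then have "(q - p) * l \<le> 0" by (simp add: algebra_simps)
  then have "l \<le> 0" using pq by (simp add: mult_le_0_iff)
  then show ?thesis using l by simp
qed simp

text \<open>Adding \<open>L * x\<close> makes a Lipschitz function increasing and shifts all slopes
  by \<open>L\<close>; intersecting with bounded intervals supplies finite measure.\<close>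

lemma oscillating_slopes_null:
  fixes f :: "real \<Rightarrow> real"
  assumes L: "L-lipschitz_on UNIV f" and A: "A \<in> sets borel" and pq: "p < q"
    and slope1: "\<And>x d. x \<in> A \<Longrightarrow> 0 < d \<Longrightarrow> \<exists>h. h \<noteq> 0 \<and> \<bar>h\<bar> < d \<and> (f (x + h) - f x) / h < p"
    and slope2: "\<And>x d. x \<in> A \<Longrightarrow> 0 < d \<Longrightarrow> \<exists>h. h \<noteq> 0 \<and> \<bar>h\<bar> < d \<and> q < (f (x + h) - f x) / h"
  shows "emeasure lborel A = 0"
proof -
  let ?F = "\<lambda>x. f x + L * x"
  have abs_le: "\<bar>f y - f x\<bar> \<le> L * (y - x)" if "x \<le> y" for x y
    using lipschitz_onD[OF L, of y x] that by (simp add: dist_real_def)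
  have mono: "?F x \<le> ?F y" if "x \<le> y" for x y
    using abs_le[OF that] by (simp add: algebra_simps abs_le_iff)
  have lip: "?F y - ?F x \<le> (2 * L) * (y - x)" if "x \<le> y" for x y
    using abs_le[OF that] by (simp add: algebra_simps abs_le_iff)
  \<comment> \<open>A difference quotient with a step \<open>h\<close> of either sign is the slope
    over an interval that has \<open>x\<close> as an endpoint.\<close>
  have ends: "\<exists>s t. s \<le> x \<and> x \<le> t \<and> s < t \<and> t - s = \<bar>h\<bar> \<and>
      (f (x + h) - f x) / h + L = (?F t - ?F s) / (t - s)" if "h \<noteq> 0" for x h :: real
  proof (cases "0 < h")
    case True
    then show ?thesis by (intro exI[of _ x] exI[of _ "x + h"]) (auto simp: field_simps)
  next
    case False
    then show ?thesis using that
      by (intro exI[of _ "x + h"] exI[of _ x]) (auto simp: field_simps)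
  qed
  have "emeasure lborel (A \<inter> {- real n..real n}) = 0" for n
  proof (rule oscillating_slopes_null_aux[OF mono lip, where p="p + L" and q="q + L"])
    show "emeasure lborel (A \<inter> {- real n..real n}) < \<infinity>"
      by (rule order.strict_trans1[OF emeasure_mono[of _ "{- real n..real n}"]]) auto
    show "\<exists>s t. s \<le> x \<and> x \<le> t \<and> s < t \<and> t - s < d \<and> ?F t - ?F s \<le> (p + L) * (t - s)"
      if xd: "x \<in> A \<inter> {- real n..real n}" "0 < d" for x d
    proof -
      obtain h where h: "h \<noteq> 0" "\<bar>h\<bar> < d" "(f (x + h) - f x) / h < p" using slope1[of x d] xd by auto
      obtain s t where st: "s \<le> x" "x \<le> t" "s < t" "t - s = \<bar>h\<bar>"
          "(f (x + h) - f x) / h + L = (?F t - ?F s) / (t - s)" using ends[OF h(1)] by blast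
      then have "(?F t - ?F s) / (t - s) \<le> p + L" using h by simp
      then show ?thesis using st h by (intro exI[of _ s] exI[of _ t]) (simp add: pos_divide_le_eq)
    qed
    show "\<exists>s t. s \<le> x \<and> x \<le> t \<and> s < t \<and> t - s < d \<and> (q + L) * (t - s) \<le> ?F t - ?F s"
      if xd: "x \<in> A \<inter> {- real n..real n}" "0 < d" for x d
    proof -
      obtain h where h: "h \<noteq> 0" "\<bar>h\<bar> < d" "q < (f (x + h) - f x) / h" using slope2[of x d] xd by auto
      obtain s t where st: "s \<le> x" "x \<le> t" "s < t" "t - s = \<bar>h\<bar>"
          "(f (x + h) - f x) / h + L = (?F t - ?F s) / (t - s)" using ends[OF h(1)] by blast
      then have "q + L \<le> (?F t - ?F s) / (t - s)" using h by simp
      then show ?thesis using st h by (intro exI[of _ s] exI[of _ t]) (simp add: pos_le_divide_eq)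
    qed
  qed (use A pq in auto)
  then have "emeasure lborel (\<Union>n. A \<inter> {- real n..real n}) = 0"
    using A by (intro emeasure_UN_eq_0) auto
  moreover have "(\<Union>n. A \<inter> {- real n..real n}) = A"
  proof -
    have "\<exists>n. x \<in> {-real n..real n}" for x :: real
      by (metis abs_le_iff atLeastAtMost_iff minus_le_iff real_arch_simple)
    then show ?thesis by auto
  qed
  ultimately show ?thesis by simp
qed

text \<open>The exceptional set is a countable union of sets of the form \<open>E\<close>; on every line in
  direction \<open>b\<close> these are null by the one-dimensional result, and translation invariance in
  direction \<open>b\<close> turns this into a statement about the whole space without choosing coordinates.\<close>

lemma line_preimage_borel:
  fixes x b :: "'a::euclidean_space"
  assumes "N \<in> sets borel" shows "{t. x + t *\<^sub>R b \<in> N} \<in> sets borel"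
proof -
  have "(\<lambda>t. x + t *\<^sub>R b) -` N \<inter> space borel \<in> sets borel"
    by (rule measurable_sets[OF _ assms]) measurable
  then show ?thesis by (simp add: vimage_def)
qed

text \<open>All translates of \<open>N\<close> along \<open>b\<close> have the measure of
  \<open>N\<close>. Averaging over the parameter in \<open>{0..1}\<close> and exchanging the
  integrals leaves the measures of the sections along lines, which vanish.\<close>

lemma AE_lborel_line_average:
  fixes b :: "'a::euclidean_space"
  assumes N: "N \<in> sets borel"
    and line: "\<And>x. emeasure lborel {t. x + t *\<^sub>R b \<in> N} = 0"
  shows "emeasure lborel N = 0"
proof -
  have meas: "(\<lambda>(x, t). indicator N (x + t *\<^sub>R b) :: ennreal) \<in> borel_measurable (lborel \<Otimes>\<^sub>M (lborel :: real measure))"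
    using N by measurable
  have tr: "(\<integral>\<^sup>+x. indicator N (x + t *\<^sub>R b) \<partial>lborel) = emeasure lborel N" for t :: real
  proof -
    have "emeasure lborel N = (\<integral>\<^sup>+x. indicator N x \<partial>distr lborel borel ((+) (t *\<^sub>R b)))"
      using N by (simp add: lborel_distr_plus)
    also have "\<dots> = (\<integral>\<^sup>+x. indicator N (x + t *\<^sub>R b) \<partial>lborel)"
      using N by (subst nn_integral_distr) (auto simp: add.commute)
    finally show ?thesis by simp
  qed
  have zero: "(\<integral>\<^sup>+t. indicator N (x + t *\<^sub>R b) \<partial>lborel) = 0" for x
  proof -
    have "(\<integral>\<^sup>+t. indicator N (x + t *\<^sub>R b) \<partial>lborel) = (\<integral>\<^sup>+t. indicator {t. x + t *\<^sub>R b \<in> N} t \<partial>lborel)"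
      by (intro nn_integral_cong) (auto simp: indicator_def)
    also have "\<dots> = emeasure lborel {t. x + t *\<^sub>R b \<in> N}"
      using line_preimage_borel[OF N] by (intro nn_integral_indicator) simp
    finally show ?thesis using line by simp
  qed
  have "emeasure lborel N = (\<integral>\<^sup>+t. emeasure lborel N * indicator {0..1::real} t \<partial>lborel)"
    by (simp add: nn_integral_cmult)
  also have "\<dots> = (\<integral>\<^sup>+t. (\<integral>\<^sup>+x. indicator N (x + t *\<^sub>R b) \<partial>lborel) * indicator {0..1::real} t \<partial>lborel)"
    by (simp add: tr)
  also have "\<dots> \<le> (\<integral>\<^sup>+t. (\<integral>\<^sup>+x. indicator N (x + t *\<^sub>R b) \<partial>lborel) \<partial>lborel)"
    by (intro nn_integral_mono) (auto simp: indicator_def)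
  also have "\<dots> = (\<integral>\<^sup>+x. (\<integral>\<^sup>+t. indicator N (x + t *\<^sub>R b) \<partial>lborel) \<partial>lborel)"
    by (rule lborel_pair.Fubini'[OF meas])
  finally show ?thesis using zero by simp
qed

section \<open>Difference quotients and existence of directional derivatives\<close>

definition has_partial :: "'a::euclidean_space \<Rightarrow> ('a \<Rightarrow> real) \<Rightarrow> 'a \<Rightarrow> real \<Rightarrow> bool" where
  "has_partial b u x D \<longleftrightarrow> ((\<lambda>t. u (x + t *\<^sub>R b)) has_real_derivative D) (at 0)"

text \<open>Encoded as a countable intersection over bounds for the step, so as to be Borel: for
  continuous \<open>u\<close> and an open condition \<open>P\<close> each union is open, although it
  runs over uncountably many \<open>h\<close>.\<close>

definition slope_set :: "'a::euclidean_space \<Rightarrow> ('a \<Rightarrow> real) \<Rightarrow> (real \<Rightarrow> bool) \<Rightarrow> 'a set" where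
  "slope_set b u P = (\<Inter>n. \<Union>h\<in>{h. h \<noteq> 0 \<and> \<bar>h\<bar> < 1 / real (Suc n)}. {x. P ((u (x + h *\<^sub>R b) - u x) / h)})"

lemma slope_set_iff:
  "x \<in> slope_set b u P \<longleftrightarrow> (\<forall>d>0. \<exists>h. h \<noteq> 0 \<and> \<bar>h\<bar> < d \<and> P ((u (x + h *\<^sub>R b) - u x) / h))"
proof
  assume *: "x \<in> slope_set b u P"
  show "\<forall>d>0. \<exists>h. h \<noteq> 0 \<and> \<bar>h\<bar> < d \<and> P ((u (x + h *\<^sub>R b) - u x) / h)"
  proof (intro allI impI)
    fix d :: real assume "0 < d"
    then obtain n where n: "1 / real (Suc n) < d" using nat_approx_posE by blast
    have "x \<in> (\<Union>h\<in>{h. h \<noteq> 0 \<and> \<bar>h\<bar> < 1 / real (Suc n)}. {x. P ((u (x + h *\<^sub>R b) - u x) / h)})"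
      using * unfolding slope_set_def by blast
    then show "\<exists>h. h \<noteq> 0 \<and> \<bar>h\<bar> < d \<and> P ((u (x + h *\<^sub>R b) - u x) / h)"
      using n less_trans by blast
  qed
next
  assume "\<forall>d>0. \<exists>h. h \<noteq> 0 \<and> \<bar>h\<bar> < d \<and> P ((u (x + h *\<^sub>R b) - u x) / h)"
  then have "\<exists>h. h \<noteq> 0 \<and> \<bar>h\<bar> < 1 / real (Suc n) \<and> P ((u (x + h *\<^sub>R b) - u x) / h)" for n
    by simp
  then show "x \<in> slope_set b u P"
    unfolding slope_set_def by blast
qed

lemma slope_set_borel:
  assumes u: "continuous_on UNIV u" and P: "open {y. P y}"
  shows "slope_set b u P \<in> sets borel"
proof -
  have "open {x. P ((u (x + h *\<^sub>R b) - u x) / h)}" if "h \<noteq> 0" for h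
  proof -
    have "continuous_on UNIV (\<lambda>x. (u (x + h *\<^sub>R b) - u x) / h)"
      using that by (intro continuous_intros continuous_on_compose2[OF u]) auto
    from open_vimage[OF P this] show ?thesis by (simp add: vimage_def)
  qed
  then have "open (\<Union>h\<in>{h. h \<noteq> 0 \<and> \<bar>h\<bar> < 1 / real (Suc n)}. {x. P ((u (x + h *\<^sub>R b) - u x) / h)})" for n
    by auto
  then show ?thesis unfolding slope_set_def by (intro sets.countable_INT) auto
qed

text \<open>The derivative fails to exist exactly when the lower and the upper limit of the
  difference quotients can be separated by two rationals; the Lipschitz bound excludes infinite
  limits.\<close>

lemma has_partial_iff_slopes:
  assumes L: "L-lipschitz_on UNIV u"
  shows "(\<exists>D. has_partial b u x D) \<longleftrightarrow>
    x \<notin> (\<Union>p\<in>\<rat>. \<Union>q\<in>\<rat> \<inter> {p<..}. slope_set b u (\<lambda>y. y < p) \<inter> slope_set b u (\<lambda>y. q < y))"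
    (is "?l \<longleftrightarrow> x \<notin> ?R")
proof
  assume ?l
  then obtain D where D: "((\<lambda>h. (u (x + h *\<^sub>R b) - u x) / h) \<longlongrightarrow> D) (at 0)"
    by (auto simp: has_partial_def DERIV_def)
  show "x \<notin> ?R"
  proof
    assume "x \<in> ?R"
    then obtain p q where pq: "p < q" "x \<in> slope_set b u (\<lambda>y. y < p)" "x \<in> slope_set b u (\<lambda>y. q < y)" by auto
    define e where "e = (q - p) / 2"
    have "0 < e" using pq by (simp add: e_def)
    then obtain d where d: "d > 0" "\<And>h. h \<noteq> 0 \<Longrightarrow> \<bar>h\<bar> < d \<Longrightarrow> \<bar>(u (x + h *\<^sub>R b) - u x) / h - D\<bar> < e"
      using D unfolding LIM_eq by (metis diff_zero real_norm_def)
    obtain h where h: "h \<noteq> 0" "\<bar>h\<bar> < d" "(u (x + h *\<^sub>R b) - u x) / h < p"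
      using pq(2) d(1) unfolding slope_set_iff by blast
    obtain k where k: "k \<noteq> 0" "\<bar>k\<bar> < d" "q < (u (x + k *\<^sub>R b) - u x) / k"
      using pq(3) d(1) unfolding slope_set_iff by blast
    have "D < p + e" "q - e < D" using d(2)[OF h(1,2)] d(2)[OF k(1,2)] h k by linarith+
    then show False by (simp add: e_def field_simps)
  qed
next
  assume R: "x \<notin> ?R"
  let ?s = "\<lambda>h. (u (x + h *\<^sub>R b) - u x) / h"
  have bd: "\<bar>?s h\<bar> \<le> L * norm b" if "h \<noteq> 0" for h
    using lipschitz_onD[OF L, of "x + h *\<^sub>R b" x] that
    by (simp add: dist_norm abs_mult divide_simps mult.assoc mult.left_commute mult.commute)
  define I where "I = Liminf (at 0) (\<lambda>h. ereal (?s h))"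
  define S where "S = Limsup (at 0) (\<lambda>h. ereal (?s h))"
  have ev: "eventually (\<lambda>h. \<bar>?s h\<bar> \<le> L * norm b) (at 0)"
    using bd by (auto simp: eventually_at intro!: exI[of _ 1])
  have IS: "I \<le> S" unfolding I_def S_def by (rule Liminf_le_Limsup) simp
  have S1: "S \<le> ereal (L * norm b)"
    unfolding S_def by (rule Limsup_bounded, rule eventually_mono[OF ev]) (simp only: ereal_less_eq abs_le_iff)
  have I1: "ereal (- (L * norm b)) \<le> I"
    unfolding I_def by (rule Liminf_bounded, rule eventually_mono[OF ev]) (simp only: ereal_less_eq abs_le_iff, linarith)
  have "\<not> I < S"
  proof
    assume "I < S"
    then obtain p where p: "I < ereal (of_rat p)" "ereal (of_rat p) < S" using ereal_dense3 by blast
    then obtain q where q: "ereal (of_rat p) < ereal (of_rat q)" "ereal (of_rat q) < S" using ereal_dense3 by blast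
    have "x \<in> slope_set b u (\<lambda>y. y < of_rat p)"
    proof (rule ccontr)
      assume "x \<notin> slope_set b u (\<lambda>y. y < of_rat p)"
      then obtain d where d: "d > 0" "\<And>h. h \<noteq> 0 \<Longrightarrow> \<bar>h\<bar> < d \<Longrightarrow> of_rat p \<le> ?s h"
        unfolding slope_set_iff by (metis not_less)
      then have "eventually (\<lambda>h. ereal (of_rat p) \<le> ereal (?s h)) (at 0)"
        by (auto simp: eventually_at dist_real_def intro!: exI[of _ d])
      then have "ereal (of_rat p) \<le> I" unfolding I_def by (rule Liminf_bounded)
      then show False using p by simp
    qed
    moreover have "x \<in> slope_set b u (\<lambda>y. of_rat q < y)"
    proof (rule ccontr)
      assume "x \<notin> slope_set b u (\<lambda>y. of_rat q < y)"
      then obtain d where d: "d > 0" "\<And>h. h \<noteq> 0 \<Longrightarrow> \<bar>h\<bar> < d \<Longrightarrow> ?s h \<le> of_rat q"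
        unfolding slope_set_iff by (metis not_less)
      then have "eventually (\<lambda>h. ereal (?s h) \<le> ereal (of_rat q)) (at 0)"
        by (auto simp: eventually_at dist_real_def intro!: exI[of _ d])
      then have "S \<le> ereal (of_rat q)" unfolding S_def by (rule Limsup_bounded)
      then show False using q by simp
    qed
    ultimately have "x \<in> ?R" using q(1) by (intro UN_I[of "of_rat p"] UN_I[of "of_rat q"]) auto
    then show False using R by simp
  qed
  then have eq: "I = S" using IS by auto
  obtain D where "S = ereal D" using S1 I1 eq by (cases S) auto
  then have "((\<lambda>h. ereal (?s h)) \<longlongrightarrow> ereal D) (at 0)"
    using eq by (intro Liminf_eq_Limsup) (auto simp: I_def S_def)
  then have "has_partial b u x D" by (simp add: has_partial_def DERIV_def)
  then show ?l by blast
qed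

lemma has_partial_imp_partial_deriv:
  assumes "has_partial b u x D" shows "partial_deriv b u x = D"
  using assms unfolding has_partial_def partial_deriv_def by (rule DERIV_imp_deriv)

lemma nonpartial_set_borel:
  assumes L: "L-lipschitz_on UNIV u"
  shows "{x. \<nexists>D. has_partial b u x D} \<in> sets borel"
proof -
  have "continuous_on UNIV u" using L by (rule lipschitz_on_continuous_on)
  then have "slope_set b u (\<lambda>y. y < p) \<in> sets borel" "slope_set b u (\<lambda>y. q < y) \<in> sets borel" for p q
    by (auto intro!: slope_set_borel simp: open_Collect_less)
  then have 1: "slope_set b u (\<lambda>y. y < p) \<inter> slope_set b u (\<lambda>y. q < y) \<in> sets borel" for p q
    by (rule sets.Int)
  have 2: "(\<Union>q\<in>\<rat> \<inter> {p<..}. slope_set b u (\<lambda>y. y < p) \<inter> slope_set b u (\<lambda>y. q < y)) \<in> sets borel" for p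
    by (rule sets.countable_UN'[OF countable_Int1[OF countable_rat]]) (use 1 in blast)
  have "(\<Union>p\<in>\<rat>. \<Union>q\<in>\<rat> \<inter> {p<..}. slope_set b u (\<lambda>y. y < p) \<inter> slope_set b u (\<lambda>y. q < y)) \<in> sets borel"
    by (rule sets.countable_UN'[OF countable_rat]) (use 2 in blast)
  moreover have "{x. \<nexists>D. has_partial b u x D} =
      (\<Union>p\<in>\<rat>. \<Union>q\<in>\<rat> \<inter> {p<..}. slope_set b u (\<lambda>y. y < p) \<inter> slope_set b u (\<lambda>y. q < y))"
    using has_partial_iff_slopes[OF L, of b] by blast
  ultimately show ?thesis by simp
qed

text \<open>Rademacher's theorem for a single direction, which is what a gradient defined through
  partial derivatives calls for. The set on which slopes below \<open>p\<close> and slopes above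
  \<open>q\<close> both recur is null on every line in direction \<open>b\<close>, hence null, and
  there are countably many rational pairs.\<close>

theorem lipschitz_AE_has_partial:
  fixes u :: "'a::euclidean_space \<Rightarrow> real"
  assumes L: "L-lipschitz_on UNIV u"
  shows "AE x in lborel. has_partial b u x (partial_deriv b u x)"
proof -
  have cont: "continuous_on UNIV u" using L by (rule lipschitz_on_continuous_on)
  have "emeasure lborel (slope_set b u (\<lambda>y. y < p) \<inter> slope_set b u (\<lambda>y. q < y)) = 0" if pq: "p < q" for p q
  proof (rule AE_lborel_line_average[where b=b])
    let ?E = "slope_set b u (\<lambda>y. y < p) \<inter> slope_set b u (\<lambda>y. q < y)"
    show E: "?E \<in> sets borel"
      by (intro sets.Int slope_set_borel[OF cont]) (auto simp: open_Collect_less)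
    fix x
    show "emeasure lborel {t. x + t *\<^sub>R b \<in> ?E} = 0"
    proof (rule oscillating_slopes_null[OF _ _ pq])
      show "(L * norm b)-lipschitz_on UNIV (\<lambda>t. u (x + t *\<^sub>R b))"
      proof (rule lipschitz_onI)
        show "dist (u (x + s *\<^sub>R b)) (u (x + t *\<^sub>R b)) \<le> L * norm b * dist s t" for s t
          using lipschitz_onD[OF L, of "x + s *\<^sub>R b" "x + t *\<^sub>R b"]
          by (simp add: dist_norm scaleR_diff_left[symmetric] mult_ac)
        show "0 \<le> L * norm b" using lipschitz_on_nonneg[OF L] by simp
      qed
      show "{t. x + t *\<^sub>R b \<in> ?E} \<in> sets borel" by (rule line_preimage_borel[OF E])
      fix t d :: real assume t: "t \<in> {t. x + t *\<^sub>R b \<in> ?E}" and d: "0 < d"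
      show "\<exists>h. h \<noteq> 0 \<and> \<bar>h\<bar> < d \<and> (u (x + (t + h) *\<^sub>R b) - u (x + t *\<^sub>R b)) / h < p"
        using t d by (simp add: slope_set_iff scaleR_add_left add.assoc)
      show "\<exists>h. h \<noteq> 0 \<and> \<bar>h\<bar> < d \<and> q < (u (x + (t + h) *\<^sub>R b) - u (x + t *\<^sub>R b)) / h"
        using t d by (simp add: slope_set_iff scaleR_add_left add.assoc)
    qed
  qed
  then have n: "AE x in lborel. x \<notin> slope_set b u (\<lambda>y. y < p) \<inter> slope_set b u (\<lambda>y. q < y)" if "p < q" for p q
    using that by (intro AE_not_in null_setsI sets.Int) (simp_all add: slope_set_borel[OF cont] open_Collect_less)
  have "AE x in lborel. \<forall>q\<in>\<rat> \<inter> {p<..}. x \<notin> slope_set b u (\<lambda>y. y < p) \<inter> slope_set b u (\<lambda>y. q < y)" for p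
    unfolding AE_ball_countable[OF countable_Int1[OF countable_rat]] by (intro ballI n) simp
  then have "AE x in lborel. \<forall>p\<in>\<rat>. \<forall>q\<in>\<rat> \<inter> {p<..}. x \<notin> slope_set b u (\<lambda>y. y < p) \<inter> slope_set b u (\<lambda>y. q < y)"
    unfolding AE_ball_countable[OF countable_rat] by blast
  then show ?thesis
  proof (eventually_elim)
    fix x assume "\<forall>p\<in>\<rat>. \<forall>q\<in>\<rat> \<inter> {p<..}. x \<notin> slope_set b u (\<lambda>y. y < p) \<inter> slope_set b u (\<lambda>y. q < y)"
    then have "\<exists>D. has_partial b u x D" unfolding has_partial_iff_slopes[OF L] by blast
    then show "has_partial b u x (partial_deriv b u x)" using has_partial_imp_partial_deriv by metis
  qed
qed

section \<open>Locally Lipschitz functions\<close>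

lemma has_compact_support_iff:
  fixes u :: "'a::euclidean_space \<Rightarrow> real"
  shows "has_compact_support u \<longleftrightarrow> (\<exists>R. \<forall>x. R < norm x \<longrightarrow> u x = 0)"
proof
  assume "has_compact_support u"
  then have "bounded {x. u x \<noteq> 0}"
    unfolding has_compact_support_def by (meson bounded_subset closure_subset compact_imp_bounded)
  then show "\<exists>R. \<forall>x. R < norm x \<longrightarrow> u x = 0"
    unfolding bounded_iff by (metis mem_Collect_eq not_less)
next
  assume "\<exists>R. \<forall>x. R < norm x \<longrightarrow> u x = 0"
  then obtain R where "\<And>x. R < norm x \<Longrightarrow> u x = 0" by blast
  then have "{x. u x \<noteq> 0} \<subseteq> cball 0 R" by (force simp: not_le[symmetric])
  then have "bounded {x. u x \<noteq> 0}" using bounded_cball bounded_subset by blast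
  then show "has_compact_support u"
    unfolding has_compact_support_def by (simp add: compact_closure)
qed

text \<open>Globally Lipschitz functions are not closed under products. Being Lipschitz on every
  ball about the origin is stable under all operations used below, and compact support gives a
  global constant back at the end.\<close>

definition locally_lip :: "('a::real_normed_vector \<Rightarrow> 'b::real_normed_vector) \<Rightarrow> bool" where
  "locally_lip f \<longleftrightarrow> (\<forall>R. \<exists>C. C-lipschitz_on (cball 0 R) f)"

lemma locally_lipD:
  assumes "locally_lip f" obtains C where "0 \<le> C" "\<And>x y. norm x \<le> R \<Longrightarrow> norm y \<le> R \<Longrightarrow> norm (f x - f y) \<le> C * norm (x - y)"
proof -
  obtain C where "C-lipschitz_on (cball 0 R) f" using assms unfolding locally_lip_def by blast
  then show thesis using that[of C] lipschitz_onD[of C "cball 0 R" f] lipschitz_on_nonneg[of C "cball 0 R" f] by (simp add: dist_norm)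
qed

lemma locally_lipI:
  assumes "\<And>R. 0 \<le> R \<Longrightarrow> \<exists>C. \<forall>x y. norm x \<le> R \<longrightarrow> norm y \<le> R \<longrightarrow> norm (f x - f y) \<le> C * norm (x - y)"
  shows "locally_lip f"
  unfolding locally_lip_def
proof
  fix R :: real
  show "\<exists>C. C-lipschitz_on (cball 0 R) f"
  proof (cases "0 \<le> R")
    case True
    then obtain C where C: "\<And>x y. norm x \<le> R \<Longrightarrow> norm y \<le> R \<Longrightarrow> norm (f x - f y) \<le> C * norm (x - y)"
      using assms by blast
    have "\<bar>C\<bar>-lipschitz_on (cball 0 R) f"
    proof (rule lipschitz_onI)
      fix x y :: 'a assume "x \<in> cball 0 R" "y \<in> cball 0 R"
      then have "norm (f x - f y) \<le> C * norm (x - y)" by (intro C) auto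
      also have "\<dots> \<le> \<bar>C\<bar> * norm (x - y)" by (intro mult_right_mono) auto
      finally show "dist (f x) (f y) \<le> \<bar>C\<bar> * dist x y" by (simp add: dist_norm)
    qed simp
    then show ?thesis by blast
  qed (auto simp: lipschitz_on_def intro!: exI[of _ 0])
qed

lemma locally_lip_bounded:
  assumes "locally_lip f" obtains M where "0 \<le> M" "\<And>x. norm x \<le> R \<Longrightarrow> norm (f x) \<le> M"
proof -
  obtain C where C: "0 \<le> C" "\<And>x y. norm x \<le> \<bar>R\<bar> \<Longrightarrow> norm y \<le> \<bar>R\<bar> \<Longrightarrow> norm (f x - f y) \<le> C * norm (x - y)"
    using locally_lipD[OF assms] by metis
  have "norm (f x) \<le> norm (f 0) + C * \<bar>R\<bar>" if "norm x \<le> R" for x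
  proof -
    have "norm (f x) \<le> norm (f x - f 0) + norm (f 0)" using norm_triangle_sub[of "f x" "f 0"] by simp
    also have "norm (f x - f 0) \<le> C * norm (x - 0)" using that by (intro C) auto
    also have "C * norm (x - 0) \<le> C * \<bar>R\<bar>" using that C(1) by (intro mult_left_mono) auto
    finally show ?thesis by simp
  qed
  then show thesis using C(1) by (intro that[of "norm (f 0) + C * \<bar>R\<bar>"]) auto
qed

lemma lipschitz_imp_locally_lip: "L-lipschitz_on UNIV f \<Longrightarrow> locally_lip f"
  unfolding locally_lip_def using lipschitz_on_subset subset_UNIV by blast

lemma locally_lip_const [simp]: "locally_lip (\<lambda>x. c)"
  by (rule locally_lipI) (auto intro!: exI[of _ 0])

lemma locally_lip_bounded_linear: "bounded_linear f \<Longrightarrow> locally_lip f"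
proof (rule locally_lipI)
  assume f: "bounded_linear f"
  then obtain K where "\<And>x. norm (f x) \<le> norm x * K" using bounded_linear.bounded by blast
  then show "\<exists>C. \<forall>x y. norm x \<le> R \<longrightarrow> norm y \<le> R \<longrightarrow> norm (f x - f y) \<le> C * norm (x - y)" for R
    using bounded_linear.linear[OF f] by (metis linear_diff mult.commute)
qed

lemma locally_lip_id [simp]: "locally_lip (\<lambda>x. x)"
  by (intro locally_lip_bounded_linear bounded_linear_ident)

lemma locally_lip_inner [simp]: "locally_lip (\<lambda>x. x \<bullet> b)"
  by (intro locally_lip_bounded_linear bounded_linear_inner_left)

lemma locally_lip_norm [simp]: "locally_lip (\<lambda>x. norm x)"
  by (rule locally_lipI) (auto intro!: exI[of _ 1] norm_triangle_ineq3)

lemma locally_lip_compose: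
  assumes "locally_lip g" "locally_lip f" shows "locally_lip (\<lambda>x. g (f x))"
proof (rule locally_lipI)
  fix R
  obtain M where M: "\<And>x. norm x \<le> R \<Longrightarrow> norm (f x) \<le> M" using locally_lip_bounded[OF assms(2)] by metis
  obtain C where C: "0 \<le> C" "\<And>x y. norm x \<le> M \<Longrightarrow> norm y \<le> M \<Longrightarrow> norm (g x - g y) \<le> C * norm (x - y)"
    using locally_lipD[OF assms(1)] by metis
  obtain D where D: "\<And>x y. norm x \<le> R \<Longrightarrow> norm y \<le> R \<Longrightarrow> norm (f x - f y) \<le> D * norm (x - y)"
    using locally_lipD[OF assms(2)] by metis
  have "norm (g (f x) - g (f y)) \<le> (C * D) * norm (x - y)" if "norm x \<le> R" "norm y \<le> R" for x y
  proof -
    have "norm (g (f x) - g (f y)) \<le> C * norm (f x - f y)" using that M by (intro C) auto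
    also have "\<dots> \<le> C * (D * norm (x - y))" using that D C(1) by (intro mult_left_mono) auto
    finally show ?thesis by (simp add: mult.assoc)
  qed
  then show "\<exists>C. \<forall>x y. norm x \<le> R \<longrightarrow> norm y \<le> R \<longrightarrow> norm (g (f x) - g (f y)) \<le> C * norm (x - y)" by blast
qed

lemma locally_lip_scaleR [simp]:
  fixes g :: "'a::real_normed_vector \<Rightarrow> 'b::real_normed_vector"
  assumes "locally_lip f" "locally_lip g" shows "locally_lip (\<lambda>x. f x *\<^sub>R g x)"
proof (rule locally_lipI)
  fix R
  obtain M where M: "\<And>x. norm x \<le> R \<Longrightarrow> norm (f x) \<le> M" "0 \<le> M" using locally_lip_bounded[OF assms(1)] by metis
  obtain N where N: "\<And>x. norm x \<le> R \<Longrightarrow> norm (g x) \<le> N" "0 \<le> N" using locally_lip_bounded[OF assms(2)] by metis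
  obtain C where C: "\<And>x y. norm x \<le> R \<Longrightarrow> norm y \<le> R \<Longrightarrow> norm (f x - f y) \<le> C * norm (x - y)"
    using locally_lipD[OF assms(1)] by metis
  obtain D where D: "\<And>x y. norm x \<le> R \<Longrightarrow> norm y \<le> R \<Longrightarrow> norm (g x - g y) \<le> D * norm (x - y)"
    using locally_lipD[OF assms(2)] by metis
  have "norm (f x *\<^sub>R g x - f y *\<^sub>R g y) \<le> (M * D + C * N) * norm (x - y)" if xy: "norm x \<le> R" "norm y \<le> R" for x y
  proof -
    have "f x *\<^sub>R g x - f y *\<^sub>R g y = f x *\<^sub>R (g x - g y) + (f x - f y) *\<^sub>R g y" by (simp add: algebra_simps)
    then have "norm (f x *\<^sub>R g x - f y *\<^sub>R g y) \<le> norm (f x *\<^sub>R (g x - g y)) + norm ((f x - f y) *\<^sub>R g y)"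
      by (metis norm_triangle_ineq)
    also have "\<dots> = norm (f x) * norm (g x - g y) + norm (f x - f y) * norm (g y)" by simp
    also have "norm (f x) * norm (g x - g y) \<le> M * (D * norm (x - y))"
      using xy M D by (intro mult_mono) auto
    also have "norm (f x - f y) * norm (g y) \<le> (C * norm (x - y)) * N"
      using xy N C by (intro mult_mono order_trans[OF norm_ge_zero C[OF xy]]) auto
    finally show ?thesis by (simp add: algebra_simps)
  qed
  then show "\<exists>C. \<forall>x y. norm x \<le> R \<longrightarrow> norm y \<le> R \<longrightarrow> norm (f x *\<^sub>R g x - f y *\<^sub>R g y) \<le> C * norm (x - y)" by blast
qed

lemma locally_lip_add [simp]:
  assumes "locally_lip f" "locally_lip g" shows "locally_lip (\<lambda>x. f x + g x)"
  unfolding locally_lip_def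
proof
  fix R
  obtain C D where "C-lipschitz_on (cball 0 R) f" "D-lipschitz_on (cball 0 R) g"
    using assms unfolding locally_lip_def by blast
  from lipschitz_on_add[OF this] show "\<exists>C. C-lipschitz_on (cball 0 R) (\<lambda>x. f x + g x)" by blast
qed

lemma locally_lip_mult [simp]:
  fixes f g :: "'a::real_normed_vector \<Rightarrow> real"
  assumes "locally_lip f" "locally_lip g" shows "locally_lip (\<lambda>x. f x * g x)"
  using locally_lip_scaleR[OF assms] by simp

lemma locally_lip_minus [simp]:
  fixes f g :: "'a::real_normed_vector \<Rightarrow> 'b::real_normed_vector"
  assumes "locally_lip f" "locally_lip g" shows "locally_lip (\<lambda>x. f x - g x)"
proof -
  have "locally_lip (\<lambda>x. f x + (-1) *\<^sub>R g x)" using assms by (intro locally_lip_add locally_lip_scaleR locally_lip_const)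
  then show ?thesis by simp
qed

lemma locally_lip_power [simp]:
  fixes f :: "'a::real_normed_vector \<Rightarrow> real"
  assumes "locally_lip f" shows "locally_lip (\<lambda>x. f x ^ n)"
  by (induction n) (use assms in auto)

lemma locally_lip_max [simp]:
  fixes f :: "'a::real_normed_vector \<Rightarrow> real"
  assumes "locally_lip f" shows "locally_lip (\<lambda>x. max a (f x))" "locally_lip (\<lambda>x. min a (f x))"
proof -
  have "locally_lip (\<lambda>x. max a x)" "locally_lip (\<lambda>x. min a x)"
    by (rule locally_lipI, auto intro!: exI[of _ 1] simp: max_def min_def)+
  from this[THEN locally_lip_compose, OF assms]
  show "locally_lip (\<lambda>x. max a (f x))" "locally_lip (\<lambda>x. min a (f x))" by auto
qed

lemma locally_lip_inverse [simp]:
  fixes f :: "'a::real_normed_vector \<Rightarrow> real"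
  assumes "locally_lip f" and c: "0 < c" "\<And>x. c \<le> f x" shows "locally_lip (\<lambda>x. inverse (f x))"
proof (rule locally_lipI)
  fix R
  obtain C where C: "0 \<le> C" "\<And>x y. norm x \<le> R \<Longrightarrow> norm y \<le> R \<Longrightarrow> norm (f x - f y) \<le> C * norm (x - y)"
    using locally_lipD[OF assms(1)] by metis
  have "norm (inverse (f x) - inverse (f y)) \<le> (C / (c * c)) * norm (x - y)" if xy: "norm x \<le> R" "norm y \<le> R" for x y
  proof -
    have p: "0 < f x" "0 < f y" using c less_le_trans by blast+
    have "norm (inverse (f x) - inverse (f y)) = \<bar>f x - f y\<bar> / (f x * f y)"
      using p by (simp add: field_simps abs_mult abs_if)
    also have "\<dots> \<le> (C * norm (x - y)) / (c * c)"
      using C(2)[OF xy] c C(1) p by (intro frac_le mult_mono) (auto intro: less_imp_le)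
    finally show ?thesis by simp
  qed
  then show "\<exists>C. \<forall>x y. norm x \<le> R \<longrightarrow> norm y \<le> R \<longrightarrow> norm (inverse (f x) - inverse (f y)) \<le> C * norm (x - y)" by blast
qed

lemma locally_lip_continuous: "locally_lip f \<Longrightarrow> continuous_on UNIV f"
proof -
  assume f: "locally_lip f"
  have "isCont f x" for x
  proof -
    obtain C where "C-lipschitz_on (cball 0 (norm x + 1)) f" using f unfolding locally_lip_def by blast
    then have "C-lipschitz_on (ball x 1) f"
    proof (rule lipschitz_on_subset)
      have "norm y \<le> norm x + 1" if "norm (x - y) < 1" for y
        using norm_triangle_ineq2[of y x] that by (simp add: norm_minus_commute)
      then show "ball x 1 \<subseteq> cball 0 (norm x + 1)" by (auto simp: dist_norm)
    qed
    then have "continuous_on (ball x 1) f" by (rule lipschitz_on_continuous_on)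
    then show ?thesis by (simp add: continuous_on_eq_continuous_at)
  qed
  then show ?thesis by (simp add: continuous_on_eq_continuous_at)
qed

text \<open>Points at distance at most 1 lie either both in the ball of radius \<open>R + 1\<close>
  or both outside the support; for more distant points the bound \<open>2 * M\<close> on the
  increment suffices.\<close>

lemma locally_lip_compact_support_imp_lipschitz:
  fixes u :: "'a::euclidean_space \<Rightarrow> real"
  assumes u: "locally_lip u" and supp: "\<And>x. R < norm x \<Longrightarrow> u x = 0"
  shows "\<exists>L. L-lipschitz_on UNIV u"
proof -
  obtain M where M: "0 \<le> M" "\<And>x. norm x \<le> R \<Longrightarrow> norm (u x) \<le> M" using locally_lip_bounded[OF u] by metis
  have M': "\<bar>u x\<bar> \<le> M" for x using M supp[of x] by (cases "norm x \<le> R") auto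
  obtain C where C: "0 \<le> C" "\<And>x y. norm x \<le> R + 1 \<Longrightarrow> norm y \<le> R + 1 \<Longrightarrow> norm (u x - u y) \<le> C * norm (x - y)"
    using locally_lipD[OF u] by metis
  have "(C + 2 * M)-lipschitz_on UNIV u"
  proof (rule lipschitz_onI)
    fix x y :: 'a
    show "dist (u x) (u y) \<le> (C + 2 * M) * dist x y"
    proof (cases "norm (x - y) \<le> 1")
      case True
      have "norm (u x - u y) \<le> C * norm (x - y)"
      proof (cases "norm x \<le> R + 1 \<and> norm y \<le> R + 1")
        case False
        then have "R < norm x \<and> R < norm y"
          using True norm_triangle_ineq3[of x y] by linarith
        then show ?thesis using supp C(1) by simp
      qed (use C in auto)
      also have "\<dots> \<le> (C + 2 * M) * norm (x - y)" using M by (intro mult_right_mono) auto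
      finally show ?thesis by (simp add: dist_norm)
    next
      case False
      have "norm (u x - u y) \<le> 2 * M * 1" using M'[of x] M'[of y] by simp
      also have "\<dots> \<le> 2 * M * norm (x - y)" using False M by (intro mult_left_mono) auto
      also have "\<dots> \<le> (C + 2 * M) * norm (x - y)" using C by (intro mult_right_mono) auto
      finally show ?thesis by (simp add: dist_norm)
    qed
  qed (use C M in simp)
  then show ?thesis by blast
qed

section \<open>Rules for partial derivatives\<close>

lemma has_partial_has_derivative:
  assumes "(u has_derivative D) (at x)" shows "has_partial b u x (D b)"
proof -
  have l: "((\<lambda>t. x + t *\<^sub>R b) has_derivative (\<lambda>t. t *\<^sub>R b)) (at (0::real))"
    by (auto intro!: derivative_eq_intros)
  have u: "(u has_derivative D) (at (x + 0 *\<^sub>R b))" using assms by simp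
  have "((\<lambda>t. u (x + t *\<^sub>R b)) has_derivative (\<lambda>t. D (t *\<^sub>R b))) (at 0)"
    using has_derivative_compose[OF l u] by simp
  moreover have "D (t *\<^sub>R b) = D b * t" for t
    using has_derivative_linear[OF assms] by (simp add: linear_scale)
  ultimately show ?thesis by (simp add: has_partial_def has_field_derivative_def)
qed

lemma has_partial_mult:
  assumes "has_partial b u x D" "has_partial b v x E"
  shows "has_partial b (\<lambda>x. u x * v x) x (D * v x + E * u x)"
  using DERIV_mult[OF assms[unfolded has_partial_def]] by (simp add: has_partial_def)

lemma has_partial_add:
  assumes "has_partial b u x D" "has_partial b v x E"
  shows "has_partial b (\<lambda>x. u x + v x) x (D + E)"
  using DERIV_add[OF assms[unfolded has_partial_def]] by (simp add: has_partial_def)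

lemma has_partial_const: "has_partial b (\<lambda>x. c) x 0"
  by (simp add: has_partial_def)

lemma has_partial_cong_open:
  assumes "has_partial b u x D" "open S" "x \<in> S" "\<And>y. y \<in> S \<Longrightarrow> v y = u y"
  shows "has_partial b v x D"
proof -
  have "isCont (\<lambda>t. x + t *\<^sub>R b) (0::real)" by (intro continuous_intros)
  then have "((\<lambda>t. x + t *\<^sub>R b) \<longlongrightarrow> x) (nhds (0::real))"
    by (metis (no_types, lifting) add.right_neutral isCont_def scaleR_zero_left tendsto_at_iff_tendsto_nhds)
  then have "eventually (\<lambda>t. x + t *\<^sub>R b \<in> S) (nhds 0)"
    using assms(2,3) topological_tendstoD by blast
  then have "eventually (\<lambda>t. v (x + t *\<^sub>R b) = u (x + t *\<^sub>R b)) (nhds 0)"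
    by (rule eventually_mono) (use assms(4) in auto)
  then show ?thesis using assms(1) unfolding has_partial_def
    by (subst DERIV_cong_ev[OF refl _ refl])
qed

lemma has_partial_slope_LIMSEQ:
  assumes "has_partial b u x D"
  shows "(\<lambda>n. (u (x + (1 / real (Suc n)) *\<^sub>R b) - u x) / (1 / real (Suc n))) \<longlonglongrightarrow> D"
proof -
  have "((\<lambda>h. (u (x + h *\<^sub>R b) - u x) / h) \<longlongrightarrow> D) (at 0)"
    using assms by (simp add: has_partial_def DERIV_def)
  moreover have "filterlim (\<lambda>n. 1 / real (Suc n)) (at 0) sequentially"
    using LIMSEQ_inverse_real_of_nat by (auto simp: filterlim_at inverse_eq_divide)
  ultimately show ?thesis by (rule filterlim_compose)
qed

text \<open>A comparison of increments passes to the limit in the difference quotients. This takes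
  the place of a chain rule for truncations, which need not be differentiable at the level where
  they cut.\<close>

lemma has_partial_abs_le:
  assumes "has_partial b u x D" "has_partial b v x E" "\<And>y. \<bar>u y - u x\<bar> \<le> \<bar>v y - v x\<bar>"
  shows "\<bar>D\<bar> \<le> \<bar>E\<bar>"
proof (rule LIMSEQ_le)
  show "(\<lambda>n. \<bar>(u (x + (1 / real (Suc n)) *\<^sub>R b) - u x) / (1 / real (Suc n))\<bar>) \<longlonglongrightarrow> \<bar>D\<bar>"
    using has_partial_slope_LIMSEQ[OF assms(1)] by (rule tendsto_rabs)
  show "(\<lambda>n. \<bar>(v (x + (1 / real (Suc n)) *\<^sub>R b) - v x) / (1 / real (Suc n))\<bar>) \<longlonglongrightarrow> \<bar>E\<bar>"
    using has_partial_slope_LIMSEQ[OF assms(2)] by (rule tendsto_rabs)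
  show "\<exists>N. \<forall>n\<ge>N. \<bar>(u (x + (1 / real (Suc n)) *\<^sub>R b) - u x) / (1 / real (Suc n))\<bar>
    \<le> \<bar>(v (x + (1 / real (Suc n)) *\<^sub>R b) - v x) / (1 / real (Suc n))\<bar>"
    using assms(3) by (auto simp: abs_mult abs_divide intro!: divide_right_mono mult_right_mono)
qed

lemma has_partial_bound:
  assumes "L-lipschitz_on UNIV u" "has_partial b u x D" shows "\<bar>D\<bar> \<le> L * norm b"
proof (rule LIMSEQ_le_const2)
  show "(\<lambda>n. \<bar>(u (x + (1 / real (Suc n)) *\<^sub>R b) - u x) / (1 / real (Suc n))\<bar>) \<longlonglongrightarrow> \<bar>D\<bar>"
    using has_partial_slope_LIMSEQ[OF assms(2)] by (rule tendsto_rabs)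
  have "\<bar>(u (x + h *\<^sub>R b) - u x) / h\<bar> \<le> L * norm b" if "0 < h" for h
    using lipschitz_onD[OF assms(1), of "x + h *\<^sub>R b" x] that
    by (simp add: dist_norm abs_divide divide_simps mult_ac)
  from this[of "1 / real (Suc _)"]
  show "\<exists>N. \<forall>n\<ge>N. \<bar>(u (x + (1 / real (Suc n)) *\<^sub>R b) - u x) / (1 / real (Suc n))\<bar> \<le> L * norm b"
    by (intro exI[of _ 0] allI impI) simp
qed

section \<open>Measurability and integrals of partial derivatives\<close>

lemma partial_deriv_borel:
  fixes u :: "'a::euclidean_space \<Rightarrow> real"
  assumes L: "L-lipschitz_on UNIV u"
  shows "partial_deriv b u \<in> borel_measurable borel"
proof -
  let ?N = "{x. \<nexists>D. has_partial b u x D}"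
  let ?s = "\<lambda>n x. (u (x + (1 / real (Suc n)) *\<^sub>R b) - u x) / (1 / real (Suc n))"
  \<comment> \<open>Where no derivative exists, \<open>deriv\<close> chooses from the identically
    false predicate, so its value is one constant, the same for all such \<open>x\<close>.\<close>
  have eq: "partial_deriv b u x = (if x \<in> ?N then (SOME D::real. False) else lim (\<lambda>n. ?s n x))" for x
  proof (cases "x \<in> ?N")
    case True
    then show ?thesis by (simp add: partial_deriv_def deriv_def has_partial_def)
  next
    case False
    then obtain D where D: "has_partial b u x D" by blast
    then have "lim (\<lambda>n. ?s n x) = D" by (intro limI has_partial_slope_LIMSEQ)
    then show ?thesis using False has_partial_imp_partial_deriv[OF D] by (simp only: if_False)
  qed
  have c: "continuous_on UNIV u" using L by (rule lipschitz_on_continuous_on)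
  have "?s n \<in> borel_measurable borel" for n
    by (intro borel_measurable_continuous_onI continuous_intros continuous_on_compose2[OF c]) auto
  then have "(\<lambda>x. lim (\<lambda>n. ?s n x)) \<in> borel_measurable borel"
    by (rule borel_measurable_lim_metric)
  then have "(\<lambda>x. if x \<in> ?N then (SOME D::real. False) else lim (\<lambda>n. ?s n x)) \<in> borel_measurable borel"
  proof (intro measurable_If_set borel_measurable_const)
    show "?N \<inter> space borel \<in> sets borel"
      using nonpartial_set_borel[OF L] by (simp only: space_borel Int_UNIV_right)
  qed
  moreover have "partial_deriv b u = (\<lambda>x. if x \<in> ?N then (SOME D::real. False) else lim (\<lambda>n. ?s n x))"
    using eq by (rule ext)
  ultimately show ?thesis by simp
qed

lemma gradient_borel:
  fixes u :: "'a::euclidean_space \<Rightarrow> real"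
  assumes L: "L-lipschitz_on UNIV u"
  shows "gradient u \<in> borel_measurable borel"
  unfolding gradient_def[abs_def] using partial_deriv_borel[OF L] by measurable

lemma gradient_inner_Basis: "b \<in> Basis \<Longrightarrow> gradient u x \<bullet> b = partial_deriv b u x"
  by (simp add: gradient_def inner_sum_left inner_Basis if_distrib cong: if_cong)

lemma norm_gradient_squared: "(norm (gradient u x))\<^sup>2 = (\<Sum>b\<in>Basis. (partial_deriv b u x)\<^sup>2)"
  unfolding power2_norm_eq_inner by (subst euclidean_inner) (simp add: gradient_inner_Basis power2_eq_square)

lemma lborel_integral_translate:
  fixes f :: "'a::euclidean_space \<Rightarrow> real"
  assumes "f \<in> borel_measurable borel"
  shows "(\<integral>x. f (x + c) \<partial>lborel) = (\<integral>x. f x \<partial>lborel)"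
    and "integrable lborel f \<Longrightarrow> integrable lborel (\<lambda>x. f (x + c))"
proof -
  have "(\<integral>x. f x \<partial>lborel) = (\<integral>x. f x \<partial>distr lborel borel ((+) c))" by (simp add: lborel_distr_plus)
  also have "\<dots> = (\<integral>x. f (x + c) \<partial>lborel)" using assms by (subst integral_distr) (auto simp: add.commute)
  finally show "(\<integral>x. f (x + c) \<partial>lborel) = (\<integral>x. f x \<partial>lborel)" by simp
  assume "integrable lborel f"
  then have "integrable (distr lborel borel ((+) c)) f" by (simp add: lborel_distr_plus)
  then show "integrable lborel (\<lambda>x. f (x + c))"
    using assms by (subst (asm) integrable_distr_eq) (auto simp: add.commute)
qed

lemma integrable_continuous_compact_support:
  fixes f :: "'a::euclidean_space \<Rightarrow> real"
  assumes "continuous_on UNIV f" "\<And>x. R < norm x \<Longrightarrow> f x = 0"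
  shows "integrable lborel f"
proof -
  have "integrable lborel (\<lambda>x. indicator (cball 0 R) x *\<^sub>R f x)"
    by (rule borel_integrable_compact[OF compact_cball continuous_on_subset[OF assms(1)]]) simp
  moreover have "(\<lambda>x. indicator (cball 0 R) x *\<^sub>R f x) = f"
  proof
    show "indicator (cball 0 R) x *\<^sub>R f x = f x" for x
      using assms(2)[of x] by (cases "R < norm x") (auto simp: indicator_def)
  qed
  ultimately show ?thesis by simp
qed

lemma integrable_cball_bounded:
  fixes f :: "'a::euclidean_space \<Rightarrow> real"
  assumes "f \<in> borel_measurable borel" "AE x in lborel. \<bar>f x\<bar> \<le> M" "AE x in lborel. R < norm x \<longrightarrow> f x = 0"
  shows "integrable lborel f"
proof (rule Bochner_Integration.integrable_bound)
  show "integrable lborel (\<lambda>x::'a. M * indicator (cball 0 R) x)"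
    by (intro integrable_mult_right integrable_real_indicator) (simp_all add: emeasure_lborel_cball_finite[unfolded infinity_ennreal_def])
  show "AE x in lborel. norm (f x) \<le> norm (M * indicator (cball 0 R) x)"
    using assms(2,3) by eventually_elim (auto simp: indicator_def not_le)
qed (use assms in simp)

lemma partial_zero_outside:
  assumes "\<And>x. R < norm x \<Longrightarrow> u x = 0" "R < norm x"
  shows "has_partial b u x 0"
proof (rule has_partial_cong_open[where u="\<lambda>_. 0" and S="- cball 0 R"])
  show "has_partial b (\<lambda>_. 0) x 0" by (rule has_partial_const)
qed (use assms in auto)

text \<open>Integration by parts in its simplest form: difference quotients have integral 0 by
  translation invariance, and they are dominated by \<open>L * norm b\<close> on the ball enlarged
  by \<open>norm b\<close>.\<close>

lemma integral_partial_deriv_eq_0: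
  fixes g :: "'a::euclidean_space \<Rightarrow> real"
  assumes L: "L-lipschitz_on UNIV g" and supp: "\<And>x. R < norm x \<Longrightarrow> g x = 0"
  shows "integrable lborel (partial_deriv b g)" "(\<integral>x. partial_deriv b g x \<partial>lborel) = 0"
proof -
  have c: "continuous_on UNIV g" using L by (rule lipschitz_on_continuous_on)
  have gm: "g \<in> borel_measurable borel" using c by (rule borel_measurable_continuous_onI)
  have gi: "integrable lborel g" by (rule integrable_continuous_compact_support[OF c supp])
  let ?s = "\<lambda>n x. (g (x + (1 / real (Suc n)) *\<^sub>R b) - g x) / (1 / real (Suc n))"
  let ?w = "\<lambda>x. (L * norm b) * indicator (cball (0::'a) (R + norm b)) x"
  have lim: "AE x in lborel. (\<lambda>n. ?s n x) \<longlonglongrightarrow> partial_deriv b g x"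
    using lipschitz_AE_has_partial[OF L, of b] by eventually_elim (rule has_partial_slope_LIMSEQ)
  have bd: "norm (?s n x) \<le> ?w x" for n x
  proof (cases "x \<in> cball 0 (R + norm b)")
    case True
    have "norm (?s n x) = \<bar>g (x + (1 / real (Suc n)) *\<^sub>R b) - g x\<bar> * real (Suc n)" by (simp add: abs_mult)
    also have "\<dots> \<le> (L * norm ((1 / real (Suc n)) *\<^sub>R b)) * real (Suc n)"
      using lipschitz_onD[OF L, of "x + (1 / real (Suc n)) *\<^sub>R b" x]
      by (intro mult_right_mono) (simp_all add: dist_norm)
    also have "\<dots> = L * norm b" by simp
    finally show ?thesis using True by simp
  next
    case False
    have "norm ((1 / real (Suc n)) *\<^sub>R b) \<le> norm b" by (simp add: divide_le_eq mult_le_cancel_left1)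
    then have "R < norm (x + (1 / real (Suc n)) *\<^sub>R b)"
      using False norm_triangle_ineq2[of x "- ((1 / real (Suc n)) *\<^sub>R b)"] by simp
    moreover have "R < norm x" using False norm_ge_zero[of b] by (simp only: mem_cball_0)
    ultimately show ?thesis using supp False by simp
  qed
  have wi: "integrable lborel ?w"
    by (intro integrable_mult_right integrable_real_indicator) (simp_all add: emeasure_lborel_cball_finite[unfolded infinity_ennreal_def])
  have sm: "?s n \<in> borel_measurable lborel" for n using gm by measurable
  have pm: "partial_deriv b g \<in> borel_measurable lborel" using partial_deriv_borel[OF L] by simp
  note dc = integrable_dominated_convergence[OF pm sm wi lim] integral_dominated_convergence[OF pm sm wi lim]
  show "integrable lborel (partial_deriv b g)" by (rule dc(1)) (use bd in auto)
  have "(\<integral>x. ?s n x \<partial>lborel) = 0" for n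
    using lborel_integral_translate[OF gm] gi by (simp add: Bochner_Integration.integral_diff)
  moreover have "(\<lambda>n. \<integral>x. ?s n x \<partial>lborel) \<longlonglongrightarrow> (\<integral>x. partial_deriv b g x \<partial>lborel)"
    by (rule dc(2)) (use bd in auto)
  ultimately show "(\<integral>x. partial_deriv b g x \<partial>lborel) = 0"
    by (simp add: LIMSEQ_const_iff)
qed

section \<open>Polar coordinates and radial fields\<close>

lemma emeasure_lborel_scaleR_image:
  fixes S :: "'a::euclidean_space set"
  assumes S: "S \<in> sets borel" and c: "0 < c"
  shows "emeasure lborel {x. (1/c) *\<^sub>R x \<in> S} = ennreal (c ^ DIM('a)) * emeasure lborel S"
proof -
  have m: "{x. (1/c) *\<^sub>R x \<in> S} \<in> sets borel"
  proof -
    have "(\<lambda>x. (1/c) *\<^sub>R x) -` S \<inter> space borel \<in> sets borel" by (rule measurable_sets[OF _ S]) measurable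
    then show ?thesis by (simp add: vimage_def)
  qed
  have "emeasure lborel {x. (1/c) *\<^sub>R x \<in> S} =
      emeasure (density (distr lborel borel (\<lambda>x. 0 + c *\<^sub>R x)) (\<lambda>_. ennreal (\<bar>c\<bar> ^ DIM('a)))) {x. (1/c) *\<^sub>R x \<in> S}"
    using lborel_affine[of c "0::'a"] c by simp
  also have "\<dots> = ennreal (c ^ DIM('a)) * emeasure (distr lborel borel (\<lambda>x. c *\<^sub>R x)) {x. (1/c) *\<^sub>R x \<in> S}"
    using m c by (subst emeasure_density_const) auto
  also have "emeasure (distr lborel borel (\<lambda>x. c *\<^sub>R x)) {x. (1/c) *\<^sub>R x \<in> S} = emeasure lborel S"
    using m c by (subst emeasure_distr) (auto simp: vimage_def)
  finally show ?thesis .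
qed

text \<open>This is surface measure on the unit sphere divided by the dimension: the mass of a set
  is the volume of the cone over it in the unit ball. The origin, which \<open>sgn\<close> sends to
  \<open>0\<close>, is a null set.\<close>

definition sphere_measure :: "'a::euclidean_space measure" where
  "sphere_measure = distr (restrict_space lborel (ball 0 1)) borel sgn"

lemma sgn_borel [measurable]: "(sgn :: 'a::euclidean_space \<Rightarrow> 'a) \<in> borel_measurable borel"
  unfolding sgn_div_norm by measurable

lemma nn_integral_sphere_measure:
  fixes f :: "'a::euclidean_space \<Rightarrow> ennreal"
  assumes "f \<in> borel_measurable borel"
  shows "(\<integral>\<^sup>+x. f x \<partial>sphere_measure) = (\<integral>\<^sup>+x\<in>ball 0 1. f (sgn x) \<partial>lborel)"
proof -
  have "(sgn :: 'a \<Rightarrow> 'a) \<in> measurable (restrict_space lborel (ball 0 1)) borel"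
    by (rule measurable_restrict_space1) simp
  then show ?thesis using assms unfolding sphere_measure_def
    by (subst nn_integral_distr) (auto simp: nn_integral_restrict_space)
qed

lemma sets_sphere_measure [simp, measurable_cong]: "sets sphere_measure = sets borel"
  by (simp add: sphere_measure_def)

lemma space_sphere_measure [simp]: "space sphere_measure = UNIV"
  by (simp add: sphere_measure_def)

lemma emeasure_sphere_measure:
  fixes A :: "'a::euclidean_space set"
  assumes "A \<in> sets borel"
  shows "emeasure sphere_measure A = emeasure lborel {x \<in> ball 0 1. sgn x \<in> A}"
proof -
  have 1: "{x \<in> ball 0 1. sgn x \<in> A} \<in> sets (borel :: 'a measure)"
  proof -
    have "sgn -` A \<inter> space (borel :: 'a measure) \<in> sets borel" by (rule measurable_sets[OF sgn_borel assms])
    then have "ball 0 1 \<inter> sgn -` A \<in> sets (borel :: 'a measure)" by (intro sets.Int) auto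
    moreover have "{x \<in> ball 0 1. sgn x \<in> A} = ball 0 1 \<inter> sgn -` A" by auto
    ultimately show ?thesis by simp
  qed
  have "emeasure sphere_measure A = (\<integral>\<^sup>+x. indicator A x \<partial>sphere_measure)" using assms by simp
  also have "\<dots> = (\<integral>\<^sup>+x. indicator A (sgn x) * indicator (ball 0 1) x \<partial>(lborel :: 'a measure))"
    by (rule nn_integral_sphere_measure) (use assms in simp)
  also have "\<dots> = (\<integral>\<^sup>+x. indicator {x \<in> ball 0 1. sgn x \<in> A} x \<partial>(lborel :: 'a measure))"
    by (intro nn_integral_cong) (auto simp: indicator_def)
  also have "\<dots> = emeasure lborel {x \<in> ball 0 1. sgn x \<in> A}"
    using 1 by simp
  finally show ?thesis .
qed

lemma finite_sphere_measure: "emeasure (sphere_measure :: 'a::euclidean_space measure) A < \<infinity>"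
proof (cases "A \<in> sets borel")
  case True
  have "emeasure (sphere_measure :: 'a measure) A \<le> emeasure lborel (ball (0::'a) 1)"
    unfolding emeasure_sphere_measure[OF True] by (intro emeasure_mono) auto
  also have "\<dots> < \<infinity>" by (rule emeasure_lborel_ball_finite)
  finally show ?thesis .
qed (simp add: emeasure_notin_sets)

text \<open>Polar coordinates in the variables \<open>t = |x|^n\<close> and \<open>x/|x|\<close>, in which Lebesgue measure is a
  product without density.\<close>

lemma polar_emeasure:
  fixes A :: "'a::euclidean_space set"
  assumes A: "A \<in> sets borel" and t: "0 < t"
  shows "emeasure lborel {x. norm x ^ DIM('a) < t \<and> sgn x \<in> A} = ennreal t * emeasure sphere_measure A"
proof -
  let ?n = "DIM('a)"
  define c where "c = root ?n t"
  have c: "0 < c" "c ^ ?n = t" using t by (simp_all add: c_def)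
  have 1: "{x \<in> ball 0 1. sgn x \<in> A} \<in> sets (borel :: 'a measure)"
  proof -
    have "sgn -` A \<inter> space (borel :: 'a measure) \<in> sets borel" by (rule measurable_sets[OF sgn_borel A])
    then have "ball 0 1 \<inter> sgn -` A \<in> sets (borel :: 'a measure)" by (intro sets.Int) auto
    moreover have "{x \<in> ball 0 1. sgn x \<in> A} = ball 0 1 \<inter> sgn -` A" by auto
    ultimately show ?thesis by simp
  qed
  have "norm x ^ ?n < t \<longleftrightarrow> norm ((1/c) *\<^sub>R x) < 1" for x :: 'a
  proof -
    have "norm x ^ ?n < t \<longleftrightarrow> norm x ^ ?n < c ^ ?n" using c by simp
    also have "\<dots> \<longleftrightarrow> norm x < c" using c by (meson DIM_positive less_imp_le norm_ge_zero power_less_imp_less_base power_strict_mono)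
    finally show ?thesis using c by (simp add: divide_less_eq)
  qed
  moreover have "sgn ((1/c) *\<^sub>R x) = sgn x" for x :: 'a using c by (simp add: sgn_scaleR)
  ultimately have "{x. norm x ^ ?n < t \<and> sgn x \<in> A} = {x. (1/c) *\<^sub>R x \<in> {x \<in> ball 0 1. sgn x \<in> A}}"
    by auto
  then show ?thesis
    using emeasure_lborel_scaleR_image[OF 1 c(1)] emeasure_sphere_measure[OF A] c by simp
qed

lemma polar_distr:
  "distr (lborel :: 'a::euclidean_space measure) (borel \<Otimes>\<^sub>M borel) (\<lambda>x. (norm x ^ DIM('a), sgn x))
     = density lborel (indicator {0..}) \<Otimes>\<^sub>M sphere_measure"
proof (rule pair_measure_eqI[symmetric])
  let ?n = "DIM('a)"
  let ?M1 = "density lborel (indicator {0::real..})"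
  interpret s: finite_measure "sphere_measure :: 'a measure"
    by (rule finite_measureI) (use finite_sphere_measure[of "UNIV :: 'a set"] in auto)
  show "sigma_finite_measure (sphere_measure :: 'a measure)" by (rule s.sigma_finite_measure_axioms)
  show "sigma_finite_measure ?M1"
    by (subst sigma_finite_measure.sigma_finite_iff_density_finite[OF sigma_finite_lborel]) (auto simp: indicator_def)
  show "sets (?M1 \<Otimes>\<^sub>M (sphere_measure :: 'a measure)) = sets (distr (lborel :: 'a measure) (borel \<Otimes>\<^sub>M borel) (\<lambda>x. (norm x ^ ?n, sgn x)))"
    by (simp cong: sets_pair_measure_cong)
  fix A B assume "A \<in> sets ?M1" "B \<in> sets (sphere_measure :: 'a measure)"
  then have A: "A \<in> sets borel" and B: "B \<in> sets borel" by auto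
  have sB: "{x. sgn x \<in> B} \<in> sets (borel :: 'a measure)"
    using measurable_sets[OF sgn_borel B] by (simp add: vimage_def)
  let ?D = "distr (density (lborel :: 'a measure) (indicator {x. sgn x \<in> B})) borel (\<lambda>x. norm x ^ ?n)"
  let ?E = "density lborel (\<lambda>t. indicator {0::real..} t * emeasure sphere_measure B)"
  have eD: "emeasure ?D X = emeasure lborel {x. norm x ^ ?n \<in> X \<and> sgn x \<in> B}" if "X \<in> sets borel" for X
  proof -
    have 1: "(\<lambda>x::'a. norm x ^ ?n) -` X \<inter> space borel \<in> sets borel"
      by (rule measurable_sets[OF _ that]) measurable
    then have "emeasure ?D X = emeasure (density (lborel :: 'a measure) (indicator {x. sgn x \<in> B})) ((\<lambda>x::'a. norm x ^ ?n) -` X)"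
      using that by (subst emeasure_distr) auto
    also have "\<dots> = emeasure lborel ({x. sgn x \<in> B} \<inter> (\<lambda>x::'a. norm x ^ ?n) -` X)"
      using 1 sB by (subst emeasure_restricted) auto
    also have "{x. sgn x \<in> B} \<inter> (\<lambda>x::'a. norm x ^ ?n) -` X = {x. norm x ^ ?n \<in> X \<and> sgn x \<in> B}" by auto
    finally show ?thesis .
  qed
  have hm: "(\<lambda>t::real. indicator {0..} t * K) \<in> borel_measurable borel" for K :: ennreal by measurable
  have eE: "emeasure ?E X = emeasure lborel (X \<inter> {0..}) * emeasure sphere_measure B" if "X \<in> sets borel" for X
  proof -
    have "emeasure ?E X = (\<integral>\<^sup>+t. (indicator {0..} t * emeasure sphere_measure B) * indicator X t \<partial>lborel)"
    proof (rule emeasure_density)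
      show "(\<lambda>t. indicator {0::real..} t * emeasure sphere_measure B) \<in> borel_measurable lborel"
        unfolding measurable_lborel2 by (rule hm)
    qed (use that in simp)
    also have "\<dots> = (\<integral>\<^sup>+t. indicator (X \<inter> {0..}) t * emeasure sphere_measure B \<partial>lborel)"
      by (intro nn_integral_cong) (auto simp: indicator_def)
    also have "\<dots> = emeasure lborel (X \<inter> {0..}) * emeasure sphere_measure B"
      using that by (subst nn_integral_multc) auto
    finally show ?thesis .
  qed
  \<comment> \<open>With \<open>B\<close> fixed both sides are measures in the radial variable, and
    \<open>polar_emeasure\<close> says that they agree on the half-lines
    \<open>{..<t}\<close>.\<close>
  have "?D = ?E"
  proof (rule measure_eqI_generator_eq[where E="range lessThan" and \<Omega>=UNIV and A="\<lambda>i. {..<real i}"])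
    show "Int_stable (range (lessThan :: real \<Rightarrow> _))"
    proof (rule Int_stableI)
      fix A B :: "real set" assume "A \<in> range lessThan" "B \<in> range lessThan"
      then obtain a b where "A = {..<a}" "B = {..<b}" by blast
      then have "A \<inter> B = {..<min a b}" by auto
      then show "A \<inter> B \<in> range lessThan" by simp
    qed
    show "emeasure ?D X = emeasure ?E X" if X: "X \<in> range lessThan" for X
    proof -
      obtain t where t: "X = {..<t}" using X by blast
      show ?thesis
      proof (cases "0 < t")
        case True
        have "X \<inter> {0..} = {0..<t}" unfolding t by auto
        then have "emeasure lborel (X \<inter> {0..}) = ennreal t" using True by simp
        then show ?thesis using polar_emeasure[OF B True] t by (simp add: eD eE)
      next
        case False
        then have "\<not> norm x ^ ?n < t" for x :: 'a by (simp add: not_less order_trans[of t 0])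
        moreover have "X \<inter> {0..} = {}" using False t by auto
        ultimately show ?thesis using t by (simp add: eD eE)
      qed
    qed
    show "(\<Union>i. {..<real i}) = UNIV" using reals_Archimedean2 by auto
    show "emeasure ?D {..<real i} \<noteq> \<infinity>" for i
    proof -
      have "emeasure ?D {..<real i} = ennreal (real i) * emeasure sphere_measure B"
      proof (cases "i = 0")
        case True
        have "\<not> norm x ^ ?n < 0" for x :: 'a by (simp add: not_less)
        then show ?thesis using True by (simp add: eD)
      next
        case False
        then show ?thesis using polar_emeasure[OF B, of "real i"] by (simp add: eD)
      qed
      then show ?thesis using finite_sphere_measure[of B] by (simp add: ennreal_mult_eq_top_iff)
    qed
  qed (auto simp: borel_Iio)
  then have "emeasure ?D A = emeasure ?E A" by simp
  then have "emeasure lborel (A \<inter> {0..}) * emeasure sphere_measure B = emeasure lborel {x::'a. norm x ^ ?n \<in> A \<and> sgn x \<in> B}"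
    using A by (simp add: eD eE)
  moreover have "emeasure ?M1 A = emeasure lborel (A \<inter> {0..})"
    using A by (subst emeasure_restricted) (auto simp: Int_commute)
  moreover have "emeasure (distr (lborel :: 'a measure) (borel \<Otimes>\<^sub>M borel) (\<lambda>x. (norm x ^ ?n, sgn x))) (A \<times> B)
      = emeasure lborel {x::'a. norm x ^ ?n \<in> A \<and> sgn x \<in> B}"
  proof -
    have "A \<times> B \<in> sets (borel \<Otimes>\<^sub>M borel)" using A B by simp
    moreover have "(\<lambda>x::'a. (norm x ^ ?n, sgn x)) \<in> lborel \<rightarrow>\<^sub>M borel \<Otimes>\<^sub>M borel" by measurable
    ultimately show ?thesis by (subst emeasure_distr) (auto simp: vimage_def)
  qed
  ultimately show "emeasure ?M1 A * emeasure sphere_measure B =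
      emeasure (distr (lborel :: 'a measure) (borel \<Otimes>\<^sub>M borel) (\<lambda>x. (norm x ^ ?n, sgn x))) (A \<times> B)"
    by simp
qed

theorem nn_integral_polar:
  fixes f :: "real \<Rightarrow> 'a::euclidean_space \<Rightarrow> ennreal"
  assumes f: "(\<lambda>(t, z). f t z) \<in> borel_measurable (borel \<Otimes>\<^sub>M borel)"
  shows "(\<integral>\<^sup>+x. f (norm x ^ DIM('a)) (sgn x) \<partial>lborel) =
    (\<integral>\<^sup>+t\<in>{0..}. (\<integral>\<^sup>+z\<in>ball 0 1. f t (sgn z) \<partial>lborel) \<partial>lborel)"
proof -
  let ?n = "DIM('a)"
  interpret s: finite_measure "sphere_measure :: 'a measure"
    by (rule finite_measureI) (use finite_sphere_measure[of "UNIV :: 'a set"] in auto)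
  have m: "(\<lambda>x::'a. (norm x ^ ?n, sgn x)) \<in> lborel \<rightarrow>\<^sub>M borel \<Otimes>\<^sub>M borel" by measurable
  have "(\<integral>\<^sup>+x. f (norm x ^ ?n) (sgn x) \<partial>lborel)
      = (\<integral>\<^sup>+p. (case p of (t, z) \<Rightarrow> f t z) \<partial>distr (lborel :: 'a measure) (borel \<Otimes>\<^sub>M borel) (\<lambda>x. (norm x ^ ?n, sgn x)))"
    using f m by (subst nn_integral_distr) auto
  also have "\<dots> = (\<integral>\<^sup>+p. (case p of (t, z) \<Rightarrow> f t z) \<partial>(density lborel (indicator {0..}) \<Otimes>\<^sub>M sphere_measure))"
    by (simp only: polar_distr)
  also have "\<dots> = (\<integral>\<^sup>+t. \<integral>\<^sup>+z. f t z \<partial>sphere_measure \<partial>density lborel (indicator {0..}))"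
  proof -
    have "(\<lambda>(t, z). f t z) \<in> borel_measurable (density lborel (indicator {0..}) \<Otimes>\<^sub>M (sphere_measure :: 'a measure))"
      using f by (simp cong: measurable_cong_sets sets_pair_measure_cong)
    from s.nn_integral_fst[OF this] show ?thesis by simp
  qed
  also have "\<dots> = (\<integral>\<^sup>+t. (\<integral>\<^sup>+z. f t z \<partial>sphere_measure) * indicator {0..} t \<partial>lborel)"
  proof (subst nn_integral_density)
    have "(\<lambda>(t, z). f t z) \<in> borel_measurable (lborel \<Otimes>\<^sub>M (sphere_measure :: 'a measure))"
      using f by (simp cong: measurable_cong_sets sets_pair_measure_cong)
    from s.borel_measurable_nn_integral_fst[OF this]
    show "(\<lambda>t. \<integral>\<^sup>+ z. f t z \<partial>sphere_measure) \<in> borel_measurable lborel" by simp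
  qed (auto simp: mult.commute)
  also have "\<dots> = (\<integral>\<^sup>+t\<in>{0..}. (\<integral>\<^sup>+z\<in>ball 0 1. f t (sgn z) \<partial>lborel) \<partial>lborel)"
  proof -
    have "f t \<in> borel_measurable borel" for t
      using measurable_compose[OF measurable_Pair1' f, of t] by simp
    then show ?thesis by (simp add: nn_integral_sphere_measure)
  qed
  finally show ?thesis .
qed

corollary nn_integral_radial:
  fixes f :: "real \<Rightarrow> ennreal"
  assumes [measurable]: "f \<in> borel_measurable borel"
  shows "(\<integral>\<^sup>+x. f (norm (x::'a::euclidean_space) ^ DIM('a)) \<partial>lborel) = ennreal (unit_ball_vol (real DIM('a))) * (\<integral>\<^sup>+t\<in>{0..}. f t \<partial>lborel)"
proof -
  have "(\<integral>\<^sup>+x. f (norm (x::'a) ^ DIM('a)) \<partial>lborel) = (\<integral>\<^sup>+t\<in>{0..}. (\<integral>\<^sup>+z\<in>ball (0::'a) 1. f t \<partial>lborel) \<partial>lborel)"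
    by (rule nn_integral_polar) measurable
  also have "\<dots> = (\<integral>\<^sup>+t. ennreal (unit_ball_vol (real DIM('a))) * (f t * indicator {0..} t) \<partial>lborel)"
  proof (intro nn_integral_cong)
    fix t :: real
    have "(\<integral>\<^sup>+z\<in>ball (0::'a) 1. f t \<partial>lborel) = f t * emeasure lborel (ball (0::'a) 1)"
      by (rule nn_integral_cmult_indicator) simp
    then show "(\<integral>\<^sup>+z\<in>ball (0::'a) 1. f t \<partial>lborel) * indicator {0..} t = ennreal (unit_ball_vol (real DIM('a))) * (f t * indicator {0..} t)"
      by (simp add: emeasure_ball mult_ac)
  qed
  also have "\<dots> = ennreal (unit_ball_vol (real DIM('a))) * (\<integral>\<^sup>+t\<in>{0..}. f t \<partial>lborel)"
    by (subst nn_integral_cmult) auto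
  finally show ?thesis .
qed

section \<open>Inversion in the unit sphere\<close>

lemma nn_integral_one_over:
  fixes f :: "real \<Rightarrow> ennreal"
  assumes [measurable]: "f \<in> borel_measurable borel" and T: "1 < T"
  shows "(\<integral>\<^sup>+t\<in>{1..T}. f t \<partial>lborel) = (\<integral>\<^sup>+t\<in>{1/T..1}. f (1/t) * ennreal (1/t\<^sup>2) \<partial>lborel)"
proof -
  \<comment> \<open>The reflection is inserted because \<open>- 1 / t\<close>, unlike
    \<open>1 / t\<close>, is increasing for positive \<open>t\<close>, as the substitution rule
    requires.\<close>
  have "(\<integral>\<^sup>+t\<in>{1..T}. f t \<partial>lborel) = ennreal \<bar>-1\<bar> * (\<integral>\<^sup>+x. (f (0 + (-1) * x) * indicator {1..T} (0 + (-1) * x)) \<partial>lborel)"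
    by (rule nn_integral_real_affine) auto
  also have "\<dots> = (\<integral>\<^sup>+x\<in>{-1/(1/T)..-1/1}. f (- x) \<partial>lborel)"
    by (auto intro!: nn_integral_cong simp: indicator_def)
  also have "\<dots> = (\<integral>\<^sup>+t\<in>{1/T..1}. f (- (-1/t)) * ennreal (1/t\<^sup>2) \<partial>lborel)"
  proof (rule nn_integral_substitution_aux[where g="\<lambda>t. -1/t" and f="\<lambda>x. f (-x)" and g'="\<lambda>t. 1/t\<^sup>2"])
    show "((\<lambda>t. - 1 / t) has_real_derivative 1 / x\<^sup>2) (at x)" if x: "x \<in> {1 / T..1}" for x
    proof -
      have "x \<noteq> 0" using T x by (auto simp: divide_le_eq)
      then show ?thesis by (auto intro!: derivative_eq_intros simp: power2_eq_square)
    qed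
    show "continuous_on {1 / T..1} (\<lambda>t. 1 / t\<^sup>2)"
      using T by (intro continuous_intros) (auto simp: divide_le_eq)
  qed (use T in auto)
  finally show ?thesis by simp
qed

text \<open>In polar coordinates inversion keeps the direction and replaces \<open>t = |x|^n\<close>
  by \<open>1 / t\<close>. Its Jacobian is therefore \<open>1 / t\<^sup>2\<close>, which is
  \<open>1 / norm y ^ (2 * n)\<close>.\<close>

lemma nn_integral_inversion:
  fixes f :: "'a::euclidean_space \<Rightarrow> ennreal"
  assumes [measurable]: "f \<in> borel_measurable borel" and M: "1 < M"
  shows "(\<integral>\<^sup>+x\<in>{x. 1 \<le> norm x \<and> norm x \<le> M}. f x \<partial>lborel)
    = (\<integral>\<^sup>+y\<in>{y. 1/M \<le> norm y \<and> norm y \<le> 1}. f ((1/(norm y)\<^sup>2) *\<^sub>R y) * ennreal (1 / norm y ^ (2 * DIM('a))) \<partial>lborel)"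
proof -
  let ?n = "DIM('a)"
  define T where "T = M ^ ?n"
  have T: "1 < T" using M by (simp add: T_def one_less_power)
  have [measurable]: "ball (0::'a) 1 \<in> sets borel" by simp
  have r_le: "1 \<le> norm x \<longleftrightarrow> 1 \<le> norm x ^ ?n" "norm x \<le> M \<longleftrightarrow> norm x ^ ?n \<le> T"
    "norm x \<le> 1 \<longleftrightarrow> norm x ^ ?n \<le> 1" "1/M \<le> norm x \<longleftrightarrow> 1/T \<le> norm x ^ ?n" for x :: 'a
  proof -
    have *: "p \<le> q \<longleftrightarrow> p ^ ?n \<le> q ^ ?n" if "0 \<le> p" "0 \<le> q" for p q :: real
      using that by (meson DIM_positive power_mono power_mono_iff)
    show "1 \<le> norm x \<longleftrightarrow> 1 \<le> norm x ^ ?n" using *[of 1 "norm x"] by simp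
    show "norm x \<le> M \<longleftrightarrow> norm x ^ ?n \<le> T" using *[of "norm x" M] M by (simp add: T_def)
    show "norm x \<le> 1 \<longleftrightarrow> norm x ^ ?n \<le> 1" using *[of "norm x" 1] by simp
    show "1/M \<le> norm x \<longleftrightarrow> 1/T \<le> norm x ^ ?n" using *[of "1/M" "norm x"] M by (simp add: T_def power_divide)
  qed
  have rt: "root ?n (norm x ^ ?n) = norm x" for x :: 'a by (simp add: real_root_power_cancel)
  have sg: "norm x *\<^sub>R sgn x = x" for x :: 'a by (cases "x = 0") (simp_all add: sgn_div_norm)
  let ?\<phi> = "\<lambda>t. (\<integral>\<^sup>+z\<in>ball 0 1. f (root ?n t *\<^sub>R sgn z) \<partial>lborel)"
  have \<phi>: "?\<phi> \<in> borel_measurable borel" by measurable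
  have "(\<integral>\<^sup>+x\<in>{x. 1 \<le> norm x \<and> norm x \<le> M}. f x \<partial>lborel)
      = (\<integral>\<^sup>+x. (\<lambda>t z. f (root ?n t *\<^sub>R z) * indicator {1..T} t) (norm x ^ ?n) (sgn x) \<partial>(lborel :: 'a measure))"
    by (intro nn_integral_cong) (auto simp: indicator_def rt sg r_le)
  also have "\<dots> = (\<integral>\<^sup>+t\<in>{0..}. (\<integral>\<^sup>+z\<in>ball (0::'a) 1. (f (root ?n t *\<^sub>R sgn z) * indicator {1..T} t) \<partial>lborel) \<partial>lborel)"
    by (rule nn_integral_polar) measurable
  also have "\<dots> = (\<integral>\<^sup>+t\<in>{1..T}. ?\<phi> t \<partial>lborel)"
    by (intro nn_integral_cong) (auto simp: indicator_def)
  also have "\<dots> = (\<integral>\<^sup>+t\<in>{1/T..1}. ?\<phi> (1/t) * ennreal (1/t\<^sup>2) \<partial>lborel)"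
    by (rule nn_integral_one_over[OF \<phi> T])
  also have "\<dots> = (\<integral>\<^sup>+t\<in>{0..}. (\<integral>\<^sup>+z\<in>ball (0::'a) 1. (f (root ?n (1/t) *\<^sub>R sgn z) * ennreal (1/t\<^sup>2) * indicator {1/T..1} t) \<partial>lborel) \<partial>lborel)"
  proof (intro nn_integral_cong)
    fix t :: real
    show "?\<phi> (1/t) * ennreal (1/t\<^sup>2) * indicator {1/T..1} t =
      (\<integral>\<^sup>+z\<in>ball (0::'a) 1. (f (root ?n (1/t) *\<^sub>R sgn z) * ennreal (1/t\<^sup>2) * indicator {1/T..1} t) \<partial>lborel) * indicator {0..} t"
    proof (cases "t \<in> {1/T..1}")
      case True
      moreover have "0 < 1/T" using T by simp
      ultimately have "0 < t" by (simp only: atLeastAtMost_iff) linarith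
      moreover have "?\<phi> (1/t) * ennreal (1/t\<^sup>2) = (\<integral>\<^sup>+z\<in>ball (0::'a) 1. (f (root ?n (1/t) *\<^sub>R sgn z) * ennreal (1/t\<^sup>2)) \<partial>lborel)"
      proof -
        have "?\<phi> (1/t) * ennreal (1/t\<^sup>2) = (\<integral>\<^sup>+z. f (root ?n (1/t) *\<^sub>R sgn z) * indicator (ball (0::'a) 1) z * ennreal (1/t\<^sup>2) \<partial>lborel)"
          by (rule nn_integral_multc[symmetric]) measurable
        also have "\<dots> = (\<integral>\<^sup>+z\<in>ball (0::'a) 1. (f (root ?n (1/t) *\<^sub>R sgn z) * ennreal (1/t\<^sup>2)) \<partial>lborel)"
          by (intro nn_integral_cong) (simp only: mult.assoc mult.commute mult.left_commute)
        finally show ?thesis .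
      qed
      ultimately show ?thesis using True by simp
    qed simp
  qed
  also have "\<dots> = (\<integral>\<^sup>+y. (\<lambda>t z. f (root ?n (1/t) *\<^sub>R z) * ennreal (1/t\<^sup>2) * indicator {1/T..1} t) (norm y ^ ?n) (sgn y) \<partial>(lborel :: 'a measure))"
    by (rule nn_integral_polar[symmetric]) measurable
  also have "\<dots> = (\<integral>\<^sup>+y\<in>{y. 1/M \<le> norm y \<and> norm y \<le> 1}. f ((1/(norm y)\<^sup>2) *\<^sub>R y) * ennreal (1 / norm y ^ (2 * ?n)) \<partial>lborel)"
  proof (intro nn_integral_cong)
    fix y :: 'a
    have "root ?n (1 / norm y ^ ?n) = 1 / norm y" by (simp add: real_root_divide rt)
    moreover have "(1 / norm y) *\<^sub>R sgn y = (1/(norm y)\<^sup>2) *\<^sub>R y" by (simp add: sgn_div_norm power2_eq_square divide_inverse)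
    moreover have "(norm y ^ ?n)\<^sup>2 = norm y ^ (2 * ?n)" by (simp add: power_mult[symmetric] mult.commute)
    ultimately show "(\<lambda>t z. f (root ?n (1/t) *\<^sub>R z) * ennreal (1/t\<^sup>2) * indicator {1/T..1} t) (norm y ^ ?n) (sgn y)
       = f ((1/(norm y)\<^sup>2) *\<^sub>R y) * ennreal (1 / norm y ^ (2 * ?n)) * indicator {y. 1/M \<le> norm y \<and> norm y \<le> 1} y"
      by (auto simp: indicator_def r_le)
  qed
  finally show ?thesis .
qed

lemma AE_norm_notin_finite:
  assumes "finite N" shows "AE x in lborel. norm (x::'a::euclidean_space) \<notin> N"
proof -
  have "AE x in lborel. x \<notin> sphere (0::'a) r" for r
  proof (rule AE_not_in)
    have "sphere (0::'a) r \<in> null_sets lebesgue" using negligible_sphere by (simp only: negligible_iff_null_sets)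
    moreover have "sphere (0::'a) r \<in> sets lborel" by simp
    ultimately show "sphere (0::'a) r \<in> null_sets lborel" by (simp only: null_sets_completion_iff)
  qed
  then have "AE x in lborel. \<forall>r\<in>N. x \<notin> sphere (0::'a) r"
    using assms by (subst AE_ball_countable) (auto intro: countable_finite)
  then show ?thesis by eventually_elim auto
qed

section \<open>Divergence of radial fields\<close>

lemma has_partial_compose:
  assumes "has_partial b u x D" "(f has_real_derivative E) (at (u x))"
  shows "has_partial b (\<lambda>x. f (u x)) x (E * D)"
proof -
  have "(f has_real_derivative E) (at (u (x + 0 *\<^sub>R b)))" using assms(2) by simp
  from DERIV_chain2[OF this assms(1)[unfolded has_partial_def]] show ?thesis by (simp add: has_partial_def)
qed

lemma has_partial_norm:
  assumes "x \<noteq> 0" shows "has_partial b norm x ((x \<bullet> b) / norm x)"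
proof -
  have "(norm has_derivative (\<lambda>h. h \<bullet> sgn x)) (at x)" using has_derivative_norm[OF assms] by simp
  from has_partial_has_derivative[OF this, of b] show ?thesis
    by (simp add: sgn_div_norm inner_commute divide_inverse mult.commute)
qed

lemma has_partial_inner: "has_partial b (\<lambda>x. x \<bullet> c) x (b \<bullet> c)"
  by (rule has_partial_has_derivative) (auto intro!: derivative_eq_intros)

text \<open>The divergence theorem in the form used later: with \<open>w = u\<close> for means over
  shells, and with \<open>w\<close> the square of a function for the Kelvin extension. The profile
  \<open>k\<close> is glued from smooth pieces, hence the finite set \<open>N\<close> of exceptional
  radii.\<close>

lemma radial_divergence:
  fixes w :: "'a::euclidean_space \<Rightarrow> real" and k k' :: "real \<Rightarrow> real"
  assumes w: "locally_lip w" and k: "locally_lip (\<lambda>x::'a. k (norm x))"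
    and supp: "\<And>x. R < norm x \<Longrightarrow> w x * k (norm x) = 0"
    and Dw: "AE x in lborel. \<forall>b\<in>Basis. has_partial b w x (Dw x \<bullet> b)"
    and N: "finite N" and dk: "\<And>r. 0 < r \<Longrightarrow> r \<notin> N \<Longrightarrow> (k has_real_derivative k' r) (at r)"
  shows "has_bochner_integral lborel
    (\<lambda>x. \<Sum>b\<in>Basis. partial_deriv b (\<lambda>x. w x * k (norm x) * (x \<bullet> b)) x) 0"
    "AE x in lborel. (\<Sum>b\<in>Basis. partial_deriv b (\<lambda>x. w x * k (norm x) * (x \<bullet> b)) x) =
      k (norm x) * (Dw x \<bullet> x) + w x * (DIM('a) * k (norm x) + norm x * k' (norm x))"
proof -
  have "has_bochner_integral lborel (partial_deriv b (\<lambda>x. w x * k (norm x) * (x \<bullet> b))) 0" for b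
  proof -
    have "locally_lip (\<lambda>x. w x * k (norm x) * (x \<bullet> b))" by (intro locally_lip_mult w k locally_lip_inner)
    moreover have 0: "w x * k (norm x) * (x \<bullet> b) = 0" if "R < norm x" for x :: 'a using supp[OF that] by simp
    ultimately obtain L where "L-lipschitz_on UNIV (\<lambda>x. w x * k (norm x) * (x \<bullet> b))"
      using locally_lip_compact_support_imp_lipschitz by blast
    from integral_partial_deriv_eq_0[where b=b, OF this 0] show ?thesis
      by (simp add: has_bochner_integral_iff)
  qed
  then have "has_bochner_integral lborel
    (\<lambda>x. \<Sum>b\<in>(Basis::'a set). partial_deriv b (\<lambda>x. w x * k (norm x) * (x \<bullet> b)) x) (\<Sum>b\<in>(Basis::'a set). 0)"
    by (intro has_bochner_integral_sum) auto
  then show "has_bochner_integral lborel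
    (\<lambda>x. \<Sum>b\<in>Basis. partial_deriv b (\<lambda>x. w x * k (norm x) * (x \<bullet> b)) x) 0" by simp
  have "AE x in lborel. norm (x::'a) \<notin> insert 0 N" using N by (intro AE_norm_notin_finite) simp
  with Dw show "AE x in lborel. (\<Sum>b\<in>Basis. partial_deriv b (\<lambda>x. w x * k (norm x) * (x \<bullet> b)) x) =
      k (norm x) * (Dw x \<bullet> x) + w x * (DIM('a) * k (norm x) + norm x * k' (norm x))"
  proof eventually_elim
    fix x :: 'a assume D: "\<forall>b\<in>Basis. has_partial b w x (Dw x \<bullet> b)" and x: "norm x \<notin> insert 0 N"
    then have x0: "x \<noteq> 0" by auto
    have "partial_deriv b (\<lambda>x. w x * k (norm x) * (x \<bullet> b)) x =
        k (norm x) * ((Dw x \<bullet> b) * (x \<bullet> b)) + w x * k (norm x) + (w x * k' (norm x) / norm x) * ((x \<bullet> b) * (x \<bullet> b))"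
      if b: "b \<in> Basis" for b
    proof -
      have 1: "has_partial b (\<lambda>x. k (norm x)) x (k' (norm x) * ((x \<bullet> b) / norm x))"
        by (rule has_partial_compose[OF has_partial_norm[OF x0]]) (use dk x x0 in auto)
      have 2: "has_partial b (\<lambda>x. x \<bullet> b) x 1" using has_partial_inner[of b b x] b by (simp add: inner_Basis)
      have 3: "has_partial b w x (Dw x \<bullet> b)" using D b by blast
      from has_partial_imp_partial_deriv[OF has_partial_mult[OF has_partial_mult[OF 3 1] 2]]
      show ?thesis by (simp add: algebra_simps)
    qed
    then have "(\<Sum>b\<in>Basis. partial_deriv b (\<lambda>x. w x * k (norm x) * (x \<bullet> b)) x) =
       (\<Sum>b\<in>Basis. k (norm x) * ((Dw x \<bullet> b) * (x \<bullet> b)) + w x * k (norm x) + (w x * k' (norm x) / norm x) * ((x \<bullet> b) * (x \<bullet> b)))"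
      by (intro sum.cong) auto
    also have "\<dots> = k (norm x) * (Dw x \<bullet> x) + w x * (DIM('a) * k (norm x)) + (w x * k' (norm x) / norm x) * (x \<bullet> x)"
    proof -
      have "x \<bullet> x = (\<Sum>b\<in>Basis. (x \<bullet> b) * (x \<bullet> b))" "Dw x \<bullet> x = (\<Sum>b\<in>Basis. (Dw x \<bullet> b) * (x \<bullet> b))"
        by (rule euclidean_inner)+
      then show ?thesis by (simp only: sum.distrib sum_distrib_left[symmetric] sum_constant)
    qed
    also have "x \<bullet> x = norm x * norm x" by (metis power2_norm_eq_inner power2_eq_square)
    finally show "(\<Sum>b\<in>Basis. partial_deriv b (\<lambda>x. w x * k (norm x) * (x \<bullet> b)) x) =
      k (norm x) * (Dw x \<bullet> x) + w x * (DIM('a) * k (norm x) + norm x * k' (norm x))"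
      using x0 by (simp add: algebra_simps)
  qed
qed

text \<open>This is the energy of the field \<open>x / |x|^n\<close> outside the ball of radius
  \<open>a\<close>. In the variable \<open>t = |x|^n\<close> the integrand is
  \<open>t powr q\<close>, integrable at infinity since
  \<open>q + 1 = 2 / n - 1 < 0\<close>.\<close>

lemma nn_integral_norm_tail:
  fixes a :: real
  assumes n: "3 \<le> DIM('a::euclidean_space)" and a: "0 < a"
  shows "(\<integral>\<^sup>+x\<in>{x::'a. a \<le> norm x}. ennreal (1 / norm x ^ (2 * DIM('a) - 2)) \<partial>lborel)
    = ennreal (real DIM('a) * unit_ball_vol (real DIM('a)) / ((real DIM('a) - 2) * a ^ (DIM('a) - 2)))"
proof -
  let ?n = "DIM('a)" let ?w = "unit_ball_vol (real ?n)"
  define q where "q = 2 / real ?n - 2"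
  have pw: "1 / s ^ (2 * ?n - 2) = (s ^ ?n) powr q" if "0 < s" for s :: real
  proof -
    have "(s ^ ?n) powr q = s powr (real ?n * q)" using that by (simp add: powr_realpow[symmetric] powr_powr)
    also have "real ?n * q = - real (2 * ?n - 2)" using n by (simp add: q_def field_simps)
    also have "s powr (- real (2 * ?n - 2)) = 1 / s ^ (2 * ?n - 2)"
      using that by (simp only: powr_minus powr_realpow inverse_eq_divide)
    finally show ?thesis by simp
  qed
  have A: "0 < a ^ ?n" using a by simp
  have "(\<integral>\<^sup>+x\<in>{x::'a. a \<le> norm x}. ennreal (1 / norm x ^ (2 * ?n - 2)) \<partial>lborel)
     = (\<integral>\<^sup>+x. (\<lambda>t. ennreal (t powr q) * indicator {a ^ ?n..} t) (norm (x::'a) ^ ?n) \<partial>lborel)"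
  proof (intro nn_integral_cong)
    fix x :: 'a
    have "a \<le> norm x \<longleftrightarrow> a ^ ?n \<le> norm x ^ ?n"
      using a by (meson DIM_positive less_imp_le norm_ge_zero power_mono power_mono_iff)
    then show "ennreal (1 / norm x ^ (2 * ?n - 2)) * indicator {x::'a. a \<le> norm x} x
        = (\<lambda>t. ennreal (t powr q) * indicator {a ^ ?n..} t) (norm x ^ ?n)"
      using a pw[of "norm x"] by (cases "a \<le> norm x") (auto simp: indicator_def simp del: zero_less_norm_iff)
  qed
  also have "\<dots> = ennreal ?w * (\<integral>\<^sup>+t. (ennreal (t powr q) * indicator {a ^ ?n..} t) * indicator {0..} t \<partial>lborel)"
    by (rule nn_integral_radial) measurable
  also have "(\<integral>\<^sup>+t. (ennreal (t powr q) * indicator {a ^ ?n..} t) * indicator {0..} t \<partial>lborel)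
      = (\<integral>\<^sup>+t. ennreal (t powr q) * indicator {a ^ ?n..} t \<partial>lborel)"
    using A by (intro nn_integral_cong) (auto simp: indicator_def)
  also have "\<dots> = ennreal (0 - (a ^ ?n) powr (q + 1) / (q + 1))"
  proof (rule nn_integral_FTC_atLeast)
    have q1: "q + 1 < 0" using n by (simp add: q_def field_simps)
    show "((\<lambda>t. t powr (q + 1) / (q + 1)) has_real_derivative x powr q) (at x)" if "a ^ ?n \<le> x" for x
      using that A q1 by (auto intro!: derivative_eq_intros)
    show "((\<lambda>t. t powr (q + 1) / (q + 1)) \<longlongrightarrow> 0) at_top"
      using tendsto_divide[OF tendsto_neg_powr[OF q1 filterlim_ident] tendsto_const, of "q + 1"] q1 by simp
  qed auto
  also have "0 - (a ^ ?n) powr (q + 1) / (q + 1) = real ?n / ((real ?n - 2) * a ^ (?n - 2))"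
  proof -
    have "(a ^ ?n) powr (q + 1) = a powr (real ?n * (q + 1))" using a by (simp add: powr_realpow[symmetric] powr_powr)
    also have "real ?n * (q + 1) = - real (?n - 2)" using n by (simp add: q_def field_simps)
    also have "a powr (- real (?n - 2)) = 1 / a ^ (?n - 2)"
      using a by (simp only: powr_minus powr_realpow inverse_eq_divide)
    finally have "0 - (a ^ ?n) powr (q + 1) / (q + 1) = (1 / a ^ (?n - 2)) / (- (q + 1))"
      by (simp only: diff_0 minus_divide_right)
    moreover have "- (q + 1) = (real ?n - 2) / real ?n" using n by (simp add: q_def field_simps)
    moreover have "real (?n - 2) = real ?n - 2" using n by simp
    moreover have "1 / X / ((real ?n - 2) / real ?n) = real ?n / ((real ?n - 2) * X)" for X :: real by simp
    ultimately show ?thesis by (simp only:)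
  qed
  finally show ?thesis using n a
    by (simp add: ennreal_mult[symmetric] mult.commute)
qed

lemma AE_all_partials:
  fixes u :: "'a::euclidean_space \<Rightarrow> real"
  assumes L: "L-lipschitz_on UNIV u"
  shows "AE x in lborel. \<forall>b\<in>Basis. has_partial b u x (gradient u x \<bullet> b)"
proof -
  have "AE x in lborel. \<forall>b\<in>Basis. has_partial b u x (partial_deriv b u x)"
    using lipschitz_AE_has_partial[OF L] by (subst AE_ball_countable) (auto intro: countable_finite)
  then show ?thesis by (simp add: gradient_inner_Basis cong: ball_cong)
qed

lemma gradient_bounded:
  fixes u :: "'a::euclidean_space \<Rightarrow> real"
  assumes L: "L-lipschitz_on UNIV u"
  shows "AE x in lborel. (norm (gradient u x))\<^sup>2 \<le> real DIM('a) * L\<^sup>2"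
  using AE_all_partials[OF L]
proof eventually_elim
  fix x assume "\<forall>b\<in>Basis. has_partial b u x (gradient u x \<bullet> b)"
  then have "\<bar>partial_deriv b u x\<bar> \<le> L" if "b \<in> Basis" for b
    using has_partial_bound[OF L, of b x] that by (auto simp: gradient_inner_Basis)
  then have "(partial_deriv b u x)\<^sup>2 \<le> L\<^sup>2" if "b \<in> Basis" for b
    using that by (metis abs_le_square_iff abs_of_nonneg lipschitz_on_nonneg[OF L])
  then have "(\<Sum>b\<in>Basis. (partial_deriv b u x)\<^sup>2) \<le> real (card (Basis :: 'a set)) * L\<^sup>2"
    by (intro sum_bounded_above) auto
  then show "(norm (gradient u x))\<^sup>2 \<le> real DIM('a) * L\<^sup>2" by (simp add: norm_gradient_squared)
qed

lemma gradient_zero_outside: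
  assumes "\<And>x. R < norm x \<Longrightarrow> u x = 0" "R < norm x" shows "gradient u x = 0"
proof -
  have "partial_deriv b u x = 0" for b
    by (rule has_partial_imp_partial_deriv[OF partial_zero_outside[where R=R]]) (use assms in auto)
  then show ?thesis by (simp add: gradient_def)
qed

lemma integrable_gradient_square:
  fixes u :: "'a::euclidean_space \<Rightarrow> real"
  assumes L: "L-lipschitz_on UNIV u" and supp: "\<And>x. R < norm x \<Longrightarrow> u x = 0"
  shows "integrable lborel (\<lambda>x. (norm (gradient u x))\<^sup>2)"
proof (rule integrable_cball_bounded)
  show "(\<lambda>x. (norm (gradient u x))\<^sup>2) \<in> borel_measurable borel" using gradient_borel[OF L] by measurable
  show "AE x in lborel. \<bar>(norm (gradient u x))\<^sup>2\<bar> \<le> real DIM('a) * L\<^sup>2" using gradient_bounded[OF L] by simp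
  show "AE x in lborel. R < norm x \<longrightarrow> (norm (gradient u x))\<^sup>2 = 0"
  proof (intro AE_I2 impI)
    fix x :: 'a assume "R < norm x"
    from gradient_zero_outside[OF supp this] show "(norm (gradient u x))\<^sup>2 = 0" by simp
  qed
qed

lemma integrable_gradient_inner:
  fixes u :: "'a::euclidean_space \<Rightarrow> real"
  assumes L: "L-lipschitz_on UNIV u" and supp: "\<And>x. R < norm x \<Longrightarrow> u x = 0"
    and [measurable]: "V \<in> borel_measurable borel" and V: "integrable lborel (\<lambda>x. (norm (V x))\<^sup>2)"
  shows "integrable lborel (\<lambda>x. gradient u x \<bullet> V x)"
proof (rule Bochner_Integration.integrable_bound)
  show "integrable lborel (\<lambda>x. (norm (gradient u x))\<^sup>2 + (norm (V x))\<^sup>2)"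
    using integrable_gradient_square[OF L supp] V by (rule Bochner_Integration.integrable_add)
  show "(\<lambda>x. gradient u x \<bullet> V x) \<in> borel_measurable lborel" using gradient_borel[OF L] by measurable
  show "AE x in lborel. norm (gradient u x \<bullet> V x) \<le> norm ((norm (gradient u x))\<^sup>2 + (norm (V x))\<^sup>2)"
  proof (intro AE_I2)
    fix x
    have "norm (gradient u x \<bullet> V x) \<le> norm (gradient u x) * norm (V x)"
      using Cauchy_Schwarz_ineq2 by simp
    also have "\<dots> \<le> (norm (gradient u x))\<^sup>2 + (norm (V x))\<^sup>2"
    proof -
      have "2 * (norm (gradient u x) * norm (V x)) \<le> (norm (gradient u x))\<^sup>2 + (norm (V x))\<^sup>2"
        using sum_squares_bound[of "norm (gradient u x)" "norm (V x)"] by (simp add: power2_eq_square mult.assoc)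
      moreover have "0 \<le> norm (gradient u x) * norm (V x)" by simp
      ultimately show ?thesis by linarith
    qed
    finally show "norm (gradient u x \<bullet> V x) \<le> norm ((norm (gradient u x))\<^sup>2 + (norm (V x))\<^sup>2)" by simp
  qed
qed

text \<open>The field \<open>V\<close> below is the gradient of the potential of the uniform distribution on the
  shell. Its energy does not exceed the one of the equilibrium field of the inner ball.\<close>

lemma shell_average_le_energy_centered:
  fixes u :: "'a::euclidean_space \<Rightarrow> real"
  assumes n: "3 \<le> DIM('a)" and L: "L-lipschitz_on UNIV u" and supp: "\<And>x. R < norm x \<Longrightarrow> u x = 0"
    and ab: "0 < a" "a < b"
    and m: "(\<integral>x. u x * indicator {x. a < norm x \<and> norm x < b} x \<partial>lborel)
      = m * (unit_ball_vol (real DIM('a)) * (b ^ DIM('a) - a ^ DIM('a)))"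
  shows "m\<^sup>2 * (real DIM('a) * (real DIM('a) - 2) * unit_ball_vol (real DIM('a)) * a ^ (DIM('a) - 2))
    \<le> (\<integral>x. (norm (gradient u x))\<^sup>2 \<partial>lborel)"
proof -
  let ?n = "DIM('a)" let ?w = "unit_ball_vol (real ?n)"
  let ?S = "{x::'a. a < norm x \<and> norm x < b}"
  have w: "0 < ?w" by simp
  have abn: "a ^ ?n < b ^ ?n" using ab n by (intro power_strict_mono) auto
  define d where "d = b ^ ?n - a ^ ?n"
  have d: "0 < d" using abn by (simp add: d_def)
  \<comment> \<open>\<open>V\<close> vanishes in the inner ball and is \<open>x / |x|^n\<close>
    beyond the shell; in between the profile makes the divergence of \<open>V\<close> the constant
    \<open>n / d\<close>. The maxima merge the three cases into one locally Lipschitz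
    expression.\<close>
  define k where "k = (\<lambda>r::real. (b ^ ?n * inverse (max b r ^ ?n) - a ^ ?n * inverse (max a r ^ ?n)) / d)"
  define k' where "k' = (\<lambda>r::real. ((if r < b then 0 else - (b ^ ?n * (?n / r ^ (?n + 1)))) - (if r < a then 0 else - (a ^ ?n * (?n / r ^ (?n + 1))))) / d)"
  define V where "V = (\<lambda>x::'a. k (norm x) *\<^sub>R x)"
  have b: "0 < b" using ab by simp
  have kll: "locally_lip (\<lambda>x::'a. k (norm x))"
  proof -
    have 1: "locally_lip (\<lambda>x::'a. inverse (max c (norm x) ^ ?n))" if "0 < c" for c
      by (rule locally_lip_inverse[of _ "c ^ ?n"]) (use that in \<open>auto intro!: power_mono\<close>)
    have "locally_lip (\<lambda>x::'a. (b ^ ?n * inverse (max b (norm x) ^ ?n) - a ^ ?n * inverse (max a (norm x) ^ ?n)) * inverse d)"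
      by (intro locally_lip_mult locally_lip_minus locally_lip_const 1) (use ab in auto)
    then show ?thesis by (simp add: k_def divide_inverse)
  qed
  have dmax: "((\<lambda>r. c ^ ?n * inverse (max c r ^ ?n)) has_real_derivative (if r < c then 0 else - (c ^ ?n * (?n / r ^ (?n + 1))))) (at r)"
    if r: "0 < r" "r \<noteq> c" and c: "0 < c" for r c :: real
  proof (cases "r < c")
    case True
    have "((\<lambda>r. 1) has_real_derivative 0) (at r)" by simp
    then have "((\<lambda>r. c ^ ?n * inverse (max c r ^ ?n)) has_real_derivative 0) (at r)"
      by (rule DERIV_cong_ev[THEN iffD1, rotated -1, OF _ refl _ refl])
         (use True c in \<open>auto simp: eventually_nhds max_def intro!: exI[of _ "{..<c}"]\<close>)
    then show ?thesis using True by simp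
  next
    case False
    have "((\<lambda>r. c ^ ?n * inverse (r ^ ?n)) has_real_derivative (- (c ^ ?n * (?n / r ^ (?n + 1))))) (at r)"
    proof -
      have e: "?n = Suc (?n - 1)" using n by simp
      have "((\<lambda>r. r ^ ?n) has_real_derivative real ?n * r ^ (?n - 1)) (at r)"
        by (auto intro!: derivative_eq_intros)
      from DERIV_cmult[OF DERIV_inverse'[OF this], of "c ^ ?n"]
      have "((\<lambda>r. c ^ ?n * inverse (r ^ ?n)) has_real_derivative c ^ ?n * - (inverse (r ^ ?n) * (real ?n * r ^ (?n - 1)) * inverse (r ^ ?n))) (at r)"
        using r by simp
      moreover have "inverse (r ^ ?n) * (real ?n * r ^ (?n - 1)) * inverse (r ^ ?n) = ?n / r ^ (?n + 1)"
      proof -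
        have "r ^ ?n = r * r ^ (?n - 1)" using e by (metis power_Suc)
        then show ?thesis using r by (simp add: field_simps)
      qed
      ultimately show ?thesis by simp
    qed
    then have "((\<lambda>r. c ^ ?n * inverse (max c r ^ ?n)) has_real_derivative (- (c ^ ?n * (?n / r ^ (?n + 1))))) (at r)"
      by (rule DERIV_cong_ev[THEN iffD1, rotated -1, OF _ refl _ refl])
         (use False r in \<open>auto simp: eventually_nhds max_def intro!: exI[of _ "{c<..}"]\<close>)
    then show ?thesis using False by simp
  qed
  have dk: "(k has_real_derivative k' r) (at r)" if "0 < r" "r \<notin> {a, b}" for r
    unfolding k_def k'_def using that b ab
    by (intro DERIV_cdivide DERIV_diff dmax) auto
  have kval: "k r = (if r < a then 0 else if r < b then (1 - a ^ ?n / r ^ ?n) / d else 1 / r ^ ?n)" if "0 \<le> r" for r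
  proof -
    have one: "a ^ ?n * inverse (a ^ ?n) = 1" "b ^ ?n * inverse (b ^ ?n) = 1" using ab by simp_all
    consider "r < a" | "a \<le> r" "r < b" | "b \<le> r" by linarith
    then show ?thesis
    proof cases
      case 1
      then have "max b r = b" "max a r = a" using ab by auto
      then show ?thesis using 1 one by (simp only: k_def) simp
    next
      case 2
      then have "max b r = b" "max a r = r" by auto
      then show ?thesis using 2 one by (simp only: k_def) (simp add: divide_inverse)
    next
      case 3
      then have "max b r = r" "max a r = r" "\<not> r < a" "\<not> r < b" using ab by auto
      moreover have "(b ^ ?n * X - a ^ ?n * X) / d = X" for X
        using d by (simp add: d_def left_diff_distrib[symmetric])
      ultimately show ?thesis by (simp only: k_def if_False) (simp add: divide_inverse)
    qed
  qed
  have div: "?n * k r + r * k' r = (?n / d) * (if a < r \<and> r < b then 1 else 0)" if r: "0 < r" "r \<notin> {a, b}" for r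
  proof -
    have e: "r * (X * (?n / r ^ (?n + 1))) = ?n * (X / r ^ ?n)" for X using r by (simp add: field_simps)
    consider "r < a" | "a < r" "r < b" | "b < r" using r ab by force
    then show ?thesis
    proof cases
      case 1 then show ?thesis using ab r by (simp add: kval k'_def)
    next
      case 2
      then have "r * k' r = ?n * (a ^ ?n / r ^ ?n) / d" using e[of "a ^ ?n"] by (simp add: k'_def)
      moreover have "k r = (1 - a ^ ?n / r ^ ?n) / d" using 2 r by (simp add: kval)
      moreover have "?n * ((1 - X) / d) + ?n * X / d = ?n / d" for X :: real
        by (simp add: right_diff_distrib diff_divide_distrib)
      ultimately have "?n * k r + r * k' r = ?n / d" by (simp only:)
      then show ?thesis using 2 by simp
    next
      case 3
      then have "k' r = (- (b ^ ?n * (?n / r ^ (?n + 1))) + a ^ ?n * (?n / r ^ (?n + 1))) / d" using ab by (simp add: k'_def)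
      also have "\<dots> = - (?n / r ^ (?n + 1)) * ((b ^ ?n - a ^ ?n) / d)"
      proof -
        have "(- (Q * z) + P * z) / d = - z * ((Q - P) / d)" for P Q z :: real using d by (simp add: field_simps)
        then show ?thesis .
      qed
      also have "\<dots> = - (?n / r ^ (?n + 1))" using d by (simp add: d_def)
      finally have "r * k' r = - ?n / r ^ ?n" using r by simp
      then show ?thesis using 3 ab r by (simp add: kval)
    qed
  qed
  have cont: "continuous_on UNIV u" using L by (rule lipschitz_on_continuous_on)
  have Vm: "V \<in> borel_measurable borel"
    unfolding V_def using locally_lip_continuous[OF kll] by (intro borel_measurable_continuous_onI continuous_intros)
  \<comment> \<open>The energy of \<open>x / |x|^n\<close> outside the ball of radius
    \<open>a\<close>. It dominates that of \<open>V\<close> because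
    \<open>0 \<le> k r \<le> 1 / r ^ n\<close> for \<open>r \<ge> a\<close>.\<close>
  let ?T = "real ?n * ?w / ((real ?n - 2) * a ^ (?n - 2))"
  have T: "0 < ?T" using n ab w by auto
  have Vle: "(norm (V x))\<^sup>2 \<le> 1 / norm x ^ (2 * ?n - 2) * indicator {x. a \<le> norm x} x" for x
  proof (cases "a \<le> norm x")
    case True
    then have x: "0 < norm x" using ab by linarith
    have "0 \<le> k (norm x) \<and> k (norm x) \<le> 1 / norm x ^ ?n"
    proof (cases "norm x < b")
      case True
      have p: "0 < norm x ^ ?n" using x by simp
      have le: "a ^ ?n \<le> norm x ^ ?n" "norm x ^ ?n \<le> b ^ ?n" using \<open>a \<le> norm x\<close> True ab by (auto intro!: power_mono)
      have "(1 - a ^ ?n / norm x ^ ?n) / d = ((norm x ^ ?n - a ^ ?n) / d) / norm x ^ ?n"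
      proof -
        have "(1 - P / Q) / d = ((Q - P) / d) / Q" if "0 < Q" for P Q :: real
          using that d by (simp add: field_simps)
        then show ?thesis using p .
      qed
      moreover have "(norm x ^ ?n - a ^ ?n) / d \<le> 1" "0 \<le> (norm x ^ ?n - a ^ ?n) / d" using le d by (auto simp: d_def divide_le_eq)
      moreover have "k (norm x) = (1 - a ^ ?n / norm x ^ ?n) / d" using True \<open>a \<le> norm x\<close> by (simp add: kval)
      moreover have "0 \<le> Z / norm x ^ ?n \<and> Z / norm x ^ ?n \<le> 1 / norm x ^ ?n" if "Z \<le> 1" "0 \<le> Z" for Z
        using that p by (simp add: divide_right_mono)
      ultimately show ?thesis by (simp only:)
    next
      case False then show ?thesis using \<open>a \<le> norm x\<close> by (simp add: kval)
    qed
    then have "(k (norm x))\<^sup>2 \<le> (1 / norm x ^ ?n)\<^sup>2" by (intro power_mono) auto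
    then have "(k (norm x))\<^sup>2 * (norm x)\<^sup>2 \<le> (1 / norm x ^ ?n)\<^sup>2 * (norm x)\<^sup>2" by (intro mult_right_mono) auto
    also have "\<dots> = 1 / norm x ^ (2 * ?n - 2)"
    proof -
      have "norm x ^ (2 * ?n) = norm x ^ (2 * ?n - 2) * (norm x)\<^sup>2"
      proof -
        have "2 * ?n = (2 * ?n - 2) + 2" using n by simp
        then show ?thesis by (metis power_add)
      qed
      moreover have "(norm x ^ ?n)\<^sup>2 = norm x ^ (2 * ?n)" by (simp add: power_mult[symmetric] mult.commute)
      ultimately show ?thesis using x by (simp add: power_divide)
    qed
    finally show ?thesis using True by (simp add: V_def power_mult_distrib)
  next
    case False then show ?thesis by (simp add: V_def kval)
  qed
  have Vnn: "(\<integral>\<^sup>+x. ennreal ((norm (V x))\<^sup>2) \<partial>lborel) \<le> ennreal ?T"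
  proof -
    have "(\<integral>\<^sup>+x. ennreal ((norm (V x))\<^sup>2) \<partial>lborel) \<le> (\<integral>\<^sup>+x\<in>{x::'a. a \<le> norm x}. ennreal (1 / norm x ^ (2 * ?n - 2)) \<partial>lborel)"
    proof (intro nn_integral_mono)
      fix x :: 'a
      show "ennreal ((norm (V x))\<^sup>2) \<le> ennreal (1 / norm x ^ (2 * ?n - 2)) * indicator {x. a \<le> norm x} x"
        using ennreal_leI[OF Vle[of x]] by (auto simp: indicator_def split: if_splits)
    qed
    then show ?thesis by (simp only: nn_integral_norm_tail[OF n ab(1)])
  qed
  have Vi: "integrable lborel (\<lambda>x. (norm (V x))\<^sup>2)"
    using Vnn Vm by (intro integrableI_nonneg) (auto simp: less_top[symmetric] top_unique)
  have VT: "(\<integral>x. (norm (V x))\<^sup>2 \<partial>lborel) \<le> ?T"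
    using Vnn Vi T by (simp add: nn_integral_eq_integral)
  have s0: "u x * k (norm x) = 0" if "R < norm x" for x using supp[OF that] by simp
  have fin: "finite {a, b}" by simp
  have rd: "has_bochner_integral lborel (\<lambda>x. \<Sum>b\<in>Basis. partial_deriv b (\<lambda>x. u x * k (norm x) * (x \<bullet> b)) x) 0"
    "AE x in lborel. (\<Sum>b\<in>Basis. partial_deriv b (\<lambda>x. u x * k (norm x) * (x \<bullet> b)) x) =
      k (norm x) * (gradient u x \<bullet> x) + u x * (?n * k (norm x) + norm x * k' (norm x))"
    by (rule radial_divergence[where R=R, OF lipschitz_imp_locally_lip[OF L] kll _ AE_all_partials[OF L] fin], (erule s0, erule dk, assumption))+
  have gi: "integrable lborel (\<lambda>x. gradient u x \<bullet> V x)"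
    by (rule integrable_gradient_inner[OF L supp Vm Vi])
  have ui: "integrable lborel (\<lambda>x. u x * indicator ?S x)"
  proof -
    have "?S \<in> sets lborel" by measurable
    from integrable_mult_indicator[OF this integrable_continuous_compact_support[OF cont supp]]
    show ?thesis by (simp add: mult.commute)
  qed
  \<comment> \<open>The divergence of \<open>u V\<close> integrates to 0, which turns the integral
    of \<open>u\<close> over the shell into a pairing of its gradient with \<open>V\<close>.\<close>
  have "(\<integral>x. gradient u x \<bullet> V x + (?n / d) * (u x * indicator ?S x) \<partial>lborel) = 0"
  proof -
    have "(\<integral>x. gradient u x \<bullet> V x + (?n / d) * (u x * indicator ?S x) \<partial>lborel)
      = (\<integral>x. (\<Sum>b\<in>Basis. partial_deriv b (\<lambda>x. u x * k (norm x) * (x \<bullet> b)) x) \<partial>lborel)"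
    proof (rule integral_cong_AE)
      have "AE x in lborel. norm (x::'a) \<notin> {0, a, b}" by (rule AE_norm_notin_finite) simp
      with rd(2) show "AE x in lborel. gradient u x \<bullet> V x + (?n / d) * (u x * indicator ?S x)
        = (\<Sum>b\<in>Basis. partial_deriv b (\<lambda>x. u x * k (norm x) * (x \<bullet> b)) x)"
      proof eventually_elim
        fix x :: 'a
        assume 1: "(\<Sum>b\<in>Basis. partial_deriv b (\<lambda>x. u x * k (norm x) * (x \<bullet> b)) x)
           = k (norm x) * (gradient u x \<bullet> x) + u x * (?n * k (norm x) + norm x * k' (norm x))" and x: "norm x \<notin> {0, a, b}"
        have "0 < norm x" using x by auto
        with div[of "norm x"] x have "?n * k (norm x) + norm x * k' (norm x) = (?n / d) * indicator ?S x" by (simp add: indicator_def)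
        with 1 show "gradient u x \<bullet> V x + (?n / d) * (u x * indicator ?S x)
          = (\<Sum>b\<in>Basis. partial_deriv b (\<lambda>x. u x * k (norm x) * (x \<bullet> b)) x)" by (simp add: V_def)
      qed
      show "(\<lambda>x. gradient u x \<bullet> V x + (?n / d) * (u x * indicator ?S x)) \<in> borel_measurable lborel"
        using gi ui by (intro borel_measurable_add borel_measurable_times borel_measurable_const borel_measurable_integrable)
      show "(\<lambda>x. \<Sum>b\<in>Basis. partial_deriv b (\<lambda>x. u x * k (norm x) * (x \<bullet> b)) x) \<in> borel_measurable lborel"
        using rd(1) by (auto simp: has_bochner_integral_iff)
    qed
    then show ?thesis using rd(1) by (simp add: has_bochner_integral_iff)
  qed
  then have P: "(\<integral>x. gradient u x \<bullet> V x \<partial>lborel) = - (?n * ?w * m)"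
  proof -
    have "(\<integral>x. gradient u x \<bullet> V x + (?n / d) * (u x * indicator ?S x) \<partial>lborel)
      = (\<integral>x. gradient u x \<bullet> V x \<partial>lborel) + (?n / d) * (\<integral>x. u x * indicator ?S x \<partial>lborel)"
      using gi ui by (subst Bochner_Integration.integral_add) (auto simp only: integrable_mult_right integral_mult_right_zero)
    also have "(?n / d) * (\<integral>x. u x * indicator ?S x \<partial>lborel) = ?n * ?w * m"
      using d by (simp only: m d_def[symmetric]) simp
    finally show ?thesis using \<open>(\<integral>x. gradient u x \<bullet> V x + (?n / d) * (u x * indicator ?S x) \<partial>lborel) = 0\<close> by linarith
  qed
  \<comment> \<open>The minimiser of the quadratic bound below for the integral of
    \<open>|gradient u + t V|^2\<close>; inserting it is the Cauchy-Schwarz inequality.\<close>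
  define t where "t = ?n * ?w * m / ?T"
  let ?E = "\<integral>x. (norm (gradient u x))\<^sup>2 \<partial>lborel"
  have ei: "integrable lborel (\<lambda>x. (norm (gradient u x))\<^sup>2)" by (rule integrable_gradient_square[OF L supp])
  have "0 \<le> (\<integral>x. (norm (gradient u x + t *\<^sub>R V x))\<^sup>2 \<partial>lborel)" by simp
  also have "\<dots> = (\<integral>x. (norm (gradient u x))\<^sup>2 + (2 * t) * (gradient u x \<bullet> V x) + t\<^sup>2 * (norm (V x))\<^sup>2 \<partial>lborel)"
    by (intro Bochner_Integration.integral_cong refl)
      (simp only: power2_norm_eq_inner, simp add: inner_add_left inner_add_right inner_commute power2_eq_square algebra_simps)
  also have "\<dots> = ?E + (2 * t) * (\<integral>x. gradient u x \<bullet> V x \<partial>lborel) + t\<^sup>2 * (\<integral>x. (norm (V x))\<^sup>2 \<partial>lborel)"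
    using ei gi Vi by simp
  also have "\<dots> \<le> ?E + (2 * t) * (- (?n * ?w * m)) + t\<^sup>2 * ?T"
    unfolding P by (intro add_left_mono mult_left_mono VT) simp
  also have "\<dots> = ?E - (?n * ?w * m)\<^sup>2 / ?T"
  proof -
    have "E + (2 * (c / T)) * (- c) + (c / T)\<^sup>2 * T = E - c\<^sup>2 / T" if "0 < T" for E c T :: real
      using that by (simp add: power2_eq_square field_simps)
    from this[OF T] show ?thesis unfolding t_def .
  qed
  also have "(?n * ?w * m)\<^sup>2 / ?T = m\<^sup>2 * (real ?n * (real ?n - 2) * ?w * a ^ (?n - 2))"
  proof -
    have "(N * W * m)\<^sup>2 / (N * W / ((N - 2) * A)) = m\<^sup>2 * (N * (N - 2) * W * A)" if "0 < N" "0 < W" for N W A :: real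
      using that by (simp add: power2_eq_square)
    from this[OF _ w] n show ?thesis by simp
  qed
  finally show ?thesis by simp
qed

section \<open>Energy and capacity\<close>

definition energy :: "('a::euclidean_space \<Rightarrow> real) \<Rightarrow> ennreal" where
  "energy u = (\<integral>\<^sup>+x. ennreal ((norm (gradient u x))\<^sup>2) \<partial>lborel)"

definition lip_cs :: "('a::euclidean_space \<Rightarrow> real) \<Rightarrow> bool" where
  "lip_cs u \<longleftrightarrow> (\<exists>L. L-lipschitz_on UNIV u) \<and> has_compact_support u"

lemma lip_csE:
  assumes "lip_cs u" obtains L R where "L-lipschitz_on UNIV u" "\<And>x. R < norm x \<Longrightarrow> u x = 0"
  using assms unfolding lip_cs_def has_compact_support_iff by blast

lemma lip_csI:
  assumes "locally_lip u" "\<And>x. R < norm x \<Longrightarrow> u x = 0" shows "lip_cs u"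
  unfolding lip_cs_def has_compact_support_iff
  using locally_lip_compact_support_imp_lipschitz[OF assms] assms(2) by blast

lemma lip_cs_locally_lip: "lip_cs u \<Longrightarrow> locally_lip u"
  unfolding lip_cs_def using lipschitz_imp_locally_lip by blast

lemma lip_cs_AE_partials: "lip_cs u \<Longrightarrow> AE x in lborel. \<forall>b\<in>Basis. has_partial b u x (gradient u x \<bullet> b)"
  unfolding lip_cs_def using AE_all_partials by blast

lemma capacity_eq: "capacity F = (INF u\<in>{u. lip_cs u \<and> (\<forall>x\<in>F. u x = 1)}. energy u)"
  by (simp add: capacity_def energy_def lip_cs_def conj_assoc)

lemma capacity_le_energy: "lip_cs u \<Longrightarrow> (\<And>x. x \<in> F \<Longrightarrow> u x = 1) \<Longrightarrow> capacity F \<le> energy u"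
  unfolding capacity_eq by (rule INF_lower) auto

lemma capacity_greatest:
  assumes "\<And>u. lip_cs u \<Longrightarrow> (\<And>x. x \<in> F \<Longrightarrow> u x = 1) \<Longrightarrow> C \<le> energy u" shows "C \<le> capacity F"
  unfolding capacity_eq by (rule INF_greatest) (use assms in auto)

lemma lip_cs_energy:
  assumes "lip_cs u"
  shows "integrable lborel (\<lambda>x. (norm (gradient u x))\<^sup>2)"
    "energy u = ennreal (\<integral>x. (norm (gradient u x))\<^sup>2 \<partial>lborel)"
proof -
  obtain L R where L: "L-lipschitz_on UNIV u" "\<And>x. R < norm x \<Longrightarrow> u x = 0" using lip_csE[OF assms] by blast
  show i: "integrable lborel (\<lambda>x. (norm (gradient u x))\<^sup>2)" by (rule integrable_gradient_square[OF L])
  show "energy u = ennreal (\<integral>x. (norm (gradient u x))\<^sup>2 \<partial>lborel)"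
    unfolding energy_def by (rule nn_integral_eq_integral[OF i]) simp
qed

section \<open>Affine substitutions and scaling of the capacity\<close>

lemma nn_integral_affine:
  fixes f :: "'a::euclidean_space \<Rightarrow> ennreal"
  assumes [measurable]: "f \<in> borel_measurable borel" and r: "0 < r"
  shows "(\<integral>\<^sup>+y. f y \<partial>lborel) = ennreal (r ^ DIM('a)) * (\<integral>\<^sup>+x. f (p + r *\<^sub>R x) \<partial>lborel)"
proof -
  have "(\<integral>\<^sup>+y. f y \<partial>lborel) = (\<integral>\<^sup>+y. f y \<partial>density (distr lborel borel (\<lambda>x. p + r *\<^sub>R x)) (\<lambda>_. ennreal (\<bar>r\<bar> ^ DIM('a))))"
    using lborel_affine[of r p] r by simp
  also have "\<dots> = (\<integral>\<^sup>+y. ennreal (r ^ DIM('a)) * f y \<partial>distr lborel borel (\<lambda>x. p + r *\<^sub>R x))"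
    using r by (subst nn_integral_density) auto
  also have "\<dots> = (\<integral>\<^sup>+x. ennreal (r ^ DIM('a)) * f (p + r *\<^sub>R x) \<partial>lborel)"
    by (subst nn_integral_distr) auto
  also have "\<dots> = ennreal (r ^ DIM('a)) * (\<integral>\<^sup>+x. f (p + r *\<^sub>R x) \<partial>lborel)"
    by (subst nn_integral_cmult) auto
  finally show ?thesis .
qed

lemma integral_affine:
  fixes f :: "'a::euclidean_space \<Rightarrow> real"
  assumes [measurable]: "f \<in> borel_measurable borel" and r: "0 < r"
  shows "(\<integral>y. f y \<partial>lborel) = r ^ DIM('a) * (\<integral>x. f (p + r *\<^sub>R x) \<partial>lborel)"
    "integrable lborel f \<longleftrightarrow> integrable lborel (\<lambda>x. f (p + r *\<^sub>R x))"
proof -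
  have eq: "lborel = density (distr lborel borel (\<lambda>x. p + r *\<^sub>R x)) (\<lambda>_. ennreal (r ^ DIM('a)))"
    using lborel_affine[of r p] r by simp
  have "(\<integral>y. f y \<partial>lborel) = (\<integral>y. f y \<partial>density (distr lborel borel (\<lambda>x. p + r *\<^sub>R x)) (\<lambda>_. ennreal (r ^ DIM('a))))"
    using eq by simp
  also have "\<dots> = (\<integral>y. r ^ DIM('a) * f y \<partial>distr lborel borel (\<lambda>x. p + r *\<^sub>R x))"
    using r by (subst integral_density) auto
  also have "\<dots> = (\<integral>x. r ^ DIM('a) * f (p + r *\<^sub>R x) \<partial>lborel)"
    by (subst integral_distr) auto
  finally show "(\<integral>y. f y \<partial>lborel) = r ^ DIM('a) * (\<integral>x. f (p + r *\<^sub>R x) \<partial>lborel)" by simp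
  have "integrable lborel f \<longleftrightarrow> integrable (density (distr lborel borel (\<lambda>x. p + r *\<^sub>R x)) (\<lambda>_. ennreal (r ^ DIM('a)))) f"
    using eq by simp
  also have "\<dots> \<longleftrightarrow> integrable (distr lborel borel (\<lambda>x. p + r *\<^sub>R x)) (\<lambda>y. r ^ DIM('a) * f y)"
    using r by (subst integrable_density) auto
  also have "\<dots> \<longleftrightarrow> integrable lborel (\<lambda>x. r ^ DIM('a) * f (p + r *\<^sub>R x))"
    by (subst integrable_distr_eq) auto
  also have "\<dots> \<longleftrightarrow> integrable lborel (\<lambda>x. f (p + r *\<^sub>R x))" using r by simp
  finally show "integrable lborel f \<longleftrightarrow> integrable lborel (\<lambda>x. f (p + r *\<^sub>R x))" .
qed

lemma AE_affine:
  fixes P :: "'a::euclidean_space \<Rightarrow> bool"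
  assumes P: "AE y in lborel. P y" and r: "0 < r" shows "AE x in lborel. P (p + r *\<^sub>R x)"
proof -
  obtain N where N: "{y. \<not> P y} \<subseteq> N" "emeasure lborel N = 0" "N \<in> sets borel"
    using P by (rule AE_E) auto
  have m: "(\<lambda>x. p + r *\<^sub>R x) -` N \<inter> space borel \<in> sets borel" by (rule measurable_sets[OF _ N(3)]) measurable
  have "(\<integral>\<^sup>+y. indicator N y \<partial>lborel) = ennreal (r ^ DIM('a)) * (\<integral>\<^sup>+x. indicator N (p + r *\<^sub>R x) \<partial>lborel)"
    by (rule nn_integral_affine) (use N r in auto)
  then have "(\<integral>\<^sup>+x. indicator N (p + r *\<^sub>R x) \<partial>lborel) = 0" using N r by simp
  moreover have "(\<integral>\<^sup>+x. indicator N (p + r *\<^sub>R x) \<partial>lborel) = (\<integral>\<^sup>+x. indicator ((\<lambda>x. p + r *\<^sub>R x) -` N) x \<partial>lborel)"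
    by (intro nn_integral_cong) (auto simp: indicator_def)
  ultimately have "emeasure lborel ((\<lambda>x. p + r *\<^sub>R x) -` N) = 0" using m by simp
  then show ?thesis by (rule AE_I[rotated]) (use N m in auto)
qed

lemma has_partial_affine:
  assumes "has_partial b u (p + r *\<^sub>R x) D" shows "has_partial b (\<lambda>x. u (p + r *\<^sub>R x)) x (r * D)"
proof -
  have "((\<lambda>t. u ((p + r *\<^sub>R x) + t *\<^sub>R b)) has_real_derivative D) (at (r * 0))"
    using assms by (simp add: has_partial_def)
  moreover have "((\<lambda>t. r * t) has_real_derivative r) (at 0)" by (auto intro!: derivative_eq_intros)
  ultimately have "((\<lambda>t. u ((p + r *\<^sub>R x) + (r * t) *\<^sub>R b)) has_real_derivative (D * r)) (at 0)"
    by (rule DERIV_chain2)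
  then show ?thesis by (simp add: has_partial_def algebra_simps)
qed

text \<open>The gradient gains a factor \<open>r\<close> and the volume element a factor
  \<open>1 / r ^ n\<close>. The identity is kept free of quotients so that it can be used in
  \<open>ennreal\<close>.\<close>

lemma lip_cs_affine:
  assumes u: "lip_cs u" and r: "0 < r"
  shows "lip_cs (\<lambda>x. u (p + r *\<^sub>R x))"
    "ennreal (r ^ DIM('a)) * energy (\<lambda>x. u (p + r *\<^sub>R x)) = ennreal (r\<^sup>2) * energy (u :: 'a::euclidean_space \<Rightarrow> real)"
proof -
  obtain L R where L: "L-lipschitz_on UNIV u" "\<And>x. R < norm x \<Longrightarrow> u x = 0" using lip_csE[OF u] by blast
  show "lip_cs (\<lambda>x. u (p + r *\<^sub>R x))"
  proof (rule lip_csI)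
    have "locally_lip (\<lambda>x. p + r *\<^sub>R x)" by (intro locally_lip_add locally_lip_scaleR locally_lip_const locally_lip_id)
    from locally_lip_compose[OF lipschitz_imp_locally_lip[OF L(1)] this]
    show "locally_lip (\<lambda>x. u (p + r *\<^sub>R x))" .
    fix x :: 'a assume "(R + norm p) / r < norm x"
    then have "R + norm p < norm (r *\<^sub>R x)" using r by (simp add: divide_less_eq mult.commute)
    then have "R < norm (p + r *\<^sub>R x)" using norm_triangle_ineq2[of "r *\<^sub>R x" "- p"] by (simp add: add.commute)
    then show "u (p + r *\<^sub>R x) = 0" by (rule L(2))
  qed
  have "AE x in lborel. gradient (\<lambda>x. u (p + r *\<^sub>R x)) x = r *\<^sub>R gradient u (p + r *\<^sub>R x)"
    using AE_affine[OF lip_cs_AE_partials[OF u] r, of p]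
  proof eventually_elim
    fix x assume "\<forall>b\<in>Basis. has_partial b u (p + r *\<^sub>R x) (gradient u (p + r *\<^sub>R x) \<bullet> b)"
    then have "partial_deriv b (\<lambda>x. u (p + r *\<^sub>R x)) x = r * (gradient u (p + r *\<^sub>R x) \<bullet> b)" if "b \<in> Basis" for b
      using has_partial_imp_partial_deriv[OF has_partial_affine] that by blast
    then show "gradient (\<lambda>x. u (p + r *\<^sub>R x)) x = r *\<^sub>R gradient u (p + r *\<^sub>R x)"
      by - (rule euclidean_eqI, simp only: gradient_inner_Basis inner_scaleR_left)
  qed
  then have "energy (\<lambda>x. u (p + r *\<^sub>R x)) = (\<integral>\<^sup>+x. ennreal (r\<^sup>2) * ennreal ((norm (gradient u (p + r *\<^sub>R x)))\<^sup>2) \<partial>lborel)"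
    unfolding energy_def by (intro nn_integral_cong_AE, eventually_elim) (simp add: ennreal_mult[symmetric] power_mult_distrib)
  moreover have gm: "gradient u \<in> borel_measurable borel" by (rule gradient_borel[OF L(1)])
  ultimately have "energy (\<lambda>x. u (p + r *\<^sub>R x)) = ennreal (r\<^sup>2) * (\<integral>\<^sup>+x. ennreal ((norm (gradient u (p + r *\<^sub>R x)))\<^sup>2) \<partial>lborel)"
    by (subst (asm) nn_integral_cmult) auto
  moreover have "energy u = ennreal (r ^ DIM('a)) * (\<integral>\<^sup>+x. ennreal ((norm (gradient u (p + r *\<^sub>R x)))\<^sup>2) \<partial>lborel)"
    unfolding energy_def by (rule nn_integral_affine) (use gm r in auto)
  ultimately show "ennreal (r ^ DIM('a)) * energy (\<lambda>x. u (p + r *\<^sub>R x)) = ennreal (r\<^sup>2) * energy u"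
    by (simp add: mult_ac)
qed

text \<open>A competitor for \<open>F\<close>, composed with the affine map, is a competitor for the
  preimage. One inequality suffices, since the inverse map gives the other.\<close>

lemma capacity_scaling:
  fixes F :: "'a::euclidean_space set"
  assumes r: "0 < r" and n: "2 \<le> DIM('a)"
  shows "ennreal (r ^ (DIM('a) - 2)) * capacity {x. p + r *\<^sub>R x \<in> F} \<le> capacity F"
proof (rule capacity_greatest)
  fix u :: "'a \<Rightarrow> real" assume u: "lip_cs u" "\<And>x. x \<in> F \<Longrightarrow> u x = 1"
  have "capacity {x. p + r *\<^sub>R x \<in> F} \<le> energy (\<lambda>x. u (p + r *\<^sub>R x))"
    by (rule capacity_le_energy[OF lip_cs_affine(1)[OF u(1) r]]) (use u in auto)
  then have "ennreal (r ^ DIM('a)) * capacity {x. p + r *\<^sub>R x \<in> F} \<le> ennreal (r\<^sup>2) * energy u"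
    unfolding lip_cs_affine(2)[OF u(1) r, of p, symmetric] by (rule mult_left_mono) simp
  moreover have "r ^ DIM('a) = r\<^sup>2 * r ^ (DIM('a) - 2)" using n by (metis le_add_diff_inverse power_add)
  ultimately have "ennreal (r\<^sup>2) * (ennreal (r ^ (DIM('a) - 2)) * capacity {x. p + r *\<^sub>R x \<in> F}) \<le> ennreal (r\<^sup>2) * energy u"
    using r by (simp add: ennreal_mult mult.assoc)
  then show "ennreal (r ^ (DIM('a) - 2)) * capacity {x. p + r *\<^sub>R x \<in> F} \<le> energy u"
    using r by (subst (asm) ennreal_mult_le_mult_iff) auto
qed

lemma emeasure_shell:
  fixes p :: "'a::euclidean_space"
  assumes "0 < a" "a < b"
  shows "measure lborel {x. a < dist p x \<and> dist p x < b} = unit_ball_vol (real DIM('a)) * (b ^ DIM('a) - a ^ DIM('a))"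
    "emeasure lborel {x. a < dist p x \<and> dist p x < b} < \<infinity>"
proof -
  have eq: "{x. a < dist p x \<and> dist p x < b} = ball p b - cball p a" by auto
  have "measure lborel (ball p b - cball p a) = measure lborel (ball p b) - measure lborel (cball p a)"
    by (rule measure_Diff) (use assms emeasure_lborel_cball_finite[of p a] emeasure_lborel_ball_finite[of p b] in \<open>auto simp: less_top[symmetric]\<close>)
  moreover have "measure lborel (ball p b) = unit_ball_vol (real DIM('a)) * b ^ DIM('a)"
    "measure lborel (cball p a) = unit_ball_vol (real DIM('a)) * a ^ DIM('a)"
    using assms by (simp_all add: measure_def emeasure_ball emeasure_cball)
  ultimately show "measure lborel {x. a < dist p x \<and> dist p x < b} = unit_ball_vol (real DIM('a)) * (b ^ DIM('a) - a ^ DIM('a))"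
    unfolding eq by (simp add: algebra_simps)
  have "emeasure lborel (ball p b - cball p a) \<le> emeasure lborel (ball p b)" by (intro emeasure_mono) auto
  then show "emeasure lborel {x. a < dist p x \<and> dist p x < b} < \<infinity>"
    unfolding eq using emeasure_lborel_ball_finite order_le_less_trans by blast
qed

lemma shell_average_le_energy:
  fixes u :: "'a::euclidean_space \<Rightarrow> real"
  assumes n: "3 \<le> DIM('a)" and u: "lip_cs u" and ab: "0 < a" "a < b"
    and m: "(\<integral>x. u x * indicator {x. a < dist p x \<and> dist p x < b} x \<partial>lborel)
      = m * (unit_ball_vol (real DIM('a)) * (b ^ DIM('a) - a ^ DIM('a)))"
  shows "ennreal (m\<^sup>2 * (real DIM('a) * (real DIM('a) - 2) * unit_ball_vol (real DIM('a)) * a ^ (DIM('a) - 2)))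
    \<le> energy u"
proof -
  let ?v = "\<lambda>x. u (p + 1 *\<^sub>R x)"
  have v: "lip_cs ?v" by (rule lip_cs_affine[OF u]) simp
  have ev: "energy ?v = energy u" using lip_cs_affine(2)[OF u, of 1 p] by simp
  obtain L R where L: "L-lipschitz_on UNIV ?v" "\<And>x. R < norm x \<Longrightarrow> ?v x = 0" using lip_csE[OF v] by blast
  have "continuous_on UNIV u" using lip_cs_locally_lip[OF u] by (rule locally_lip_continuous)
  then have um: "(\<lambda>x. u x * indicator {x. a < dist p x \<and> dist p x < b} x) \<in> borel_measurable borel"
    by (intro borel_measurable_times borel_measurable_continuous_onI borel_measurable_indicator) measurable
  have "(\<integral>x. u x * indicator {x. a < dist p x \<and> dist p x < b} x \<partial>lborel) =
     (\<integral>x. ?v x * indicator {x. a < norm x \<and> norm x < b} x \<partial>lborel)"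
    by (subst integral_affine(1)[OF um, of 1 p]) (auto simp: indicator_def dist_norm)
  then have "(\<integral>x. ?v x * indicator {x. a < norm x \<and> norm x < b} x \<partial>lborel)
      = m * (unit_ball_vol (real DIM('a)) * (b ^ DIM('a) - a ^ DIM('a)))" using m by simp
  from shell_average_le_energy_centered[OF n L ab this]
  show ?thesis unfolding ev[symmetric] lip_cs_energy(2)[OF v] by (rule ennreal_leI)
qed

text \<open>A competitor has mean 1 over every shell inside the ball, so the shell estimate applies
  with \<open>m = 1\<close>; then the inner radius tends to \<open>r\<close>.\<close>

lemma capacity_cball_ge:
  fixes p :: "'a::euclidean_space"
  assumes n: "3 \<le> DIM('a)" and r: "0 < r"
  shows "ennreal (real DIM('a) * (real DIM('a) - 2) * unit_ball_vol (real DIM('a)) * r ^ (DIM('a) - 2)) \<le> capacity (cball p r)"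
proof (rule capacity_greatest)
  fix u :: "'a \<Rightarrow> real" assume u: "lip_cs u" "\<And>x. x \<in> cball p r \<Longrightarrow> u x = 1"
  let ?c = "real DIM('a) * (real DIM('a) - 2) * unit_ball_vol (real DIM('a))"
  obtain E where E: "energy u = ennreal E" "0 \<le> E" using lip_cs_energy(2)[OF u(1)] by (metis ennreal_cases ennreal_neq_top)
  have "?c * a ^ (DIM('a) - 2) \<le> E" if a: "0 < a" "a < r" for a
  proof -
    let ?S = "{x. a < dist p x \<and> dist p x < r}"
    have "(\<integral>x. u x * indicator ?S x \<partial>lborel) = (\<integral>x. indicator ?S x \<partial>lborel)"
      by (intro Bochner_Integration.integral_cong refl) (auto simp: indicator_def u(2))
    also have "\<dots> = 1 * (unit_ball_vol (real DIM('a)) * (r ^ DIM('a) - a ^ DIM('a)))"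
      using emeasure_shell[OF a, of p] by simp
    finally have "ennreal (?c * a ^ (DIM('a) - 2)) \<le> energy u"
      using shell_average_le_energy[OF n u(1) a, of p 1] by simp
    then show ?thesis using E by simp
  qed
  then have "eventually (\<lambda>a. ?c * a ^ (DIM('a) - 2) \<le> E) (at_left r)"
    using eventually_at_left_real[OF r] by (auto elim: eventually_mono)
  moreover have "((\<lambda>a. ?c * a ^ (DIM('a) - 2)) \<longlongrightarrow> ?c * r ^ (DIM('a) - 2)) (at_left r)"
    by (intro tendsto_intros)
  ultimately have "?c * r ^ (DIM('a) - 2) \<le> E" by (intro tendsto_upperbound) auto
  then show "ennreal (?c * r ^ (DIM('a) - 2)) \<le> energy u" unfolding E(1) by (rule ennreal_leI)
qed

section \<open>The Kelvin transform and capacity of a subset of a ball\<close>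

definition C1_grad :: "('a::euclidean_space \<Rightarrow> real) \<Rightarrow> ('a \<Rightarrow> 'a) \<Rightarrow> bool" where
  "C1_grad v Dv \<longleftrightarrow> (\<forall>x. (v has_derivative (\<lambda>h. Dv x \<bullet> h)) (at x)) \<and> continuous_on UNIV Dv"

lemma C1_gradD:
  assumes "C1_grad v Dv"
  shows "(v has_derivative (\<lambda>h. Dv x \<bullet> h)) (at x)" "continuous_on UNIV Dv" "continuous_on UNIV v"
    "has_partial b v x (Dv x \<bullet> b)" "gradient v x = Dv x"
proof -
  show d: "(v has_derivative (\<lambda>h. Dv x \<bullet> h)) (at x)" for x using assms by (simp add: C1_grad_def)
  show "continuous_on UNIV Dv" using assms by (simp add: C1_grad_def)
  show "continuous_on UNIV v"
    using d by (meson continuous_at_imp_continuous_on has_derivative_continuous)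
  show hp: "has_partial b v x (Dv x \<bullet> b)" for b by (rule has_partial_has_derivative[OF d])
  show "gradient v x = Dv x"
    by (rule euclidean_eqI) (simp only: gradient_inner_Basis has_partial_imp_partial_deriv[OF hp])
qed

lemma C1_grad_locally_lip:
  fixes v :: "'a::euclidean_space \<Rightarrow> real"
  assumes v: "C1_grad v Dv" shows "locally_lip v"
proof (rule locally_lipI)
  fix R :: real
  have "compact (Dv ` cball 0 R)"
    using continuous_on_subset[OF C1_gradD(2)[OF v]] by (intro compact_continuous_image) auto
  then obtain B where B: "\<And>x. x \<in> cball 0 R \<Longrightarrow> norm (Dv x) \<le> B"
    by (meson bounded_iff compact_imp_bounded imageI)
  have "norm (v x - v y) \<le> B * norm (x - y)" if "norm x \<le> R" "norm y \<le> R" for x y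
  proof (rule differentiable_bound[where S="cball 0 R" and f'="\<lambda>x h. Dv x \<bullet> h"])
    show "(v has_derivative (\<lambda>h. Dv x \<bullet> h)) (at x within cball 0 R)" for x
      using C1_gradD(1)[OF v] has_derivative_at_withinI by blast
    show "onorm (\<lambda>h. Dv x \<bullet> h) \<le> B" if "x \<in> cball 0 R" for x
    proof (rule onorm_le)
      fix h
      have "norm (Dv x \<bullet> h) \<le> norm (Dv x) * norm h" using Cauchy_Schwarz_ineq2 by simp
      also have "\<dots> \<le> B * norm h" using B[OF that] by (intro mult_right_mono) auto
      finally show "norm (Dv x \<bullet> h) \<le> B * norm h" .
    qed
  qed (use that in auto)
  then show "\<exists>C. \<forall>x y. norm x \<le> R \<longrightarrow> norm y \<le> R \<longrightarrow> norm (v x - v y) \<le> C * norm (x - y)" by blast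
qed

lemma integrable_ball_continuous:
  fixes f :: "'a::euclidean_space \<Rightarrow> real"
  assumes "continuous_on UNIV f" shows "integrable lborel (\<lambda>x. f x * indicator (ball p r) x)"
proof -
  have "integrable lborel (\<lambda>x. indicator (cball p r) x *\<^sub>R f x)"
    by (rule borel_integrable_compact[OF compact_cball continuous_on_subset[OF assms]]) simp
  then have "integrable lborel (\<lambda>x. indicator (ball p r) x *\<^sub>R (indicator (cball p r) x *\<^sub>R f x))"
    by (rule integrable_mult_indicator[rotated]) simp
  moreover have "indicator (ball p r) x *\<^sub>R (indicator (cball p r) x *\<^sub>R f x) = f x * indicator (ball p r) x" for x
    by (auto simp: indicator_def)
  ultimately show ?thesis by (simp only:)
qed

lemma has_derivative_inversion:
  fixes x :: "'a::euclidean_space"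
  assumes x: "x \<noteq> 0"
  shows "((\<lambda>x. (1 / (norm x)\<^sup>2) *\<^sub>R x) has_derivative
    (\<lambda>h. (1 / (norm x)\<^sup>2) *\<^sub>R h - (2 * (x \<bullet> h) / (norm x) ^ 4) *\<^sub>R x)) (at x)"
proof -
  have nz: "x \<bullet> x \<noteq> 0" using x by simp
  have "((\<lambda>x. inverse (x \<bullet> x)) has_derivative (\<lambda>h. - (inverse (x \<bullet> x) * (x \<bullet> h + h \<bullet> x) * inverse (x \<bullet> x)))) (at x)"
    by (rule Deriv.has_derivative_inverse[where f="\<lambda>x. x \<bullet> x", OF nz]) (auto intro!: derivative_eq_intros)
  from has_derivative_scaleR[OF this has_derivative_ident]
  have "((\<lambda>x. inverse (x \<bullet> x) *\<^sub>R x) has_derivative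
     (\<lambda>h. inverse (x \<bullet> x) *\<^sub>R h + (- (inverse (x \<bullet> x) * (x \<bullet> h + h \<bullet> x) * inverse (x \<bullet> x))) *\<^sub>R x)) (at x)" .
  moreover have "inverse (x \<bullet> x) *\<^sub>R h + (- (inverse (x \<bullet> x) * (x \<bullet> h + h \<bullet> x) * inverse (x \<bullet> x))) *\<^sub>R x
     = (1 / (norm x)\<^sup>2) *\<^sub>R h - (2 * (x \<bullet> h) / (norm x) ^ 4) *\<^sub>R x" for h
  proof -
    have "x \<bullet> x = (norm x)\<^sup>2" by (simp add: power2_norm_eq_inner)
    moreover have "inverse ((norm x)\<^sup>2) * inverse ((norm x)\<^sup>2) = inverse (norm x ^ 4)"
      by (simp add: power4_eq_xxxx power2_eq_square)
    ultimately show ?thesis by (simp add: inner_commute[of h x] divide_inverse mult_ac)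
  qed
  moreover have "inverse (x \<bullet> x) *\<^sub>R x = (1 / (norm x)\<^sup>2) *\<^sub>R x" for x :: 'a
    by (simp add: power2_norm_eq_inner divide_inverse)
  ultimately show ?thesis by simp
qed

text \<open>The vector in brackets is the derivative of the inversion applied to \<open>D\<close>,
  that is, a reflection followed by scaling with \<open>1 / r\<^sup>2\<close>. Hence its length is
  \<open>|D| / r\<^sup>2\<close>, and its inner product with \<open>x\<close> is that of
  \<open>D\<close> with the sign reversed, divided by \<open>r\<^sup>2\<close>.\<close>

lemma norm_kelvin_gradient:
  fixes D x :: "'a::real_inner"
  assumes r: "norm x = r" "0 < r"
  shows "(norm (h *\<^sub>R ((1 / r\<^sup>2) *\<^sub>R D - (2 * (D \<bullet> x) / r ^ 4) *\<^sub>R x) + (e / r) *\<^sub>R x))\<^sup>2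
    = h\<^sup>2 * (norm D)\<^sup>2 / r ^ 4 - 2 * h * e * (D \<bullet> x) / r ^ 3 + e\<^sup>2"
proof -
  let ?G = "(1 / r\<^sup>2) *\<^sub>R D - (2 * (D \<bullet> x) / r ^ 4) *\<^sub>R x"
  have xx: "x \<bullet> x = r\<^sup>2" using r by (simp add: power2_norm_eq_inner[symmetric])
  have p: "r ^ 4 = r\<^sup>2 * r\<^sup>2" "r ^ 3 = r\<^sup>2 * r" by (simp_all add: power2_eq_square power3_eq_cube power4_eq_xxxx)
  have GG: "?G \<bullet> ?G = (norm D)\<^sup>2 / r ^ 4"
  proof -
    have "?G \<bullet> ?G = (1 / r\<^sup>2)\<^sup>2 * (D \<bullet> D) - 2 * (1 / r\<^sup>2) * (2 * (D \<bullet> x) / r ^ 4) * (D \<bullet> x) + (2 * (D \<bullet> x) / r ^ 4)\<^sup>2 * r\<^sup>2"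
      by (simp only: inner_diff_left inner_diff_right inner_scaleR_left inner_scaleR_right xx inner_commute[of x D])
        (simp add: power2_eq_square algebra_simps)
    also have "\<dots> = (norm D)\<^sup>2 / r ^ 4"
    proof -
      have "(1 / q)\<^sup>2 * A - 2 * (1 / q) * (2 * t / (q * q)) * t + (2 * t / (q * q))\<^sup>2 * q = A / (q * q)"
        if "0 < q" for q A t :: real using that by (simp add: power2_eq_square field_simps)
      from this[of "r\<^sup>2"] show ?thesis using r unfolding p power2_norm_eq_inner by simp
    qed
    finally show ?thesis .
  qed
  have Gx: "?G \<bullet> x = - (D \<bullet> x) / r\<^sup>2"
  proof -
    have "?G \<bullet> x = (1 / r\<^sup>2) * (D \<bullet> x) - (2 * (D \<bullet> x) / (r\<^sup>2 * r\<^sup>2)) * r\<^sup>2"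
      by (simp only: inner_diff_left inner_scaleR_left xx p)
    also have "\<dots> = - (D \<bullet> x) / r\<^sup>2"
    proof -
      have "(1 / q) * t - (2 * t / (q * q)) * q = - t / q" if "0 < q" for q t :: real using that by (simp add: field_simps)
      from this[of "r\<^sup>2"] show ?thesis using r by simp
    qed
    finally show ?thesis .
  qed
  have "(norm (h *\<^sub>R ?G + (e / r) *\<^sub>R x))\<^sup>2 = h\<^sup>2 * (?G \<bullet> ?G) + 2 * h * (e / r) * (?G \<bullet> x) + (e / r)\<^sup>2 * (x \<bullet> x)"
    unfolding power2_norm_eq_inner
    by (simp only: inner_add_left inner_add_right inner_scaleR_left inner_scaleR_right inner_commute[of x ?G])
      (simp add: power2_eq_square algebra_simps)
  also have "\<dots> = h\<^sup>2 * (norm D)\<^sup>2 / r ^ 4 - 2 * h * e * (D \<bullet> x) / r ^ 3 + e\<^sup>2"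
    unfolding GG Gx xx using r by (simp add: power2_eq_square power3_eq_cube)
  finally show ?thesis .
qed

text \<open>The scalar identity behind the Kelvin transform: the energy density of
  \<open>h(|x|) v(x/|x|^2)\<close>, pulled back by the inversion, is at most \<open>|Dv|^2 + div(v^2 z(|y|) y)\<close>.\<close>

lemma kelvin_density_le:
  fixes s d A v g :: real and n :: nat
  assumes n: "3 \<le> n" and s: "0 < s" "s \<le> 1" and d: "0 \<le> d" "d < 1" "d \<le> s ^ (n - 2)" and A: "0 \<le> A"
  defines "h \<equiv> (s ^ (n - 2) - d) / (1 - d)" and "e \<equiv> - v * ((real n - 2) * s ^ (n - 1) / (1 - d))"
  shows "(h\<^sup>2 * A * s ^ 4 - 2 * h * e * g * s + e\<^sup>2) / s ^ (2 * n)
    \<le> A + 2 * v * g * ((real n - 2) / (1 - d)\<^sup>2 * (1 / s\<^sup>2 - d / s ^ n)) + v\<^sup>2 * ((real n - 2)\<^sup>2 / (1 - d)\<^sup>2 / s\<^sup>2)"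
proof -
  define m where "m = n - 2"
  have nm: "n = m + 2" using n by (simp add: m_def)
  define q where "q = s ^ m"
  have q: "0 < q" "q \<le> 1" "d \<le> q" using s d by (auto simp: q_def m_def power_le_one)
  have "2 * n = m * 2 + 4" by (simp add: nm)
  then have pw: "s ^ (n - 1) = q * s" "s ^ n = q * s\<^sup>2" "s ^ (2 * n) = q\<^sup>2 * s ^ 4"
    by (simp_all only: power_add power_mult q_def) (simp_all add: nm power2_eq_square)
  have h: "h = (q - d) / (1 - d)" by (simp add: h_def q_def m_def)
  have e: "e = - v * ((real n - 2) * (q * s) / (1 - d))" by (simp only: e_def pw)
  \<comment> \<open>The truncated factor lies between 0 and the Kelvin factor
    \<open>s ^ (n - 2)\<close>. This is the only place where something is lost; the other two terms
    of the density are computed exactly.\<close>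
  have h1: "0 \<le> h" "h \<le> q"
  proof -
    show "0 \<le> h" using q d by (simp add: h)
    have "q * d \<le> 1 * d" using q d by (intro mult_right_mono) auto
    then show "h \<le> q" using d by (simp add: h divide_le_eq algebra_simps)
  qed
  have "h\<^sup>2 \<le> q\<^sup>2" using h1 by (intro power_mono) auto
  then have t1: "(h\<^sup>2 * A * s ^ 4) / (q\<^sup>2 * s ^ 4) \<le> A" using q s mult_right_mono[OF \<open>h\<^sup>2 \<le> q\<^sup>2\<close> A] by (simp add: divide_le_eq mult.commute)
  have t2: "(2 * h * e * g * s) / (q\<^sup>2 * s ^ 4) = - (2 * v * g * ((real n - 2) / (1 - d)\<^sup>2 * (1 / s\<^sup>2 - d / (q * s\<^sup>2))))"
  proof -
    have "(2 * ((q - d) / D) * (- v * (N * (q * s) / D)) * g * s) / (q\<^sup>2 * s ^ 4)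
      = - (2 * v * g * (N / D\<^sup>2 * (1 / s\<^sup>2 - d / (q * s\<^sup>2))))" if "0 < D" for D N :: real
      using q s that by (simp add: power2_eq_square power4_eq_xxxx field_simps)
    then show ?thesis unfolding h e using d by simp
  qed
  have t3: "e\<^sup>2 / (q\<^sup>2 * s ^ 4) = v\<^sup>2 * ((real n - 2)\<^sup>2 / (1 - d)\<^sup>2 / s\<^sup>2)"
    unfolding e using q s d by (simp add: power_mult_distrib power_divide power2_eq_square power4_eq_xxxx mult_ac)
  have "(h\<^sup>2 * A * s ^ 4 - 2 * h * e * g * s + e\<^sup>2) / s ^ (2 * n)
     = (h\<^sup>2 * A * s ^ 4) / (q\<^sup>2 * s ^ 4) - (2 * h * e * g * s) / (q\<^sup>2 * s ^ 4) + e\<^sup>2 / (q\<^sup>2 * s ^ 4)"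
    by (simp only: pw add_divide_distrib diff_divide_distrib)
  then show ?thesis using t1 unfolding t2 t3 pw by linarith
qed

text \<open>On the annulus the bound for \<open>P\<close> is \<open>|Dv|^2\<close> plus the
  divergence of \<open>v^2 z(|y|) y\<close>, and \<open>d = a ^ (n - 2)\<close> makes
  \<open>z\<close> vanish at radius \<open>a\<close>. Subtracting the constant
  \<open>c = z(1)\<close> makes the profile vanish on the unit sphere, so that the field has compact
  support and its divergence has integral 0. What remains is \<open>c\<close> times the divergence
  of \<open>v^2 y\<close> over the ball, a boundary term in disguise.\<close>

lemma kelvin_exterior_integral:
  fixes v :: "'a::euclidean_space \<Rightarrow> real"
  assumes n: "3 \<le> DIM('a)" and v: "C1_grad v Dv" and a: "0 < a" "a < 1"
    and P0: "\<And>y. 0 \<le> P y" and d: "d = a ^ (DIM('a) - 2)"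
    and P: "\<And>y. a \<le> norm y \<Longrightarrow> norm y \<le> 1 \<Longrightarrow> P y \<le> (norm (Dv y))\<^sup>2
      + 2 * v y * (Dv y \<bullet> y) * ((real DIM('a) - 2) / (1 - d)\<^sup>2 * (1 / (norm y)\<^sup>2 - d / norm y ^ DIM('a)))
      + (v y)\<^sup>2 * ((real DIM('a) - 2)\<^sup>2 / (1 - d)\<^sup>2 / (norm y)\<^sup>2)"
  defines "I \<equiv> (\<integral>x. (norm (Dv x))\<^sup>2 * indicator (ball 0 1) x \<partial>lborel) + (real DIM('a) - 2) / (1 - d) *
      (\<integral>x. (real DIM('a) * (v x)\<^sup>2 + 2 * v x * (Dv x \<bullet> x)) * indicator (ball 0 1) x \<partial>lborel)"
  shows "(\<integral>\<^sup>+y\<in>{y. a \<le> norm y \<and> norm y \<le> 1}. ennreal (P y) \<partial>lborel) \<le> ennreal I" "0 \<le> I"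
proof -
  let ?n = "DIM('a)"
  have d1: "0 < d" "d < 1" using a n by (auto simp: d power_less_one_iff)
  define c where "c = (real ?n - 2) / (1 - d)"
  define C where "C = (real ?n - 2) / (1 - d)\<^sup>2"
  have Cc: "C * (1 - d) = c" using d1 by (simp add: C_def c_def power2_eq_square)
  \<comment> \<open>Clamping the radius to \<open>{a..1}\<close> continues the profile by
    \<open>- c\<close> on the small ball and by \<open>0\<close> outside the unit ball.\<close>
  define k where "k = (\<lambda>r::real. C * (inverse ((max a (min 1 r))\<^sup>2) - d * inverse (max a (min 1 r) ^ ?n)) - c)"
  define k' where "k' = (\<lambda>r::real. if r < a \<or> 1 < r then 0 else C * (d * (real ?n / r ^ (?n + 1)) - 2 / r ^ 3))"
  have an: "a ^ ?n = d * a\<^sup>2"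
  proof -
    have "?n = (?n - 2) + 2" using n by simp
    then show ?thesis unfolding d by (metis power_add)
  qed
  have z0: "inverse (a\<^sup>2) - d * inverse (a ^ ?n) = 0" using a d1 by (simp add: an)
  have kll: "locally_lip (\<lambda>x::'a. k (norm x))"
    unfolding k_def
  proof (intro locally_lip_minus locally_lip_mult locally_lip_const)
    have 1: "locally_lip (\<lambda>x::'a. max a (min 1 (norm x)) ^ j)" for j
      by (intro locally_lip_power locally_lip_max locally_lip_norm)
    have 2: "a ^ j \<le> max a (min 1 (norm x)) ^ j" for j and x :: 'a using a by (intro power_mono) auto
    show "locally_lip (\<lambda>x::'a. inverse ((max a (min 1 (norm x)))\<^sup>2))"
      by (rule locally_lip_inverse[OF 1 _ 2]) (use a in simp)
    show "locally_lip (\<lambda>x::'a. inverse (max a (min 1 (norm x)) ^ ?n))"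
      by (rule locally_lip_inverse[OF 1 _ 2]) (use a in simp)
  qed
  have klow: "k r = - c" if "r \<le> a" for r
  proof -
    have "max a (min 1 r) = a" using that a by auto
    then show ?thesis by (simp add: k_def z0)
  qed
  have khigh: "k r = 0" if "1 \<le> r" for r
  proof -
    have "max a (min 1 r) = 1" using that a by auto
    then show ?thesis using Cc by (simp add: k_def)
  qed
  have kmid: "k r = C * (inverse (r\<^sup>2) - d * inverse (r ^ ?n)) - c" if "a \<le> r" "r \<le> 1" for r
  proof -
    have "max a (min 1 r) = r" using that by auto
    then show ?thesis by (simp only: k_def)
  qed
  have dinv: "((\<lambda>r. inverse (r ^ j)) has_real_derivative (- (real j / r ^ (j + 1)))) (at r)" if r: "0 < r" and j: "0 < j" for r :: real and j :: nat
  proof -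
    obtain i where i: "j = Suc i" using j by (cases j) auto
    have "((\<lambda>r. r ^ j) has_real_derivative real j * r ^ i) (at r)"
      using DERIV_pow[of "Suc i" r] by (simp add: i)
    from DERIV_inverse'[OF this] r
    have "((\<lambda>r. inverse (r ^ j)) has_real_derivative - (inverse (r ^ j) * (real j * r ^ i) * inverse (r ^ j))) (at r)" by simp
    moreover have "inverse (r ^ j) * (real j * r ^ i) * inverse (r ^ j) = real j / r ^ (j + 1)"
      unfolding i using r by (simp add: field_simps)
    ultimately show ?thesis by simp
  qed
  have dk: "(k has_real_derivative k' r) (at r)" if r: "0 < r" "r \<notin> {a, 1}" for r
  proof -
    consider "r < a" | "a < r" "r < 1" | "1 < r" using r by force
    then show ?thesis
    proof cases
      case 1
      have "((\<lambda>r. - c) has_real_derivative 0) (at r)" by simp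
      then have "(k has_real_derivative 0) (at r)"
        by (rule has_field_derivative_transform_within_open[of _ _ _ "{..<a}"]) (use 1 klow in auto)
      then show ?thesis using 1 by (simp add: k'_def)
    next
      case 2
      have "((\<lambda>r. C * (inverse (r\<^sup>2) - d * inverse (r ^ ?n)) - c) has_real_derivative
          C * (- (real 2 / r ^ (2 + 1)) - d * (- (real ?n / r ^ (?n + 1)))) - 0) (at r)"
        by (intro DERIV_diff DERIV_cmult dinv DERIV_const) (use r n in auto)
      then have "(k has_real_derivative C * (- (real 2 / r ^ (2 + 1)) - d * (- (real ?n / r ^ (?n + 1)))) - 0) (at r)"
        by (rule has_field_derivative_transform_within_open[of _ _ _ "{a<..<1}"]) (use 2 kmid in auto)
      then show ?thesis using 2 by (simp add: k'_def eval_nat_numeral algebra_simps)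
    next
      case 3
      have "((\<lambda>r. 0) has_real_derivative 0) (at r)" by simp
      then have "(k has_real_derivative 0) (at r)"
        by (rule has_field_derivative_transform_within_open[of _ _ _ "{1<..}"]) (use 3 khigh in auto)
      then show ?thesis using 3 by (simp add: k'_def)
    qed
  qed
  let ?w = "\<lambda>x. v x * v x" let ?Dw = "\<lambda>x. (2 * v x) *\<^sub>R Dv x"
  have wll: "locally_lip ?w" by (intro locally_lip_mult C1_grad_locally_lip[OF v])
  have Dw: "AE x in lborel. \<forall>b\<in>Basis. has_partial b ?w x (?Dw x \<bullet> b)"
  proof (intro AE_I2 ballI)
    fix x b
    from has_partial_mult[OF C1_gradD(4)[OF v, of b x] C1_gradD(4)[OF v, of b x]]
    show "has_partial b ?w x (?Dw x \<bullet> b)" by (simp add: algebra_simps)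
  qed
  define R where "R = (\<lambda>x. \<Sum>b\<in>Basis. partial_deriv b (\<lambda>x. ?w x * k (norm x) * (x \<bullet> b)) x)"
  have s0: "?w x * k (norm x) = 0" if "1 < norm x" for x using khigh[of "norm x"] that by simp
  have fin: "finite {a, 1}" by simp
  have rd: "has_bochner_integral lborel R 0"
    "AE x in lborel. R x = k (norm x) * (?Dw x \<bullet> x) + ?w x * (real ?n * k (norm x) + norm x * k' (norm x))"
    unfolding R_def
    by (rule radial_divergence[where R=1, OF wll kll _ Dw fin], (erule s0, erule dk, assumption))+
  let ?B = "\<lambda>x. indicator (ball (0::'a) 1) x :: real"
  \<comment> \<open>Almost everywhere \<open>?U\<close> is \<open>|Dv|^2\<close> on the small ball,
    the bound for \<open>P\<close> on the annulus and \<open>0\<close> beyond; on the annulus its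
    sign comes from \<open>P0\<close>.\<close>
  let ?U = "\<lambda>x. (norm (Dv x))\<^sup>2 * ?B x + R x + c * ((real ?n * (v x)\<^sup>2 + 2 * v x * (Dv x \<bullet> x)) * ?B x)"
  have i1: "integrable lborel (\<lambda>x. (norm (Dv x))\<^sup>2 * ?B x)"
    by (intro integrable_ball_continuous continuous_intros C1_gradD(2)[OF v])
  have i2: "integrable lborel (\<lambda>x. (real ?n * (v x)\<^sup>2 + 2 * v x * (Dv x \<bullet> x)) * ?B x)"
    by (intro integrable_ball_continuous continuous_intros C1_gradD(2,3)[OF v])
  have i3: "integrable lborel R" "(\<integral>x. R x \<partial>lborel) = 0" using rd(1) by (auto simp: has_bochner_integral_iff)
  have Ui: "integrable lborel ?U"
    by (intro Bochner_Integration.integrable_add integrable_mult_right i1 i2 i3)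
  have UI: "(\<integral>x. ?U x \<partial>lborel) = I"
  proof -
    have "(\<integral>x. ?U x \<partial>lborel) = (\<integral>x. (norm (Dv x))\<^sup>2 * ?B x + R x \<partial>lborel) + (\<integral>x. c * ((real ?n * (v x)\<^sup>2 + 2 * v x * (Dv x \<bullet> x)) * ?B x) \<partial>lborel)"
      by (rule Bochner_Integration.integral_add) (intro Bochner_Integration.integrable_add integrable_mult_right i1 i2 i3)+
    also have "(\<integral>x. (norm (Dv x))\<^sup>2 * ?B x + R x \<partial>lborel) = (\<integral>x. (norm (Dv x))\<^sup>2 * ?B x \<partial>lborel) + (\<integral>x. R x \<partial>lborel)"
      by (rule Bochner_Integration.integral_add[OF i1 i3(1)])
    finally show ?thesis by (simp only: i3(2) integral_mult_right_zero I_def c_def add_0_right)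
  qed
  have "AE x in lborel. norm (x::'a) \<notin> {0, a, 1}" by (rule AE_norm_notin_finite) simp
  with rd(2) have U: "AE x in lborel. 0 \<le> ?U x \<and> P x * indicator {y. a \<le> norm y \<and> norm y \<le> 1} x \<le> ?U x"
  proof eventually_elim
    fix x :: 'a
    assume R: "R x = k (norm x) * (?Dw x \<bullet> x) + ?w x * (real ?n * k (norm x) + norm x * k' (norm x))"
      and x: "norm x \<notin> {0, a, 1}"
    define s where "s = norm x"
    have s: "0 < s" "s \<noteq> a" "s \<noteq> 1" using x by (auto simp: s_def)
    define g where "g = Dv x \<bullet> x"
    have R': "R x = k s * (2 * v x * g) + (v x)\<^sup>2 * (real ?n * k s + s * k' s)"
      using R by (simp add: s_def g_def power2_eq_square)
    consider "s < a" | "a < s" "s < 1" | "1 < s" using s by force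
    then show "0 \<le> ?U x \<and> P x * indicator {y. a \<le> norm y \<and> norm y \<le> 1} x \<le> ?U x"
    proof cases
      case 1
      then have "R x = - (c * (real ?n * (v x)\<^sup>2 + 2 * v x * g))"
        using klow[of s] by (simp add: R' k'_def algebra_simps)
      then have "?U x = (norm (Dv x))\<^sup>2" using 1 a by (simp add: s_def g_def)
      then show ?thesis using 1 by (simp add: s_def)
    next
      case 2
      define z where "z = C * (inverse (s\<^sup>2) - d * inverse (s ^ ?n))"
      have ks: "k s = z - c" using kmid[of s] 2 by (simp add: z_def)
      have ks': "s * k' s = C * (d * (real ?n * inverse (s ^ ?n)) - 2 * inverse (s\<^sup>2))"
        using 2 s by (simp add: k'_def power2_eq_square power3_eq_cube field_simps)
      have "R x + c * (real ?n * (v x)\<^sup>2 + 2 * v x * g)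
          = 2 * v x * g * z + (v x)\<^sup>2 * (real ?n * z + C * (d * (real ?n * inverse (s ^ ?n)) - 2 * inverse (s\<^sup>2)))"
        unfolding R' ks ks' by (simp add: algebra_simps)
      also have "real ?n * z + C * (d * (real ?n * inverse (s ^ ?n)) - 2 * inverse (s\<^sup>2)) = C * (real ?n - 2) * inverse (s\<^sup>2)"
        by (simp add: z_def algebra_simps)
      also have "C * (real ?n - 2) * inverse (s\<^sup>2) = (real ?n - 2)\<^sup>2 / (1 - d)\<^sup>2 / s\<^sup>2"
        by (simp add: C_def power2_eq_square divide_inverse)
      finally have "?U x = (norm (Dv x))\<^sup>2 + 2 * v x * g * z + (v x)\<^sup>2 * ((real ?n - 2)\<^sup>2 / (1 - d)\<^sup>2 / s\<^sup>2)"
        using 2 by (simp add: s_def g_def)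
      moreover have "z = (real ?n - 2) / (1 - d)\<^sup>2 * (1 / s\<^sup>2 - d / s ^ ?n)"
        by (simp add: z_def C_def divide_inverse)
      ultimately have "P x \<le> ?U x" using P[of x] 2 by (simp add: s_def g_def)
      then show ?thesis using P0[of x] 2 by (simp add: s_def)
    next
      case 3
      then have "R x = 0" using khigh[of s] by (simp add: R' k'_def)
      then have "?U x = 0" using 3 by (simp add: s_def)
      then show ?thesis using 3 by (simp add: s_def)
    qed
  qed
  then have U0: "AE x in lborel. 0 \<le> ?U x" by eventually_elim simp
  show "0 \<le> I" unfolding UI[symmetric] by (rule integral_nonneg_AE[OF U0])
  have "(\<integral>\<^sup>+y\<in>{y. a \<le> norm y \<and> norm y \<le> 1}. ennreal (P y) \<partial>lborel) \<le> (\<integral>\<^sup>+y. ennreal (?U y) \<partial>lborel)"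
  proof (rule nn_integral_mono_AE)
    show "AE y in lborel. ennreal (P y) * indicator {y. a \<le> norm y \<and> norm y \<le> 1} y \<le> ennreal (?U y)"
      using U
    proof eventually_elim
      fix y assume "0 \<le> ?U y \<and> P y * indicator {y. a \<le> norm y \<and> norm y \<le> 1} y \<le> ?U y"
      then have "ennreal (P y * indicator {y. a \<le> norm y \<and> norm y \<le> 1} y) \<le> ennreal (?U y)" by (intro ennreal_leI) auto
      moreover have "ennreal (P y * indicator {y. a \<le> norm y \<and> norm y \<le> 1} y) = ennreal (P y) * indicator {y. a \<le> norm y \<and> norm y \<le> 1} y"
        by (cases "y \<in> {y. a \<le> norm y \<and> norm y \<le> 1}") simp_all
      ultimately show "ennreal (P y) * indicator {y. a \<le> norm y \<and> norm y \<le> 1} y \<le> ennreal (?U y)" by (simp only:)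
    qed
  qed
  also have "\<dots> = ennreal (\<integral>y. ?U y \<partial>lborel)" by (rule nn_integral_eq_integral[OF Ui U0])
  finally show "(\<integral>\<^sup>+y\<in>{y. a \<le> norm y \<and> norm y \<le> 1}. ennreal (P y) \<partial>lborel) \<le> ennreal I" unfolding UI .
qed

text \<open>The competitor is \<open>v\<close> in the unit ball, continued by its Kelvin transform.
  The factor \<open>|x|^(2 - n)\<close> is lowered by \<open>d\<close> and renormalised: it remains
  1 on the unit sphere and reaches 0 at radius \<open>1 / a\<close>, which gives compact
  support.\<close>

lemma capacity_le_kelvin:
  fixes v :: "'a::euclidean_space \<Rightarrow> real"
  assumes n: "3 \<le> DIM('a)" and v: "C1_grad v Dv" and F: "F \<subseteq> cball 0 1" "\<And>x. x \<in> F \<Longrightarrow> v x = 1"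
    and a: "0 < a" "a < 1"
  shows "capacity F \<le> ennreal (2 * (\<integral>x. (norm (Dv x))\<^sup>2 * indicator (ball 0 1) x \<partial>lborel)
     + (real DIM('a) - 2) / (1 - a ^ (DIM('a) - 2)) *
       (\<integral>x. (real DIM('a) * (v x)\<^sup>2 + 2 * v x * (Dv x \<bullet> x)) * indicator (ball 0 1) x \<partial>lborel))"
proof -
  let ?n = "DIM('a)"
  define d where "d = a ^ (?n - 2)"
  have d1: "0 < d" "d < 1" using a n by (auto simp: d_def power_less_one_iff)
  \<comment> \<open>The clamped radius makes \<open>W\<close> one locally Lipschitz expression for
    all three regions; \<open>\<Phi>\<close> is the identity in the ball and the inversion
    outside.\<close>
  define H where "H = (\<lambda>t::real. (inverse (min (1 / a) (max 1 t) ^ (?n - 2)) - d) * inverse (1 - d))"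
  define \<Phi> where "\<Phi> = (\<lambda>x::'a. inverse ((max 1 (norm x))\<^sup>2) *\<^sub>R x)"
  define W where "W = (\<lambda>x. H (norm x) * v (\<Phi> x))"
  have a1: "1 < 1 / a" using a by simp
  have Wll: "locally_lip W"
  proof -
    have "locally_lip (\<lambda>x::'a. H (norm x))" unfolding H_def
    proof (intro locally_lip_mult locally_lip_minus locally_lip_const locally_lip_inverse[where c=1])
      show "locally_lip (\<lambda>x::'a. min (1 / a) (max 1 (norm x)) ^ (?n - 2))"
        by (intro locally_lip_power locally_lip_max locally_lip_norm)
      show "1 \<le> min (1 / a) (max 1 (norm x)) ^ (?n - 2)" for x :: 'a
        using a1 by (intro one_le_power) auto
    qed simp
    moreover have "locally_lip \<Phi>" unfolding \<Phi>_def
    proof (intro locally_lip_scaleR locally_lip_id locally_lip_inverse[where c=1])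
      show "locally_lip (\<lambda>x::'a. (max 1 (norm x))\<^sup>2)"
        by (intro locally_lip_power locally_lip_max locally_lip_norm)
      show "1 \<le> (max 1 (norm x))\<^sup>2" for x :: 'a by (intro one_le_power) auto
    qed simp
    ultimately show ?thesis unfolding W_def
      by (intro locally_lip_mult locally_lip_compose[OF C1_grad_locally_lip[OF v]])
  qed
  have Win: "W x = v x" if "norm x \<le> 1" for x
  proof -
    have "max 1 (norm x) = 1" "min (1 / a) (max 1 (norm x)) = 1" using that a1 by auto
    then show ?thesis using d1 by (simp add: W_def H_def \<Phi>_def)
  qed
  have Wout: "W x = 0" if "1 / a < norm x" for x
  proof -
    have m: "min (1 / a) (max 1 (norm x)) = 1 / a" using that a1 by auto
    have "inverse ((1 / a) ^ (?n - 2)) = d" using a by (simp add: d_def power_one_over)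
    then show ?thesis by (simp add: W_def H_def m)
  qed
  have Wcs: "lip_cs W" by (rule lip_csI[OF Wll Wout])
  have cap: "capacity F \<le> energy W"
  proof (rule capacity_le_energy[OF Wcs])
    fix x assume "x \<in> F"
    then have "norm x \<le> 1" using F(1) by auto
    then show "W x = 1" using Win F(2)[OF \<open>x \<in> F\<close>] by simp
  qed
  define h where "h = (\<lambda>r::real. ((1 / r) ^ (?n - 2) - d) / (1 - d))"
  define h' where "h' = (\<lambda>r::real. - ((real ?n - 2) * (1 / r) ^ (?n - 1) / (1 - d)))"
  define Y where "Y = (\<lambda>x::'a. (1 / (norm x)\<^sup>2) *\<^sub>R x)"
  define G where "G = (\<lambda>x. h (norm x) *\<^sub>R ((1 / (norm x)\<^sup>2) *\<^sub>R Dv (Y x) - (2 * (Dv (Y x) \<bullet> x) / norm x ^ 4) *\<^sub>R x)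
      + (v (Y x) * h' (norm x) / norm x) *\<^sub>R x)"
  have [measurable]: "Dv \<in> borel_measurable borel" "v \<in> borel_measurable borel"
    using C1_gradD(2,3)[OF v] by (auto intro: borel_measurable_continuous_onI)
  have [measurable]: "Y \<in> borel_measurable borel" unfolding Y_def by measurable
  have [measurable]: "G \<in> borel_measurable borel" unfolding G_def h_def h'_def by measurable
  have dh: "(h has_real_derivative h' r) (at r)" if "0 < r" for r
  proof -
    obtain m where m: "?n - 2 = Suc m" "?n - 1 = m + 2" "?n = m + 3" using n by (intro that[of "?n - 3"]) auto
    have 1: "((\<lambda>r. 1 / r) has_real_derivative (- (1 / r)\<^sup>2)) (at r)"
      using that by (auto intro!: derivative_eq_intros simp: power2_eq_square)
    have "((\<lambda>r. (1 / r) ^ Suc m) has_real_derivative (real (Suc m) * (1 / r) ^ m * (- (1 / r)\<^sup>2))) (at r)"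
      using DERIV_chain2[OF DERIV_pow[of "Suc m" "1 / r"] 1] by simp
    then have "((\<lambda>r. ((1 / r) ^ Suc m - d) / (1 - d)) has_real_derivative ((real (Suc m) * (1 / r) ^ m * (- (1 / r)\<^sup>2) - 0) / (1 - d))) (at r)"
      by (intro DERIV_cdivide DERIV_diff DERIV_const)
    moreover have "(real (Suc m) * (1 / r) ^ m * (- (1 / r)\<^sup>2) - 0) / (1 - d) = h' r"
      unfolding h'_def m(2) power_add by (simp add: m(3))
    ultimately show ?thesis unfolding h_def m(1) by simp
  qed
  have gradW: "gradient W x = (if norm x < 1 then Dv x else if norm x < 1 / a then G x else 0)"
    if x: "norm x \<notin> {0, 1, 1 / a}" for x
  proof -
    consider "norm x < 1" | "1 < norm x" "norm x < 1 / a" | "1 / a < norm x" using x by force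
    then show ?thesis
    proof cases
      case 1
      have "has_partial b W x (Dv x \<bullet> b)" for b
        by (rule has_partial_cong_open[OF C1_gradD(4)[OF v], of "ball 0 1"]) (use 1 Win in auto)
      then have "gradient W x = Dv x"
        by - (rule euclidean_eqI, simp only: gradient_inner_Basis has_partial_imp_partial_deriv)
      then show ?thesis using 1 by simp
    next
      case 2
      have x0: "x \<noteq> 0" using x by auto
      have "has_partial b W x (G x \<bullet> b)" for b
      proof -
        have 3: "has_partial b (\<lambda>x. h (norm x)) x (h' (norm x) * ((x \<bullet> b) / norm x))"
          by (rule has_partial_compose[OF has_partial_norm[OF x0] dh]) (use x0 in simp)
        have "((\<lambda>x. v (Y x)) has_derivative (\<lambda>k. Dv (Y x) \<bullet> ((1 / (norm x)\<^sup>2) *\<^sub>R k - (2 * (x \<bullet> k) / (norm x) ^ 4) *\<^sub>R x))) (at x)"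
          unfolding Y_def by (rule has_derivative_compose[OF has_derivative_inversion[OF x0] C1_gradD(1)[OF v]])
        from has_partial_mult[OF 3 has_partial_has_derivative[OF this]]
        have "has_partial b (\<lambda>x. h (norm x) * v (Y x)) x (h' (norm x) * ((x \<bullet> b) / norm x) * v (Y x) +
           (Dv (Y x) \<bullet> ((1 / (norm x)\<^sup>2) *\<^sub>R b - (2 * (x \<bullet> b) / (norm x) ^ 4) *\<^sub>R x)) * h (norm x))" .
        moreover have "h' (norm x) * ((x \<bullet> b) / norm x) * v (Y x) +
           (Dv (Y x) \<bullet> ((1 / (norm x)\<^sup>2) *\<^sub>R b - (2 * (x \<bullet> b) / (norm x) ^ 4) *\<^sub>R x)) * h (norm x) = G x \<bullet> b"
          by (simp add: G_def inner_add_left inner_diff_left inner_diff_right algebra_simps)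
        ultimately have "has_partial b (\<lambda>x. h (norm x) * v (Y x)) x (G x \<bullet> b)" by simp
        then show ?thesis
        proof (rule has_partial_cong_open[of _ _ _ _ "{x. 1 < norm x} \<inter> {x. norm x < 1 / a}"])
          show "open ({x::'a. 1 < norm x} \<inter> {x. norm x < 1 / a})"
            by (intro open_Int open_Collect_less continuous_intros)
          fix y assume y: "y \<in> {x::'a. 1 < norm x} \<inter> {x. norm x < 1 / a}"
          then have "max 1 (norm y) = norm y" "min (1 / a) (max 1 (norm y)) = norm y" by auto
          then show "W y = h (norm y) * v (Y y)"
            by (simp add: W_def H_def \<Phi>_def h_def Y_def divide_inverse power_inverse)
        qed (use 2 in auto)
      qed
      then have "gradient W x = G x"
        by - (rule euclidean_eqI, simp only: gradient_inner_Basis has_partial_imp_partial_deriv)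
      then show ?thesis using 2 by simp
    next
      case 3
      then have "gradient W x = 0" by (intro gradient_zero_outside[where u=W and R="1 / a"] Wout)
      then show ?thesis using 3 a1 by simp
    qed
  qed
  let ?S = "{x::'a. 1 \<le> norm x \<and> norm x \<le> 1 / a}"
  let ?D = "\<integral>x. (norm (Dv x))\<^sup>2 * indicator (ball 0 1) x \<partial>lborel"
  have i1: "integrable lborel (\<lambda>x. (norm (Dv x))\<^sup>2 * indicator (ball 0 1) x)"
    by (intro integrable_ball_continuous continuous_intros C1_gradD(2)[OF v])
  have "energy W = (\<integral>\<^sup>+x. ennreal ((norm (Dv x))\<^sup>2 * indicator (ball 0 1) x) + ennreal ((norm (G x))\<^sup>2) * indicator ?S x \<partial>lborel)"
    unfolding energy_def
  proof (rule nn_integral_cong_AE)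
    have "AE x in lborel. norm (x::'a) \<notin> {0, 1, 1 / a}" by (rule AE_norm_notin_finite) simp
    then show "AE x in lborel. ennreal ((norm (gradient W x))\<^sup>2) =
      ennreal ((norm (Dv x))\<^sup>2 * indicator (ball 0 1) x) + ennreal ((norm (G x))\<^sup>2) * indicator ?S x"
    proof eventually_elim
      fix x :: 'a assume x: "norm x \<notin> {0, 1, 1 / a}"
      then show "ennreal ((norm (gradient W x))\<^sup>2) =
        ennreal ((norm (Dv x))\<^sup>2 * indicator (ball 0 1) x) + ennreal ((norm (G x))\<^sup>2) * indicator ?S x"
        using a1 by (auto simp: gradW indicator_def)
    qed
  qed
  also have "\<dots> = (\<integral>\<^sup>+x. ennreal ((norm (Dv x))\<^sup>2 * indicator (ball 0 1) x) \<partial>lborel) + (\<integral>\<^sup>+x\<in>?S. ennreal ((norm (G x))\<^sup>2) \<partial>lborel)"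
    by (rule nn_integral_add) (use i1 in measurable)
  also have "(\<integral>\<^sup>+x. ennreal ((norm (Dv x))\<^sup>2 * indicator (ball 0 1) x) \<partial>lborel) = ennreal ?D"
    by (rule nn_integral_eq_integral[OF i1]) auto
  finally have eW: "energy W = ennreal ?D + (\<integral>\<^sup>+x\<in>?S. ennreal ((norm (G x))\<^sup>2) \<partial>lborel)" .
  \<comment> \<open>The exterior energy density, carried into the ball by inversion and multiplied
    by the Jacobian.\<close>
  define P where "P = (\<lambda>y. (norm (G ((1 / (norm y)\<^sup>2) *\<^sub>R y)))\<^sup>2 * (1 / norm y ^ (2 * ?n)))"
  have "(\<integral>\<^sup>+x\<in>?S. ennreal ((norm (G x))\<^sup>2) \<partial>lborel)
    = (\<integral>\<^sup>+y\<in>{y. 1 / (1 / a) \<le> norm y \<and> norm y \<le> 1}. ennreal ((norm (G ((1 / (norm y)\<^sup>2) *\<^sub>R y)))\<^sup>2) * ennreal (1 / norm y ^ (2 * ?n)) \<partial>lborel)"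
    by (rule nn_integral_inversion) (use a1 in measurable)
  also have "\<dots> = (\<integral>\<^sup>+y\<in>{y. a \<le> norm y \<and> norm y \<le> 1}. ennreal (P y) \<partial>lborel)"
  proof -
    have "ennreal ((norm (G ((1 / (norm y)\<^sup>2) *\<^sub>R y)))\<^sup>2) * ennreal (1 / norm y ^ (2 * ?n)) = ennreal (P y)" for y
      unfolding P_def by (rule ennreal_mult[symmetric]) auto
    moreover have "1 / (1 / a) = a" by simp
    ultimately show ?thesis by (simp only:)
  qed
  finally have eS: "(\<integral>\<^sup>+x\<in>?S. ennreal ((norm (G x))\<^sup>2) \<partial>lborel) = (\<integral>\<^sup>+y\<in>{y. a \<le> norm y \<and> norm y \<le> 1}. ennreal (P y) \<partial>lborel)" .
  have Ple: "P y \<le> (norm (Dv y))\<^sup>2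
      + 2 * v y * (Dv y \<bullet> y) * ((real ?n - 2) / (1 - d)\<^sup>2 * (1 / (norm y)\<^sup>2 - d / norm y ^ ?n))
      + (v y)\<^sup>2 * ((real ?n - 2)\<^sup>2 / (1 - d)\<^sup>2 / (norm y)\<^sup>2)" if y: "a \<le> norm y" "norm y \<le> 1" for y
  proof -
    define s where "s = norm y"
    have s: "0 < s" "s \<le> 1" using y a by (auto simp: s_def)
    define x where "x = (1 / (norm y)\<^sup>2) *\<^sub>R y"
    have nx: "norm x = 1 / s" using s by (simp add: x_def s_def power2_eq_square)
    have Yx: "Y x = y" unfolding Y_def nx using s by (simp add: x_def s_def power_divide)
    define e where "e = v y * h' (1 / s)"
    have "(norm (G x))\<^sup>2 = (h (1/s))\<^sup>2 * (norm (Dv y))\<^sup>2 / (1/s) ^ 4 - 2 * h (1/s) * e * (Dv y \<bullet> x) / (1/s) ^ 3 + e\<^sup>2"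
      unfolding G_def Yx nx e_def by (rule norm_kelvin_gradient[OF nx]) (use s in simp)
    also have "\<dots> = (h (1/s))\<^sup>2 * (norm (Dv y))\<^sup>2 * s ^ 4 - 2 * h (1/s) * e * (Dv y \<bullet> y) * s + e\<^sup>2"
      using s by (simp add: x_def s_def[symmetric] power_divide power2_eq_square power3_eq_cube)
    finally have "P y = ((h (1/s))\<^sup>2 * (norm (Dv y))\<^sup>2 * s ^ 4 - 2 * h (1/s) * e * (Dv y \<bullet> y) * s + e\<^sup>2) / s ^ (2 * ?n)"
      by (simp add: P_def x_def s_def)
    moreover have "h (1/s) = (s ^ (?n - 2) - d) / (1 - d)" by (simp add: h_def)
    moreover have "e = - v y * ((real ?n - 2) * s ^ (?n - 1) / (1 - d))" by (simp add: e_def h'_def)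
    moreover have "d \<le> s ^ (?n - 2)" unfolding d_def using y a by (auto simp: s_def intro!: power_mono)
    ultimately show ?thesis
      using kelvin_density_le[OF n s, of d "(norm (Dv y))\<^sup>2" "v y" "Dv y \<bullet> y"] d1 by (simp add: s_def)
  qed
  have P0: "0 \<le> P y" for y by (simp add: P_def)
  note ext = kelvin_exterior_integral[OF n v a P0 d_def Ple]
  let ?I = "?D + (real ?n - 2) / (1 - d) * (\<integral>x. (real ?n * (v x)\<^sup>2 + 2 * v x * (Dv x \<bullet> x)) * indicator (ball 0 1) x \<partial>lborel)"
  have I: "(\<integral>\<^sup>+y\<in>{y. a \<le> norm y \<and> norm y \<le> 1}. ennreal (P y) \<partial>lborel) \<le> ennreal ?I" "0 \<le> ?I"
    by (rule ext; assumption)+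
  have D0: "0 \<le> ?D" by (rule Bochner_Integration.integral_nonneg) simp
  have "energy W \<le> ennreal ?D + ennreal ?I" unfolding eW eS by (rule add_left_mono[OF I(1)])
  also have "\<dots> = ennreal (?D + ?I)" by (rule ennreal_plus[symmetric, OF D0 I(2)])
  finally have "energy W \<le> ennreal (?D + ?I)" .
  moreover have "?D + ?I = 2 * ?D + (real ?n - 2) / (1 - d) * (\<integral>x. (real ?n * (v x)\<^sup>2 + 2 * v x * (Dv x \<bullet> x)) * indicator (ball 0 1) x \<partial>lborel)"
    by simp
  ultimately have "energy W \<le> ennreal (2 * ?D + (real ?n - 2) / (1 - d) * (\<integral>x. (real ?n * (v x)\<^sup>2 + 2 * v x * (Dv x \<bullet> x)) * indicator (ball 0 1) x \<partial>lborel))"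
    by (simp only:)
  from order_trans[OF cap this] show ?thesis unfolding d_def .
qed

text \<open>Letting \<open>a\<close> tend to 0 removes the truncation. The last integrand is the
  divergence of \<open>v\<^sup>2 x\<close>, so that this integral stands for the integral of
  \<open>v\<^sup>2\<close> over the unit sphere.\<close>

theorem capacity_le_ball_functional:
  fixes v :: "'a::euclidean_space \<Rightarrow> real"
  assumes n: "3 \<le> DIM('a)" and v: "C1_grad v Dv" and F: "F \<subseteq> cball 0 1" "\<And>x. x \<in> F \<Longrightarrow> v x = 1"
  shows "capacity F \<le> ennreal (2 * (\<integral>x. (norm (Dv x))\<^sup>2 * indicator (ball 0 1) x \<partial>lborel)
     + (real DIM('a) - 2) *
       (\<integral>x. (real DIM('a) * (v x)\<^sup>2 + 2 * v x * (Dv x \<bullet> x)) * indicator (ball 0 1) x \<partial>lborel))"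
    (is "_ \<le> ennreal (?D + ?m * ?J)")
proof (rule tendsto_lowerbound)
  have "((\<lambda>a::real. ?D + ?m / (1 - a ^ (DIM('a) - 2)) * ?J) \<longlongrightarrow> ?D + ?m / (1 - 0 ^ (DIM('a) - 2)) * ?J) (at_right 0)"
    by (intro tendsto_intros) (use n in \<open>auto simp: power_0_left\<close>)
  moreover have "?D + ?m / (1 - 0 ^ (DIM('a) - 2)) * ?J = ?D + ?m * ?J" using n by (simp add: power_0_left)
  ultimately show "((\<lambda>a::real. ennreal (?D + ?m / (1 - a ^ (DIM('a) - 2)) * ?J)) \<longlongrightarrow> ennreal (?D + ?m * ?J)) (at_right 0)"
    by (intro tendsto_ennrealI) simp
  have "eventually (\<lambda>a::real. a \<in> {0<..<1}) (at_right 0)" by (rule eventually_at_right_real) simp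
  then show "\<forall>\<^sub>F a in at_right 0. capacity F \<le> ennreal (?D + ?m / (1 - a ^ (DIM('a) - 2)) * ?J)"
  proof (rule eventually_mono)
    fix a :: real assume "a \<in> {0<..<1}"
    then show "capacity F \<le> ennreal (?D + ?m / (1 - a ^ (DIM('a) - 2)) * ?J)"
      by (intro capacity_le_kelvin[OF n v F]) simp_all
  qed
qed simp

text \<open>For the constant function 1 the Kelvin transform is the equilibrium potential
  \<open>|x|^(2 - n)\<close>, so nothing is lost and the bound meets the lower one; the other balls
  follow by scaling.\<close>

corollary capacity_cball_le:
  fixes p :: "'a::euclidean_space"
  assumes n: "3 \<le> DIM('a)" and r: "0 < r"
  shows "capacity (cball p r) \<le> ennreal (real DIM('a) * (real DIM('a) - 2) * unit_ball_vol (real DIM('a)) * r ^ (DIM('a) - 2))"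
proof -
  let ?n = "DIM('a)" let ?c = "real ?n * (real ?n - 2) * unit_ball_vol (real ?n)"
  have "C1_grad (\<lambda>x::'a. 1) (\<lambda>x. 0)" by (simp add: C1_grad_def)
  from capacity_le_ball_functional[OF n this, of "cball 0 1"]
  have "capacity (cball (0::'a) 1) \<le> ennreal ((real ?n - 2) * (\<integral>x. real ?n * indicator (ball (0::'a) 1) x \<partial>lborel))" by simp
  also have "(\<integral>x. real ?n * indicator (ball (0::'a) 1) x \<partial>lborel) = real ?n * unit_ball_vol (real ?n)"
    by (simp add: measure_def emeasure_ball)
  finally have 1: "capacity (cball (0::'a) 1) \<le> ennreal ?c" by (simp add: mult_ac)
  have "{x. - (1/r) *\<^sub>R p + (1/r) *\<^sub>R x \<in> cball 0 1} = cball p r"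
  proof -
    have "norm (- (1/r) *\<^sub>R p + (1/r) *\<^sub>R x) = dist p x / r" for x
    proof -
      have "- (1/r) *\<^sub>R p + (1/r) *\<^sub>R x = (1/r) *\<^sub>R (x - p)" by (simp add: algebra_simps)
      then show ?thesis using r by (simp add: dist_norm norm_minus_commute)
    qed
    then show ?thesis using r by (auto simp: divide_le_eq)
  qed
  moreover have "ennreal ((1/r) ^ (?n - 2)) * capacity {x. - (1/r) *\<^sub>R p + (1/r) *\<^sub>R x \<in> cball 0 1} \<le> ennreal ?c"
    by (rule order_trans[OF capacity_scaling 1]) (use r n in auto)
  ultimately have "ennreal ((1/r) ^ (?n - 2)) * capacity (cball p r) \<le> ennreal ?c" by (simp only:)
  then have "ennreal (r ^ (?n - 2)) * (ennreal ((1/r) ^ (?n - 2)) * capacity (cball p r)) \<le> ennreal (r ^ (?n - 2)) * ennreal ?c"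
    by (rule mult_left_mono) simp
  moreover have "ennreal (r ^ (?n - 2)) * (ennreal ((1/r) ^ (?n - 2)) * K) = K" for K
  proof -
    have "ennreal (r ^ (?n - 2)) * ennreal ((1/r) ^ (?n - 2)) = 1"
      using r by (simp add: ennreal_mult[symmetric] power_mult_distrib[symmetric])
    then show ?thesis by (simp only: mult.assoc[symmetric] mult_1)
  qed
  ultimately have "capacity (cball p r) \<le> ennreal (r ^ (?n - 2)) * ennreal ?c" by simp
  also have "\<dots> = ennreal (?c * r ^ (?n - 2))" using r n by (simp add: ennreal_mult[symmetric] mult_ac)
  finally show ?thesis .
qed

section \<open>Gaussian integrals and a Poincare inequality on balls\<close>

lemma nn_integral_lborel_pair:
  fixes \<Psi> :: "'a::euclidean_space \<times> 'b::euclidean_space \<Rightarrow> ennreal"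
  assumes "\<Psi> \<in> borel_measurable borel"
  shows "(\<integral>\<^sup>+p. \<Psi> p \<partial>lborel) = (\<integral>\<^sup>+x. \<integral>\<^sup>+y. \<Psi> (x, y) \<partial>lborel \<partial>lborel)"
    "(\<integral>\<^sup>+p. \<Psi> p \<partial>lborel) = (\<integral>\<^sup>+y. \<integral>\<^sup>+x. \<Psi> (x, y) \<partial>lborel \<partial>lborel)"
proof -
  have m: "\<Psi> \<in> borel_measurable (lborel \<Otimes>\<^sub>M lborel)" using assms by (simp add: lborel_prod)
  show 1: "(\<integral>\<^sup>+p. \<Psi> p \<partial>lborel) = (\<integral>\<^sup>+x. \<integral>\<^sup>+y. \<Psi> (x, y) \<partial>lborel \<partial>lborel)"
    using lborel.nn_integral_fst[OF m] by (simp add: lborel_prod)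
  have "(\<lambda>(x, y). \<Psi> (x, y)) \<in> borel_measurable (lborel \<Otimes>\<^sub>M lborel)" using m by simp
  from lborel_pair.Fubini'[OF this] show "(\<integral>\<^sup>+p. \<Psi> p \<partial>lborel) = (\<integral>\<^sup>+y. \<integral>\<^sup>+x. \<Psi> (x, y) \<partial>lborel \<partial>lborel)"
    unfolding 1 by simp
qed

lemma nn_integral_translate:
  fixes f :: "'a::euclidean_space \<Rightarrow> ennreal"
  assumes "f \<in> borel_measurable borel"
  shows "(\<integral>\<^sup>+x. f (x + c) \<partial>lborel) = (\<integral>\<^sup>+x. f x \<partial>lborel)"
proof -
  have "(\<integral>\<^sup>+x. f x \<partial>lborel) = (\<integral>\<^sup>+x. f (c + x) \<partial>lborel)"
    using nn_integral_affine[OF assms, of 1 c] by simp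
  then show ?thesis by (simp only: add.commute)
qed

text \<open>Writing \<open>E = 'a \<times> \<real>\<^sup>2\<close>, the map \<open>z \<mapsto> fst z / |z|\<close> sends a Gaussian on \<open>E\<close> to the uniform distribution on the
  unit ball of \<open>'a\<close> (Archimedes); \<open>e\<close> regularises the origin.\<close>

lemma nn_integral_Archimedes:
  fixes \<phi> :: "'a::euclidean_space \<Rightarrow> ennreal" and F :: "real \<Rightarrow> ennreal"
  assumes [measurable]: "\<phi> \<in> borel_measurable borel" "F \<in> borel_measurable borel" and e: "0 \<le> e"
  shows "(\<integral>\<^sup>+z. \<phi> ((1 / sqrt ((norm z)\<^sup>2 + e)) *\<^sub>R fst z) * F ((norm z)\<^sup>2 + e) \<partial>(lborel :: ('a \<times> real \<times> real) measure))
    = ennreal pi * (\<integral>\<^sup>+\<tau>\<in>{e..}. F \<tau> * ennreal (sqrt \<tau> ^ DIM('a)) * (\<integral>\<^sup>+y. \<phi> y * indicator {y. (norm y)\<^sup>2 + e / \<tau> \<le> 1} y \<partial>lborel) \<partial>lborel)"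
proof -
  have [measurable]: "(fst :: 'a \<times> real \<times> real \<Rightarrow> 'a) \<in> borel_measurable borel"
    by (intro borel_measurable_continuous_onI continuous_intros)
  have [measurable]: "Measurable.pred (borel \<Otimes>\<^sub>M borel) (\<lambda>p. snd p \<in> {(norm (fst p :: 'a))\<^sup>2 + e..})"
    unfolding atLeast_iff by measurable
  have [measurable]: "Measurable.pred borel (\<lambda>x :: 'a. \<tau> \<in> {(norm x)\<^sup>2 + e..})" for \<tau>
    unfolding atLeast_iff by measurable
  let ?g = "\<lambda>x \<tau>. \<phi> ((1 / sqrt \<tau>) *\<^sub>R x) * F \<tau>"
  have "(\<integral>\<^sup>+z. \<phi> ((1 / sqrt ((norm z)\<^sup>2 + e)) *\<^sub>R fst z) * F ((norm z)\<^sup>2 + e) \<partial>(lborel :: ('a \<times> real \<times> real) measure))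
    = (\<integral>\<^sup>+x. \<integral>\<^sup>+s. ?g x ((norm (x, s))\<^sup>2 + e) \<partial>(lborel :: (real \<times> real) measure) \<partial>lborel)"
    by (subst nn_integral_lborel_pair(1)) auto
  also have "\<dots> = (\<integral>\<^sup>+x. \<integral>\<^sup>+s. ?g x ((norm x)\<^sup>2 + (norm s ^ DIM(real \<times> real)) + e) \<partial>(lborel :: (real \<times> real) measure) \<partial>lborel)"
    by (simp add: norm_Pair real_sqrt_pow2 power2_eq_square[of "norm (_ :: real \<times> real)"])
  \<comment> \<open>In the plane \<open>|s|^2\<close> has the constant density \<open>pi\<close>.
    This is why two additional coordinates make the projected measure uniform.\<close>
  also have "\<dots> = (\<integral>\<^sup>+x. ennreal pi * (\<integral>\<^sup>+t\<in>{0..}. ?g x ((norm x)\<^sup>2 + t + e) \<partial>lborel) \<partial>lborel)"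
  proof (rule nn_integral_cong)
    fix x :: 'a
    have "(\<integral>\<^sup>+s. (\<lambda>t. ?g x ((norm x)\<^sup>2 + t + e)) (norm s ^ DIM(real \<times> real)) \<partial>(lborel :: (real \<times> real) measure))
       = ennreal (unit_ball_vol (real DIM(real \<times> real))) * (\<integral>\<^sup>+t\<in>{0..}. ?g x ((norm x)\<^sup>2 + t + e) \<partial>lborel)"
      by (rule nn_integral_radial) measurable
    moreover have "unit_ball_vol (real DIM(real \<times> real)) = pi" using unit_ball_vol_2 by simp
    ultimately show "(\<integral>\<^sup>+s. ?g x ((norm x)\<^sup>2 + (norm s ^ DIM(real \<times> real)) + e) \<partial>(lborel :: (real \<times> real) measure))
       = ennreal pi * (\<integral>\<^sup>+t\<in>{0..}. ?g x ((norm x)\<^sup>2 + t + e) \<partial>lborel)" by (simp only:)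
  qed
  also have "\<dots> = ennreal pi * (\<integral>\<^sup>+x. (\<integral>\<^sup>+t\<in>{0..}. ?g x ((norm x)\<^sup>2 + t + e) \<partial>lborel) \<partial>lborel)"
    by (rule nn_integral_cmult) measurable
  also have "(\<integral>\<^sup>+x. (\<integral>\<^sup>+t\<in>{0..}. ?g x ((norm x)\<^sup>2 + t + e) \<partial>lborel) \<partial>lborel)
     = (\<integral>\<^sup>+x. (\<integral>\<^sup>+\<tau>. ?g x \<tau> * indicator {(norm x)\<^sup>2 + e..} \<tau> \<partial>lborel) \<partial>lborel)"
  proof (rule nn_integral_cong)
    fix x :: 'a
    have "(\<integral>\<^sup>+\<tau>. ?g x \<tau> * indicator {(norm x)\<^sup>2 + e..} \<tau> \<partial>lborel) =
      (\<integral>\<^sup>+t. ?g x (t + ((norm x)\<^sup>2 + e)) * indicator {(norm x)\<^sup>2 + e..} (t + ((norm x)\<^sup>2 + e)) \<partial>lborel)"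
      by (rule nn_integral_translate[symmetric]) measurable
    also have "\<dots> = (\<integral>\<^sup>+t\<in>{0..}. ?g x ((norm x)\<^sup>2 + t + e) \<partial>lborel)"
      by (intro nn_integral_cong) (auto simp: indicator_def add_ac)
    finally show "(\<integral>\<^sup>+t\<in>{0..}. ?g x ((norm x)\<^sup>2 + t + e) \<partial>lborel) = (\<integral>\<^sup>+\<tau>. ?g x \<tau> * indicator {(norm x)\<^sup>2 + e..} \<tau> \<partial>lborel)" ..
  qed
  also have "\<dots> = (\<integral>\<^sup>+\<tau>. (\<integral>\<^sup>+x. ?g x \<tau> * indicator {(norm x)\<^sup>2 + e..} \<tau> \<partial>lborel) \<partial>lborel)"
    by (rule lborel_pair.Fubini'[symmetric]) measurable
  \<comment> \<open>For fixed \<open>\<tau>\<close> the substitution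
    \<open>x = sqrt \<tau> *\<^sub>R y\<close> produces the power of \<open>sqrt \<tau>\<close> and
    turns \<open>|x|^2 + e \<le> \<tau>\<close> into
    \<open>|y|^2 + e / \<tau> \<le> 1\<close>.\<close>
  also have "\<dots> = (\<integral>\<^sup>+\<tau>\<in>{e..}. F \<tau> * ennreal (sqrt \<tau> ^ DIM('a)) * (\<integral>\<^sup>+y. \<phi> y * indicator {y. (norm y)\<^sup>2 + e / \<tau> \<le> 1} y \<partial>lborel) \<partial>lborel)"
  proof (rule nn_integral_cong_AE)
    have "AE \<tau> in lborel. \<tau> \<noteq> (0::real)" by (rule AE_lborel_singleton)
    then show "AE \<tau> in lborel. (\<integral>\<^sup>+x. ?g x \<tau> * indicator {(norm x)\<^sup>2 + e..} \<tau> \<partial>lborel) =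
      F \<tau> * ennreal (sqrt \<tau> ^ DIM('a)) * (\<integral>\<^sup>+y. \<phi> y * indicator {y. (norm y)\<^sup>2 + e / \<tau> \<le> 1} y \<partial>lborel) * indicator {e..} \<tau>"
    proof eventually_elim
      fix \<tau> :: real assume "\<tau> \<noteq> 0"
      show "(\<integral>\<^sup>+x. ?g x \<tau> * indicator {(norm x)\<^sup>2 + e..} \<tau> \<partial>lborel) =
        F \<tau> * ennreal (sqrt \<tau> ^ DIM('a)) * (\<integral>\<^sup>+y. \<phi> y * indicator {y. (norm y)\<^sup>2 + e / \<tau> \<le> 1} y \<partial>lborel) * indicator {e..} \<tau>"
      proof (cases "e \<le> \<tau>")
        case True
        then have \<tau>: "0 < \<tau>" using e \<open>\<tau> \<noteq> 0\<close> by simp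
        have "(\<integral>\<^sup>+x. ?g x \<tau> * indicator {(norm x)\<^sup>2 + e..} \<tau> \<partial>lborel)
          = ennreal (sqrt \<tau> ^ DIM('a)) * (\<integral>\<^sup>+y. ?g (0 + sqrt \<tau> *\<^sub>R y) \<tau> * indicator {(norm (0 + sqrt \<tau> *\<^sub>R y))\<^sup>2 + e..} \<tau> \<partial>lborel)"
          by (rule nn_integral_affine) (use \<tau> in \<open>simp_all only: atLeast_iff real_sqrt_gt_0_iff, measurable\<close>)
        also have "(\<integral>\<^sup>+y. ?g (0 + sqrt \<tau> *\<^sub>R y) \<tau> * indicator {(norm (0 + sqrt \<tau> *\<^sub>R y))\<^sup>2 + e..} \<tau> \<partial>lborel)
          = (\<integral>\<^sup>+y. F \<tau> * (\<phi> y * indicator {y. (norm y)\<^sup>2 + e / \<tau> \<le> 1} y) \<partial>lborel)"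
        proof (rule nn_integral_cong)
          fix y :: 'a
          have "(norm (0 + sqrt \<tau> *\<^sub>R y))\<^sup>2 + e \<le> \<tau> \<longleftrightarrow> (norm y)\<^sup>2 + e / \<tau> \<le> 1"
            using \<tau> by (simp add: power_mult_distrib field_simps)
          moreover have "(1 / sqrt \<tau>) *\<^sub>R (0 + sqrt \<tau> *\<^sub>R y) = y" using \<tau> by simp
          ultimately show "?g (0 + sqrt \<tau> *\<^sub>R y) \<tau> * indicator {(norm (0 + sqrt \<tau> *\<^sub>R y))\<^sup>2 + e..} \<tau>
            = F \<tau> * (\<phi> y * indicator {y. (norm y)\<^sup>2 + e / \<tau> \<le> 1} y)"
            by (simp only: indicator_def mem_Collect_eq atLeast_iff mult_ac)
        qed
        also have "\<dots> = F \<tau> * (\<integral>\<^sup>+y. \<phi> y * indicator {y. (norm y)\<^sup>2 + e / \<tau> \<le> 1} y \<partial>lborel)"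
          by (rule nn_integral_cmult) measurable
        finally show ?thesis using True by (simp add: mult_ac)
      next
        case False
        then have "\<not> (norm x)\<^sup>2 + e \<le> \<tau>" for x :: 'a by (simp add: not_le add_strict_increasing2)
        then show ?thesis using False by simp
      qed
    qed
  qed
  finally show ?thesis .
qed

section \<open>Gaussian weights and moments\<close>

lemma nn_integral_exp_powr:
  assumes "0 < p" and f: "\<And>\<tau>::real. 0 < \<tau> \<Longrightarrow> f \<tau> = \<tau> powr (p - 1) / exp \<tau>"
  shows "(\<integral>\<^sup>+\<tau>\<in>{0..}. ennreal (f \<tau>) \<partial>lborel) = ennreal (Gamma p)"
proof -
  have "ennreal (Gamma p) = (\<integral>\<^sup>+t. ennreal (indicator {0..} t * t powr (p - 1) / exp t) \<partial>lborel)"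
    by (rule Gamma_conv_nn_integral_real[OF assms(1)])
  also have "\<dots> = (\<integral>\<^sup>+\<tau>\<in>{0..}. ennreal (f \<tau>) \<partial>lborel)"
  proof (rule nn_integral_cong_AE, rule eventually_mono[OF AE_lborel_singleton[of "0::real"]])
    fix \<tau> :: real assume "\<tau> \<noteq> 0"
    then show "ennreal (indicator {0..} \<tau> * \<tau> powr (p - 1) / exp \<tau>) = ennreal (f \<tau>) * indicator {0..} \<tau>"
      using f[of \<tau>] by (cases "0 < \<tau>") simp_all
  qed
  finally show ?thesis by simp
qed

lemma sqrt_power_eq_powr: "0 < \<tau> \<Longrightarrow> sqrt \<tau> ^ n = \<tau> powr (real n / 2)"
  by (simp add: powr_half_sqrt[symmetric] powr_realpow[symmetric] powr_powr)

text \<open>The radial factors of the two weights met below: the Gaussian itself, and the Gaussian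
  divided by \<open>|z|^2\<close>, which comes from the gradient of \<open>fst z / |z|\<close>.
  Their quotient \<open>n / 2\<close> is the source of the \<open>1 / n\<close> in the Poincare
  constant.\<close>

lemma nn_integral_gamma:
  "(\<integral>\<^sup>+\<tau>\<in>{0..}. ennreal (exp (- \<tau>) * sqrt \<tau> ^ n) \<partial>lborel) = ennreal (Gamma (real n / 2 + 1))"
  "1 \<le> n \<Longrightarrow> (\<integral>\<^sup>+\<tau>\<in>{0..}. ennreal (exp (- \<tau>) / \<tau> * sqrt \<tau> ^ n) \<partial>lborel) = ennreal (Gamma (real n / 2))"
proof -
  show "(\<integral>\<^sup>+\<tau>\<in>{0..}. ennreal (exp (- \<tau>) * sqrt \<tau> ^ n) \<partial>lborel) = ennreal (Gamma (real n / 2 + 1))"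
  proof (rule nn_integral_exp_powr)
    fix \<tau> :: real assume t: "0 < \<tau>"
    show "exp (- \<tau>) * sqrt \<tau> ^ n = \<tau> powr (real n / 2 + 1 - 1) / exp \<tau>"
      unfolding sqrt_power_eq_powr[OF t] exp_minus by (simp only: divide_inverse add_diff_cancel_right' mult.commute)
  qed simp
  assume n: "1 \<le> n"
  show "(\<integral>\<^sup>+\<tau>\<in>{0..}. ennreal (exp (- \<tau>) / \<tau> * sqrt \<tau> ^ n) \<partial>lborel) = ennreal (Gamma (real n / 2))"
  proof (rule nn_integral_exp_powr)
    fix \<tau> :: real assume t: "0 < \<tau>"
    have "\<tau> powr (real n / 2 - 1) = \<tau> powr (real n / 2) / \<tau>" using t by (simp only: powr_diff powr_one)
    then show "exp (- \<tau>) / \<tau> * sqrt \<tau> ^ n = \<tau> powr (real n / 2 - 1) / exp \<tau>"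
      unfolding sqrt_power_eq_powr[OF t] exp_minus by (simp only: divide_inverse mult_ac)
  qed (use n in simp)
qed

text \<open>The difference of the two sides without \<open>y\<^sup>2\<close> is the square of
  \<open>2 sinh (y / 2)\<close>, and \<open>sinh t \<ge> t\<close> for \<open>t \<ge> 0\<close>
  follows from the quadratic Taylor polynomial of \<open>exp\<close>.\<close>

lemma exp_plus_exp_minus_ge: "2 + y\<^sup>2 \<le> exp y + exp (- y)" for y :: real
proof -
  have pos: "2 * t \<le> exp t - exp (- t)" if t: "0 \<le> t" for t :: real
  proof -
    define q where "q = 1 + t + t\<^sup>2 / 2"
    have q: "1 \<le> q" using t by (simp add: q_def)
    have e: "q \<le> exp t" unfolding q_def by (rule exp_lower_Taylor_quadratic[OF t])
    have "(1 + t\<^sup>2 / 2)\<^sup>2 = 1 + t\<^sup>2 + (t\<^sup>2 / 2)\<^sup>2" by (simp add: power2_eq_square field_simps)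
    then have "1 + t\<^sup>2 \<le> (1 + t\<^sup>2 / 2)\<^sup>2" by simp
    then have "2 * t * q \<le> q * q - 1" by (simp add: q_def power2_eq_square algebra_simps)
    then have "2 * t \<le> q - 1 / q" using q by (simp add: field_simps)
    also have "1 / exp t \<le> 1 / q" using e q by (intro divide_left_mono) auto
    then have "q - 1 / q \<le> exp t - 1 / exp t" using e by linarith
    finally show ?thesis by (simp add: exp_minus divide_inverse)
  qed
  have "\<bar>y\<bar> \<le> exp (\<bar>y\<bar> / 2) - exp (- (\<bar>y\<bar> / 2))" using pos[of "\<bar>y\<bar> / 2"] by simp
  then have "\<bar>y\<bar>\<^sup>2 \<le> (exp (\<bar>y\<bar> / 2) - exp (- (\<bar>y\<bar> / 2)))\<^sup>2" by (intro power_mono) auto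
  also have "\<dots> = exp \<bar>y\<bar> + exp (- \<bar>y\<bar>) - 2"
    by (simp add: power2_eq_square algebra_simps exp_add[symmetric])
  also have "exp \<bar>y\<bar> + exp (- \<bar>y\<bar>) = exp y + exp (- y)" by (cases "0 \<le> y") auto
  finally show ?thesis by simp
qed

text \<open>Differentiation under the integral is avoided. Shifting the Gaussian by
  \<open>h a\<close> and by \<open>- h a\<close> keeps its mass \<open>Z\<close>, while the sum of
  the two shifts contains the factor \<open>2 cosh (2 h (a \<bullet> z))\<close>, at least
  \<open>2 + 4 h^2 (a \<bullet> z)^2\<close>. With \<open>y = h^2\<close>, dividing by
  \<open>y\<close> and letting it tend to 0 isolates the second moment.\<close>

lemma gaussian_second_moment_le:
  fixes a :: "'b::euclidean_space"
  assumes Z: "(\<integral>\<^sup>+z. ennreal (exp (- (norm z)\<^sup>2)) \<partial>(lborel :: 'b measure)) = ennreal Z" "0 \<le> Z"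
  shows "(\<integral>\<^sup>+z. ennreal ((a \<bullet> z)\<^sup>2 * exp (- (norm z)\<^sup>2)) \<partial>lborel) \<le> ennreal ((norm a)\<^sup>2 / 2 * Z)"
proof -
  let ?Q = "\<integral>\<^sup>+z. ennreal ((a \<bullet> z)\<^sup>2 * exp (- (norm z)\<^sup>2)) \<partial>lborel"
  let ?A = "(norm a)\<^sup>2"
  have key: "ennreal (2 * y) * ?Q \<le> ennreal ((exp (y * ?A) - 1) * Z)" if y: "0 < y" for y
  proof -
    define h where "h = sqrt y"
    have h: "0 < h" "h\<^sup>2 = y" using y by (auto simp: h_def)
    let ?E = "\<lambda>c z. ennreal (exp (- (norm (z + c *\<^sub>R a))\<^sup>2))"
    have tr: "(\<integral>\<^sup>+z. ?E c z \<partial>lborel) = ennreal Z" for c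
      using nn_integral_translate[of "\<lambda>z::'b. ennreal (exp (- (norm z)\<^sup>2))" "c *\<^sub>R a"] Z by simp
    have pt: "ennreal (exp (- (y * ?A))) * (2 * ennreal (exp (- (norm z)\<^sup>2)) + ennreal (4 * y) * ennreal ((a \<bullet> z)\<^sup>2 * exp (- (norm z)\<^sup>2)))
       \<le> ?E h z + ?E (- h) z" for z
    proof -
      have n1: "(norm (z + c *\<^sub>R a))\<^sup>2 = (norm z)\<^sup>2 + 2 * c * (a \<bullet> z) + c\<^sup>2 * ?A" for c
        unfolding power2_norm_eq_inner by (simp add: inner_add_left inner_add_right inner_commute power2_eq_square algebra_simps)
      have "exp (- (norm (z + h *\<^sub>R a))\<^sup>2) + exp (- (norm (z + (- h) *\<^sub>R a))\<^sup>2)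
          = exp (- (y * ?A)) * exp (- (norm z)\<^sup>2) * (exp (2 * h * (a \<bullet> z)) + exp (- (2 * h * (a \<bullet> z))))"
        unfolding n1 by (simp add: h distrib_left exp_add[symmetric] algebra_simps)
      moreover have "exp (- (y * ?A)) * exp (- (norm z)\<^sup>2) * (2 + (2 * h * (a \<bullet> z))\<^sup>2)
         \<le> exp (- (y * ?A)) * exp (- (norm z)\<^sup>2) * (exp (2 * h * (a \<bullet> z)) + exp (- (2 * h * (a \<bullet> z))))"
        by (intro mult_left_mono exp_plus_exp_minus_ge) auto
      moreover have "exp (- (y * ?A)) * exp (- (norm z)\<^sup>2) * (2 + (2 * h * (a \<bullet> z))\<^sup>2)
         = exp (- (y * ?A)) * (2 * exp (- (norm z)\<^sup>2) + 4 * y * ((a \<bullet> z)\<^sup>2 * exp (- (norm z)\<^sup>2)))"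
        by (simp add: power_mult_distrib h algebra_simps)
      ultimately have le: "exp (- (y * ?A)) * (2 * exp (- (norm z)\<^sup>2) + 4 * y * ((a \<bullet> z)\<^sup>2 * exp (- (norm z)\<^sup>2)))
         \<le> exp (- (norm (z + h *\<^sub>R a))\<^sup>2) + exp (- (norm (z + (- h) *\<^sub>R a))\<^sup>2)" by linarith
      have "ennreal (exp (- (y * ?A))) * (2 * ennreal (exp (- (norm z)\<^sup>2)) + ennreal (4 * y) * ennreal ((a \<bullet> z)\<^sup>2 * exp (- (norm z)\<^sup>2)))
        = ennreal (exp (- (y * ?A)) * (2 * exp (- (norm z)\<^sup>2) + 4 * y * ((a \<bullet> z)\<^sup>2 * exp (- (norm z)\<^sup>2))))"
        using y by (simp add: ennreal_mult[symmetric] ennreal_plus[symmetric] ennreal_numeral[symmetric] del: ennreal_plus ennreal_numeral)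
      also have "\<dots> \<le> ?E h z + ?E (- h) z"
        using ennreal_leI[OF le] by simp
      finally show ?thesis .
    qed
    have "ennreal (exp (- (y * ?A))) * (2 * ennreal Z + ennreal (4 * y) * ?Q)
       = (\<integral>\<^sup>+z. ennreal (exp (- (y * ?A))) * (2 * ennreal (exp (- (norm z)\<^sup>2)) + ennreal (4 * y) * ennreal ((a \<bullet> z)\<^sup>2 * exp (- (norm z)\<^sup>2))) \<partial>lborel)"
      by (subst nn_integral_cmult, measurable, subst nn_integral_add, measurable, subst nn_integral_cmult, measurable, subst nn_integral_cmult, measurable)
        (simp only: Z)
    also have "\<dots> \<le> (\<integral>\<^sup>+z. ?E h z + ?E (- h) z \<partial>lborel)"
      by (intro nn_integral_mono pt)
    also have "\<dots> = 2 * ennreal Z"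
      by (subst nn_integral_add) (simp_all only: tr mult_2 measurable_lborel1, measurable)
    finally have fin: "ennreal (exp (- (y * ?A))) * (2 * ennreal Z + ennreal (4 * y) * ?Q) \<le> 2 * ennreal Z" .
    \<comment> \<open>Finiteness comes first; only then can the inequality be read in the
      reals.\<close>
    have "?Q < \<infinity>"
    proof (rule ccontr)
      assume "\<not> ?Q < \<infinity>"
      then have "?Q = \<infinity>" by (metis infinity_ennreal_def top.not_eq_extremum)
      then have "ennreal (exp (- (y * ?A))) * (2 * ennreal Z + ennreal (4 * y) * ?Q) = \<infinity>"
        using y by (simp add: ennreal_mult_eq_top_iff ennreal_mult_top)
      then have "2 * ennreal Z = \<infinity>" using fin by (simp add: top_unique)
      then show False by (simp add: ennreal_mult_eq_top_iff)
    qed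
    then obtain Q where Q: "?Q = ennreal Q" "0 \<le> Q" by (cases ?Q) auto
    have "exp (- (y * ?A)) * (2 * Z + 4 * y * Q) \<le> 2 * Z"
      using fin y Q Z(2) by (simp add: Q(1) ennreal_mult[symmetric] ennreal_plus[symmetric] ennreal_numeral[symmetric] del: ennreal_plus ennreal_numeral)
    then have "exp (y * ?A) * (exp (- (y * ?A)) * (2 * Z + 4 * y * Q)) \<le> exp (y * ?A) * (2 * Z)"
      by (intro mult_left_mono) auto
    then have "2 * Z + 4 * y * Q \<le> exp (y * ?A) * (2 * Z)"
      by (simp add: mult.assoc[symmetric] exp_minus)
    then have "2 * y * Q \<le> (exp (y * ?A) - 1) * Z" by (simp add: algebra_simps)
    then show ?thesis using y Q by (simp add: Q(1) ennreal_mult[symmetric] ennreal_leI)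
  qed
  have "?Q < \<infinity>"
    using key[of 1] by (cases ?Q) (auto simp: ennreal_mult_top top_unique)
  then obtain Q where Q: "?Q = ennreal Q" "0 \<le> Q" by (cases ?Q) auto
  have "Q \<le> (exp (y * ?A) - 1) / y * (Z / 2)" if y: "0 < y" for y
  proof -
    have "1 \<le> exp (y * ?A)" using y by simp
    then have "2 * y * Q \<le> (exp (y * ?A) - 1) * Z"
      using key[OF y] y Q Z(2) by (simp add: Q(1) ennreal_mult[symmetric])
    then show ?thesis using y by (simp add: field_simps)
  qed
  moreover have "((\<lambda>y. (exp (y * ?A) - 1) / y * (Z / 2)) \<longlongrightarrow> ?A * (Z / 2)) (at_right 0)"
  proof (intro tendsto_intros)
    have "((\<lambda>y. exp (y * ?A)) has_real_derivative ?A) (at 0)" by (auto intro!: derivative_eq_intros)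
    then show "((\<lambda>y. (exp (y * ?A) - 1) / y) \<longlongrightarrow> ?A) (at_right 0)"
      unfolding DERIV_def by (auto intro: tendsto_mono[OF at_le])
  qed
  ultimately have "Q \<le> ?A * (Z / 2)"
    by (intro tendsto_lowerbound[where F="at_right 0" and f="\<lambda>y. (exp (y * ?A) - 1) / y * (Z / 2)"])
      (auto intro: eventually_mono[OF eventually_at_right_less[of 0]])
  then show ?thesis unfolding Q(1) by (intro ennreal_leI) simp
qed

section \<open>Shears, rotations and increments along a path\<close>

lemma nn_integral_shear:
  fixes \<Psi> :: "'b::euclidean_space \<times> 'b \<Rightarrow> ennreal"
  assumes [measurable]: "\<Psi> \<in> borel_measurable borel"
  shows "(\<integral>\<^sup>+p. \<Psi> (fst p + t *\<^sub>R snd p, snd p) \<partial>lborel) = (\<integral>\<^sup>+p. \<Psi> p \<partial>lborel)"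
    "(\<integral>\<^sup>+p. \<Psi> (fst p, snd p + t *\<^sub>R fst p) \<partial>lborel) = (\<integral>\<^sup>+p. \<Psi> p \<partial>lborel)"
    "(\<lambda>p. \<Psi> (fst p + t *\<^sub>R snd p, snd p)) \<in> borel_measurable borel"
    "(\<lambda>p. \<Psi> (fst p, snd p + t *\<^sub>R fst p)) \<in> borel_measurable borel"
proof -
  have "(\<lambda>p::'b \<times> 'b. (fst p + t *\<^sub>R snd p, snd p)) \<in> borel_measurable borel"
    "(\<lambda>p::'b \<times> 'b. (fst p, snd p + t *\<^sub>R fst p)) \<in> borel_measurable borel"
    by (intro borel_measurable_continuous_onI continuous_intros)+
  from this[THEN measurable_compose, OF assms]
  show m: "(\<lambda>p. \<Psi> (fst p + t *\<^sub>R snd p, snd p)) \<in> borel_measurable borel"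
    "(\<lambda>p. \<Psi> (fst p, snd p + t *\<^sub>R fst p)) \<in> borel_measurable borel" .
  have s1: "(\<lambda>x. \<Psi> (x, y)) \<in> borel_measurable borel" for y
    by (rule measurable_compose[OF borel_measurable_continuous_onI assms]) (intro continuous_intros)
  have s2: "(\<lambda>y. \<Psi> (x, y)) \<in> borel_measurable borel" for x
    by (rule measurable_compose[OF borel_measurable_continuous_onI assms]) (intro continuous_intros)
  show "(\<integral>\<^sup>+p. \<Psi> (fst p + t *\<^sub>R snd p, snd p) \<partial>lborel) = (\<integral>\<^sup>+p. \<Psi> p \<partial>lborel)"
    unfolding nn_integral_lborel_pair(2)[OF m(1)] nn_integral_lborel_pair(2)[OF assms]
    using nn_integral_translate[OF s1] by simp
  show "(\<integral>\<^sup>+p. \<Psi> (fst p, snd p + t *\<^sub>R fst p) \<partial>lborel) = (\<integral>\<^sup>+p. \<Psi> p \<partial>lborel)"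
    unfolding nn_integral_lborel_pair(1)[OF m(2)] nn_integral_lborel_pair(1)[OF assms]
    using nn_integral_translate[OF s2] by simp
qed

text \<open>A rotation is a product of three shears.\<close>

lemma nn_integral_rotation:
  fixes \<Psi> :: "'b::euclidean_space \<times> 'b \<Rightarrow> ennreal"
  assumes m: "\<Psi> \<in> borel_measurable borel" and cs: "c\<^sup>2 + s\<^sup>2 = 1" "0 \<le> c"
  shows "(\<integral>\<^sup>+p. \<Psi> (c *\<^sub>R fst p + s *\<^sub>R snd p, c *\<^sub>R snd p - s *\<^sub>R fst p) \<partial>lborel) = (\<integral>\<^sup>+p. \<Psi> p \<partial>lborel)"
proof -
  \<comment> \<open>The tangent of half the angle. The shears are by \<open>t\<close>,
    \<open>- s\<close> and \<open>t\<close>; the condition \<open>0 \<le> c\<close> keeps the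
    denominator positive.\<close>
  define t where "t = s / (1 + c)"
  have ts: "1 - t * s = c"
  proof -
    have "s * s = (1 - c) * (1 + c)" using cs by (simp add: power2_eq_square algebra_simps)
    then have "t * s = 1 - c" using cs(2) by (simp add: t_def)
    then show ?thesis by simp
  qed
  have "t * (1 + c) = s" using cs(2) by (simp add: t_def)
  then have tc: "t + t * c = s" by (simp add: algebra_simps)
  let ?\<Psi>1 = "\<lambda>p. \<Psi> (fst p + t *\<^sub>R snd p, snd p)"
  note m1 = nn_integral_shear(3)[OF m, of t]
  let ?\<Psi>2 = "\<lambda>p. ?\<Psi>1 (fst p, snd p + (- s) *\<^sub>R fst p)"
  note m2 = nn_integral_shear(4)[OF m1, of "- s"]
  have "(\<integral>\<^sup>+p. ?\<Psi>2 (fst p + t *\<^sub>R snd p, snd p) \<partial>lborel) = (\<integral>\<^sup>+p. \<Psi> p \<partial>lborel)"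
    using nn_integral_shear(1)[OF m2, of t] nn_integral_shear(2)[OF m1, of "- s"] nn_integral_shear(1)[OF m, of t] by simp
  moreover have "?\<Psi>2 (fst p + t *\<^sub>R snd p, snd p) = \<Psi> (c *\<^sub>R fst p + s *\<^sub>R snd p, c *\<^sub>R snd p - s *\<^sub>R fst p)" for p
  proof -
    obtain x y where p: "p = (x, y)" by (cases p)
    have "y - s *\<^sub>R (x + t *\<^sub>R y) = (1 - t * s) *\<^sub>R y - s *\<^sub>R x" by (simp add: algebra_simps)
    then have 1: "y - s *\<^sub>R (x + t *\<^sub>R y) = c *\<^sub>R y - s *\<^sub>R x" unfolding ts .
    have "x + t *\<^sub>R y + t *\<^sub>R (c *\<^sub>R y - s *\<^sub>R x) = (1 - t * s) *\<^sub>R x + (t + t * c) *\<^sub>R y" by (simp add: algebra_simps)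
    then have 2: "x + t *\<^sub>R y + t *\<^sub>R (c *\<^sub>R y - s *\<^sub>R x) = c *\<^sub>R x + s *\<^sub>R y" unfolding ts tc .
    show ?thesis unfolding p using 1 2 by simp
  qed
  ultimately show ?thesis by simp
qed

text \<open>Cauchy-Schwarz on the interval, obtained from the nonnegative integral of
  \<open>(f' x - m)\<^sup>2\<close> with \<open>m\<close> the mean slope.\<close>

lemma square_increment_le:
  fixes f f' :: "real \<Rightarrow> real"
  assumes ab: "a < b" and d: "\<And>x. (f has_real_derivative f' x) (at x)" and c: "continuous_on UNIV f'"
  shows "ennreal ((f b - f a)\<^sup>2) \<le> ennreal (b - a) * (\<integral>\<^sup>+x\<in>{a..b}. ennreal ((f' x)\<^sup>2) \<partial>lborel)"
proof -
  have cc: "isCont f' x" for x using c by (simp add: continuous_on_eq_continuous_at)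
  define m where "m = (f b - f a) / (b - a)"
  have i: "integrable lborel (\<lambda>x. f' x * indicator {a..b} x)" "integrable lborel (\<lambda>x. (f' x)\<^sup>2 * indicator {a..b} x)"
    "integrable lborel (\<lambda>x. m\<^sup>2 * indicator {a..b} x)"
    by (rule borel_integrable_atLeastAtMost; use cc in \<open>auto intro!: continuous_intros\<close>)+
  have f: "(\<integral>x. f' x * indicator {a..b} x \<partial>lborel) = f b - f a"
    by (rule integral_FTC_Icc_real) (use ab d cc in auto)
  have "0 \<le> (\<integral>x. (f' x - m)\<^sup>2 * indicator {a..b} x \<partial>lborel)" by simp
  also have "\<dots> = (\<integral>x. (f' x)\<^sup>2 * indicator {a..b} x - 2 * m * (f' x * indicator {a..b} x) + m\<^sup>2 * indicator {a..b} x \<partial>lborel)"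
    by (intro Bochner_Integration.integral_cong refl) (auto simp: indicator_def power2_eq_square algebra_simps)
  also have "\<dots> = (\<integral>x. (f' x)\<^sup>2 * indicator {a..b} x \<partial>lborel) - 2 * m * (\<integral>x. f' x * indicator {a..b} x \<partial>lborel) + (\<integral>x. m\<^sup>2 * indicator {a..b} x \<partial>lborel)"
    using i by (simp add: Bochner_Integration.integral_add Bochner_Integration.integral_diff del: integral_mult_right_zero)
       (simp add: integral_mult_right_zero)?
  also have "(\<integral>x. m\<^sup>2 * indicator {a..b} x \<partial>lborel) = m\<^sup>2 * (b - a)" using ab by simp
  finally have "2 * m * (f b - f a) - m\<^sup>2 * (b - a) \<le> (\<integral>x. (f' x)\<^sup>2 * indicator {a..b} x \<partial>lborel)" unfolding f by simp
  moreover have "2 * m * (f b - f a) - m\<^sup>2 * (b - a) = (f b - f a)\<^sup>2 / (b - a)"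
  proof -
    have key: "2 * (d / w) * d - (d / w)\<^sup>2 * w = d\<^sup>2 / w" if "0 < w" for d w :: real
      using that by (simp add: power2_eq_square)
    show ?thesis unfolding m_def by (rule key) (use ab in simp)
  qed
  ultimately have "(f b - f a)\<^sup>2 \<le> (b - a) * (\<integral>x. (f' x)\<^sup>2 * indicator {a..b} x \<partial>lborel)"
    using ab by (simp add: divide_le_eq mult.commute)
  then have "ennreal ((f b - f a)\<^sup>2) \<le> ennreal (b - a) * ennreal (\<integral>x. (f' x)\<^sup>2 * indicator {a..b} x \<partial>lborel)"
    using ab by (subst ennreal_mult[symmetric]) (auto intro: ennreal_leI)
  also have "ennreal (\<integral>x. (f' x)\<^sup>2 * indicator {a..b} x \<partial>lborel) = (\<integral>\<^sup>+x. ennreal ((f' x)\<^sup>2 * indicator {a..b} x) \<partial>lborel)"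
    by (rule nn_integral_eq_integral[symmetric, OF i(2)]) auto
  also have "\<dots> = (\<integral>\<^sup>+x\<in>{a..b}. ennreal ((f' x)\<^sup>2) \<partial>lborel)"
    by (intro nn_integral_cong) (auto simp: indicator_def)
  finally show ?thesis .
qed

text \<open>Maurey and Pisier: rotate an independent pair of Gaussian vectors into each other.\<close>

lemma gaussian_increment_le_gradient:
  fixes g :: "'b::euclidean_space \<Rightarrow> real"
  assumes g: "C1_grad g Dg"
    and Z: "(\<integral>\<^sup>+z. ennreal (exp (- (norm z)\<^sup>2)) \<partial>(lborel :: 'b measure)) = ennreal Z" "0 \<le> Z"
  shows "(\<integral>\<^sup>+p. ennreal ((g (snd p) - g (fst p))\<^sup>2 * (exp (- (norm (fst p))\<^sup>2) * exp (- (norm (snd p))\<^sup>2))) \<partial>lborel)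
    \<le> ennreal (pi\<^sup>2 / 8 * Z) * (\<integral>\<^sup>+z. ennreal ((norm (Dg z))\<^sup>2 * exp (- (norm z)\<^sup>2)) \<partial>lborel)"
proof -
  let ?G = "\<lambda>z::'b. exp (- (norm z)\<^sup>2)"
  let ?GG = "\<lambda>p. ?G (fst p) * ?G (snd p)"
  define H where "H = (\<lambda>p. (Dg (fst p) \<bullet> snd p)\<^sup>2 * ?GG p)"
  \<comment> \<open>The first component runs from \<open>fst p\<close> at angle 0 to
    \<open>snd p\<close> at angle \<open>pi/2\<close>, and its derivative in the angle is the second
    component.\<close>
  define R where "R = (\<lambda>\<theta> p. (cos \<theta> *\<^sub>R fst p + sin \<theta> *\<^sub>R snd p, cos \<theta> *\<^sub>R snd p - sin \<theta> *\<^sub>R fst p :: 'b))"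
  have cDg: "continuous_on UNIV Dg" by (rule C1_gradD(2)[OF g])
  have Hc: "continuous_on UNIV H"
    unfolding H_def by (intro continuous_intros continuous_on_compose2[OF cDg]) auto
  have Hm: "(\<lambda>p. ennreal (H p)) \<in> borel_measurable borel"
    by (intro measurable_compose[OF borel_measurable_continuous_onI[OF Hc]]) simp
  have HRc: "continuous_on UNIV (\<lambda>q. H (R (snd q) (fst q)))"
    unfolding R_def by (intro continuous_on_compose2[OF Hc] continuous_intros) auto
  have pt: "ennreal ((g (snd p) - g (fst p))\<^sup>2 * ?GG p) \<le> ennreal (pi / 2) * (\<integral>\<^sup>+\<theta>. ennreal (H (R \<theta> p)) * indicator {0..pi/2} \<theta> \<partial>lborel)" for p
  proof -
    let ?z = "\<lambda>\<theta>. fst (R \<theta> p)" and ?w = "\<lambda>\<theta>. snd (R \<theta> p)"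
    have dz: "(?z has_vector_derivative ?w \<theta>) (at \<theta>)" for \<theta>
      unfolding R_def fst_conv snd_conv by (auto intro!: derivative_eq_intros)
    have dg: "((\<lambda>\<theta>. g (?z \<theta>)) has_real_derivative (Dg (?z \<theta>) \<bullet> ?w \<theta>)) (at \<theta>)" for \<theta>
      using has_derivative_compose[OF dz[unfolded has_vector_derivative_def] C1_gradD(1)[OF g], of \<theta>]
      by (simp add: has_field_derivative_def mult_commute_abs)
    have zw: "continuous_on UNIV ?z" "continuous_on UNIV ?w"
      unfolding R_def fst_conv snd_conv by (intro continuous_intros)+
    have "continuous_on UNIV (\<lambda>\<theta>. Dg (?z \<theta>) \<bullet> ?w \<theta>)"
      by (intro continuous_intros continuous_on_compose2[OF cDg] zw) auto
    from square_increment_le[OF _ dg this, of 0 "pi / 2"]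
    have 1: "ennreal ((g (snd p) - g (fst p))\<^sup>2) \<le> ennreal (pi / 2) * (\<integral>\<^sup>+\<theta>\<in>{0..pi/2}. ennreal ((Dg (?z \<theta>) \<bullet> ?w \<theta>)\<^sup>2) \<partial>lborel)"
      by (simp add: R_def)
    \<comment> \<open>The Gaussian weight of the pair is constant along the rotation, so it can be
      moved under the integral over the angle.\<close>
    have nn: "?GG (R \<theta> p) = ?GG p" for \<theta>
    proof -
      have "(norm (fst (R \<theta> p)))\<^sup>2 + (norm (snd (R \<theta> p)))\<^sup>2 
          = (sin \<theta>)\<^sup>2 * ((norm (fst p))\<^sup>2 + (norm (snd p))\<^sup>2) + (cos \<theta>)\<^sup>2 * ((norm (fst p))\<^sup>2 + (norm (snd p))\<^sup>2)"
        unfolding power2_norm_eq_inner R_def fst_conv snd_conv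
        by (simp add: inner_add_left inner_add_right inner_diff_left inner_diff_right inner_commute power2_eq_square algebra_simps)
      also have "\<dots> = (norm (fst p))\<^sup>2 + (norm (snd p))\<^sup>2"
        by (simp only: distrib_right[symmetric] sin_cos_squared_add mult_1)
      finally have "- (norm (fst (R \<theta> p)))\<^sup>2 + - (norm (snd (R \<theta> p)))\<^sup>2 = - (norm (fst p))\<^sup>2 + - (norm (snd p))\<^sup>2" by simp
      then show ?thesis by (simp only: exp_add[symmetric])
    qed
    have "ennreal ((g (snd p) - g (fst p))\<^sup>2 * ?GG p) = ennreal ((g (snd p) - g (fst p))\<^sup>2) * ennreal (?GG p)"
      by (rule ennreal_mult) auto
    also have "\<dots> \<le> (ennreal (pi / 2) * (\<integral>\<^sup>+\<theta>\<in>{0..pi/2}. ennreal ((Dg (?z \<theta>) \<bullet> ?w \<theta>)\<^sup>2) \<partial>lborel)) * ennreal (?GG p)"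
      by (rule mult_right_mono[OF 1]) simp
    also have "\<dots> = ennreal (pi / 2) * (\<integral>\<^sup>+\<theta>. (ennreal ((Dg (?z \<theta>) \<bullet> ?w \<theta>)\<^sup>2) * indicator {0..pi/2} \<theta>) * ennreal (?GG p) \<partial>lborel)"
    proof -
      have "(\<lambda>\<theta>. Dg (?z \<theta>) \<bullet> ?w \<theta>) \<in> borel_measurable borel"
        by (intro borel_measurable_continuous_onI) fact
      then show ?thesis by (subst nn_integral_multc) (auto simp: mult.assoc)
    qed
    also have "(\<integral>\<^sup>+\<theta>. (ennreal ((Dg (?z \<theta>) \<bullet> ?w \<theta>)\<^sup>2) * indicator {0..pi/2} \<theta>) * ennreal (?GG p) \<partial>lborel)
       = (\<integral>\<^sup>+\<theta>. ennreal (H (R \<theta> p)) * indicator {0..pi/2} \<theta> \<partial>lborel)"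
    proof (rule nn_integral_cong)
      fix \<theta>
      have "ennreal (H (R \<theta> p)) = ennreal ((Dg (?z \<theta>) \<bullet> ?w \<theta>)\<^sup>2) * ennreal (?GG p)"
        unfolding H_def nn by (rule ennreal_mult) auto
      then show "(ennreal ((Dg (?z \<theta>) \<bullet> ?w \<theta>)\<^sup>2) * indicator {0..pi/2} \<theta>) * ennreal (?GG p) = ennreal (H (R \<theta> p)) * indicator {0..pi/2} \<theta>"
        by (simp only: mult_ac)
    qed
    finally show ?thesis .
  qed
  have HRm: "(\<lambda>q. ennreal (H (R (snd q) (fst q))) * indicator {0..pi/2} (snd q)) \<in> borel_measurable (borel :: (('b \<times> 'b) \<times> real) measure)"
  proof (intro borel_measurable_times_ennreal)
    show "(\<lambda>q. ennreal (H (R (snd q) (fst q)))) \<in> borel_measurable (borel :: (('b \<times> 'b) \<times> real) measure)"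
      by (intro measurable_compose[OF borel_measurable_continuous_onI[OF HRc]]) simp
    have "(snd :: ('b \<times> 'b) \<times> real \<Rightarrow> real) \<in> borel_measurable borel" by (intro borel_measurable_continuous_onI continuous_intros)
    then show "(\<lambda>q. indicator {0..pi/2} (snd q) :: ennreal) \<in> borel_measurable (borel :: (('b \<times> 'b) \<times> real) measure)"
      by measurable
  qed
  have "(\<integral>\<^sup>+p. ennreal ((g (snd p) - g (fst p))\<^sup>2 * ?GG p) \<partial>lborel)
     \<le> (\<integral>\<^sup>+p. ennreal (pi / 2) * (\<integral>\<^sup>+\<theta>. ennreal (H (R \<theta> p)) * indicator {0..pi/2} \<theta> \<partial>lborel) \<partial>lborel)"
    by (intro nn_integral_mono pt)
  also have "\<dots> = ennreal (pi / 2) * (\<integral>\<^sup>+p. (\<integral>\<^sup>+\<theta>. ennreal (H (R \<theta> p)) * indicator {0..pi/2} \<theta> \<partial>lborel) \<partial>lborel)"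
  proof (rule nn_integral_cmult)
    have "(\<lambda>q. ennreal (H (R (snd q) (fst q))) * indicator {0..pi/2} (snd q)) \<in> borel_measurable (lborel \<Otimes>\<^sub>M lborel)"
      using HRm by (simp add: lborel_prod)
    from lborel.borel_measurable_nn_integral_fst[OF this]
    show "(\<lambda>p. \<integral>\<^sup>+\<theta>. ennreal (H (R \<theta> p)) * indicator {0..pi/2} \<theta> \<partial>lborel) \<in> borel_measurable lborel" by simp
  qed
  also have "(\<integral>\<^sup>+p. (\<integral>\<^sup>+\<theta>. ennreal (H (R \<theta> p)) * indicator {0..pi/2} \<theta> \<partial>lborel) \<partial>lborel)
     = (\<integral>\<^sup>+\<theta>. (\<integral>\<^sup>+p. ennreal (H (R \<theta> p)) * indicator {0..pi/2} \<theta> \<partial>lborel) \<partial>lborel)"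
    using nn_integral_lborel_pair[OF HRm] by simp
  also have "\<dots> = (\<integral>\<^sup>+\<theta>. (\<integral>\<^sup>+p. ennreal (H p) \<partial>lborel) * indicator {0..pi/2} \<theta> \<partial>lborel)"
  proof (rule nn_integral_cong)
    fix \<theta> :: real
    show "(\<integral>\<^sup>+p. ennreal (H (R \<theta> p)) * indicator {0..pi/2} \<theta> \<partial>lborel) = (\<integral>\<^sup>+p. ennreal (H p) \<partial>lborel) * indicator {0..pi/2} \<theta>"
    proof (cases "\<theta> \<in> {0..pi/2}")
      case True
      then have "0 \<le> cos \<theta>" by (intro cos_ge_zero) auto
      moreover have "(cos \<theta>)\<^sup>2 + (sin \<theta>)\<^sup>2 = 1" by simp
      ultimately have "(\<integral>\<^sup>+p. ennreal (H (R \<theta> p)) \<partial>lborel) = (\<integral>\<^sup>+p. ennreal (H p) \<partial>lborel)"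
        unfolding R_def by (intro nn_integral_rotation[OF Hm])
      then show ?thesis using True by simp
    qed simp
  qed
  also have "\<dots> = (\<integral>\<^sup>+p. ennreal (H p) \<partial>lborel) * ennreal (pi / 2)"
    by (subst nn_integral_cmult_indicator) auto
  \<comment> \<open>For a fixed first vector the second one is an independent Gaussian, whose second
    moment in direction \<open>Dg z\<close> gives \<open>|Dg z|^2 / 2\<close>. With one
    \<open>pi / 2\<close> from Cauchy-Schwarz and one from the range of the angle, the constant is
    \<open>pi\<^sup>2 / 8\<close>.\<close>
  also have "ennreal (pi / 2) * ((\<integral>\<^sup>+p. ennreal (H p) \<partial>lborel) * ennreal (pi / 2))
    \<le> ennreal (pi / 2) * (ennreal (Z / 2) * (\<integral>\<^sup>+z. ennreal ((norm (Dg z))\<^sup>2 * ?G z) \<partial>lborel) * ennreal (pi / 2))"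
  proof (intro mult_left_mono mult_right_mono)
    have "(\<integral>\<^sup>+p. ennreal (H p) \<partial>lborel) = (\<integral>\<^sup>+z. \<integral>\<^sup>+z'. ennreal (H (z, z')) \<partial>lborel \<partial>lborel)"
      by (rule nn_integral_lborel_pair(1)[OF Hm])
    also have "\<dots> \<le> (\<integral>\<^sup>+z. ennreal (Z / 2) * ennreal ((norm (Dg z))\<^sup>2 * ?G z) \<partial>lborel)"
    proof (rule nn_integral_mono)
      fix z
      have "(\<integral>\<^sup>+z'. ennreal (H (z, z')) \<partial>lborel) = (\<integral>\<^sup>+z'. ennreal (?G z) * ennreal ((Dg z \<bullet> z')\<^sup>2 * ?G z') \<partial>lborel)"
        by (intro nn_integral_cong) (simp add: H_def ennreal_mult[symmetric] mult_ac)
      also have "\<dots> = ennreal (?G z) * (\<integral>\<^sup>+z'. ennreal ((Dg z \<bullet> z')\<^sup>2 * ?G z') \<partial>lborel)"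
        by (rule nn_integral_cmult) measurable
      also have "\<dots> \<le> ennreal (?G z) * ennreal ((norm (Dg z))\<^sup>2 / 2 * Z)"
        by (intro mult_left_mono gaussian_second_moment_le[OF Z]) simp
      also have "\<dots> = ennreal (Z / 2) * ennreal ((norm (Dg z))\<^sup>2 * ?G z)"
        using Z(2) by (simp add: ennreal_mult[symmetric] mult_ac)
      finally show "(\<integral>\<^sup>+z'. ennreal (H (z, z')) \<partial>lborel) \<le> ennreal (Z / 2) * ennreal ((norm (Dg z))\<^sup>2 * ?G z)" .
    qed
    also have "\<dots> = ennreal (Z / 2) * (\<integral>\<^sup>+z. ennreal ((norm (Dg z))\<^sup>2 * ?G z) \<partial>lborel)"
    proof (rule nn_integral_cmult)
      have [measurable]: "Dg \<in> borel_measurable borel" by (rule borel_measurable_continuous_onI[OF cDg])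
      show "(\<lambda>z. ennreal ((norm (Dg z))\<^sup>2 * ?G z)) \<in> borel_measurable lborel" by measurable
    qed
    finally show "(\<integral>\<^sup>+p. ennreal (H p) \<partial>lborel) \<le> ennreal (Z / 2) * (\<integral>\<^sup>+z. ennreal ((norm (Dg z))\<^sup>2 * ?G z) \<partial>lborel)" .
  qed simp_all
  also have "\<dots> = (ennreal (pi / 2) * ennreal (Z / 2) * ennreal (pi / 2)) * (\<integral>\<^sup>+z. ennreal ((norm (Dg z))\<^sup>2 * ?G z) \<partial>lborel)"
    by (simp only: mult_ac)
  also have "ennreal (pi / 2) * ennreal (Z / 2) * ennreal (pi / 2) = ennreal (pi\<^sup>2 / 8 * Z)"
    using Z(2) by (simp add: ennreal_mult[symmetric] power2_eq_square mult_ac)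
  finally show ?thesis .
qed

section \<open>The unit ball as a projection of a Gaussian\<close>

lemma emeasure_cball_eq_ball_integral:
  fixes \<phi> :: "'a::euclidean_space \<Rightarrow> ennreal"
  shows "(\<integral>\<^sup>+y\<in>cball 0 1. \<phi> y \<partial>lborel) = (\<integral>\<^sup>+y\<in>ball 0 1. \<phi> y \<partial>lborel)"
proof (rule nn_integral_cong_AE)
  have "AE y in lborel. norm (y::'a) \<notin> {1}" by (rule AE_norm_notin_finite) simp
  then show "AE y in lborel. \<phi> y * indicator (cball 0 1) y = \<phi> y * indicator (ball 0 1) y"
    by eventually_elim (auto simp: indicator_def)
qed

text \<open>The case \<open>e = 0\<close>: the constraint on \<open>y\<close> becomes the closed
  unit ball for every \<open>\<tau>\<close>, and the radial integral factors off as a value of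
  Gamma.\<close>

lemma nn_integral_gaussian_projection:
  fixes \<phi> :: "'a::euclidean_space \<Rightarrow> ennreal"
  assumes m: "\<phi> \<in> borel_measurable borel"
  shows "(\<integral>\<^sup>+z. \<phi> ((1 / norm z) *\<^sub>R fst z) * ennreal (exp (- (norm z)\<^sup>2)) \<partial>(lborel :: ('a \<times> real \<times> real) measure))
    = ennreal (pi * Gamma (real DIM('a) / 2 + 1)) * (\<integral>\<^sup>+y\<in>ball 0 1. \<phi> y \<partial>lborel)"
proof -
  have Fm: "(\<lambda>\<tau>::real. ennreal (exp (- \<tau>))) \<in> borel_measurable borel" by measurable
  have I: "(\<integral>\<^sup>+y. \<phi> y * indicator {y::'a. (norm y)\<^sup>2 + 0 / \<tau> \<le> 1} y \<partial>lborel) = (\<integral>\<^sup>+y\<in>ball 0 1. \<phi> y \<partial>lborel)" for \<tau> :: real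
  proof -
    have "{y::'a. (norm y)\<^sup>2 + 0 / \<tau> \<le> 1} = cball 0 1" by (auto simp: power_le_one_iff abs_square_le_1)
    then show ?thesis by (simp only: emeasure_cball_eq_ball_integral)
  qed
  have "(\<integral>\<^sup>+z. \<phi> ((1 / norm z) *\<^sub>R fst z) * ennreal (exp (- (norm z)\<^sup>2)) \<partial>(lborel :: ('a \<times> real \<times> real) measure))
    = (\<integral>\<^sup>+z. \<phi> ((1 / sqrt ((norm z)\<^sup>2 + 0)) *\<^sub>R fst z) * (\<lambda>\<tau>. ennreal (exp (- \<tau>))) ((norm z)\<^sup>2 + 0) \<partial>(lborel :: ('a \<times> real \<times> real) measure))"
    by simp
  also have "\<dots> = ennreal pi * (\<integral>\<^sup>+\<tau>\<in>{0..}. ennreal (exp (- \<tau>)) * ennreal (sqrt \<tau> ^ DIM('a)) * (\<integral>\<^sup>+y. \<phi> y * indicator {y. (norm y)\<^sup>2 + 0 / \<tau> \<le> 1} y \<partial>lborel) \<partial>lborel)"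
    by (rule nn_integral_Archimedes[OF m Fm]) simp
  also have "(\<integral>\<^sup>+\<tau>\<in>{0..}. ennreal (exp (- \<tau>)) * ennreal (sqrt \<tau> ^ DIM('a)) * (\<integral>\<^sup>+y. \<phi> y * indicator {y. (norm y)\<^sup>2 + 0 / \<tau> \<le> 1} y \<partial>lborel) \<partial>lborel)
    = (\<integral>\<^sup>+\<tau>. (ennreal (exp (- \<tau>) * sqrt \<tau> ^ DIM('a)) * indicator {0..} \<tau>) * (\<integral>\<^sup>+y\<in>ball 0 1. \<phi> y \<partial>lborel) \<partial>lborel)"
  proof (rule nn_integral_cong)
    fix \<tau> :: real
    show "ennreal (exp (- \<tau>)) * ennreal (sqrt \<tau> ^ DIM('a)) * (\<integral>\<^sup>+y. \<phi> y * indicator {y. (norm y)\<^sup>2 + 0 / \<tau> \<le> 1} y \<partial>lborel) * indicator {0..} \<tau>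
      = (ennreal (exp (- \<tau>) * sqrt \<tau> ^ DIM('a)) * indicator {0..} \<tau>) * (\<integral>\<^sup>+y\<in>ball 0 1. \<phi> y \<partial>lborel)"
    proof (cases "0 \<le> \<tau>")
      case True
      then have "ennreal (exp (- \<tau>) * sqrt \<tau> ^ DIM('a)) = ennreal (exp (- \<tau>)) * ennreal (sqrt \<tau> ^ DIM('a))"
        by (intro ennreal_mult) auto
      then show ?thesis unfolding I by (simp only: mult_ac)
    qed simp
  qed
  also have "\<dots> = ennreal (Gamma (real DIM('a) / 2 + 1)) * (\<integral>\<^sup>+y\<in>ball 0 1. \<phi> y \<partial>lborel)"
    by (subst nn_integral_multc) (measurable, simp only: nn_integral_gamma(1))
  also have "ennreal pi * \<dots> = ennreal (pi * Gamma (real DIM('a) / 2 + 1)) * (\<integral>\<^sup>+y\<in>ball 0 1. \<phi> y \<partial>lborel)"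
  proof -
    have "0 \<le> Gamma (real DIM('a) / 2 + 1)" by (intro less_imp_le Gamma_real_pos) simp
    then show ?thesis by (simp add: ennreal_mult mult.assoc)
  qed
  finally show ?thesis .
qed

lemma exp_sqrt_borel:
  "(\<lambda>\<tau>::real. ennreal (exp (- \<tau>) / \<tau> * sqrt \<tau> ^ n) * indicator {0..} \<tau>) \<in> borel_measurable lborel"
  by measurable

text \<open>For \<open>e > 0\<close> only an inequality is left: relaxing the constraint
  \<open>|y|^2 + e / \<tau> \<le> 1\<close> to the open unit ball and the lower limit
  \<open>e\<close> to 0 enlarges the integral.\<close>

lemma nn_integral_gaussian_projection_le:
  fixes \<phi> :: "'a::euclidean_space \<Rightarrow> ennreal"
  assumes m: "\<phi> \<in> borel_measurable borel" and e: "0 < e"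
  shows "(\<integral>\<^sup>+z. \<phi> ((1 / sqrt ((norm z)\<^sup>2 + e)) *\<^sub>R fst z) * ennreal (exp (- ((norm z)\<^sup>2 + e)) / ((norm z)\<^sup>2 + e)) \<partial>(lborel :: ('a \<times> real \<times> real) measure))
    \<le> ennreal (pi * Gamma (real DIM('a) / 2)) * (\<integral>\<^sup>+y\<in>ball 0 1. \<phi> y \<partial>lborel)"
proof -
  have Fm: "(\<lambda>\<tau>::real. ennreal (exp (- \<tau>) / \<tau>)) \<in> borel_measurable borel" by measurable
  have gam: "(\<integral>\<^sup>+\<tau>\<in>{0..}. ennreal (exp (- \<tau>) / \<tau> * sqrt \<tau> ^ DIM('a)) \<partial>lborel) = ennreal (Gamma (real DIM('a) / 2))"
    by (rule nn_integral_gamma(2)) (use DIM_positive[where 'a='a] in linarith)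
  have gm: "(\<lambda>\<tau>::real. ennreal (exp (- \<tau>) / \<tau> * sqrt \<tau> ^ DIM('a)) * indicator {0..} \<tau>) \<in> borel_measurable lborel"
    by (rule exp_sqrt_borel)
  have s1: "(\<integral>\<^sup>+z. \<phi> ((1 / sqrt ((norm z)\<^sup>2 + e)) *\<^sub>R fst z) * ennreal (exp (- ((norm z)\<^sup>2 + e)) / ((norm z)\<^sup>2 + e)) \<partial>(lborel :: ('a \<times> real \<times> real) measure)) = ennreal pi * (\<integral>\<^sup>+\<tau>\<in>{e..}. ennreal (exp (- \<tau>) / \<tau>) * ennreal (sqrt \<tau> ^ DIM('a)) * (\<integral>\<^sup>+y. \<phi> y * indicator {y. (norm y)\<^sup>2 + e / \<tau> \<le> 1} y \<partial>lborel) \<partial>lborel)"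
    by (rule nn_integral_Archimedes[OF m Fm]) (use e in simp)
  have s2: "ennreal pi * (\<integral>\<^sup>+\<tau>\<in>{e..}. ennreal (exp (- \<tau>) / \<tau>) * ennreal (sqrt \<tau> ^ DIM('a)) * (\<integral>\<^sup>+y. \<phi> y * indicator {y. (norm y)\<^sup>2 + e / \<tau> \<le> 1} y \<partial>lborel) \<partial>lborel) \<le> ennreal pi * (\<integral>\<^sup>+\<tau>. (ennreal (exp (- \<tau>) / \<tau> * sqrt \<tau> ^ DIM('a)) * indicator {0..} \<tau>) * (\<integral>\<^sup>+y\<in>ball 0 1. \<phi> y \<partial>lborel) \<partial>lborel)"
  proof (intro mult_left_mono nn_integral_mono)
    fix \<tau> :: real
    show "ennreal (exp (- \<tau>) / \<tau>) * ennreal (sqrt \<tau> ^ DIM('a)) * (\<integral>\<^sup>+y. \<phi> y * indicator {y. (norm y)\<^sup>2 + e / \<tau> \<le> 1} y \<partial>lborel) * indicator {e..} \<tau>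
      \<le> (ennreal (exp (- \<tau>) / \<tau> * sqrt \<tau> ^ DIM('a)) * indicator {0..} \<tau>) * (\<integral>\<^sup>+y\<in>ball 0 1. \<phi> y \<partial>lborel)"
    proof (cases "e \<le> \<tau>")
      case True
      then have t: "0 < \<tau>" using e by simp
      have "y \<in> ball 0 1" if "(norm y)\<^sup>2 + e / \<tau> \<le> 1" for y :: 'a
      proof -
        have "0 < e / \<tau>" using e t by simp
        then have "(norm y)\<^sup>2 < 1" using that by linarith
        then show ?thesis by (simp add: abs_square_less_1)
      qed
      then have le: "(\<integral>\<^sup>+y. \<phi> y * indicator {y. (norm y)\<^sup>2 + e / \<tau> \<le> 1} y \<partial>lborel) \<le> (\<integral>\<^sup>+y\<in>ball 0 1. \<phi> y \<partial>lborel)"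
        by (intro nn_integral_mono mult_left_mono) (auto simp: indicator_def)
      have "ennreal (exp (- \<tau>) / \<tau> * sqrt \<tau> ^ DIM('a)) = ennreal (exp (- \<tau>) / \<tau>) * ennreal (sqrt \<tau> ^ DIM('a))"
        using t by (intro ennreal_mult) auto
      moreover have "indicator {e..} \<tau> = (1::ennreal)" "indicator {0..} \<tau> = (1::ennreal)" using True t by auto
      ultimately show ?thesis by (simp only: mult_1_right) (intro mult_left_mono le, simp)
    qed simp
  qed simp
  have s3: "ennreal pi * (\<integral>\<^sup>+\<tau>. (ennreal (exp (- \<tau>) / \<tau> * sqrt \<tau> ^ DIM('a)) * indicator {0..} \<tau>) * (\<integral>\<^sup>+y\<in>ball 0 1. \<phi> y \<partial>lborel) \<partial>lborel) = ennreal pi * (ennreal (Gamma (real DIM('a) / 2)) * (\<integral>\<^sup>+y\<in>ball 0 1. \<phi> y \<partial>lborel))"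
    unfolding gam[symmetric] by (rule arg_cong[OF nn_integral_multc[OF gm]])
  have s4: "ennreal pi * (ennreal (Gamma (real DIM('a) / 2)) * (\<integral>\<^sup>+y\<in>ball 0 1. \<phi> y \<partial>lborel)) = ennreal (pi * Gamma (real DIM('a) / 2)) * (\<integral>\<^sup>+y\<in>ball 0 1. \<phi> y \<partial>lborel)"
  proof -
    have "0 \<le> Gamma (real DIM('a) / 2)" by (intro less_imp_le Gamma_real_pos) simp
    then show ?thesis by (simp add: ennreal_mult mult.assoc)
  qed
  show ?thesis unfolding s1 using s2 unfolding s3 s4 .
qed

text \<open>With \<open>\<rho> z\<close> in place of \<open>|z|\<close> the projection is smooth at
  the origin. Differentiating the normalising factor only shortens the gradient, because
  \<open>|z| \<le> \<rho> z\<close>.\<close>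

lemma C1_grad_projection:
  fixes v :: "'a::euclidean_space \<Rightarrow> real"
  assumes v: "C1_grad v Dv" and e: "0 < e"
  defines "\<rho> \<equiv> \<lambda>z::'a \<times> real \<times> real. sqrt ((norm z)\<^sup>2 + e)"
  defines "T \<equiv> \<lambda>z. (1 / \<rho> z) *\<^sub>R fst z"
  defines "Dg \<equiv> \<lambda>z. (1 / \<rho> z) *\<^sub>R (Dv (T z), 0) - ((Dv (T z) \<bullet> fst z) / \<rho> z ^ 3) *\<^sub>R z"
  shows "C1_grad (\<lambda>z. v (T z)) Dg" "(norm (Dg z))\<^sup>2 \<le> (norm (Dv (T z)))\<^sup>2 / ((norm z)\<^sup>2 + e)"
proof -
  have pos: "0 < (norm z)\<^sup>2 + e" for z :: "'a \<times> real \<times> real" using e by (simp add: add_nonneg_pos)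
  then have \<rho>: "0 < \<rho> z" "(\<rho> z)\<^sup>2 = (norm z)\<^sup>2 + e" for z unfolding \<rho>_def by (auto simp: less_imp_le)
  have dT: "(T has_derivative (\<lambda>h. (1 / \<rho> z) *\<^sub>R fst h + (- (z \<bullet> h) / \<rho> z ^ 3) *\<^sub>R fst z)) (at z)" for z
  proof -
    let ?q = "\<lambda>z::'a \<times> real \<times> real. z \<bullet> z + e"
    have q: "0 < ?q z" using pos[of z] by (simp add: power2_norm_eq_inner)
    have "((\<lambda>x. 1 / sqrt x) has_real_derivative (- 1 / (2 * sqrt x ^ 3))) (at x)" if x: "0 < x" for x :: real
    proof -
      have "((\<lambda>x. inverse (sqrt x)) has_real_derivative (- (inverse (sqrt x) * (inverse (sqrt x) / 2) * inverse (sqrt x)))) (at x)"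
        by (rule DERIV_inverse'[OF DERIV_real_sqrt[OF x]]) (use x in simp)
      moreover have "- (inverse s * (inverse s / 2) * inverse s) = - 1 / (2 * s ^ 3)" for s :: real
        by (cases "s = 0") (simp_all add: power3_eq_cube field_simps)
      ultimately show ?thesis by (simp only: inverse_eq_divide)
    qed
    from this[OF q]
    have "((\<lambda>x. 1 / sqrt x) has_derivative (\<lambda>h. (- 1 / (2 * sqrt (?q z) ^ 3)) * h)) (at (?q z))"
      by (simp only: has_field_derivative_def)
    moreover have "(?q has_derivative (\<lambda>h. 2 * (z \<bullet> h))) (at z)"
      by (auto intro!: derivative_eq_intros simp: inner_commute)
    ultimately have "((\<lambda>z. 1 / sqrt (?q z)) has_derivative (\<lambda>h. (- 1 / (2 * sqrt (?q z) ^ 3)) * (2 * (z \<bullet> h)))) (at z)"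
      using has_derivative_compose by blast
    moreover have "sqrt (?q z) = \<rho> z" for z by (simp add: \<rho>_def power2_norm_eq_inner)
    ultimately have "((\<lambda>z. 1 / \<rho> z) has_derivative (\<lambda>h. (- 1 / (2 * \<rho> z ^ 3)) * (2 * (z \<bullet> h)))) (at z)" by simp
    moreover have "(- 1 / (2 * \<rho> z ^ 3)) * (2 * (z \<bullet> h)) = - (z \<bullet> h) / \<rho> z ^ 3" for h by simp
    ultimately have "((\<lambda>z. 1 / \<rho> z) has_derivative (\<lambda>h. - (z \<bullet> h) / \<rho> z ^ 3)) (at z)" by simp
    moreover have "(fst has_derivative fst) (at z)" by (auto intro!: derivative_eq_intros)
    ultimately show ?thesis unfolding T_def by (rule has_derivative_scaleR)
  qed
  have cT: "continuous_on UNIV T" using dT by (meson continuous_at_imp_continuous_on has_derivative_continuous)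
  have c\<rho>: "continuous_on UNIV \<rho>" unfolding \<rho>_def by (intro continuous_intros)
  show "C1_grad (\<lambda>z. v (T z)) Dg"
    unfolding C1_grad_def
  proof (intro conjI allI)
    fix z
    have "((\<lambda>z. v (T z)) has_derivative (\<lambda>h. Dv (T z) \<bullet> ((1 / \<rho> z) *\<^sub>R fst h + (- (z \<bullet> h) / \<rho> z ^ 3) *\<^sub>R fst z))) (at z)"
      by (rule has_derivative_compose[OF dT C1_gradD(1)[OF v]])
    moreover have "Dv (T z) \<bullet> ((1 / \<rho> z) *\<^sub>R fst h + (- (z \<bullet> h) / \<rho> z ^ 3) *\<^sub>R fst z) = Dg z \<bullet> h" for h
    proof -
      have "(Dv (T z), 0 :: real \<times> real) \<bullet> h = Dv (T z) \<bullet> fst h" by (simp add: inner_prod_def)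
      then show ?thesis unfolding Dg_def inner_diff_left inner_scaleR_left by (simp add: inner_diff_right mult.commute)
    qed
    ultimately show "((\<lambda>z. v (T z)) has_derivative (\<lambda>h. Dg z \<bullet> h)) (at z)" by simp
  next
    have cD: "continuous_on UNIV (\<lambda>z. Dv (T z))" by (rule continuous_on_compose2[OF C1_gradD(2)[OF v] cT]) simp
    have nz: "\<rho> z \<noteq> 0" for z using \<rho>(1)[of z] by simp
    show "continuous_on UNIV Dg" unfolding Dg_def
      by (intro continuous_intros cD c\<rho>) (use nz in auto)
  qed
  let ?t = "Dv (T z) \<bullet> fst z"
  have "(norm (Dg z))\<^sup>2 = (1 / \<rho> z)\<^sup>2 * (norm (Dv (T z)))\<^sup>2 - 2 * (1 / \<rho> z) * (?t / \<rho> z ^ 3) * ?t + (?t / \<rho> z ^ 3)\<^sup>2 * (norm z)\<^sup>2"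
  proof -
    have 1: "(Dv (T z), 0) \<bullet> z = ?t" "(Dv (T z), 0) \<bullet> (Dv (T z), 0 :: real \<times> real) = Dv (T z) \<bullet> Dv (T z)"
      by (simp_all add: inner_prod_def)
    show ?thesis
      unfolding power2_norm_eq_inner Dg_def
      by (simp only: inner_diff_left inner_diff_right inner_scaleR_left inner_scaleR_right inner_commute[of z "(Dv (T z), 0)"] 1)
        (simp add: power2_eq_square algebra_simps)
  qed
  also have "\<dots> \<le> (1 / \<rho> z)\<^sup>2 * (norm (Dv (T z)))\<^sup>2"
  proof -
    have "(?t / \<rho> z ^ 3)\<^sup>2 * (norm z)\<^sup>2 \<le> (?t / \<rho> z ^ 3)\<^sup>2 * (\<rho> z)\<^sup>2"
      using e by (intro mult_left_mono) (simp_all add: \<rho>(2))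
    also have "(?t / r ^ 3)\<^sup>2 * r\<^sup>2 = (1 / r) * (?t / r ^ 3) * ?t" if "0 < r" for r
      using that by (simp add: power2_eq_square power3_eq_cube)
    then have "(?t / \<rho> z ^ 3)\<^sup>2 * (\<rho> z)\<^sup>2 = (1 / \<rho> z) * (?t / \<rho> z ^ 3) * ?t" using \<rho>(1) by blast
    finally have 1: "(?t / \<rho> z ^ 3)\<^sup>2 * (norm z)\<^sup>2 \<le> (1 / \<rho> z) * (?t / \<rho> z ^ 3) * ?t" .
    have "(1 / \<rho> z) * (?t / \<rho> z ^ 3) * ?t = (1 / \<rho> z) * (1 / \<rho> z ^ 3) * (?t * ?t)" by simp
    also have "0 \<le> \<dots>" using \<rho>(1)[of z] by (intro mult_nonneg_nonneg[OF mult_nonneg_nonneg] zero_le_square) (auto simp: less_imp_le)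
    finally have "0 \<le> (1 / \<rho> z) * (?t / \<rho> z ^ 3) * ?t" .
    then show ?thesis using 1 by linarith
  qed
  also have "\<dots> = (norm (Dv (T z)))\<^sup>2 / ((norm z)\<^sup>2 + e)" by (simp add: power_divide \<rho>(2))
  finally show "(norm (Dg z))\<^sup>2 \<le> (norm (Dv (T z)))\<^sup>2 / ((norm z)\<^sup>2 + e)" .
qed

text \<open>The constant \<open>\<pi>\<^sup>2/8\<close> comes from Maurey-Pisier. It is not optimal, but the local estimate only needs a constant below \<open>5/4\<close>.\<close>

lemma ball_poincare:
  fixes v :: "'a::euclidean_space \<Rightarrow> real"
  assumes v: "C1_grad v Dv" and mean: "(\<integral>x. v x * indicator (ball 0 1) x \<partial>lborel) = 0"
  shows "(\<integral>x. (v x)\<^sup>2 * indicator (ball 0 1) x \<partial>lborel)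
    \<le> pi\<^sup>2 / (8 * real DIM('a)) * (\<integral>x. (norm (Dv x))\<^sup>2 * indicator (ball 0 1) x \<partial>lborel)"
proof -
  let ?n = "DIM('a)" let ?B = "\<lambda>x. indicator (ball (0::'a) 1) x :: real"
  define w where "w = unit_ball_vol (real ?n)"
  define A where "A = (\<integral>x. (v x)\<^sup>2 * ?B x \<partial>lborel)"
  define D where "D = (\<integral>x. (norm (Dv x))\<^sup>2 * ?B x \<partial>lborel)"
  \<comment> \<open>\<open>K0\<close> and \<open>K1\<close> are the masses of the two Gaussian
    weights per unit of volume of the ball; they are related by the recursion of Gamma.\<close>
  define K0 where "K0 = pi * Gamma (real ?n / 2)"
  define K1 where "K1 = pi * Gamma (real ?n / 2 + 1)"
  have w: "0 < w" by (simp add: w_def)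
  have n0: "0 < real ?n" by simp
  have K0: "0 < K0" unfolding K0_def by (intro mult_pos_pos Gamma_real_pos) simp_all
  have K1: "K1 = real ?n / 2 * K0"
  proof -
    have "real ?n / 2 \<notin> \<int>\<^sub>\<le>\<^sub>0" 
    proof
      assume "real ?n / 2 \<in> \<int>\<^sub>\<le>\<^sub>0"
      then obtain k where "real ?n / 2 = of_int k" "k \<le> 0" by (rule nonpos_Ints_cases)
      then have "real ?n / 2 \<le> 0" by (metis of_int_le_0_iff)
      then show False using n0 by simp
    qed
    from Gamma_plus1[OF this] show ?thesis by (simp add: K1_def K0_def)
  qed
  have K1p: "0 < K1" using K0 n0 unfolding K1 by (intro mult_pos_pos) auto
  have cv: "continuous_on UNIV v" "continuous_on UNIV Dv" using C1_gradD[OF v] by auto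
  have iv: "integrable lborel (\<lambda>x. v x * ?B x)" "integrable lborel (\<lambda>x. (v x)\<^sup>2 * ?B x)"
    "integrable lborel (\<lambda>x. (norm (Dv x))\<^sup>2 * ?B x)" "integrable lborel (\<lambda>x. c * ?B x)" for c
    by (intro integrable_ball_continuous continuous_intros cv)+
  have A0: "0 \<le> A" and D0: "0 \<le> D" unfolding A_def D_def by (simp_all add: Bochner_Integration.integral_nonneg)
  have Bc: "(\<integral>x. c * ?B x \<partial>lborel) = c * w" for c
    by (simp add: measure_def emeasure_ball w_def)
  have nnB: "(\<integral>\<^sup>+x\<in>ball (0::'a) 1. ennreal (f x) \<partial>lborel) = ennreal (\<integral>x. f x * ?B x \<partial>lborel)"
    if "integrable lborel (\<lambda>x. f x * ?B x)" "\<And>x. 0 \<le> f x" for f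
  proof -
    have "(\<integral>\<^sup>+x\<in>ball (0::'a) 1. ennreal (f x) \<partial>lborel) = (\<integral>\<^sup>+x. ennreal (f x * ?B x) \<partial>lborel)"
      by (intro nn_integral_cong) (auto simp: indicator_def)
    also have "\<dots> = ennreal (\<integral>x. f x * ?B x \<partial>lborel)"
      by (rule nn_integral_eq_integral[OF that(1)]) (use that(2) in auto)
    finally show ?thesis .
  qed
  have shift: "(\<integral>\<^sup>+x\<in>ball (0::'a) 1. ennreal ((v x - c)\<^sup>2) \<partial>lborel) = ennreal (A + c\<^sup>2 * w)" for c
  proof -
    have i: "integrable lborel (\<lambda>x. (v x - c)\<^sup>2 * ?B x)"
      by (intro integrable_ball_continuous continuous_intros cv)
    have "(\<integral>x. (v x - c)\<^sup>2 * ?B x \<partial>lborel) = (\<integral>x. (v x)\<^sup>2 * ?B x - 2 * c * (v x * ?B x) + c\<^sup>2 * ?B x \<partial>lborel)"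
      by (intro Bochner_Integration.integral_cong refl) (simp add: power2_eq_square algebra_simps)
    also have "\<dots> = (\<integral>x. (v x)\<^sup>2 * ?B x - 2 * c * (v x * ?B x) \<partial>lborel) + (\<integral>x. c\<^sup>2 * ?B x \<partial>lborel)"
      by (rule Bochner_Integration.integral_add) (intro Bochner_Integration.integrable_diff integrable_mult_right iv)+
    also have "(\<integral>x. (v x)\<^sup>2 * ?B x - 2 * c * (v x * ?B x) \<partial>lborel) = A - (\<integral>x. 2 * c * (v x * ?B x) \<partial>lborel)"
      unfolding A_def by (rule Bochner_Integration.integral_diff) (intro integrable_mult_right iv)+
    also have "(\<integral>x. 2 * c * (v x * ?B x) \<partial>lborel) = 0"
      using mean by (simp only: integral_mult_right_zero mult_zero_right)
    finally have "(\<integral>x. (v x - c)\<^sup>2 * ?B x \<partial>lborel) = A + c\<^sup>2 * w" by (simp only: Bc diff_zero)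
    then show ?thesis using nnB[OF i] by simp
  qed
  let ?G = "\<lambda>z::'a \<times> real \<times> real. exp (- (norm z)\<^sup>2)"
  define T0 where "T0 = (\<lambda>z::'a \<times> real \<times> real. (1 / norm z) *\<^sub>R fst z)"
  have [measurable]: "(fst :: 'a \<times> real \<times> real \<Rightarrow> 'a) \<in> borel_measurable borel"
    by (intro borel_measurable_continuous_onI continuous_intros)
  have [measurable]: "v \<in> borel_measurable borel" by (rule borel_measurable_continuous_onI[OF cv(1)])
  have [measurable]: "Dv \<in> borel_measurable borel" by (rule borel_measurable_continuous_onI[OF cv(2)])
  have T0m[measurable]: "T0 \<in> borel_measurable borel" unfolding T0_def by measurable
  have Z: "(\<integral>\<^sup>+z. ennreal (?G z) \<partial>lborel) = ennreal (K1 * w)" "0 \<le> K1 * w"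
  proof -
    have "(\<integral>\<^sup>+z. 1 * ennreal (?G z) \<partial>lborel) = ennreal K1 * (\<integral>\<^sup>+y\<in>ball (0::'a) 1. 1 \<partial>lborel)"
      unfolding K1_def by (rule nn_integral_gaussian_projection) measurable
    also have "(\<integral>\<^sup>+y\<in>ball (0::'a) 1. 1 \<partial>lborel) = ennreal w" by (simp add: emeasure_ball w_def)
    finally show "(\<integral>\<^sup>+z. ennreal (?G z) \<partial>lborel) = ennreal (K1 * w)"
      using K1p w by (simp add: ennreal_mult)
    show "0 \<le> K1 * w" using K1p w by simp
  qed
  define X where "X = (\<lambda>g. \<integral>\<^sup>+p. ennreal ((g (snd p) - g (fst p))\<^sup>2 * (?G (fst p) * ?G (snd p))) \<partial>lborel)"
  \<comment> \<open>The two Gaussian vectors project to independent uniform points of the ball, and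
    the mean square of their difference is twice the variance because \<open>v\<close> has mean
    0.\<close>
  have X0: "X (\<lambda>z. v (T0 z)) = ennreal (K1\<^sup>2 * (2 * w * A))"
  proof -
    have pm: "(fst :: ('a \<times> real \<times> real) \<times> ('a \<times> real \<times> real) \<Rightarrow> _) \<in> borel_measurable borel"
       "(snd :: ('a \<times> real \<times> real) \<times> ('a \<times> real \<times> real) \<Rightarrow> _) \<in> borel_measurable borel"
      by (intro borel_measurable_continuous_onI continuous_intros)+
    have m: "(\<lambda>p. ennreal ((v (T0 (snd p)) - v (T0 (fst p)))\<^sup>2 * (?G (fst p) * ?G (snd p)))) \<in> borel_measurable borel"
      using pm by measurable
    have "X (\<lambda>z. v (T0 z)) = (\<integral>\<^sup>+z'. \<integral>\<^sup>+z. ennreal ((v (T0 z') - v (T0 z))\<^sup>2 * (?G z * ?G z')) \<partial>lborel \<partial>lborel)"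
      unfolding X_def using nn_integral_lborel_pair(2)[OF m] by simp
    also have "\<dots> = (\<integral>\<^sup>+z'. ennreal K1 * (ennreal (A + (v (T0 z'))\<^sup>2 * w) * ennreal (?G z')) \<partial>lborel)"
    proof (rule nn_integral_cong)
      fix z' :: "'a \<times> real \<times> real"
      have "(\<integral>\<^sup>+z. ennreal ((v (T0 z') - v (T0 z))\<^sup>2 * (?G z * ?G z')) \<partial>lborel)
        = (\<integral>\<^sup>+z. ennreal (?G z') * (ennreal ((v ((1 / norm z) *\<^sub>R fst z) - v (T0 z'))\<^sup>2) * ennreal (?G z)) \<partial>lborel)"
      proof (rule nn_integral_cong)
        fix z :: "'a \<times> real \<times> real"
        have "(v (T0 z') - v (T0 z))\<^sup>2 * (?G z * ?G z') = ?G z' * ((v ((1 / norm z) *\<^sub>R fst z) - v (T0 z'))\<^sup>2 * ?G z)"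
          unfolding T0_def by (simp add: power2_commute mult_ac)
        then show "ennreal ((v (T0 z') - v (T0 z))\<^sup>2 * (?G z * ?G z')) = ennreal (?G z') * (ennreal ((v ((1 / norm z) *\<^sub>R fst z) - v (T0 z'))\<^sup>2) * ennreal (?G z))"
          by (simp only: ennreal_mult[symmetric] zero_le_power2 exp_ge_zero mult_nonneg_nonneg)
      qed
      also have "\<dots> = ennreal (?G z') * (\<integral>\<^sup>+z. ennreal ((v ((1 / norm z) *\<^sub>R fst z) - v (T0 z'))\<^sup>2) * ennreal (?G z) \<partial>lborel)"
        by (rule nn_integral_cmult) measurable
      also have "(\<integral>\<^sup>+z. ennreal ((v ((1 / norm z) *\<^sub>R fst z) - v (T0 z'))\<^sup>2) * ennreal (?G z) \<partial>lborel)
        = ennreal K1 * (\<integral>\<^sup>+y\<in>ball (0::'a) 1. ennreal ((v y - v (T0 z'))\<^sup>2) \<partial>lborel)"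
        unfolding K1_def by (rule nn_integral_gaussian_projection[where \<phi>="\<lambda>y. ennreal ((v y - v (T0 z'))\<^sup>2)"]) measurable
      also have "(\<integral>\<^sup>+y\<in>ball (0::'a) 1. ennreal ((v y - v (T0 z'))\<^sup>2) \<partial>lborel) = ennreal (A + (v (T0 z'))\<^sup>2 * w)"
        by (rule shift)
      finally show "(\<integral>\<^sup>+z. ennreal ((v (T0 z') - v (T0 z))\<^sup>2 * (?G z * ?G z')) \<partial>lborel) = ennreal K1 * (ennreal (A + (v (T0 z'))\<^sup>2 * w) * ennreal (?G z'))"
        by (simp only: mult_ac)
    qed
    also have "\<dots> = ennreal K1 * (\<integral>\<^sup>+z'. ennreal (A + (v (T0 z'))\<^sup>2 * w) * ennreal (?G z') \<partial>lborel)"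
      by (rule nn_integral_cmult) measurable
    also have "(\<integral>\<^sup>+z'. ennreal (A + (v (T0 z'))\<^sup>2 * w) * ennreal (?G z') \<partial>lborel) = ennreal K1 * (\<integral>\<^sup>+y\<in>ball (0::'a) 1. ennreal (A + (v y)\<^sup>2 * w) \<partial>lborel)"
      unfolding K1_def T0_def by (rule nn_integral_gaussian_projection[where \<phi>="\<lambda>y. ennreal (A + (v y)\<^sup>2 * w)"]) measurable
    also have "(\<integral>\<^sup>+y\<in>ball (0::'a) 1. ennreal (A + (v y)\<^sup>2 * w) \<partial>lborel) = ennreal (2 * w * A)"
    proof -
      have i: "integrable lborel (\<lambda>x. (A + (v x)\<^sup>2 * w) * ?B x)"
        by (intro integrable_ball_continuous continuous_intros cv)
      have "(\<integral>x. (A + (v x)\<^sup>2 * w) * ?B x \<partial>lborel) = (\<integral>x. A * ?B x + w * ((v x)\<^sup>2 * ?B x) \<partial>lborel)"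
        by (intro Bochner_Integration.integral_cong refl) (simp add: algebra_simps)
      also have "\<dots> = (\<integral>x. A * ?B x \<partial>lborel) + (\<integral>x. w * ((v x)\<^sup>2 * ?B x) \<partial>lborel)"
        by (rule Bochner_Integration.integral_add) (intro integrable_mult_right iv)+
      also have "\<dots> = 2 * w * A" unfolding Bc by (simp only: integral_mult_right_zero A_def[symmetric]) simp
      finally show ?thesis using nnB[OF i] A0 w by simp
    qed
    finally show ?thesis using K1p A0 w by (simp add: ennreal_mult[symmetric] power2_eq_square mult.assoc)
  qed
  define T where "T = (\<lambda>e (z::'a \<times> real \<times> real). (1 / sqrt ((norm z)\<^sup>2 + e)) *\<^sub>R fst z)"
  \<comment> \<open>The factor \<open>exp e\<close> pays for replacing \<open>|z|^2\<close> by
    \<open>|z|^2 + e\<close> in the exponent.\<close>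
  have Xe: "X (\<lambda>z. v (T e z)) \<le> ennreal (pi\<^sup>2 / 8 * (K1 * w) * (exp e * (K0 * D)))" and gc: "continuous_on UNIV (\<lambda>z. v (T e z))" if e: "0 < e" for e
  proof -
    obtain Dg where g: "C1_grad (\<lambda>z. v (T e z)) Dg" and Dg: "\<And>z. (norm (Dg z))\<^sup>2 \<le> (norm (Dv (T e z)))\<^sup>2 / ((norm z)\<^sup>2 + e)"
      using C1_grad_projection[OF v e] unfolding T_def by blast
    show "continuous_on UNIV (\<lambda>z. v (T e z))" by (rule C1_gradD(3)[OF g])
    have [measurable]: "T e \<in> borel_measurable borel" unfolding T_def by measurable
    have "(\<integral>\<^sup>+z. ennreal ((norm (Dg z))\<^sup>2 * ?G z) \<partial>lborel)
      \<le> (\<integral>\<^sup>+z. ennreal (exp e) * (ennreal ((norm (Dv (T e z)))\<^sup>2) * ennreal (exp (- ((norm z)\<^sup>2 + e)) / ((norm z)\<^sup>2 + e))) \<partial>lborel)"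
    proof (rule nn_integral_mono)
      fix z :: "'a \<times> real \<times> real"
      have p: "0 < (norm z)\<^sup>2 + e" using e by (simp add: add_nonneg_pos)
      have "(norm (Dg z))\<^sup>2 * ?G z \<le> ((norm (Dv (T e z)))\<^sup>2 / ((norm z)\<^sup>2 + e)) * ?G z" by (intro mult_right_mono Dg) simp
      also have "((norm (Dv (T e z)))\<^sup>2 / ((norm z)\<^sup>2 + e)) * ?G z = exp e * ((norm (Dv (T e z)))\<^sup>2 * (exp (- ((norm z)\<^sup>2 + e)) / ((norm z)\<^sup>2 + e)))"
      proof -
        have "?G z = exp e * exp (- ((norm z)\<^sup>2 + e))" by (simp add: exp_add[symmetric])
        then show ?thesis by (simp only: times_divide_eq_left times_divide_eq_right mult_ac)
      qed
      finally have "(norm (Dg z))\<^sup>2 * ?G z \<le> exp e * ((norm (Dv (T e z)))\<^sup>2 * (exp (- ((norm z)\<^sup>2 + e)) / ((norm z)\<^sup>2 + e)))" .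
      then have "ennreal ((norm (Dg z))\<^sup>2 * ?G z) \<le> ennreal (exp e * ((norm (Dv (T e z)))\<^sup>2 * (exp (- ((norm z)\<^sup>2 + e)) / ((norm z)\<^sup>2 + e))))"
        by (rule ennreal_leI)
      also have "\<dots> = ennreal (exp e) * (ennreal ((norm (Dv (T e z)))\<^sup>2) * ennreal (exp (- ((norm z)\<^sup>2 + e)) / ((norm z)\<^sup>2 + e)))"
        using p by (subst ennreal_mult, simp, simp, subst ennreal_mult) (simp_all add: less_imp_le)
      finally show "ennreal ((norm (Dg z))\<^sup>2 * ?G z) \<le> ennreal (exp e) * (ennreal ((norm (Dv (T e z)))\<^sup>2) * ennreal (exp (- ((norm z)\<^sup>2 + e)) / ((norm z)\<^sup>2 + e)))" .
    qed
    also have "\<dots> = ennreal (exp e) * (\<integral>\<^sup>+z. ennreal ((norm (Dv (T e z)))\<^sup>2) * ennreal (exp (- ((norm z)\<^sup>2 + e)) / ((norm z)\<^sup>2 + e)) \<partial>lborel)"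
      by (rule nn_integral_cmult) measurable
    also have "\<dots> \<le> ennreal (exp e) * (ennreal K0 * (\<integral>\<^sup>+y\<in>ball (0::'a) 1. ennreal ((norm (Dv y))\<^sup>2) \<partial>lborel))"
      unfolding K0_def T_def
    proof (intro mult_left_mono nn_integral_gaussian_projection_le[where \<phi>="\<lambda>y. ennreal ((norm (Dv y))\<^sup>2)"] e)
      show "(\<lambda>y. ennreal ((norm (Dv y))\<^sup>2)) \<in> borel_measurable borel" by measurable
    qed simp
    also have "(\<integral>\<^sup>+y\<in>ball (0::'a) 1. ennreal ((norm (Dv y))\<^sup>2) \<partial>lborel) = ennreal D"
      using nnB[OF iv(3)] by (simp add: D_def)
    finally have 1: "(\<integral>\<^sup>+z. ennreal ((norm (Dg z))\<^sup>2 * ?G z) \<partial>lborel) \<le> ennreal (exp e) * (ennreal K0 * ennreal D)" .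
    have "X (\<lambda>z. v (T e z)) \<le> ennreal (pi\<^sup>2 / 8 * (K1 * w)) * (\<integral>\<^sup>+z. ennreal ((norm (Dg z))\<^sup>2 * ?G z) \<partial>lborel)"
      unfolding X_def by (rule gaussian_increment_le_gradient[OF g Z])
    also have "\<dots> \<le> ennreal (pi\<^sup>2 / 8 * (K1 * w)) * (ennreal (exp e) * (ennreal K0 * ennreal D))"
      by (rule mult_left_mono[OF 1]) simp
    also have "\<dots> = ennreal (pi\<^sup>2 / 8 * (K1 * w) * (exp e * (K0 * D)))"
      using K0 D0 Z(2) by (simp add: ennreal_mult[symmetric])
    finally show "X (\<lambda>z. v (T e z)) \<le> ennreal (pi\<^sup>2 / 8 * (K1 * w) * (exp e * (K0 * D)))" .
  qed
  define ek where "ek = (\<lambda>k. 1 / real (Suc k))"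
  have ek: "0 < ek k" "ek \<longlonglongrightarrow> 0" for k
    unfolding ek_def using LIMSEQ_inverse_real_of_nat by (auto simp: inverse_eq_divide)
  have T_lim: "(\<lambda>k. v (T (ek k) z)) \<longlonglongrightarrow> v (T0 z)" for z
  proof -
    have "(\<lambda>k. T (ek k) z) \<longlonglongrightarrow> T0 z"
    proof (cases "z = 0")
      case True then show ?thesis by (simp add: T_def T0_def)
    next
      case False
      have "(\<lambda>k. (1 / sqrt ((norm z)\<^sup>2 + ek k)) *\<^sub>R fst z) \<longlonglongrightarrow> (1 / sqrt ((norm z)\<^sup>2 + 0)) *\<^sub>R fst z"
        by (intro tendsto_intros ek) (use False in simp)
      then show ?thesis by (simp add: T_def T0_def)
    qed
    moreover have "isCont v (T0 z)" using cv(1) by (simp add: continuous_on_eq_continuous_at)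
    ultimately show ?thesis by (rule isCont_tendsto_compose[rotated])
  qed
  \<comment> \<open>\<open>T0\<close> is not continuous at the origin; Fatou's lemma transfers the
    bound from the regularised maps.\<close>
  have "X (\<lambda>z. v (T0 z)) \<le> liminf (\<lambda>k. X (\<lambda>z. v (T (ek k) z)))"
  proof -
    let ?u = "\<lambda>k p. ennreal ((v (T (ek k) (snd p)) - v (T (ek k) (fst p)))\<^sup>2 * (?G (fst p) * ?G (snd p)))"
    have "(\<lambda>k. ?u k p) \<longlonglongrightarrow> ennreal ((v (T0 (snd p)) - v (T0 (fst p)))\<^sup>2 * (?G (fst p) * ?G (snd p)))" for p
      by (intro tendsto_ennrealI tendsto_intros T_lim)
    then have lim: "liminf (\<lambda>k. ?u k p) = ennreal ((v (T0 (snd p)) - v (T0 (fst p)))\<^sup>2 * (?G (fst p) * ?G (snd p)))" for p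
      by (intro lim_imp_Liminf) auto
    have "(\<integral>\<^sup>+p. liminf (\<lambda>k. ?u k p) \<partial>lborel) \<le> liminf (\<lambda>k. \<integral>\<^sup>+p. ?u k p \<partial>lborel)"
    proof (rule nn_integral_liminf)
      fix k
      note c = gc[OF ek(1)[of k]]
      have "continuous_on UNIV (\<lambda>p. (v (T (ek k) (snd p)) - v (T (ek k) (fst p)))\<^sup>2 * (?G (fst p) * ?G (snd p)))"
        by (intro continuous_intros continuous_on_compose2[OF c]) auto
      from measurable_compose[OF borel_measurable_continuous_onI[OF this] measurable_ennreal]
      show "?u k \<in> borel_measurable lborel" by simp
    qed
    then show ?thesis unfolding lim X_def .
  qed
  also have "\<dots> \<le> liminf (\<lambda>k. ennreal (pi\<^sup>2 / 8 * (K1 * w) * (exp (ek k) * (K0 * D))))"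
    by (intro Liminf_mono always_eventually allI Xe ek)
  also have "\<dots> = ennreal (pi\<^sup>2 / 8 * (K1 * w) * (exp 0 * (K0 * D)))"
    by (intro lim_imp_Liminf tendsto_ennrealI tendsto_intros ek) simp
  finally have "ennreal (K1\<^sup>2 * (2 * w * A)) \<le> ennreal (pi\<^sup>2 / 8 * (K1 * w) * (K0 * D))" unfolding X0 by simp
  then have "K1\<^sup>2 * (2 * w * A) \<le> pi\<^sup>2 / 8 * (K1 * w) * (K0 * D)"
    using Z(2) K0 D0 by (subst (asm) ennreal_le_iff) auto
  then have "(K1 * w * K0) * (real ?n * A) \<le> (K1 * w * K0) * (pi\<^sup>2 / 8 * D)"
    unfolding power2_eq_square by (simp add: K1 mult_ac)
  then have "real ?n * A \<le> pi\<^sup>2 / 8 * D"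
    using K1p w K0 by (subst (asm) mult_le_cancel_left_pos) auto
  then have "A \<le> pi\<^sup>2 / (8 * real ?n) * D" using n0 by (simp add: field_simps)
  then show ?thesis unfolding A_def D_def .
qed

section \<open>The lower bound\<close>

text \<open>\<open>U\<close> is the variance part \<open>A\<close> plus the contribution
  \<open>w * k2\<close> of the mean; the Poincare bound controls the first and the capacity
  inequality the second. After insertion \<open>4 * (n\<^sup>2 - 2)\<close> exceeds the coefficient
  of \<open>D\<close> by \<open>n\<^sup>2 / 2 + 15/4 * n - 11/2\<close>, which is positive for
  \<open>n \<ge> 3\<close>.\<close>

lemma local_estimate_arith:
  fixes n :: real
  assumes n: "3 \<le> n" and g: "0 < g" "g \<le> 1" and w: "0 < w" and D: "0 \<le> D" and A: "A \<le> 5 / (4 * n) * D"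
    and k: "g * n * (n - 2) * w * k2 \<le> 2 * D + (n - 2) * ((n + 1) * A + D)"
    and U: "U = A + w * k2" and A0: "0 \<le> A"
  shows "g * n\<^sup>2 * (n - 2) / (4 * (n\<^sup>2 - 2)) * U \<le> D"
proof -
  have n2: "0 < 4 * (n\<^sup>2 - 2)" using power_mono[OF n, of 2] by simp
  have nA: "n * A \<le> 5 / 4 * D" using A n by (simp add: field_simps)
  have "g * n\<^sup>2 * (n - 2) * U = n * (n - 2) * (g * (n * A)) + n * (g * n * (n - 2) * w * k2)"
    unfolding U by (simp add: power2_eq_square algebra_simps)
  also have "\<dots> \<le> n * (n - 2) * (5 / 4 * D) + n * (2 * D + (n - 2) * ((n + 1) * A + D))"
  proof (intro add_mono mult_left_mono k)
    have "g * (n * A) \<le> 1 * (n * A)" using g A0 n by (intro mult_right_mono) auto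
    then show "g * (n * A) \<le> 5 / 4 * D" using nA by simp
  qed (use n in auto)
  also have "\<dots> = n * (n - 2) * (5 / 4 * D) + 2 * n * D + (n - 2) * (n + 1) * (n * A) + n * (n - 2) * D"
    by (simp add: algebra_simps)
  also have "\<dots> \<le> n * (n - 2) * (5 / 4 * D) + 2 * n * D + (n - 2) * (n + 1) * (5 / 4 * D) + n * (n - 2) * D"
    using n by (intro add_mono mult_left_mono nA order_refl) auto
  also have "\<dots> = (7/2 * n\<^sup>2 - 15/4 * n - 5/2) * D" by (simp add: power2_eq_square field_simps)
  also have "\<dots> \<le> (4 * (n\<^sup>2 - 2)) * D"
  proof (intro mult_right_mono D)
    have "4 * (n\<^sup>2 - 2) - (7/2 * n\<^sup>2 - 15/4 * n - 5/2) = n\<^sup>2 / 2 + (15/4 * n - 11/2)" by (simp add: field_simps)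
    moreover have "0 \<le> n\<^sup>2 / 2" "0 \<le> 15/4 * n - 11/2" using n by simp_all
    ultimately show "7/2 * n\<^sup>2 - 15/4 * n - 5/2 \<le> 4 * (n\<^sup>2 - 2)" by linarith
  qed
  finally have "g * n\<^sup>2 * (n - 2) * U / (4 * (n\<^sup>2 - 2)) \<le> D" using n2 by (simp add: divide_le_eq mult.commute)
  then show ?thesis by simp
qed

text \<open>Since \<open>F\<close> has a fixed fraction of the capacity of the ball, the energy
  bound for \<open>1 - u / k\<close> cannot be small. Multiplied by \<open>k\<^sup>2\<close>, this
  bounds the mean \<open>k\<close> of \<open>u\<close> by its gradient and its variance.\<close>

lemma local_estimate_unit:
  fixes u :: "'a::euclidean_space \<Rightarrow> real"
  assumes n: "3 \<le> DIM('a)" and u: "C1_grad u Du" and F: "F \<subseteq> cball 0 1" "\<And>x. x \<in> F \<Longrightarrow> u x = 0"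
    and g: "0 < g" "g \<le> 1"
    and cap: "ennreal (g * real DIM('a) * (real DIM('a) - 2) * unit_ball_vol (real DIM('a))) \<le> capacity F"
  shows "g * (real DIM('a))\<^sup>2 * (real DIM('a) - 2) / (4 * ((real DIM('a))\<^sup>2 - 2)) *
      (\<integral>x. (u x)\<^sup>2 * indicator (ball 0 1) x \<partial>lborel)
    \<le> (\<integral>x. (norm (Du x))\<^sup>2 * indicator (ball 0 1) x \<partial>lborel)"
proof -
  let ?n = "real DIM('a)" let ?B = "\<lambda>x. indicator (ball (0::'a) 1) x :: real"
  define w where "w = unit_ball_vol ?n"
  have w: "0 < w" by (simp add: w_def)
  have n3: "3 \<le> ?n" using n by simp
  have cu: "continuous_on UNIV u" "continuous_on UNIV Du" using C1_gradD[OF u] by auto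
  define k where "k = (\<integral>x. u x * ?B x \<partial>lborel) / w"
  define A where "A = (\<integral>x. (u x - k)\<^sup>2 * ?B x \<partial>lborel)"
  define D where "D = (\<integral>x. (norm (Du x))\<^sup>2 * ?B x \<partial>lborel)"
  have Bc: "(\<integral>x. c * ?B x \<partial>lborel) = c * w" for c
    by (simp add: measure_def emeasure_ball w_def)
  have i: "integrable lborel (\<lambda>x. u x * ?B x)" "integrable lborel (\<lambda>x. (u x - k)\<^sup>2 * ?B x)" "integrable lborel (\<lambda>x. (u x - k) * ?B x)"
    "integrable lborel (\<lambda>x. (norm (Du x))\<^sup>2 * ?B x)" "integrable lborel (\<lambda>x. c * ?B x)" for c
    by (intro integrable_ball_continuous continuous_intros cu)+
  have A0: "0 \<le> A" and D0: "0 \<le> D" unfolding A_def D_def by (simp_all add: Bochner_Integration.integral_nonneg)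
  have mean: "(\<integral>x. (u x - k) * ?B x \<partial>lborel) = 0"
  proof -
    have "(\<integral>x. (u x - k) * ?B x \<partial>lborel) = (\<integral>x. u x * ?B x - k * ?B x \<partial>lborel)"
      by (simp only: left_diff_distrib)
    also have "\<dots> = (\<integral>x. u x * ?B x \<partial>lborel) - (\<integral>x. k * ?B x \<partial>lborel)"
      by (rule Bochner_Integration.integral_diff[OF i(1) i(5)])
    also have "\<dots> = 0" unfolding Bc using w by (simp add: k_def)
    finally show ?thesis .
  qed
  have "C1_grad (\<lambda>x. u x - k) Du"
    using u unfolding C1_grad_def by (auto intro!: derivative_eq_intros)
  from ball_poincare[OF this mean] have "A \<le> pi\<^sup>2 / (8 * ?n) * D" unfolding A_def D_def .
  also have "\<dots> \<le> 5 / (4 * ?n) * D"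
  \<comment> \<open>It suffices that \<open>3.15\<^sup>2 / 8 < 5/4\<close>.\<close>
  proof (intro mult_right_mono D0)
    have "pi \<le> 3.15" using pi_approx by simp
    then have "pi\<^sup>2 \<le> 3.15\<^sup>2" by (intro power_mono) auto
    then show "pi\<^sup>2 / (8 * ?n) \<le> 5 / (4 * ?n)" using n3 by (simp add: field_simps power2_eq_square)
  qed
  finally have AD: "A \<le> 5 / (4 * ?n) * D" .
  have U: "(\<integral>x. (u x)\<^sup>2 * ?B x \<partial>lborel) = A + w * k\<^sup>2"
  proof -
    have "(\<integral>x. (u x)\<^sup>2 * ?B x \<partial>lborel) = (\<integral>x. ((u x - k)\<^sup>2 * ?B x + 2 * k * ((u x - k) * ?B x)) + k\<^sup>2 * ?B x \<partial>lborel)"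
      by (intro Bochner_Integration.integral_cong refl) (simp add: power2_eq_square algebra_simps)
    also have "\<dots> = (\<integral>x. (u x - k)\<^sup>2 * ?B x + 2 * k * ((u x - k) * ?B x) \<partial>lborel) + (\<integral>x. k\<^sup>2 * ?B x \<partial>lborel)"
      by (rule Bochner_Integration.integral_add) (intro Bochner_Integration.integrable_add integrable_mult_right i)+
    also have "(\<integral>x. (u x - k)\<^sup>2 * ?B x + 2 * k * ((u x - k) * ?B x) \<partial>lborel) = A + (\<integral>x. 2 * k * ((u x - k) * ?B x) \<partial>lborel)"
      unfolding A_def by (rule Bochner_Integration.integral_add) (intro integrable_mult_right i)+
    also have "(\<integral>x. 2 * k * ((u x - k) * ?B x) \<partial>lborel) = 0" by (simp only: integral_mult_right_zero mean mult_zero_right)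
    finally show ?thesis unfolding Bc by simp
  qed
  \<comment> \<open>The competitor is built from \<open>u\<close> itself: \<open>k\<close> may have
    either sign, and for \<open>k = 0\<close> the left side vanishes.\<close>
  have "g * ?n * (?n - 2) * w * k\<^sup>2 \<le> 2 * D + (?n - 2) * ((?n + 1) * A + D)"
  proof (cases "k = 0")
    case True
    then show ?thesis using A0 D0 n3 by (simp add: add_nonneg_nonneg)
  next
    case False
    let ?v = "\<lambda>x. 1 - u x / k" let ?Dv = "\<lambda>x. (- 1 / k) *\<^sub>R Du x"
    have "C1_grad ?v ?Dv"
      unfolding C1_grad_def
    proof (intro conjI allI)
      fix x
      have "((\<lambda>x. u x * inverse k) has_derivative (\<lambda>h. (Du x \<bullet> h) * inverse k)) (at x)"
        by (rule has_derivative_mult_left[OF C1_gradD(1)[OF u]])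
      from has_derivative_diff[OF has_derivative_const this, of 1]
      show "(?v has_derivative (\<lambda>h. ?Dv x \<bullet> h)) (at x)" by (simp add: divide_inverse mult.commute)
      show "continuous_on UNIV ?Dv" by (intro continuous_intros cu)
    qed
    from capacity_le_ball_functional[OF n this F(1)] F(2)
    have "capacity F \<le> ennreal (2 * (\<integral>x. (norm (?Dv x))\<^sup>2 * ?B x \<partial>lborel) + (?n - 2) * (\<integral>x. (?n * (?v x)\<^sup>2 + 2 * ?v x * (?Dv x \<bullet> x)) * ?B x \<partial>lborel))"
      by simp
    also have "(\<integral>x. (norm (?Dv x))\<^sup>2 * ?B x \<partial>lborel) = D / k\<^sup>2"
    proof -
      have "(\<integral>x. (norm (?Dv x))\<^sup>2 * ?B x \<partial>lborel) = (\<integral>x. (1 / k\<^sup>2) * ((norm (Du x))\<^sup>2 * ?B x) \<partial>lborel)"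
        by (intro Bochner_Integration.integral_cong refl) (simp add: power_mult_distrib power_divide)
      then show ?thesis by (simp only: integral_mult_right_zero D_def[symmetric]) simp
    qed
    finally have c1: "capacity F \<le> ennreal (2 * (D / k\<^sup>2) + (?n - 2) * (\<integral>x. (?n * (?v x)\<^sup>2 + 2 * ?v x * (?Dv x \<bullet> x)) * ?B x \<partial>lborel))" .
    \<comment> \<open>The boundary term is absorbed into volume terms: with
      \<open>a = u x - k\<close> and \<open>|x| \<le> 1\<close>,
      \<open>2 * a * (Du x \<bullet> x)\<close> is at most \<open>a\<^sup>2\<close> plus the square
      of \<open>norm (Du x)\<close>.\<close>
    have "(\<integral>x. (?n * (?v x)\<^sup>2 + 2 * ?v x * (?Dv x \<bullet> x)) * ?B x \<partial>lborel)
      \<le> (\<integral>x. ((?n + 1) / k\<^sup>2) * ((u x - k)\<^sup>2 * ?B x) + (1 / k\<^sup>2) * ((norm (Du x))\<^sup>2 * ?B x) \<partial>lborel)"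
    proof (rule integral_mono)
      show "integrable lborel (\<lambda>x. (?n * (?v x)\<^sup>2 + 2 * ?v x * (?Dv x \<bullet> x)) * ?B x)"
        by (intro integrable_ball_continuous continuous_intros cu) (use False in auto)
      show "integrable lborel (\<lambda>x. ((?n + 1) / k\<^sup>2) * ((u x - k)\<^sup>2 * ?B x) + (1 / k\<^sup>2) * ((norm (Du x))\<^sup>2 * ?B x))"
        by (intro Bochner_Integration.integrable_add integrable_mult_right i)
      fix x
      show "(?n * (?v x)\<^sup>2 + 2 * ?v x * (?Dv x \<bullet> x)) * ?B x \<le> ((?n + 1) / k\<^sup>2) * ((u x - k)\<^sup>2 * ?B x) + (1 / k\<^sup>2) * ((norm (Du x))\<^sup>2 * ?B x)"
      proof (cases "x \<in> ball 0 1")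
        case True
        define a where "a = u x - k"
        have v: "?v x = - a / k" using False by (simp add: a_def field_simps)
        have "\<bar>Du x \<bullet> x\<bar> \<le> norm (Du x) * norm x" by (rule Cauchy_Schwarz_ineq2)
        also have "\<dots> \<le> norm (Du x) * 1" using True by (intro mult_left_mono) auto
        finally have "(Du x \<bullet> x)\<^sup>2 \<le> (norm (Du x))\<^sup>2" by (simp add: abs_le_square_iff[symmetric])
        moreover have "2 * a * (Du x \<bullet> x) \<le> a\<^sup>2 + (Du x \<bullet> x)\<^sup>2" using sum_squares_bound[of a "Du x \<bullet> x"] by simp
        ultimately have "?n * a\<^sup>2 + 2 * a * (Du x \<bullet> x) \<le> (?n + 1) * a\<^sup>2 + (norm (Du x))\<^sup>2" by (simp add: algebra_simps)
        then have "(?n * a\<^sup>2 + 2 * a * (Du x \<bullet> x)) / k\<^sup>2 \<le> ((?n + 1) * a\<^sup>2 + (norm (Du x))\<^sup>2) / k\<^sup>2"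
          by (rule divide_right_mono) simp
        moreover have "?n * (?v x)\<^sup>2 + 2 * ?v x * (?Dv x \<bullet> x) = (?n * a\<^sup>2 + 2 * a * (Du x \<bullet> x)) / k\<^sup>2"
          unfolding v by (simp add: power2_eq_square add_divide_distrib)
        moreover have "((?n + 1) * a\<^sup>2 + (norm (Du x))\<^sup>2) / k\<^sup>2 = ((?n + 1) / k\<^sup>2) * (a\<^sup>2 * ?B x) + (1 / k\<^sup>2) * ((norm (Du x))\<^sup>2 * ?B x)"
          using True by (simp add: add_divide_distrib ring_distribs)
        ultimately show ?thesis using True unfolding a_def by simp
      qed simp
    qed
    also have "\<dots> = (\<integral>x. ((?n + 1) / k\<^sup>2) * ((u x - k)\<^sup>2 * ?B x) \<partial>lborel) + (\<integral>x. (1 / k\<^sup>2) * ((norm (Du x))\<^sup>2 * ?B x) \<partial>lborel)"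
      by (rule Bochner_Integration.integral_add) (intro integrable_mult_right i)+
    also have "\<dots> = ((?n + 1) * A + D) / k\<^sup>2"
      by (simp only: integral_mult_right_zero A_def[symmetric] D_def[symmetric]) (simp add: add_divide_distrib ring_distribs)
    finally have "2 * (D / k\<^sup>2) + (?n - 2) * (\<integral>x. (?n * (?v x)\<^sup>2 + 2 * ?v x * (?Dv x \<bullet> x)) * ?B x \<partial>lborel)
      \<le> 2 * (D / k\<^sup>2) + (?n - 2) * (((?n + 1) * A + D) / k\<^sup>2)"
      using n3 by (intro add_left_mono mult_left_mono) auto
    also have "\<dots> = (2 * D + (?n - 2) * ((?n + 1) * A + D)) / k\<^sup>2"
      by (simp only: add_divide_distrib[of "2 * D"] times_divide_eq_right)
    finally have "ennreal (g * ?n * (?n - 2) * w) \<le> ennreal ((2 * D + (?n - 2) * ((?n + 1) * A + D)) / k\<^sup>2)"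
      using cap c1 unfolding w_def by (meson ennreal_leI order_trans)
    moreover have "0 \<le> (2 * D + (?n - 2) * ((?n + 1) * A + D)) / k\<^sup>2" using A0 D0 n3 by (simp add: add_nonneg_nonneg)
    ultimately have "g * ?n * (?n - 2) * w \<le> (2 * D + (?n - 2) * ((?n + 1) * A + D)) / k\<^sup>2" by (subst (asm) ennreal_le_iff)
    then show ?thesis using False by (simp add: pos_le_divide_eq)
  qed
  from local_estimate_arith[OF n3 g w D0 AD this U A0]
  show ?thesis unfolding D_def .
qed

text \<open>Scaling reduces to the unit ball; the hypothesis becomes a number through the lower
  bound for the capacity of a ball.\<close>

lemma local_estimate:
  fixes u :: "'a::euclidean_space \<Rightarrow> real"
  assumes n: "3 \<le> DIM('a)" and u: "C1_grad u Du" and r: "0 < r" and F: "F \<subseteq> cball p r" "\<And>x. x \<in> F \<Longrightarrow> u x = 0"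
    and g: "0 < g" "g \<le> 1" and cap: "ennreal g * capacity (cball p r) \<le> capacity F"
  shows "g * (real DIM('a))\<^sup>2 * (real DIM('a) - 2) / (4 * ((real DIM('a))\<^sup>2 - 2)) / r\<^sup>2 *
      (\<integral>x. (u x)\<^sup>2 * indicator (ball p r) x \<partial>lborel)
    \<le> (\<integral>x. (norm (Du x))\<^sup>2 * indicator (ball p r) x \<partial>lborel)"
proof -
  let ?n = "DIM('a)" let ?w = "unit_ball_vol (real ?n)" let ?S = "\<lambda>x. p + r *\<^sub>R x"
  let ?c = "real ?n * (real ?n - 2) * ?w"
  let ?F = "{x. ?S x \<in> F}"
  have n3: "3 \<le> real ?n" using n by simp
  have inb: "?S x \<in> ball p r \<longleftrightarrow> x \<in> ball 0 1" "?S x \<in> cball p r \<longleftrightarrow> x \<in> cball 0 1" for x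
    using r by (auto simp: dist_norm)
  have cu: "continuous_on UNIV u" "continuous_on UNIV Du" using C1_gradD[OF u] by auto
  have u': "C1_grad (\<lambda>x. u (?S x)) (\<lambda>x. r *\<^sub>R Du (?S x))"
    unfolding C1_grad_def
  proof (intro conjI allI)
    fix x
    have "(?S has_derivative (\<lambda>h. r *\<^sub>R h)) (at x)" by (auto intro!: derivative_eq_intros)
    from has_derivative_compose[OF this C1_gradD(1)[OF u]]
    show "((\<lambda>x. u (?S x)) has_derivative (\<lambda>h. (r *\<^sub>R Du (?S x)) \<bullet> h)) (at x)" by simp
    show "continuous_on UNIV (\<lambda>x. r *\<^sub>R Du (?S x))"
      by (intro continuous_intros continuous_on_compose2[OF cu(2)]) auto
  qed
  have "{y. - (1/r) *\<^sub>R p + (1/r) *\<^sub>R y \<in> ?F} = F"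
  proof -
    have "p + r *\<^sub>R (- (1/r) *\<^sub>R p + (1/r) *\<^sub>R y) = y" for y using r by (simp add: algebra_simps)
    then show ?thesis by simp
  qed
  then have sc: "ennreal ((1/r) ^ (?n - 2)) * capacity F \<le> capacity ?F"
    using capacity_scaling[of "1/r" "- (1/r) *\<^sub>R p" ?F] r n by simp
  have "ennreal (g * (?c * r ^ (?n - 2))) = ennreal g * ennreal (?c * r ^ (?n - 2))"
    using g n3 r by (intro ennreal_mult) auto
  also have "\<dots> \<le> ennreal g * capacity (cball p r)"
    by (intro mult_left_mono capacity_cball_ge[OF n r]) simp
  also have "\<dots> \<le> capacity F" by (rule cap)
  finally have "ennreal ((1/r) ^ (?n - 2)) * ennreal (g * (?c * r ^ (?n - 2))) \<le> ennreal ((1/r) ^ (?n - 2)) * capacity F"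
    by (rule mult_left_mono) simp
  also note sc
  also have "ennreal ((1/r) ^ (?n - 2)) * ennreal (g * (?c * r ^ (?n - 2))) = ennreal (g * ?c)"
    using r g n3 by (simp add: ennreal_mult[symmetric] power_one_over)
  finally have cap': "ennreal (g * real ?n * (real ?n - 2) * ?w) \<le> capacity ?F" by (simp add: mult.assoc)
  have F': "?F \<subseteq> cball 0 1" using F(1) inb(2) by blast
  have est: "g * (real ?n)\<^sup>2 * (real ?n - 2) / (4 * ((real ?n)\<^sup>2 - 2)) * (\<integral>x. (u (?S x))\<^sup>2 * indicator (ball 0 1) x \<partial>lborel)
    \<le> (\<integral>x. (norm (r *\<^sub>R Du (?S x)))\<^sup>2 * indicator (ball 0 1) x \<partial>lborel)"
    by (rule local_estimate_unit[OF n u' F' _ g cap']) (use F(2) in auto)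
  have ind: "indicator (ball p r) (?S x) = (indicator (ball 0 1) x :: real)" for x using inb(1)[of x] by (simp only: indicator_def)
  have [measurable]: "u \<in> borel_measurable borel" "Du \<in> borel_measurable borel"
    using cu by (auto intro: borel_measurable_continuous_onI)
  have [measurable]: "ball p r \<in> sets borel" by simp
  have 1: "(\<integral>x. (u x)\<^sup>2 * indicator (ball p r) x \<partial>lborel) = r ^ ?n * (\<integral>x. (u (?S x))\<^sup>2 * indicator (ball 0 1) x \<partial>lborel)"
    using integral_affine(1)[of "\<lambda>x. (u x)\<^sup>2 * indicator (ball p r) x" r p] r by (simp add: ind)
  have 2: "(\<integral>x. (norm (Du x))\<^sup>2 * indicator (ball p r) x \<partial>lborel) = r ^ ?n * (\<integral>x. (norm (Du (?S x)))\<^sup>2 * indicator (ball 0 1) x \<partial>lborel)"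
    using integral_affine(1)[of "\<lambda>x. (norm (Du x))\<^sup>2 * indicator (ball p r) x" r p] r by (simp add: ind)
  have 3: "(\<integral>x. (norm (r *\<^sub>R Du (?S x)))\<^sup>2 * indicator (ball 0 1) x \<partial>lborel) = r\<^sup>2 * (\<integral>x. (norm (Du (?S x)))\<^sup>2 * indicator (ball 0 1) x \<partial>lborel)"
    using r by (simp add: power_mult_distrib mult.assoc)
  have gen: "C / r\<^sup>2 * (R * U) \<le> R * V" if "C * U \<le> r\<^sup>2 * V" "0 \<le> R" for C U V R
  proof -
    have "R * (C * U / r\<^sup>2) \<le> R * V" using that r by (intro mult_left_mono) (simp_all add: divide_le_eq mult.commute)
    then show ?thesis by (simp add: mult_ac)
  qed
  show ?thesis unfolding 1 2 by (rule gen[OF est[unfolded 3]]) (use r in simp)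
qed

section \<open>Test functions and coverings\<close>

lemma C_k_imp_C1_grad:
  fixes u :: "'a::euclidean_space \<Rightarrow> real"
  assumes u: "\<forall>k. C_k k u" shows "C1_grad u (gradient u)"
proof -
  have u1: "C_k (Suc 0) u" using u by blast
  have diff: "\<And>x. u differentiable (at x)" and cp: "\<And>b. b \<in> Basis \<Longrightarrow> continuous_on UNIV (partial_deriv b u)"
    using u1 by auto
  have "(u has_derivative (\<lambda>h. gradient u x \<bullet> h)) (at x)" for x
  proof -
    obtain D where D: "(u has_derivative D) (at x)" using diff[of x] unfolding differentiable_def by blast
    have "D h = gradient u x \<bullet> h" for h
    proof -
      have "D h = D (\<Sum>b\<in>Basis. (h \<bullet> b) *\<^sub>R b)" by (simp only: euclidean_representation)
      also have "\<dots> = (\<Sum>b\<in>Basis. (h \<bullet> b) * D b)"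
        using has_derivative_linear[OF D] by (simp add: linear_sum linear_scale)
      also have "\<dots> = (\<Sum>b\<in>Basis. (gradient u x \<bullet> b) * (h \<bullet> b))"
        by (intro sum.cong refl) (simp add: gradient_inner_Basis has_partial_imp_partial_deriv[OF has_partial_has_derivative[OF D]] mult.commute)
      also have "\<dots> = gradient u x \<bullet> h" by (rule euclidean_inner[symmetric])
      finally show ?thesis .
    qed
    then have "D = (\<lambda>h. gradient u x \<bullet> h)" by (rule ext)
    then show ?thesis using D by simp
  qed
  moreover have "continuous_on UNIV (gradient u)"
    unfolding gradient_def[abs_def] by (intro continuous_intros cp)
  ultimately show ?thesis by (simp add: C1_grad_def)
qed

lemma nn_integral_square_pos:
  fixes u :: "'a::euclidean_space \<Rightarrow> real"
  assumes c: "continuous_on UNIV u" and "u \<noteq> (\<lambda>_. 0)"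
  shows "(\<integral>\<^sup>+x. ennreal ((u x)\<^sup>2) \<partial>lborel) \<noteq> 0"
proof
  assume "(\<integral>\<^sup>+x. ennreal ((u x)\<^sup>2) \<partial>lborel) = 0"
  moreover have [measurable]: "u \<in> borel_measurable borel" by (rule borel_measurable_continuous_onI[OF c])
  ultimately have "AE x in lborel. ennreal ((u x)\<^sup>2) = 0" by (subst (asm) nn_integral_0_iff_AE) auto
  then have ae: "AE x in lborel. u x = 0" by eventually_elim (simp add: ennreal_eq_0_iff)
  have op: "open {x. u x \<noteq> 0}" using c by (intro open_Collect_neq) auto
  have "{x \<in> space lborel. \<not> u x = 0} \<in> sets lborel" using borel_open[OF op] by simp
  from ae have "{x \<in> space lborel. \<not> u x = 0} \<in> null_sets lborel" by (simp only: AE_iff_null[OF \<open>{x \<in> space lborel. \<not> u x = 0} \<in> sets lborel\<close>])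
  then have "negligible {x. u x \<noteq> 0}" by (simp add: negligible_iff_null_sets null_sets_completionI)
  moreover note op
  ultimately have "{x. u x \<noteq> 0} = {}" using open_not_negligible by blast
  then show False using assms(2) by auto
qed

lemma test_function_outside:
  assumes u: "u \<in> test_functions \<Omega>" and x: "x \<notin> \<Omega>"
  shows "u x = 0" "gradient u x = 0"
proof -
  have x: "x \<in> - closure {x. u x \<noteq> 0}" using u x unfolding test_functions_def by auto
  then show "u x = 0" using closure_subset[of "{x. u x \<noteq> 0}"] by blast
  have "has_partial b u x 0" for b
  proof (rule has_partial_cong_open[OF has_partial_const _ x])
    show "open (- closure {x. u x \<noteq> 0})" by auto
    show "u y = 0" if "y \<in> - closure {x. u x \<noteq> 0}" for y using that closure_subset[of "{x. u x \<noteq> 0}"] by blast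
  qed
  from has_partial_imp_partial_deriv[OF this] show "gradient u x = 0" by (simp add: gradient_def)
qed

text \<open>By Tonelli the sum of the integrals over the balls is the integral of \<open>f\<close>
  weighted with the number of balls containing the point, a number between 1 and
  \<open>N\<close>.\<close>

lemma covering_integral_sandwich:
  fixes S :: "'a::euclidean_space set" and f :: "'a \<Rightarrow> ennreal"
  assumes S: "ball_covering S \<rho> N" and f[measurable]: "f \<in> borel_measurable borel"
  shows "(\<integral>\<^sup>+x. f x \<partial>lborel) \<le> (\<integral>\<^sup>+p. (\<integral>\<^sup>+x\<in>cball p \<rho>. f x \<partial>lborel) \<partial>count_space S)"
    "(\<integral>\<^sup>+p. (\<integral>\<^sup>+x\<in>cball p \<rho>. f x \<partial>lborel) \<partial>count_space S) \<le> of_nat N * (\<integral>\<^sup>+x. f x \<partial>lborel)"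
proof -
  have cnt: "countable S" and UN: "(\<Union>a\<in>S. cball a \<rho>) = UNIV" and fin: "\<And>x. finite {a \<in> S. x \<in> cball a \<rho>}"
    and N: "\<And>x. card {a \<in> S. x \<in> cball a \<rho>} \<le> N"
    using S unfolding ball_covering_def by auto
  have cov: "\<exists>a\<in>S. x \<in> cball a \<rho>" for x using UN by blast
  have "(\<integral>\<^sup>+p. (\<integral>\<^sup>+x\<in>cball p \<rho>. f x \<partial>lborel) \<partial>count_space S) = (\<integral>\<^sup>+x. (\<integral>\<^sup>+p. f x * indicator (cball p \<rho>) x \<partial>count_space S) \<partial>lborel)"
    by (rule nn_integral_count_space_nn_integral[OF cnt, symmetric]) (intro borel_measurable_times_ennreal borel_measurable_indicator, auto)
  also have "\<dots> = (\<integral>\<^sup>+x. f x * of_nat (card {a \<in> S. x \<in> cball a \<rho>}) \<partial>lborel)"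
  proof (rule nn_integral_cong)
    fix x :: 'a
    have "(\<integral>\<^sup>+p. f x * indicator (cball p \<rho>) x \<partial>count_space S) = (\<integral>\<^sup>+p. f x * indicator {a \<in> S. x \<in> cball a \<rho>} p \<partial>count_space S)"
      by (intro nn_integral_cong) (auto simp: indicator_def)
    also have "\<dots> = f x * emeasure (count_space S) {a \<in> S. x \<in> cball a \<rho>}"
      by (rule nn_integral_cmult_indicator) auto
    also have "emeasure (count_space S) {a \<in> S. x \<in> cball a \<rho>} = of_nat (card {a \<in> S. x \<in> cball a \<rho>})"
      using fin by (intro emeasure_count_space_finite) auto
    finally show "(\<integral>\<^sup>+p. f x * indicator (cball p \<rho>) x \<partial>count_space S) = f x * of_nat (card {a \<in> S. x \<in> cball a \<rho>})" .
  qed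
  finally have eq: "(\<integral>\<^sup>+p. (\<integral>\<^sup>+x\<in>cball p \<rho>. f x \<partial>lborel) \<partial>count_space S) = (\<integral>\<^sup>+x. f x * of_nat (card {a \<in> S. x \<in> cball a \<rho>}) \<partial>lborel)" .
  show "(\<integral>\<^sup>+x. f x \<partial>lborel) \<le> (\<integral>\<^sup>+p. (\<integral>\<^sup>+x\<in>cball p \<rho>. f x \<partial>lborel) \<partial>count_space S)"
    unfolding eq
  proof (rule nn_integral_mono)
    fix x :: 'a
    have "1 \<le> card {a \<in> S. x \<in> cball a \<rho>}"
      using cov[of x] fin[of x] by (auto simp: Suc_le_eq card_gt_0_iff)
    then have "of_nat 1 \<le> (of_nat (card {a \<in> S. x \<in> cball a \<rho>}) :: ennreal)" by (simp only: of_nat_le_iff)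
    then have "f x * of_nat 1 \<le> f x * of_nat (card {a \<in> S. x \<in> cball a \<rho>})" by (rule mult_left_mono) simp
    then show "f x \<le> f x * of_nat (card {a \<in> S. x \<in> cball a \<rho>})" by simp
  qed
  have "(\<integral>\<^sup>+x. f x * of_nat (card {a \<in> S. x \<in> cball a \<rho>}) \<partial>lborel) \<le> (\<integral>\<^sup>+x. of_nat N * f x \<partial>lborel)"
  proof (rule nn_integral_mono)
    fix x :: 'a
    have "of_nat (card {a \<in> S. x \<in> cball a \<rho>}) \<le> (of_nat N :: ennreal)" by (simp only: of_nat_le_iff N)
    then show "f x * of_nat (card {a \<in> S. x \<in> cball a \<rho>}) \<le> of_nat N * f x"
      by (metis mult.commute mult_right_mono zero_le)
  qed
  also have "\<dots> = of_nat N * (\<integral>\<^sup>+x. f x \<partial>lborel)" by (rule nn_integral_cmult) simp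
  finally show "(\<integral>\<^sup>+p. (\<integral>\<^sup>+x\<in>cball p \<rho>. f x \<partial>lborel) \<partial>count_space S) \<le> of_nat N * (\<integral>\<^sup>+x. f x \<partial>lborel)"
    unfolding eq .
qed

text \<open>Multiplicity does not change under scaling, so one covering serves every radius above
  the capacitary radius.\<close>

lemma ball_covering_rescale:
  fixes S :: "'a::euclidean_space set"
  assumes S: "ball_covering S \<rho> N" and r: "0 < r"
  shows "ball_covering ((\<lambda>x. (r / \<rho>) *\<^sub>R x) ` S) r N"
proof -
  have \<rho>: "0 < \<rho>" and cnt: "countable S" and cov: "(\<Union>a\<in>S. cball a \<rho>) = UNIV"
    and N: "\<And>x. finite {a \<in> S. x \<in> cball a \<rho>} \<and> card {a \<in> S. x \<in> cball a \<rho>} \<le> N"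
    using S unfolding ball_covering_def by auto
  define c where "c = r / \<rho>"
  have c: "0 < c" "c * \<rho> = r" using r \<rho> by (auto simp: c_def)
  have mem: "c *\<^sub>R y \<in> cball (c *\<^sub>R a) r \<longleftrightarrow> y \<in> cball a \<rho>" for a y :: 'a
  proof -
    have "dist (c *\<^sub>R a) (c *\<^sub>R y) = c * dist a y" using c by (simp add: dist_norm scaleR_diff_right[symmetric])
    then show ?thesis using c by (simp flip: c(2))
  qed
  have x: "x = c *\<^sub>R ((1/c) *\<^sub>R x)" for x :: 'a using c by simp
  have set: "{a \<in> (\<lambda>x. c *\<^sub>R x) ` S. x \<in> cball a r} = (\<lambda>x. c *\<^sub>R x) ` {a \<in> S. (1/c) *\<^sub>R x \<in> cball a \<rho>}" for x
    using mem[of "(1/c) *\<^sub>R x"] x[of x] by auto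
  have "\<exists>a\<in>(\<lambda>x. c *\<^sub>R x) ` S. x \<in> cball a r" for x
  proof -
    obtain a where "a \<in> S" "(1/c) *\<^sub>R x \<in> cball a \<rho>" using cov by blast
    then show ?thesis using set[of x] by blast
  qed
  moreover have "finite {a \<in> (\<lambda>x. c *\<^sub>R x) ` S. x \<in> cball a r} \<and> card {a \<in> (\<lambda>x. c *\<^sub>R x) ` S. x \<in> cball a r} \<le> N" for x
    unfolding set using N[of "(1/c) *\<^sub>R x"] card_image_le by (meson finite_imageI order_trans)
  ultimately show ?thesis unfolding ball_covering_def c_def[symmetric] using r cnt by auto
qed

lemma nn_integral_cball_eq_ball:
  fixes p :: "'a::euclidean_space"
  assumes c: "continuous_on UNIV f" and f0: "\<And>x. 0 \<le> f x"
  shows "(\<integral>\<^sup>+x\<in>cball p r. ennreal (f x) \<partial>lborel) = ennreal (\<integral>x. f x * indicator (ball p r) x \<partial>lborel)"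
proof -
  have "(\<integral>\<^sup>+x\<in>cball p r. ennreal (f x) \<partial>lborel) = (\<integral>\<^sup>+x. ennreal (f x * indicator (ball p r) x) \<partial>lborel)"
  proof (rule nn_integral_cong_AE)
    have "AE y in lborel. norm (y::'a) \<notin> {r}" by (rule AE_norm_notin_finite) simp
    from AE_affine[OF this, of 1 "- p"]
    have "AE x in lborel. norm (x - p) \<noteq> r" by simp
    then show "AE x in lborel. ennreal (f x) * indicator (cball p r) x = ennreal (f x * indicator (ball p r) x)"
    proof eventually_elim
      fix x assume "norm (x - p) \<noteq> r"
      then show "ennreal (f x) * indicator (cball p r) x = ennreal (f x * indicator (ball p r) x)"
        by (cases "x \<in> ball p r") (auto simp: indicator_def dist_norm norm_minus_commute)
    qed
  qed
  also have "\<dots> = ennreal (\<integral>x. f x * indicator (ball p r) x \<partial>lborel)"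
    by (rule nn_integral_eq_integral[OF integrable_ball_continuous[OF c]]) (use f0 in auto)
  finally show ?thesis .
qed

lemma dirichlet_bottom_ge:
  fixes \<Omega> S :: "'a::euclidean_space set"
  assumes n: "3 \<le> DIM('a)" and g: "0 < g" "g < 1" and \<Omega>: "open \<Omega>" and N: "0 < N" and S: "ball_covering S \<rho> N"
    and r: "0 < r" "capacitary_radius \<Omega> g < ennreal r"
  shows "ennreal (lower_const g DIM('a) N / r\<^sup>2) \<le> dirichlet_bottom \<Omega>"
  unfolding dirichlet_bottom_def
proof (rule INF_greatest)
  fix u assume u: "u \<in> {u \<in> test_functions \<Omega>. u \<noteq> (\<lambda>_. 0)}"
  then have ut: "u \<in> test_functions \<Omega>" and u0: "u \<noteq> (\<lambda>_. 0)" by auto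
  let ?n = "real DIM('a)"
  have n3: "3 \<le> ?n" using n by simp
  have C1: "C1_grad u (gradient u)" using ut by (intro C_k_imp_C1_grad) (auto simp: test_functions_def)
  have cu: "continuous_on UNIV u" "continuous_on UNIV (gradient u)" using C1_gradD[OF C1] by auto
  have [measurable]: "u \<in> borel_measurable borel" "gradient u \<in> borel_measurable borel"
    using cu by (auto intro: borel_measurable_continuous_onI)
  define c where "c = g * ?n\<^sup>2 * (?n - 2) / (4 * (?n\<^sup>2 - 2)) / r\<^sup>2"
  have n2: "0 < ?n\<^sup>2 - 2" using power_mono[OF n3, of 2] by simp
  have c0: "0 < c" using g n3 n2 r by (simp add: c_def)
  have loc: "c * (\<integral>x. (u x)\<^sup>2 * indicator (ball p r) x \<partial>lborel) \<le> (\<integral>x. (norm (gradient u x))\<^sup>2 * indicator (ball p r) x \<partial>lborel)" for p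
  proof -
    have "\<not> negligible_in_cball g (cball p r - \<Omega>) p r"
    proof
      assume "negligible_in_cball g (cball p r - \<Omega>) p r"
      then have "ennreal r \<le> capacitary_radius \<Omega> g"
        unfolding capacitary_radius_def using r(1) by (intro SUP_upper) auto
      then show False using r(2) by simp
    qed
    moreover have "compact (cball p r - \<Omega>)" using \<Omega> by (intro compact_diff) auto
    ultimately have "ennreal g * capacity (cball p r) \<le> capacity (cball p r - \<Omega>)"
      unfolding negligible_in_cball_def by auto
    then show ?thesis unfolding c_def
      by (intro local_estimate[OF n C1 r(1), of "cball p r - \<Omega>"]) (use g test_function_outside(1)[OF ut] in auto)
  qed
  let ?U = "\<integral>\<^sup>+x. ennreal ((u x)\<^sup>2) \<partial>lborel" and ?V = "\<integral>\<^sup>+x. ennreal ((norm (gradient u x))\<^sup>2) \<partial>lborel"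
  let ?S = "(\<lambda>x::'a. (r / \<rho>) *\<^sub>R x) ` S"
  have S': "ball_covering ?S r N" by (rule ball_covering_rescale[OF S r(1)])
  \<comment> \<open>On the left each point is counted at least once, on the gradient side at most
    \<open>N\<close> times; this is where \<open>1 / N\<close> enters the constant.\<close>
  have "ennreal c * ?U \<le> ennreal c * (\<integral>\<^sup>+p. (\<integral>\<^sup>+x\<in>cball p r. ennreal ((u x)\<^sup>2) \<partial>lborel) \<partial>count_space ?S)"
    by (intro mult_left_mono covering_integral_sandwich(1)[OF S']) auto
  also have "\<dots> = (\<integral>\<^sup>+p. ennreal c * (\<integral>\<^sup>+x\<in>cball p r. ennreal ((u x)\<^sup>2) \<partial>lborel) \<partial>count_space ?S)"
    by (rule nn_integral_cmult[symmetric]) simp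
  also have "\<dots> \<le> (\<integral>\<^sup>+p. (\<integral>\<^sup>+x\<in>cball p r. ennreal ((norm (gradient u x))\<^sup>2) \<partial>lborel) \<partial>count_space ?S)"
  proof (rule nn_integral_mono)
    fix p
    have 1: "(\<integral>\<^sup>+x\<in>cball p r. ennreal ((u x)\<^sup>2) \<partial>lborel) = ennreal (\<integral>x. (u x)\<^sup>2 * indicator (ball p r) x \<partial>lborel)"
      by (rule nn_integral_cball_eq_ball) (auto intro!: continuous_intros cu)
    have 2: "(\<integral>\<^sup>+x\<in>cball p r. ennreal ((norm (gradient u x))\<^sup>2) \<partial>lborel) = ennreal (\<integral>x. (norm (gradient u x))\<^sup>2 * indicator (ball p r) x \<partial>lborel)"
      by (rule nn_integral_cball_eq_ball) (auto intro!: continuous_intros cu)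
    show "ennreal c * (\<integral>\<^sup>+x\<in>cball p r. ennreal ((u x)\<^sup>2) \<partial>lborel) \<le> (\<integral>\<^sup>+x\<in>cball p r. ennreal ((norm (gradient u x))\<^sup>2) \<partial>lborel)"
      unfolding 1 2 using loc[of p] c0 by (subst ennreal_mult[symmetric]) (auto intro!: ennreal_leI Bochner_Integration.integral_nonneg)
  qed
  also have "\<dots> \<le> of_nat N * ?V" by (rule covering_integral_sandwich(2)[OF S']) measurable
  finally have main: "ennreal c * ?U \<le> of_nat N * ?V" .
  have "ennreal (1 / real N) * (ennreal c * ?U) \<le> ennreal (1 / real N) * (of_nat N * ?V)"
    by (rule mult_left_mono[OF main]) simp
  also have "\<dots> = ?V"
  proof -
    have "ennreal (1 / real N) * of_nat N = 1"
      using N by (simp add: ennreal_of_nat_eq_real_of_nat ennreal_mult[symmetric])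
    then show ?thesis by (simp only: mult.assoc[symmetric] mult_1)
  qed
  finally have "(ennreal (1 / real N) * ennreal c) * ?U \<le> ?V" by (simp only: mult.assoc)
  moreover have "ennreal (1 / real N) * ennreal c = ennreal (lower_const g DIM('a) N / r\<^sup>2)"
    using c0 N by (simp add: ennreal_mult[symmetric] c_def lower_const_def mult_ac)
  ultimately have main2: "ennreal (lower_const g DIM('a) N / r\<^sup>2) * ?U \<le> ?V" by simp
  \<comment> \<open>In \<open>ennreal\<close> a factor may be cancelled against the denominator only
    when it is neither 0 nor infinite.\<close>
  have U0: "?U \<noteq> 0" by (rule nn_integral_square_pos[OF cu(1) u0])
  have Utop: "?U \<noteq> top"
  proof -
    obtain R where R: "\<And>x. R < norm x \<Longrightarrow> u x = 0"
      using ut unfolding test_functions_def has_compact_support_iff by blast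
    have "integrable lborel (\<lambda>x. (u x)\<^sup>2)"
      by (rule integrable_continuous_compact_support[of _ R]) (auto intro!: continuous_intros cu simp: R)
    then have "?U = ennreal (\<integral>x. (u x)\<^sup>2 \<partial>lborel)" by (rule nn_integral_eq_integral) simp
    then show ?thesis by simp
  qed
  have V: "(\<integral>\<^sup>+x\<in>\<Omega>. ennreal ((norm (gradient u x))\<^sup>2) \<partial>lborel) = ?V"
    by (intro nn_integral_cong) (auto simp: indicator_def test_function_outside(2)[OF ut])
  have U: "(\<integral>\<^sup>+x\<in>\<Omega>. ennreal (\<bar>u x\<bar>\<^sup>2) \<partial>lborel) = ?U"
    by (intro nn_integral_cong) (auto simp: indicator_def test_function_outside(1)[OF ut])
  have "ennreal (lower_const g DIM('a) N / r\<^sup>2) = ennreal (lower_const g DIM('a) N / r\<^sup>2) * ?U / ?U"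
    using U0 Utop by (simp add: ennreal_mult_divide_eq)
  also have "\<dots> \<le> ?V / ?U" by (rule divide_right_mono_ennreal[OF main2])
  finally show "ennreal (lower_const g DIM('a) N / r\<^sup>2) \<le>
      (\<integral>\<^sup>+x\<in>\<Omega>. ennreal ((norm (gradient u x))\<^sup>2) \<partial>lborel) / (\<integral>\<^sup>+x\<in>\<Omega>. ennreal (\<bar>u x\<bar>\<^sup>2) \<partial>lborel)"
    unfolding U V .
qed

text \<open>The estimate holds for every radius above the capacitary radius \<open>R\<close>, and
  \<open>r\<close> may decrease to \<open>R\<close>. For \<open>R = 0\<close> it exceeds every
  finite value, so that the bottom of the spectrum is infinite.\<close>

lemma lower_bound:
  fixes \<Omega> S :: "'a::euclidean_space set"
  assumes n: "3 \<le> DIM('a)" and g: "0 < g" "g < 1" and \<Omega>: "open \<Omega>" and N: "0 < N" and S: "ball_covering S \<rho> N"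
  shows "ennreal (lower_const g DIM('a) N) * inverse ((capacitary_radius \<Omega> g)\<^sup>2) \<le> dirichlet_bottom \<Omega>"
proof (cases "capacitary_radius \<Omega> g")
  case top
  then show ?thesis by simp
next
  case (real R)
  let ?c = "lower_const g DIM('a) N"
  have n3: "3 \<le> real DIM('a)" using n by simp
  have n2: "0 < (real DIM('a))\<^sup>2 - 2" using power_mono[OF n3, of 2] by simp
  have c: "0 < ?c" unfolding lower_const_def using g n3 n2 N by (intro divide_pos_pos mult_pos_pos) auto
  have ge: "ennreal (?c / r\<^sup>2) \<le> dirichlet_bottom \<Omega>" if "R < r" for r
    by (rule dirichlet_bottom_ge[OF n g \<Omega> N S]) (use that real in \<open>auto intro: ennreal_lessI\<close>)
  show ?thesis
  proof (cases "dirichlet_bottom \<Omega>")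
    case (real l)
    have le: "?c / r\<^sup>2 \<le> l" if "R < r" for r using ge[OF that] real by simp
    have "0 < R"
    proof (rule ccontr)
      assume "\<not> 0 < R"
      then have R: "R = 0" using \<open>0 \<le> R\<close> by simp
      \<comment> \<open>Chosen so that \<open>?c / r\<^sup>2\<close> equals
        \<open>l + 1\<close>.\<close>
      define r where "r = sqrt (?c / (l + 1))"
      have r: "0 < r" "r\<^sup>2 = ?c / (l + 1)" using c \<open>0 \<le> l\<close> by (auto simp: r_def)
      have "?c / r\<^sup>2 \<le> l" using le[of r] r R by simp
      moreover have "?c / r\<^sup>2 = l + 1" unfolding r(2) using c \<open>0 \<le> l\<close> by simp
      ultimately show False by simp
    qed
    have "?c / R\<^sup>2 \<le> l"
    proof (rule tendsto_upperbound)
      show "((\<lambda>r. ?c / r\<^sup>2) \<longlongrightarrow> ?c / R\<^sup>2) (at_right R)" using \<open>0 < R\<close> by (intro tendsto_intros) auto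
      show "\<forall>\<^sub>F r in at_right R. ?c / r\<^sup>2 \<le> l"
        by (rule eventually_mono[OF eventually_at_right_less]) (rule le)
    qed simp
    moreover have "ennreal ?c * inverse ((ennreal R)\<^sup>2) = ennreal (?c / R\<^sup>2)"
      using \<open>0 < R\<close> c by (simp add: ennreal_power inverse_ennreal ennreal_mult[symmetric] divide_inverse)
    ultimately show ?thesis using \<open>capacitary_radius \<Omega> g = ennreal R\<close> real by (simp add: ennreal_leI)
  qed simp
qed

section \<open>Mollification\<close>

text \<open>Smoothness of \<open>exp (-1/t)\<close> at \<open>0\<close>: derivatives stay in the family indexed by polynomials in \<open>1/t\<close>.\<close>

definition flat_exp :: "real poly \<Rightarrow> real \<Rightarrow> real" where
  "flat_exp p t = (if t \<le> 0 then 0 else poly p (1 / t) * exp (- (1 / t)))"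

lemma poly_times_exp_minus_tendsto_0:
  fixes p :: "real poly"
  shows "((\<lambda>y. poly p y * exp (- y)) \<longlongrightarrow> 0) at_top"
proof -
  have "((\<lambda>y. \<Sum>i\<le>degree p. coeff p i * (y ^ i / exp y)) \<longlongrightarrow> (\<Sum>i\<le>degree p. coeff p i * 0)) at_top"
    by (intro tendsto_intros tendsto_power_div_exp_0)
  then show ?thesis
    by (simp add: poly_altdef sum_distrib_right exp_minus divide_inverse mult.assoc)
qed

text \<open>With \<open>y = 1 / t\<close>, differentiating \<open>p(y) exp(-y)\<close> in
  \<open>t\<close> replaces \<open>p\<close> by \<open>y^2 (p - p')\<close>. At 0 the right
  difference quotient is \<open>y p(y) exp(-y)\<close>, which tends to 0 as \<open>y\<close>
  grows.\<close>

lemma DERIV_flat_exp: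
  "(flat_exp p has_real_derivative flat_exp ([:0, 0, 1:] * (p - pderiv p)) t) (at t)"
proof -
  let ?q = "[:0, 0, 1:] * (p - pderiv p)"
  consider "t < 0" | "t > 0" | "t = 0" by linarith
  then show ?thesis
  proof cases
    case 1
    have "((\<lambda>_. 0) has_real_derivative 0) (at t)" by simp
    then have "(flat_exp p has_real_derivative 0) (at t)"
      by (rule has_field_derivative_transform_within_open[of _ _ _ "{..<0}"]) (use 1 in \<open>auto simp: flat_exp_def\<close>)
    then show ?thesis using 1 by (simp add: flat_exp_def)
  next
    case 2
    have d1: "((\<lambda>t. 1 / t) has_real_derivative - (1 / t\<^sup>2)) (at t)"
      using 2 by (auto intro!: derivative_eq_intros simp: power2_eq_square)
    have d2: "((\<lambda>t. poly p (1 / t)) has_real_derivative poly (pderiv p) (1 / t) * - (1 / t\<^sup>2)) (at t)"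
      by (rule DERIV_chain2[OF poly_DERIV d1])
    have d3: "((\<lambda>t. exp (- (1 / t))) has_real_derivative exp (- (1 / t)) * - (- (1 / t\<^sup>2))) (at t)"
      by (rule DERIV_chain2[OF DERIV_exp DERIV_minus[OF d1]])
    have "((\<lambda>t. poly p (1 / t) * exp (- (1 / t))) has_real_derivative flat_exp ?q t) (at t)"
      by (rule DERIV_cong[OF DERIV_mult[OF d2 d3]])
        (use 2 in \<open>simp add: flat_exp_def field_simps power2_eq_square\<close>)
    then show ?thesis
      by (rule has_field_derivative_transform_within_open[of _ _ _ "{0<..}"]) (use 2 in \<open>auto simp: flat_exp_def\<close>)
  next
    case 3
    have "((\<lambda>h. flat_exp p h / h) \<longlongrightarrow> 0) (at 0)"
    proof (rule filterlim_split_at)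
      have "((\<lambda>h::real. 0::real) \<longlongrightarrow> 0) (at_left 0)" by simp
      moreover have "\<forall>\<^sub>F h in at_left (0::real). 0 = flat_exp p h / h"
        by (simp add: eventually_at_filter flat_exp_def)
      ultimately show "((\<lambda>h. flat_exp p h / h) \<longlongrightarrow> 0) (at_left 0)" by (rule Lim_transform_eventually)
      have "((\<lambda>h. poly ([:0, 1:] * p) (inverse h) * exp (- inverse h)) \<longlongrightarrow> 0) (at_right (0::real))"
        by (rule filterlim_compose[OF poly_times_exp_minus_tendsto_0 filterlim_inverse_at_top_right])
      moreover have "\<forall>\<^sub>F h in at_right (0::real). poly ([:0, 1:] * p) (inverse h) * exp (- inverse h) = flat_exp p h / h"
        by (rule eventually_mono[OF eventually_at_right_less]) (simp add: flat_exp_def divide_inverse)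
      ultimately show "((\<lambda>h. flat_exp p h / h) \<longlongrightarrow> 0) (at_right 0)" by (rule Lim_transform_eventually)
    qed
    then show ?thesis using 3 by (simp add: DERIV_def flat_exp_def)
  qed
qed

section \<open>Closure properties of smooth functions\<close>

lemma C_k_Suc_imp: "C_k (Suc k) u \<Longrightarrow> C_k k u"
proof (induction k arbitrary: u)
  case 0
  then show ?case by (simp add: continuous_at_imp_continuous_on differentiable_imp_continuous_within)
next
  case (Suc k)
  then show ?case by (metis C_k.simps(2))
qed

lemma has_partial_differentiable:
  fixes u :: "'a::euclidean_space \<Rightarrow> real"
  assumes "u differentiable (at x)" shows "has_partial b u x (partial_deriv b u x)"
proof -
  obtain D where "(u has_derivative D) (at x)" using assms unfolding differentiable_def by blast
  from has_partial_has_derivative[OF this, of b] show ?thesis by (simp add: has_partial_imp_partial_deriv)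
qed

lemma C_k_add: "C_k k u \<Longrightarrow> C_k k v \<Longrightarrow> C_k k (\<lambda>x. u x + v x)"
proof (induction k arbitrary: u v)
  case 0
  then show ?case by (simp add: continuous_intros)
next
  case (Suc k)
  have "partial_deriv b (\<lambda>x. u x + v x) = (\<lambda>x. partial_deriv b u x + partial_deriv b v x)" for b
    using Suc.prems by (intro ext has_partial_imp_partial_deriv has_partial_add has_partial_differentiable) auto
  then show ?case using Suc by auto
qed

lemma C_k_mult: "C_k k u \<Longrightarrow> C_k k v \<Longrightarrow> C_k k (\<lambda>x. u x * v x)"
proof (induction k arbitrary: u v)
  case 0
  then show ?case by (simp add: continuous_intros)
next
  case (Suc k)
  have "partial_deriv b (\<lambda>x. u x * v x) = (\<lambda>x. partial_deriv b u x * v x + partial_deriv b v x * u x)" for b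
    using Suc.prems by (intro ext has_partial_imp_partial_deriv has_partial_mult has_partial_differentiable) auto
  moreover have "C_k k u" "C_k k v" using Suc.prems by (auto intro: C_k_Suc_imp)
  ultimately show ?case using Suc by (auto intro!: C_k_add Suc.IH)
qed

lemma C_k_const: "C_k k (\<lambda>x. c)"
proof (induction k arbitrary: c)
  case (Suc k)
  have "partial_deriv b (\<lambda>x. c) = (\<lambda>x. 0)" for b :: 'a
    by (intro ext has_partial_imp_partial_deriv has_partial_const)
  then show ?case using Suc by simp
qed simp

lemma C_k_inner: "C_k k (\<lambda>x. x \<bullet> a)"
proof (cases k)
  case (Suc j)
  have d: "((\<lambda>x. x \<bullet> a) has_derivative (\<lambda>h. h \<bullet> a)) (at x)" for x
    by (auto intro!: derivative_eq_intros)
  have "partial_deriv b (\<lambda>x. x \<bullet> a) = (\<lambda>x. b \<bullet> a)" for b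
    by (intro ext has_partial_imp_partial_deriv has_partial_has_derivative d)
  then show ?thesis using Suc d by (auto simp: C_k_const differentiable_def)
qed (simp add: continuous_intros)

text \<open>The induction leaves the polynomial arbitrary, since every derivative brings in another
  one; \<open>x \<bullet> x\<close> is taken instead of the norm because it is smooth at the
  origin.\<close>

lemma C_k_flat_exp: "C_k k (\<lambda>x::'a::euclidean_space. flat_exp p (c - x \<bullet> x))"
proof (induction k arbitrary: p)
  case 0
  have "continuous_on UNIV (flat_exp p)"
    using DERIV_flat_exp DERIV_isCont continuous_at_imp_continuous_on by blast
  then have "continuous_on UNIV (\<lambda>x::'a. flat_exp p (c - x \<bullet> x))"
    by (rule continuous_on_compose2) (auto intro!: continuous_intros)
  then show ?case by simp
next
  case (Suc k)
  let ?q = "[:0, 0, 1:] * (p - pderiv p)"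
  have d: "((\<lambda>x::'a. flat_exp p (c - x \<bullet> x)) has_derivative (\<lambda>h. flat_exp ?q (c - x \<bullet> x) * (- 2 * (x \<bullet> h)))) (at x)" for x
  proof -
    have "((\<lambda>x::'a. c - x \<bullet> x) has_derivative (\<lambda>h. - 2 * (x \<bullet> h))) (at x)"
      by (auto intro!: derivative_eq_intros simp: inner_commute)
    from has_derivative_compose[OF this DERIV_flat_exp[unfolded has_field_derivative_def]] show ?thesis .
  qed
  have "partial_deriv b (\<lambda>x::'a. flat_exp p (c - x \<bullet> x)) = (\<lambda>x. flat_exp ?q (c - x \<bullet> x) * (- 2 * (x \<bullet> b)))" for b
    by (intro ext has_partial_imp_partial_deriv has_partial_has_derivative d)
  moreover have "C_k k (\<lambda>x::'a. flat_exp ?q (c - x \<bullet> x) * (- 2 * (x \<bullet> b)))" for b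
    by (intro C_k_mult Suc.IH C_k_const C_k_inner)
  ultimately show ?case using d by (auto simp: differentiable_def)
qed

section \<open>Smoothing by a kernel\<close>

lemma smooth_bump:
  assumes "0 < s"
  obtains \<rho> :: "'a::euclidean_space \<Rightarrow> real" where "\<forall>k. C_k k \<rho>" "\<And>x. 0 \<le> \<rho> x" "\<And>x. s \<le> norm x \<Longrightarrow> \<rho> x = 0"
    "integrable lborel \<rho>" "(\<integral>x. \<rho> x \<partial>lborel) = 1"
proof -
  define f where "f x = flat_exp 1 (s\<^sup>2 - x \<bullet> x)" for x :: 'a
  have f: "\<forall>k. C_k k f" unfolding f_def[abs_def] using C_k_flat_exp by blast
  then have c: "continuous_on UNIV f" using C_k.simps(1) by blast
  have f0: "0 \<le> f x" for x by (simp add: f_def flat_exp_def)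
  have fs: "f x = 0" if "s \<le> norm x" for x
    using that assms by (simp add: f_def flat_exp_def flip: power2_norm_eq_inner)
  have i: "integrable lborel f" by (rule integrable_continuous_compact_support[OF c, of s]) (simp add: fs)
  let ?I = "\<integral>x. f x \<partial>lborel"
  have "?I \<noteq> 0"
  proof
    assume "?I = 0"
    then have ae: "AE x in lborel. f x = 0" using integral_nonneg_eq_0_iff_AE[OF i] f0 by simp
    have op: "open {x. f x \<noteq> 0}" using c by (intro open_Collect_neq) auto
    have B: "{x \<in> space lborel. \<not> f x = 0} \<in> sets lborel" using borel_open[OF op] by simp
    from ae have "{x \<in> space lborel. \<not> f x = 0} \<in> null_sets lborel" by (simp only: AE_iff_null[OF B])
    then have "negligible {x. f x \<noteq> 0}" by (simp add: negligible_iff_null_sets null_sets_completionI)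
    then have "{x. f x \<noteq> 0} = {}" using op open_not_negligible by blast
    moreover have "f 0 \<noteq> 0" using assms by (simp add: f_def flat_exp_def)
    ultimately show False by blast
  qed
  moreover have "0 \<le> ?I" using f0 by simp
  ultimately have I: "0 < ?I" by simp
  show thesis
  proof (rule that[of "\<lambda>x. (1 / ?I) * f x"])
    show "\<forall>k. C_k k (\<lambda>x. (1 / ?I) * f x)" using f by (intro allI C_k_mult C_k_const) blast
    show "(\<integral>x. (1 / ?I) * f x \<partial>lborel) = 1" using I by simp
    show "integrable lborel (\<lambda>x. (1 / ?I) * f x)" by (rule integrable_mult_right[OF i])
  qed (use I f0 fs in auto)
qed

text \<open>Convolution of \<open>f\<close> with the reflected kernel. The point \<open>x\<close>
  enters through \<open>\<rho>\<close> only, so each derivative falls on the kernel and changes its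
  sign.\<close>

definition correlation :: "('a::euclidean_space \<Rightarrow> real) \<Rightarrow> ('a \<Rightarrow> real) \<Rightarrow> 'a \<Rightarrow> real" where
  "correlation f \<rho> x = (\<integral>y. f y * \<rho> (y - x) \<partial>lborel)"

text \<open>The first-order Taylor error of \<open>\<rho>\<close> is uniform, as its gradient is
  uniformly continuous, and it is integrated against \<open>|f|\<close>. The derivative is written
  in coordinates with correlations as coefficients, so that the lemma can be applied to these
  again.\<close>

lemma has_derivative_correlation:
  fixes f \<rho> :: "'a::euclidean_space \<Rightarrow> real"
  assumes cf: "continuous_on UNIV f" and fR: "\<And>x. R < norm x \<Longrightarrow> f x = 0"
    and \<rho>: "\<forall>k. C_k k \<rho>" and \<rho>R: "\<And>x. Q < norm x \<Longrightarrow> \<rho> x = 0"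
  shows "(correlation f \<rho> has_derivative (\<lambda>h. \<Sum>b\<in>Basis. correlation f (\<lambda>x. - partial_deriv b \<rho> x) x * (h \<bullet> b))) (at x)"
proof -
  have C1: "C1_grad \<rho> (gradient \<rho>)" by (rule C_k_imp_C1_grad[OF \<rho>])
  note cg = C1_gradD(2)[OF C1] and c\<rho> = C1_gradD(3)[OF C1]
  have cp: "continuous_on UNIV (partial_deriv b \<rho>)" if "b \<in> Basis" for b
    using continuous_on_inner[OF cg continuous_on_const, of b] gradient_inner_Basis[OF that] by simp
  have int: "integrable lborel (\<lambda>y. f y * g (y - x))" if "continuous_on UNIV g" for g :: "'a \<Rightarrow> real" and x
    by (rule integrable_continuous_compact_support[of _ R])
      (auto intro!: continuous_intros cf continuous_on_compose2[OF that] simp: fR)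
  have fi: "integrable lborel (\<lambda>y. \<bar>f y\<bar>)"
    by (rule integrable_continuous_compact_support[of _ R]) (auto intro!: continuous_intros cf simp: fR)
  define K where "K = (\<integral>y. \<bar>f y\<bar> \<partial>lborel)"
  have K0: "0 \<le> K" by (simp add: K_def)
  have lin: "(\<Sum>b\<in>Basis. correlation f (\<lambda>x. - partial_deriv b \<rho> x) x * (h \<bullet> b))
      = (\<integral>y. f y * - (gradient \<rho> (y - x) \<bullet> h) \<partial>lborel)" for h
  proof -
    have "(\<integral>y. f y * - (gradient \<rho> (y - x) \<bullet> h) \<partial>lborel)
      = (\<integral>y. (\<Sum>b\<in>Basis. (f y * - partial_deriv b \<rho> (y - x)) * (h \<bullet> b)) \<partial>lborel)"
    proof (intro Bochner_Integration.integral_cong refl)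
      fix y
      have "gradient \<rho> (y - x) \<bullet> h = (\<Sum>b\<in>Basis. partial_deriv b \<rho> (y - x) * (h \<bullet> b))"
        by (subst euclidean_inner) (simp add: gradient_inner_Basis)
      then show "f y * - (gradient \<rho> (y - x) \<bullet> h) = (\<Sum>b\<in>Basis. (f y * - partial_deriv b \<rho> (y - x)) * (h \<bullet> b))"
        by (simp add: sum_distrib_left sum_negf mult.assoc)
    qed
    also have "\<dots> = (\<Sum>b\<in>Basis. (\<integral>y. (f y * - partial_deriv b \<rho> (y - x)) * (h \<bullet> b) \<partial>lborel))"
      using int[of "\<lambda>z. - partial_deriv _ \<rho> z"] cp
      by (intro Bochner_Integration.integral_sum integrable_mult_left) (auto intro!: continuous_intros)
    finally show ?thesis by (simp add: correlation_def)
  qed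
  have unif: "\<exists>d>0. \<forall>z w. dist z w < d \<longrightarrow> norm (gradient \<rho> z - gradient \<rho> w) \<le> e" if e: "0 < e" for e
  proof -
    have "uniformly_continuous_on (cball 0 (Q + 1)) (gradient \<rho>)"
      by (intro compact_uniformly_continuous continuous_on_subset[OF cg]) auto
    then obtain d where d: "0 < d" "\<And>z w. z \<in> cball 0 (Q + 1) \<Longrightarrow> w \<in> cball 0 (Q + 1) \<Longrightarrow> dist w z < d \<Longrightarrow> dist (gradient \<rho> w) (gradient \<rho> z) < e"
      using e unfolding uniformly_continuous_on_def by meson
    \<comment> \<open>Two points at distance less than 1 lie either both in the ball of radius
      \<open>Q + 1\<close> or both outside the support of \<open>\<rho>\<close>.\<close>
    have "norm (gradient \<rho> z - gradient \<rho> w) \<le> e" if zw: "dist z w < min d 1" for z w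
    proof (cases "norm z \<le> Q + 1 \<and> norm w \<le> Q + 1")
      case True
      then show ?thesis using d(2)[of w z] zw by (simp add: dist_norm)
    next
      case False
      moreover have "norm z < norm w + 1" "norm w < norm z + 1"
        using zw norm_triangle_ineq2[of z w] norm_triangle_ineq2[of w z] by (auto simp: dist_norm norm_minus_commute)
      ultimately have "Q < norm z" "Q < norm w" by auto
      then show ?thesis using gradient_zero_outside[of Q \<rho>] \<rho>R e by simp
    qed
    then show ?thesis using d(1) by (intro exI[of _ "min d 1"]) auto
  qed
  show ?thesis
    unfolding has_derivative_at_alt
  proof (intro conjI allI impI)
    show "bounded_linear (\<lambda>h. \<Sum>b\<in>Basis. correlation f (\<lambda>x. - partial_deriv b \<rho> x) x * (h \<bullet> b))"
      by (intro bounded_linear_sum bounded_linear_const_mult bounded_linear_inner_left)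
    fix e :: real assume e: "0 < e"
    \<comment> \<open>\<open>K + 1\<close> in place of \<open>K\<close>, since the integral of
      \<open>|f|\<close> may be 0.\<close>
    obtain d where d: "0 < d" "\<And>z w. dist z w < d \<Longrightarrow> norm (gradient \<rho> z - gradient \<rho> w) \<le> e / (K + 1)"
      using unif[of "e / (K + 1)"] e K0 by auto
    have taylor: "\<bar>\<rho> (z - h) - \<rho> z + gradient \<rho> z \<bullet> h\<bar> \<le> e / (K + 1) * norm h" if h: "norm h < d" for z h
    proof -
      have "norm ((\<rho> (z - h) - gradient \<rho> z \<bullet> (z - h)) - (\<rho> z - gradient \<rho> z \<bullet> z)) \<le> e / (K + 1) * norm ((z - h) - z)"
      proof (rule differentiable_bound[where S="ball z d" and f'="\<lambda>w k. gradient \<rho> w \<bullet> k - gradient \<rho> z \<bullet> k"])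
        fix w assume w: "w \<in> ball z d"
        show "((\<lambda>w. \<rho> w - gradient \<rho> z \<bullet> w) has_derivative (\<lambda>k. gradient \<rho> w \<bullet> k - gradient \<rho> z \<bullet> k)) (at w within ball z d)"
          by (intro derivative_intros has_derivative_at_withinI[OF C1_gradD(1)[OF C1]] has_derivative_inner_right has_derivative_ident)
        show "onorm (\<lambda>k. gradient \<rho> w \<bullet> k - gradient \<rho> z \<bullet> k) \<le> e / (K + 1)"
        proof (rule onorm_le)
          fix k
          have "norm (gradient \<rho> w \<bullet> k - gradient \<rho> z \<bullet> k) \<le> norm (gradient \<rho> w - gradient \<rho> z) * norm k"
            using Cauchy_Schwarz_ineq2[of "gradient \<rho> w - gradient \<rho> z" k] by (simp add: inner_diff_left)
          also have "\<dots> \<le> e / (K + 1) * norm k"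
            using d(2)[of w z] w by (intro mult_right_mono) (auto simp: dist_commute)
          finally show "norm (gradient \<rho> w \<bullet> k - gradient \<rho> z \<bullet> k) \<le> e / (K + 1) * norm k" .
        qed
      qed (use h d(1) in \<open>auto simp: dist_norm\<close>)
      then show ?thesis by (simp add: inner_diff_right algebra_simps)
    qed
    show "\<exists>d>0. \<forall>y. norm (y - x) < d \<longrightarrow> norm (correlation f \<rho> y - correlation f \<rho> x
        - (\<Sum>b\<in>Basis. correlation f (\<lambda>x. - partial_deriv b \<rho> x) x * ((y - x) \<bullet> b))) \<le> e * norm (y - x)"
    proof (intro exI[of _ d] conjI allI impI)
      fix x' assume x': "norm (x' - x) < d"
      define h where "h = x' - x"
      have h: "norm h < d" "x' = x + h" using x' by (auto simp: h_def)
      have cgx: "continuous_on UNIV (\<lambda>z. - (gradient \<rho> z \<bullet> h))" by (intro continuous_intros cg)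
      have "correlation f \<rho> x' - correlation f \<rho> x - (\<Sum>b\<in>Basis. correlation f (\<lambda>x. - partial_deriv b \<rho> x) x * (h \<bullet> b))
        = (\<integral>y. f y * \<rho> (y - x') - f y * \<rho> (y - x) - f y * - (gradient \<rho> (y - x) \<bullet> h) \<partial>lborel)"
        unfolding correlation_def lin[unfolded correlation_def] using int[OF c\<rho>] int[OF cgx] by simp
      also have "\<bar>\<dots>\<bar> \<le> (\<integral>y. \<bar>f y\<bar> * (e / (K + 1) * norm h) \<partial>lborel)"
      proof (rule order_trans[OF integral_abs_bound], rule integral_mono)
        show "integrable lborel (\<lambda>y. \<bar>f y * \<rho> (y - x') - f y * \<rho> (y - x) - f y * - (gradient \<rho> (y - x) \<bullet> h)\<bar>)"
          by (intro integrable_abs Bochner_Integration.integrable_diff int c\<rho> cgx)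
        show "integrable lborel (\<lambda>y. \<bar>f y\<bar> * (e / (K + 1) * norm h))" by (intro integrable_mult_left fi)
        fix y
        have "f y * \<rho> (y - x') - f y * \<rho> (y - x) - f y * - (gradient \<rho> (y - x) \<bullet> h)
          = f y * (\<rho> ((y - x) - h) - \<rho> (y - x) + gradient \<rho> (y - x) \<bullet> h)"
          by (simp add: h(2) algebra_simps)
        then show "\<bar>f y * \<rho> (y - x') - f y * \<rho> (y - x) - f y * - (gradient \<rho> (y - x) \<bullet> h)\<bar> \<le> \<bar>f y\<bar> * (e / (K + 1) * norm h)"
          using taylor[OF h(1), of "y - x"] by (simp only: abs_mult mult_left_mono abs_ge_zero)
      qed
      also have "\<dots> = K * (e / (K + 1) * norm h)" by (simp add: K_def)
      also have "\<dots> = (K / (K + 1)) * (e * norm h)" by simp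
      also have "\<dots> \<le> 1 * (e * norm h)" using K0 e by (intro mult_right_mono) auto
      finally show "norm (correlation f \<rho> x' - correlation f \<rho> x
        - (\<Sum>b\<in>Basis. correlation f (\<lambda>x. - partial_deriv b \<rho> x) x * ((x' - x) \<bullet> b))) \<le> e * norm (x' - x)"
        by (simp add: h_def)
    qed (rule d(1))
  qed
qed

text \<open>The induction leaves the kernel arbitrary, because a partial derivative of a correlation
  is the correlation with another kernel of the same kind.\<close>

lemma C_k_correlation:
  fixes f \<rho> :: "'a::euclidean_space \<Rightarrow> real"
  assumes cf: "continuous_on UNIV f" and fR: "\<And>x. R < norm x \<Longrightarrow> f x = 0"
    and \<rho>: "\<forall>k. C_k k \<rho>" and \<rho>R: "\<And>x. Q < norm x \<Longrightarrow> \<rho> x = 0"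
  shows "C_k k (correlation f \<rho>)"
  using \<rho> \<rho>R
proof (induction k arbitrary: \<rho>)
  case 0
  have "isCont (correlation f \<rho>) x" for x
    using has_derivative_continuous[OF has_derivative_correlation[where R=R and Q=Q, OF cf fR 0]] .
  then show ?case by (simp add: continuous_at_imp_continuous_on)
next
  case (Suc k)
  note d = has_derivative_correlation[where R=R and Q=Q, OF cf fR Suc.prems]
  have "partial_deriv b (correlation f \<rho>) = correlation f (\<lambda>x. - partial_deriv b \<rho> x)" if b: "b \<in> Basis" for b
  proof (intro ext has_partial_imp_partial_deriv)
    fix x
    have hp: "has_partial b (correlation f \<rho>) x (\<Sum>c\<in>Basis. correlation f (\<lambda>x. - partial_deriv c \<rho> x) x * (b \<bullet> c))"
      by (rule has_partial_has_derivative[OF d])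
    show "has_partial b (correlation f \<rho>) x (correlation f (\<lambda>x. - partial_deriv b \<rho> x) x)"
      using hp b by (simp add: inner_Basis if_distrib cong: if_cong)
  qed
  moreover have "C_k k (correlation f (\<lambda>x. - partial_deriv b \<rho> x))" if b: "b \<in> Basis" for b
  proof (rule Suc.IH)
    have "C_k j (partial_deriv b \<rho>)" for j using Suc.prems(1) b C_k.simps(2) by blast
    then have "C_k j (\<lambda>x. (- 1) * partial_deriv b \<rho> x)" for j by (intro C_k_mult C_k_const)
    then show "\<forall>j. C_k j (\<lambda>x. - partial_deriv b \<rho> x)" by simp
    show "- partial_deriv b \<rho> x = 0" if "Q < norm x" for x
      using has_partial_imp_partial_deriv[OF partial_zero_outside[of Q \<rho>, OF Suc.prems(2) that]] by simp
  qed
  ultimately show ?case unfolding C_k.simps differentiable_def using d by auto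
qed

lemma correlation_translate:
  fixes f \<rho> :: "'a::euclidean_space \<Rightarrow> real"
  assumes [measurable]: "f \<in> borel_measurable borel" "\<rho> \<in> borel_measurable borel"
  shows "correlation f \<rho> x = (\<integral>y. f (y + x) * \<rho> y \<partial>lborel)"
  unfolding correlation_def using lborel_integral_translate(1)[of "\<lambda>y. f y * \<rho> (y - x)" x] by simp

text \<open>Averaging with a probability density does not increase the energy, by Jensen's
  inequality for each partial derivative and translation invariance. Values move by at most
  \<open>L * s\<close>, and supports grow by at most \<open>s\<close>.\<close>

lemma mollify:
  fixes f :: "'a::euclidean_space \<Rightarrow> real"
  assumes f: "lip_cs f" and e: "0 < e"
  obtains F where "\<forall>k. C_k k F" "energy F \<le> energy f" "\<And>x. \<bar>F x - f x\<bar> \<le> e"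
    "\<And>x. (\<And>y. dist x y \<le> e \<Longrightarrow> f y = 0) \<Longrightarrow> F x = 0"
proof -
  obtain L R where L: "L-lipschitz_on UNIV f" and fR: "\<And>x. R < norm x \<Longrightarrow> f x = 0" using lip_csE[OF f] by blast
  have L0: "0 \<le> L" using L by (rule lipschitz_on_nonneg)
  have cf: "continuous_on UNIV f" using L by (rule lipschitz_on_continuous_on)
  \<comment> \<open>\<open>L + 1\<close> covers \<open>L = 0\<close>; both \<open>s\<close> and
    \<open>L * s\<close> are at most \<open>e\<close>.\<close>
  define s where "s = min e (e / (L + 1))"
  have s: "0 < s" "s \<le> e" "L * s \<le> e"
  proof -
    show "0 < s" "s \<le> e" using e L0 by (auto simp: s_def)
    have "L * s \<le> (L + 1) * (e / (L + 1))" using L0 \<open>0 < s\<close> by (intro mult_mono) (auto simp: s_def)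
    then show "L * s \<le> e" using L0 by simp
  qed
  obtain \<rho> :: "'a \<Rightarrow> real" where \<rho>: "\<forall>k. C_k k \<rho>" "\<And>x. 0 \<le> \<rho> x" "\<And>x. s \<le> norm x \<Longrightarrow> \<rho> x = 0"
    "integrable lborel \<rho>" "(\<integral>x. \<rho> x \<partial>lborel) = 1"
    using smooth_bump[OF s(1)] by metis
  have c\<rho>: "continuous_on UNIV \<rho>" using \<rho>(1) C_k.simps(1) by blast
  note [measurable] = borel_measurable_continuous_onI[OF cf] borel_measurable_continuous_onI[OF c\<rho>] gradient_borel[OF L]
  define F where "F = correlation f \<rho>"
  have FC: "\<forall>k. C_k k F" unfolding F_def
    using C_k_correlation[OF cf fR \<rho>(1), where Q=s] \<rho>(3) by simp
  have F: "F x = (\<integral>y. f (y + x) * \<rho> y \<partial>lborel)" for x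
    unfolding F_def by (rule correlation_translate) measurable
  have ci: "integrable lborel (\<lambda>y. g (y + x) * \<rho> y)" if "continuous_on UNIV g" for g :: "'a \<Rightarrow> real" and x
    by (rule integrable_continuous_compact_support[of _ s])
      (auto intro!: continuous_intros c\<rho> continuous_on_compose2[OF that] simp: \<rho>(3))
  show thesis
  proof (rule that[OF FC])
    fix x
    have "F x - f x = (\<integral>y. (f (y + x) - f x) * \<rho> y \<partial>lborel)"
      using ci[OF cf, of x] \<rho>(4,5) by (simp add: F left_diff_distrib)
    also have "\<bar>\<dots>\<bar> \<le> (\<integral>y. e * \<rho> y \<partial>lborel)"
    proof (rule order_trans[OF integral_abs_bound], rule integral_mono)
      have "integrable lborel (\<lambda>y. (f (y + x) - f x) * \<rho> y)" using ci[OF cf, of x] \<rho>(4) by (simp add: left_diff_distrib)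
      then show "integrable lborel (\<lambda>y. \<bar>(f (y + x) - f x) * \<rho> y\<bar>)" by (rule integrable_abs)
      show "integrable lborel (\<lambda>y. e * \<rho> y)" by (rule integrable_mult_right[OF \<rho>(4)])
      fix y
      show "\<bar>(f (y + x) - f x) * \<rho> y\<bar> \<le> e * \<rho> y"
      proof (cases "norm y < s")
        case True
        have "\<bar>f (y + x) - f x\<bar> \<le> L * norm y" using lipschitz_onD[OF L, of "y + x" x] by (simp add: dist_norm)
        also have "\<dots> \<le> L * s" using True L0 by (intro mult_left_mono) auto
        finally have "\<bar>f (y + x) - f x\<bar> \<le> e" using s by simp
        then show ?thesis using \<rho>(2)[of y] by (simp add: abs_mult mult_right_mono)
      qed (simp add: \<rho>(3))
    qed
    also have "\<dots> = e" using \<rho>(5) by simp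
    finally show "\<bar>F x - f x\<bar> \<le> e" .
  next
    fix x assume x: "\<And>y. dist x y \<le> e \<Longrightarrow> f y = 0"
    have "f (y + x) * \<rho> y = 0" for y
      using x[of "y + x"] \<rho>(3)[of y] s by (cases "norm y < s") (auto simp: dist_norm)
    then have z: "(\<lambda>y. f (y + x) * \<rho> y) = (\<lambda>y. 0)" by blast
    show "F x = 0" unfolding F z by simp
  next
    \<comment> \<open>The derivative of \<open>F\<close>, already known to exist, is evaluated
      through the difference quotients of \<open>f\<close> instead of those of the kernel; they are
      dominated by \<open>L * \<rho> y\<close>.\<close>
    have part: "partial_deriv b F x = (\<integral>y. (gradient f (y + x) \<bullet> b) * \<rho> y \<partial>lborel)"
      if b: "b \<in> Basis" for b x
    proof -
      let ?q = "\<lambda>n y. (f (y + (1 / real (Suc n)) *\<^sub>R b) - f y) / (1 / real (Suc n))"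
      have "has_partial b F x (partial_deriv b F x)"
        using FC C_k.simps(2) by (intro has_partial_differentiable) blast
      from has_partial_slope_LIMSEQ[OF this]
      have 1: "(\<lambda>n. (F (x + (1 / real (Suc n)) *\<^sub>R b) - F x) / (1 / real (Suc n))) \<longlonglongrightarrow> partial_deriv b F x" .
      have q: "(F (x + (1 / real (Suc n)) *\<^sub>R b) - F x) / (1 / real (Suc n)) = (\<integral>y. ?q n (y + x) * \<rho> y \<partial>lborel)" for n
      proof -
        have "(\<integral>y. ?q n (y + x) * \<rho> y \<partial>lborel)
          = (\<integral>y. (f (y + (x + (1 / real (Suc n)) *\<^sub>R b)) * \<rho> y - f (y + x) * \<rho> y) / (1 / real (Suc n)) \<partial>lborel)"
          by (intro Bochner_Integration.integral_cong refl) (simp add: add.assoc left_diff_distrib diff_divide_distrib)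
        also have "\<dots> = (F (x + (1 / real (Suc n)) *\<^sub>R b) - F x) / (1 / real (Suc n))"
          unfolding F using ci[OF cf] by (subst integral_divide_zero) simp
        finally show ?thesis ..
      qed
      have "(\<lambda>n. \<integral>y. ?q n (y + x) * \<rho> y \<partial>lborel) \<longlonglongrightarrow> (\<integral>y. (gradient f (y + x) \<bullet> b) * \<rho> y \<partial>lborel)"
      proof (rule integral_dominated_convergence)
        show "integrable lborel (\<lambda>y. L * \<rho> y)" by (rule integrable_mult_right[OF \<rho>(4)])
        show "AE y in lborel. norm (?q n (y + x) * \<rho> y) \<le> L * \<rho> y" for n
        proof (rule AE_I2)
          fix y
          define \<Delta> where "\<Delta> = f (y + x + (1 / real (Suc n)) *\<^sub>R b) - f (y + x)"
          have "\<bar>\<Delta>\<bar> \<le> L * (1 / real (Suc n))"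
            using lipschitz_onD[OF L, of "y + x + (1 / real (Suc n)) *\<^sub>R b" "y + x"] b
            by (simp add: dist_norm \<Delta>_def)
          then have "\<bar>\<Delta> / (1 / real (Suc n))\<bar> \<le> L" unfolding abs_divide by (simp add: field_simps)
          then have "\<bar>?q n (y + x)\<bar> \<le> L" by (simp only: \<Delta>_def)
          then show "norm (?q n (y + x) * \<rho> y) \<le> L * \<rho> y" using \<rho>(2)[of y] by (simp add: abs_mult mult_right_mono)
        qed
        have "AE y in lborel. has_partial b f y (gradient f y \<bullet> b)" using lip_cs_AE_partials[OF f] by eventually_elim (use b in auto)
        from AE_affine[OF this zero_less_one, of x]
        show "AE y in lborel. (\<lambda>n. ?q n (y + x) * \<rho> y) \<longlonglongrightarrow> (gradient f (y + x) \<bullet> b) * \<rho> y"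
        proof eventually_elim
          fix y assume "has_partial b f (x + 1 *\<^sub>R y) (gradient f (x + 1 *\<^sub>R y) \<bullet> b)"
          then have "has_partial b f (y + x) (gradient f (y + x) \<bullet> b)" by (simp add: add.commute)
          from has_partial_slope_LIMSEQ[OF this]
          show "(\<lambda>n. ?q n (y + x) * \<rho> y) \<longlonglongrightarrow> (gradient f (y + x) \<bullet> b) * \<rho> y" by (rule tendsto_mult_right)
        qed
      qed measurable
      from LIMSEQ_unique[OF 1[unfolded q] this] show ?thesis .
    qed
    have jensen: "ennreal ((partial_deriv b F x)\<^sup>2) \<le> (\<integral>\<^sup>+y. ennreal ((gradient f (y + x) \<bullet> b)\<^sup>2 * \<rho> y) \<partial>lborel)"
      if b: "b \<in> Basis" for b x
    proof -
      let ?g = "\<lambda>y. gradient f (y + x) \<bullet> b" and ?m = "partial_deriv b F x"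
      have bd: "AE y in lborel. \<bar>?g y\<bar> \<le> L"
      proof -
        have "AE y in lborel. \<bar>gradient f y \<bullet> b\<bar> \<le> L"
          using lip_cs_AE_partials[OF f]
        proof eventually_elim
          fix y assume "\<forall>b\<in>Basis. has_partial b f y (gradient f y \<bullet> b)"
          then show "\<bar>gradient f y \<bullet> b\<bar> \<le> L" using has_partial_bound[OF L] b by fastforce
        qed
        from AE_affine[OF this, of 1 x] show ?thesis by (simp add: add.commute)
      qed
      have i1: "integrable lborel (\<lambda>y. ?g y * \<rho> y)"
      proof (rule Bochner_Integration.integrable_bound[OF integrable_mult_right[OF \<rho>(4), of L]])
        show "AE y in lborel. norm (?g y * \<rho> y) \<le> norm (L * \<rho> y)"
          using bd by eventually_elim (simp add: abs_mult \<rho>(2) L0 mult_right_mono)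
      qed measurable
      have i2: "integrable lborel (\<lambda>y. (?g y)\<^sup>2 * \<rho> y)"
      proof (rule Bochner_Integration.integrable_bound[OF integrable_mult_right[OF \<rho>(4), of "L\<^sup>2"]])
        show "AE y in lborel. norm ((?g y)\<^sup>2 * \<rho> y) \<le> norm (L\<^sup>2 * \<rho> y)"
          using bd
        proof eventually_elim
          fix y assume "\<bar>?g y\<bar> \<le> L"
          then have "(?g y)\<^sup>2 \<le> L\<^sup>2" using L0 by (simp add: abs_le_square_iff[symmetric])
          then show "norm ((?g y)\<^sup>2 * \<rho> y) \<le> norm (L\<^sup>2 * \<rho> y)" by (simp add: abs_mult \<rho>(2) mult_right_mono)
        qed
      qed measurable
      \<comment> \<open>Jensen's inequality for the square: the variance of \<open>?g\<close> under
        the density \<open>\<rho>\<close> is nonnegative.\<close>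
      have "0 \<le> (\<integral>y. (?g y - ?m)\<^sup>2 * \<rho> y \<partial>lborel)" by (intro Bochner_Integration.integral_nonneg) (simp add: \<rho>(2))
      also have "\<dots> = (\<integral>y. (?g y)\<^sup>2 * \<rho> y - 2 * ?m * (?g y * \<rho> y) + ?m\<^sup>2 * \<rho> y \<partial>lborel)"
        by (intro Bochner_Integration.integral_cong refl) (simp add: power2_eq_square algebra_simps)
      also have "\<dots> = (\<integral>y. (?g y)\<^sup>2 * \<rho> y \<partial>lborel) - 2 * ?m * ?m + ?m\<^sup>2 * 1"
        using i1 i2 \<rho>(4,5) part[OF b, of x] by simp
      finally have "?m\<^sup>2 \<le> (\<integral>y. (?g y)\<^sup>2 * \<rho> y \<partial>lborel)" by (simp add: power2_eq_square)
      then show ?thesis by (subst nn_integral_eq_integral[OF i2]) (auto simp: \<rho>(2) intro: ennreal_leI)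
    qed
    have "energy F = (\<integral>\<^sup>+x. (\<Sum>b\<in>Basis. ennreal ((partial_deriv b F x)\<^sup>2)) \<partial>lborel)"
      unfolding energy_def norm_gradient_squared by (simp add: sum_ennreal)
    also have "\<dots> \<le> (\<integral>\<^sup>+x. (\<Sum>b\<in>Basis. (\<integral>\<^sup>+y. ennreal ((gradient f (y + x) \<bullet> b)\<^sup>2 * \<rho> y) \<partial>lborel)) \<partial>lborel)"
      by (intro nn_integral_mono sum_mono jensen)
    also have "\<dots> = (\<integral>\<^sup>+x. (\<integral>\<^sup>+y. (\<Sum>b\<in>Basis. ennreal ((gradient f (y + x) \<bullet> b)\<^sup>2 * \<rho> y)) \<partial>lborel) \<partial>lborel)"
      by (subst nn_integral_sum) measurable
    also have "\<dots> = (\<integral>\<^sup>+x. (\<integral>\<^sup>+y. ennreal ((norm (gradient f (y + x)))\<^sup>2 * \<rho> y) \<partial>lborel) \<partial>lborel)"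
      unfolding norm_gradient_squared sum_distrib_right
      by (simp add: sum_ennreal \<rho>(2) gradient_inner_Basis)
    also have "\<dots> = (\<integral>\<^sup>+y. (\<integral>\<^sup>+x. ennreal ((norm (gradient f (y + x)))\<^sup>2 * \<rho> y) \<partial>lborel) \<partial>lborel)"
    proof -
      have "(\<lambda>p::'a\<times>'a. ennreal ((norm (gradient f (snd p + fst p)))\<^sup>2 * \<rho> (snd p))) \<in> borel_measurable borel"
        unfolding borel_prod[symmetric] by measurable
      from nn_integral_lborel_pair[OF this] show ?thesis by simp
    qed
    also have "\<dots> = (\<integral>\<^sup>+y. energy f * ennreal (\<rho> y) \<partial>lborel)"
    proof (rule nn_integral_cong)
      fix y
      have "(\<integral>\<^sup>+x. ennreal ((norm (gradient f (y + x)))\<^sup>2 * \<rho> y) \<partial>lborel)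
        = (\<integral>\<^sup>+x. ennreal ((norm (gradient f (x + y)))\<^sup>2) * ennreal (\<rho> y) \<partial>lborel)"
        by (simp add: ennreal_mult \<rho>(2) add.commute)
      also have "\<dots> = (\<integral>\<^sup>+x. ennreal ((norm (gradient f (x + y)))\<^sup>2) \<partial>lborel) * ennreal (\<rho> y)"
        by (rule nn_integral_multc) measurable
      also have "(\<integral>\<^sup>+x. ennreal ((norm (gradient f (x + y)))\<^sup>2) \<partial>lborel) = energy f"
        unfolding energy_def by (rule nn_integral_translate) measurable
      finally show "(\<integral>\<^sup>+x. ennreal ((norm (gradient f (y + x)))\<^sup>2 * \<rho> y) \<partial>lborel) = energy f * ennreal (\<rho> y)" .
    qed
    also have "\<dots> = energy f * ennreal (\<integral>y. \<rho> y \<partial>lborel)"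
      by (subst nn_integral_cmult) (auto simp: nn_integral_eq_integral[OF \<rho>(4)] \<rho>(2))
    finally show "energy F \<le> energy f" using \<rho>(5) by simp
  qed
qed

section \<open>The upper bound\<close>

text \<open>The first term of the minimum bounds \<open>(n - 1) * k\<close> by \<open>1/4\<close>,
  from which the upper bounds follow. The inequality for \<open>g\<close> amounts to
  \<open>(n - 2) * k * (1 + g) \<le> (1 - g) / 2\<close>; it comes from the first term if
  \<open>g < 1/3\<close>, and from the second one otherwise, when
  \<open>1 + g \<le> 4 * g\<close>.\<close>

lemma kappa_bounds:
  fixes g n k :: real
  assumes n: "3 \<le> n" and g: "0 < g" "g < 1" and k: "k = min (1 / (4 * (n - 1))) ((1 - g) / (2 * (4 * n - 5) * g))"
  shows "0 < k" "k \<le> 1 / 8" "2 * (n - 2) * k \<le> 1 / 2" "g \<le> (1 - 2 * (n - 2) * k) * ((1 + g) / 2)"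
    "2 * (n - 1) * k \<le> 1 / 2" "2 * (n - 2) * k\<^sup>2 + 2 * n * k \<le> 13 / 16"
proof -
  have "0 < 1 / (4 * (n - 1))" "0 < (1 - g) / (2 * (4 * n - 5) * g)"
    using n g by (auto intro!: divide_pos_pos mult_pos_pos)
  then show k0: "0 < k" using k by simp
  have "k \<le> 1 / (4 * (n - 1))" using k by simp
  then have k1: "(n - 1) * k \<le> 1 / 4" using n by (simp add: field_simps)
  have "k \<le> (1 - g) / (2 * (4 * n - 5) * g)" using k by simp
  moreover have "0 < 2 * (4 * n - 5) * g" using n g by (intro mult_pos_pos) auto
  ultimately have k2: "k * (2 * (4 * n - 5) * g) \<le> 1 - g" by (simp add: pos_le_divide_eq)
  have "2 * k \<le> (n - 1) * k" using n k0 by (intro mult_right_mono) auto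
  then show k8: "k \<le> 1 / 8" using k1 by simp
  have "(n - 2) * k \<le> (n - 1) * k" using k0 by (intro mult_right_mono) auto
  then have k3: "(n - 2) * k \<le> 1 / 4" using k1 by simp
  then show "2 * (n - 2) * k \<le> 1 / 2" by (simp add: algebra_simps)
  show "2 * (n - 1) * k \<le> 1 / 2" using k1 by (simp add: algebra_simps)
  have nk0: "0 \<le> (n - 2) * k" using n k0 by simp
  have "((n - 2) * k) * (1 + g) \<le> (1 - g) / 2"
  proof (cases "1 / 3 \<le> g")
    case True
    have "((n - 2) * k) * (1 + g) \<le> ((n - 2) * k) * (4 * g)" using nk0 True by (intro mult_left_mono) auto
    also have "\<dots> = (k * g) * (4 * n - 8)" by (simp add: algebra_simps)
    also have "\<dots> \<le> (k * g) * (4 * n - 5)" using k0 g by (intro mult_left_mono) auto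
    finally show ?thesis using k2 by (simp add: algebra_simps)
  next
    case False
    have "((n - 2) * k) * (1 + g) \<le> (1 / 4) * (1 + g)" using k3 g by (intro mult_right_mono) auto
    then show ?thesis using False by simp
  qed
  then show "g \<le> (1 - 2 * (n - 2) * k) * ((1 + g) / 2)" by (simp add: field_simps)
  have "((n - 2) * k) * k \<le> (1 / 4) * (1 / 8)" using k3 k8 nk0 k0 by (intro mult_mono) auto
  then have "2 * (n - 2) * k\<^sup>2 \<le> 1 / 16" by (simp add: power2_eq_square algebra_simps)
  moreover have "2 * n * k = 2 * ((n - 1) * k) + 2 * k" by (simp add: algebra_simps)
  ultimately show "2 * (n - 2) * k\<^sup>2 + 2 * n * k \<le> 13 / 16" using k1 k8 by linarith
qed

text \<open>Convexity: the tangent of the power function at \<open>y\<close> lies below its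
  graph.\<close>

lemma power_diff_ge:
  fixes x y :: real
  assumes "0 \<le> y" "y \<le> x"
  shows "real (Suc m) * (x - y) * y ^ m \<le> x ^ Suc m - y ^ Suc m"
proof (induction m)
  case (Suc m)
  have "real (Suc (Suc m)) * (x - y) * y ^ Suc m = y * (real (Suc m) * (x - y) * y ^ m) + (x - y) * y ^ Suc m"
    by (simp add: algebra_simps)
  also have "\<dots> \<le> y * (x ^ Suc m - y ^ Suc m) + (x - y) * y ^ Suc m" using Suc assms by (intro add_mono mult_left_mono) auto
  also have "\<dots> = y * x ^ Suc m + (x - 2 * y) * y ^ Suc m" by (simp add: algebra_simps)
  also have "\<dots> \<le> x ^ Suc (Suc m) - y ^ Suc (Suc m)"
  proof -
    have "y ^ Suc m \<le> x ^ Suc m" using assms by (intro power_mono) auto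
    then have "0 \<le> (x - y) * (x ^ Suc m - y ^ Suc m)" using assms by simp
    then show ?thesis by (simp add: algebra_simps)
  qed
  finally show ?case .
qed simp

lemma bernoulli_minus:
  fixes k :: real assumes "k \<le> 1" shows "1 - real m * k \<le> (1 - k) ^ m"
  using Bernoulli_inequality[of "- k" m] assms by simp

text \<open>The tangent estimate at \<open>1 - 2 * k\<close>, where by Bernoulli's inequality the
  power with exponent \<open>n - 1\<close> is still at least one half.\<close>

lemma inner_shell_volume:
  fixes k :: real
  assumes "0 \<le> k" "2 * (real n - 1) * k \<le> 1 / 2" "2 * k \<le> 1" "0 < n"
  shows "real n * k / 2 \<le> (1 - k) ^ n - (1 - 2 * k) ^ n"
proof -
  obtain m where m: "n = Suc m" using assms(4) gr0_implies_Suc by blast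
  have "1 / 2 \<le> (1 - 2 * k) ^ m" using bernoulli_minus[of "2 * k" m] assms(2,3) by (simp add: m)
  then have "(real n * k) * (1 / 2) \<le> (real n * k) * (1 - 2 * k) ^ m" using assms(1) by (intro mult_left_mono) auto
  also have "\<dots> \<le> (1 - k) ^ n - (1 - 2 * k) ^ n"
    using power_diff_ge[of "1 - 2 * k" "1 - k" m] assms by (simp add: m)
  finally show ?thesis by simp
qed

lemma has_partial_abs_le_add:
  assumes "has_partial b u x D" "has_partial b v x E" "has_partial b w x G"
    and "\<And>y. \<bar>u y - u x\<bar> \<le> \<bar>v y - v x\<bar> + \<bar>w y - w x\<bar>"
  shows "\<bar>D\<bar> \<le> \<bar>E\<bar> + \<bar>G\<bar>"
proof (rule LIMSEQ_le)
  show "(\<lambda>n. \<bar>(u (x + (1 / real (Suc n)) *\<^sub>R b) - u x) / (1 / real (Suc n))\<bar>) \<longlonglongrightarrow> \<bar>D\<bar>"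
    using has_partial_slope_LIMSEQ[OF assms(1)] by (rule tendsto_rabs)
  show "(\<lambda>n. \<bar>(v (x + (1 / real (Suc n)) *\<^sub>R b) - v x) / (1 / real (Suc n))\<bar>
      + \<bar>(w (x + (1 / real (Suc n)) *\<^sub>R b) - w x) / (1 / real (Suc n))\<bar>) \<longlonglongrightarrow> \<bar>E\<bar> + \<bar>G\<bar>"
    by (intro tendsto_add tendsto_rabs has_partial_slope_LIMSEQ assms)
  show "\<exists>N. \<forall>n\<ge>N. \<bar>(u (x + (1 / real (Suc n)) *\<^sub>R b) - u x) / (1 / real (Suc n))\<bar>
    \<le> \<bar>(v (x + (1 / real (Suc n)) *\<^sub>R b) - v x) / (1 / real (Suc n))\<bar>
      + \<bar>(w (x + (1 / real (Suc n)) *\<^sub>R b) - w x) / (1 / real (Suc n))\<bar>"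
    unfolding abs_divide by (intro exI allI impI) (simp only: flip: add_divide_distrib, intro divide_right_mono assms(4), simp)
qed

text \<open>The comparison of increments passes to each partial derivative separately. It is meant
  for the truncation of a competitor to values in \<open>{0..1}\<close>.\<close>

lemma energy_contraction:
  assumes u: "lip_cs u" and v: "lip_cs v" and le: "\<And>x y. \<bar>u y - u x\<bar> \<le> \<bar>v y - v x\<bar>"
  shows "energy u \<le> energy v"
  unfolding energy_def
proof (rule nn_integral_mono_AE)
  show "AE x in lborel. ennreal ((norm (gradient u x))\<^sup>2) \<le> ennreal ((norm (gradient v x))\<^sup>2)"
    using lip_cs_AE_partials[OF u] lip_cs_AE_partials[OF v]
  proof eventually_elim
    fix x assume a: "\<forall>b\<in>Basis. has_partial b u x (gradient u x \<bullet> b)" "\<forall>b\<in>Basis. has_partial b v x (gradient v x \<bullet> b)"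
    have "(norm (gradient u x))\<^sup>2 \<le> (norm (gradient v x))\<^sup>2"
      unfolding norm_gradient_squared
    proof (rule sum_mono)
      fix b :: 'a assume b: "b \<in> Basis"
      have "\<bar>gradient u x \<bullet> b\<bar> \<le> \<bar>gradient v x \<bullet> b\<bar>"
        using has_partial_abs_le[OF bspec[OF a(1) b] bspec[OF a(2) b] le] .
      then show "(partial_deriv b u x)\<^sup>2 \<le> (partial_deriv b v x)\<^sup>2" using b by (simp add: gradient_inner_Basis abs_le_square_iff)
    qed
    then show "ennreal ((norm (gradient u x))\<^sup>2) \<le> ennreal ((norm (gradient v x))\<^sup>2)" by (rule ennreal_leI)
  qed
qed

lemma measure_closed_shell:
  fixes p :: "'a::euclidean_space"
  assumes "0 \<le> a" "a \<le> b"
  shows "emeasure lborel {x. a \<le> dist p x \<and> dist p x \<le> b} = ennreal (unit_ball_vol (real DIM('a)) * (b ^ DIM('a) - a ^ DIM('a)))"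
proof -
  have fin: "emeasure lborel (cball p b) \<noteq> top" "emeasure lborel (ball p a) \<noteq> top"
    using emeasure_lborel_cball_finite[of p b] emeasure_lborel_ball_finite[of p a] by auto
  have eq: "{x. a \<le> dist p x \<and> dist p x \<le> b} = cball p b - ball p a" by auto
  have "measure lborel (cball p b - ball p a) = measure lborel (cball p b) - measure lborel (ball p a)"
    by (rule measure_Diff) (use assms fin in auto)
  also have "\<dots> = unit_ball_vol (real DIM('a)) * (b ^ DIM('a) - a ^ DIM('a))"
    using content_cball[of b p] content_ball[of a p] assms by (simp add: algebra_simps)
  finally have m: "measure lborel (cball p b - ball p a) = unit_ball_vol (real DIM('a)) * (b ^ DIM('a) - a ^ DIM('a))" .
  have "emeasure lborel (cball p b - ball p a) \<le> emeasure lborel (cball p b)" by (intro emeasure_mono) auto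
  then have "emeasure lborel (cball p b - ball p a) \<noteq> top" using fin(1) neq_top_trans by blast
  then show ?thesis unfolding eq using m by (subst emeasure_eq_ennreal_measure) auto
qed

text \<open>In each coordinate \<open>(x + y)^2 \<le> 2 x^2 + 2 y^2\<close>. Off the closed shell
  \<open>\<eta>\<close> is locally constant, and on it every partial derivative is at most
  \<open>l\<close>; the sum over the coordinates gives the factor \<open>DIM('a)\<close>.\<close>

lemma energy_le_with_cutoff:
  fixes f \<phi> \<eta> :: "'a::euclidean_space \<Rightarrow> real"
  assumes f: "lip_cs f" and \<phi>: "lip_cs \<phi>" and \<eta>: "lip_cs \<eta>"
    and le: "\<And>x y. \<bar>f y - f x\<bar> \<le> \<bar>\<phi> y - \<phi> x\<bar> + \<bar>\<eta> y - \<eta> x\<bar>"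
    and lip: "l-lipschitz_on UNIV \<eta>" and ab: "0 \<le> a" "a \<le> b" and in1: "\<And>x. dist p x < a \<Longrightarrow> \<eta> x = 1" and out: "\<And>x. b < dist p x \<Longrightarrow> \<eta> x = 0"
  shows "energy f \<le> 2 * energy \<phi> + ennreal (2 * real DIM('a) * l\<^sup>2 * (unit_ball_vol (real DIM('a)) * (b ^ DIM('a) - a ^ DIM('a))))"
proof -
  let ?Sh = "{x. a \<le> dist p x \<and> dist p x \<le> b}" and ?n = "real DIM('a)"
  have Sh: "?Sh \<in> sets lborel" by (simp add: borel_closed closed_Collect_conj closed_Collect_le continuous_on_dist continuous_on_const continuous_on_id)
  obtain L where L: "L-lipschitz_on UNIV \<phi>" using \<phi> lip_csE by blast
  note [measurable] = gradient_borel[OF L] Sh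
  have "energy f \<le> (\<integral>\<^sup>+x. (2 * ennreal ((norm (gradient \<phi> x))\<^sup>2) + ennreal (2 * ?n * l\<^sup>2) * indicator ?Sh x) \<partial>lborel)"
    unfolding energy_def
  proof (rule nn_integral_mono_AE)
    show "AE x in lborel. ennreal ((norm (gradient f x))\<^sup>2) \<le> 2 * ennreal ((norm (gradient \<phi> x))\<^sup>2) + ennreal (2 * ?n * l\<^sup>2) * indicator ?Sh x"
      using lip_cs_AE_partials[OF f] lip_cs_AE_partials[OF \<phi>] lip_cs_AE_partials[OF \<eta>]
    proof eventually_elim
      fix x assume a: "\<forall>b\<in>Basis. has_partial b f x (gradient f x \<bullet> b)" "\<forall>b\<in>Basis. has_partial b \<phi> x (gradient \<phi> x \<bullet> b)"
        "\<forall>b\<in>Basis. has_partial b \<eta> x (gradient \<eta> x \<bullet> b)"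
      have le_b: "(partial_deriv e f x)\<^sup>2 \<le> 2 * (partial_deriv e \<phi> x)\<^sup>2 + 2 * l\<^sup>2 * indicator ?Sh x" if e: "e \<in> Basis" for e
      proof -
        have 1: "\<bar>gradient f x \<bullet> e\<bar> \<le> \<bar>gradient \<phi> x \<bullet> e\<bar> + \<bar>gradient \<eta> x \<bullet> e\<bar>"
          by (rule has_partial_abs_le_add[OF bspec[OF a(1) e] bspec[OF a(2) e] bspec[OF a(3) e] le])
        have 2: "(gradient \<eta> x \<bullet> e)\<^sup>2 \<le> l\<^sup>2 * indicator ?Sh x"
        proof (cases "x \<in> ?Sh")
          case True
          have "\<bar>gradient \<eta> x \<bullet> e\<bar> \<le> l" using has_partial_bound[OF lip bspec[OF a(3) e]] e by simp
          then have "(gradient \<eta> x \<bullet> e)\<^sup>2 \<le> l\<^sup>2" using lipschitz_on_nonneg[OF lip] by (simp flip: abs_le_square_iff)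
          then show ?thesis using True by simp
        next
          case False
          then consider "x \<in> ball p a" | "x \<in> - cball p b" by fastforce
          then have "has_partial e \<eta> x 0"
          proof cases
            case 1
            show ?thesis by (rule has_partial_cong_open[OF has_partial_const[of _ 1] open_ball 1]) (use in1 in auto)
          next
            case 2
            show ?thesis by (rule has_partial_cong_open[OF has_partial_const[of _ 0] _ 2]) (use out in auto)
          qed
          then show ?thesis using e False by (simp add: gradient_inner_Basis has_partial_imp_partial_deriv)
        qed
        have "(gradient f x \<bullet> e)\<^sup>2 \<le> (\<bar>gradient \<phi> x \<bullet> e\<bar> + \<bar>gradient \<eta> x \<bullet> e\<bar>)\<^sup>2"
          using 1 by (simp flip: abs_le_square_iff)
        also have "\<dots> \<le> 2 * (gradient \<phi> x \<bullet> e)\<^sup>2 + 2 * (gradient \<eta> x \<bullet> e)\<^sup>2"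
          using sum_squares_bound[of "\<bar>gradient \<phi> x \<bullet> e\<bar>" "\<bar>gradient \<eta> x \<bullet> e\<bar>"] by (simp add: power2_sum)
        finally show ?thesis using 2 e by (simp add: gradient_inner_Basis)
      qed
      have "(norm (gradient f x))\<^sup>2 \<le> (\<Sum>e\<in>Basis. 2 * (partial_deriv e \<phi> x)\<^sup>2 + 2 * l\<^sup>2 * indicator ?Sh x)"
        unfolding norm_gradient_squared by (intro sum_mono le_b)
      also have "\<dots> = 2 * (norm (gradient \<phi> x))\<^sup>2 + 2 * ?n * l\<^sup>2 * indicator ?Sh x"
        unfolding norm_gradient_squared by (simp add: sum.distrib sum_distrib_left)
      finally have "ennreal ((norm (gradient f x))\<^sup>2) \<le> ennreal (2 * (norm (gradient \<phi> x))\<^sup>2 + 2 * ?n * l\<^sup>2 * indicator ?Sh x)"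
        by (rule ennreal_leI)
      also have "\<dots> = 2 * ennreal ((norm (gradient \<phi> x))\<^sup>2) + ennreal (2 * ?n * l\<^sup>2) * indicator ?Sh x"
        by (cases "x \<in> ?Sh") (auto simp: ennreal_plus ennreal_mult)
      finally show "ennreal ((norm (gradient f x))\<^sup>2) \<le> 2 * ennreal ((norm (gradient \<phi> x))\<^sup>2) + ennreal (2 * ?n * l\<^sup>2) * indicator ?Sh x" .
    qed
  qed
  also have "\<dots> = 2 * energy \<phi> + ennreal (2 * ?n * l\<^sup>2) * emeasure lborel ?Sh"
    unfolding energy_def using Sh by (subst nn_integral_add) (simp_all add: nn_integral_cmult nn_integral_cmult_indicator)
  also have "ennreal (2 * ?n * l\<^sup>2) * emeasure lborel ?Sh = ennreal (2 * ?n * l\<^sup>2 * (unit_ball_vol ?n * (b ^ DIM('a) - a ^ DIM('a))))"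
    unfolding measure_closed_shell[OF ab] using ab
    by (subst ennreal_mult) (auto intro!: mult_nonneg_nonneg power_mono)
  finally show ?thesis .
qed

definition cutoff :: "'a::euclidean_space \<Rightarrow> real \<Rightarrow> real \<Rightarrow> 'a \<Rightarrow> real" where
  "cutoff p r s x = max 0 (min 1 ((r - dist p x) / s))"

lemma cutoff_lipschitz:
  assumes "0 < s" shows "(1 / s)-lipschitz_on UNIV (cutoff p r s)"
proof (rule lipschitz_onI)
  fix x y :: 'a
  have "dist (cutoff p r s x) (cutoff p r s y) \<le> \<bar>(r - dist p x) / s - (r - dist p y) / s\<bar>"
    by (simp add: cutoff_def dist_real_def)
  also have "\<dots> = \<bar>dist p y - dist p x\<bar> / s" using assms by (simp flip: diff_divide_distrib)
  also have "\<dots> \<le> dist x y / s" using assms by (intro divide_right_mono) (auto simp: abs_le_iff dist_commute, metis add.commute dist_commute dist_triangle diff_le_eq, metis add.commute dist_commute dist_triangle diff_le_eq)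
  finally show "dist (cutoff p r s x) (cutoff p r s y) \<le> 1 / s * dist x y" by simp
qed (use assms in simp)

lemma cutoff_bounds: "0 \<le> cutoff p r s x" "cutoff p r s x \<le> 1"
  by (auto simp: cutoff_def)

text \<open>From \<open>2 q F \<le> F^2 + q^2\<close>: a lower bound for the mean of
  \<open>h\<close> yields one for the integral of the square, with no sign condition on
  \<open>F\<close> or \<open>h\<close>.\<close>

lemma integral_square_ge:
  fixes F :: "'a::euclidean_space \<Rightarrow> real"
  assumes A: "A \<in> sets lborel" "emeasure lborel A < \<infinity>" and i: "integrable lborel (\<lambda>x. (F x)\<^sup>2)"
    and h: "integrable lborel (\<lambda>x. h x * indicator A x)" "\<And>x. x \<in> A \<Longrightarrow> h x \<le> F x"
    and q: "0 \<le> q" "q * measure lborel A \<le> (\<integral>x. h x * indicator A x \<partial>lborel)"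
  shows "q\<^sup>2 * measure lborel A \<le> (\<integral>x. (F x)\<^sup>2 \<partial>lborel)"
proof -
  have iA: "integrable lborel (\<lambda>x. indicator A x :: real)" using A by (intro integrable_real_indicator) auto
  have "q\<^sup>2 * measure lborel A \<le> 2 * q * (\<integral>x. h x * indicator A x \<partial>lborel) - q\<^sup>2 * measure lborel A"
    using mult_left_mono[OF q(2) q(1)] by (simp add: power2_eq_square)
  also have "\<dots> = (\<integral>x. 2 * q * (h x * indicator A x) - q\<^sup>2 * indicator A x \<partial>lborel)"
    using h(1) iA A by simp
  also have "\<dots> \<le> (\<integral>x. (F x)\<^sup>2 \<partial>lborel)"
  proof (rule integral_mono)
    show "integrable lborel (\<lambda>x. 2 * q * (h x * indicator A x) - q\<^sup>2 * indicator A x)"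
      by (intro Bochner_Integration.integrable_diff integrable_mult_right h(1) iA)
    fix x
    show "2 * q * (h x * indicator A x) - q\<^sup>2 * indicator A x \<le> (F x)\<^sup>2"
    proof (cases "x \<in> A")
      case True
      have "2 * q * h x \<le> 2 * q * F x" using h(2)[OF True] q(1) by (intro mult_left_mono) auto
      also have "\<dots> \<le> (F x)\<^sup>2 + q\<^sup>2" using sum_squares_bound[of "F x" q] by (simp add: mult_ac)
      finally show ?thesis using True by simp
    qed simp
  qed (rule i)
  finally show ?thesis .
qed

text \<open>Common factors cancel and leave
  \<open>(2 g' (n - 2) k^2 + 2 n k) * 2 / (q^2 k^3 r^2)\<close>. The bracket is at most
  \<open>13/16\<close>, and \<open>13/16 * 2 / (15/64)^2\<close> is about \<open>29.6\<close>, below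
  the constant \<open>32\<close>.\<close>

lemma upper_ratio_arith:
  fixes n w r k g g' q P :: real
  assumes n: "3 \<le> n" and w: "0 < w" and r: "0 < r" "0 < P" and k: "0 < k" "2 * (n - 2) * k\<^sup>2 + 2 * n * k \<le> 13 / 16"
    and g: "g < 1" "0 \<le> g'" "g' \<le> 1" and q: "15 / 64 * (1 - g) \<le> q"
  shows "(2 * (g' * (n * (n - 2) * w * P)) + 2 * n * (1 / (k * r))\<^sup>2 * (w * (r\<^sup>2 * P * (n * k)))) / (q\<^sup>2 * (w * (r\<^sup>2 * P * (n * k / 2))))
    \<le> 32 / ((1 - g)\<^sup>2 * k ^ 3) / r\<^sup>2"
proof -
  have "0 < 15 / 64 * (1 - g)" using g by simp
  then have q0: "0 < q" using q by (rule less_le_trans)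
  have e1: "2 * n * (1 / (k * r))\<^sup>2 * (w * (r\<^sup>2 * P * (n * k))) = n * w * P * (2 * n / k)"
    using r k by (simp add: field_simps power2_eq_square)
  have "(2 * (g' * (n * (n - 2) * w * P)) + 2 * n * (1 / (k * r))\<^sup>2 * (w * (r\<^sup>2 * P * (n * k)))) / (q\<^sup>2 * (w * (r\<^sup>2 * P * (n * k / 2))))
    = (2 * g' * (n - 2) * k\<^sup>2 + 2 * n * k) * (2 / (q\<^sup>2 * k ^ 3)) / r\<^sup>2"
    unfolding e1 using r k w n q0 by (simp add: divide_simps) (simp add: algebra_simps power2_eq_square power3_eq_cube)
  also have "\<dots> \<le> (13 / 16) * (2 / ((15 / 64 * (1 - g))\<^sup>2 * k ^ 3)) / r\<^sup>2"
  proof (intro divide_right_mono mult_mono divide_left_mono mult_right_mono power_mono)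
    have "g' * (2 * (n - 2) * k\<^sup>2) \<le> 1 * (2 * (n - 2) * k\<^sup>2)" using g n by (intro mult_right_mono) auto
    moreover have "2 * g' * (n - 2) * k\<^sup>2 = g' * (2 * (n - 2) * k\<^sup>2)" by simp
    ultimately show "2 * g' * (n - 2) * k\<^sup>2 + 2 * n * k \<le> 13 / 16" using k(2) by linarith
  qed (use q g k q0 in auto)
  also have "\<dots> \<le> 32 / ((1 - g)\<^sup>2 * k ^ 3) / r\<^sup>2"
  proof (rule divide_right_mono)
    have "13 / 16 * (2 / ((15 / 64 * t)\<^sup>2 * k ^ 3)) \<le> 32 / (t\<^sup>2 * k ^ 3)" if "0 < t" for t :: real
      using that k by (simp add: power_mult_distrib divide_simps)
    from this[of "1 - g"] show "13 / 16 * (2 / ((15 / 64 * (1 - g))\<^sup>2 * k ^ 3)) \<le> 32 / ((1 - g)\<^sup>2 * k ^ 3)" using g by simp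
  qed simp
  finally show ?thesis .
qed

lemma dirichlet_bottom_le_quotient:
  assumes F: "F \<in> test_functions \<Omega>" and num: "energy F \<le> ennreal M" and den: "D \<le> (\<integral>x. (F x)\<^sup>2 \<partial>lborel)" and D: "0 < D" and M: "0 \<le> M"
  shows "dirichlet_bottom \<Omega> \<le> ennreal (M / D)"
proof -
  \<comment> \<open>The integral of a function that is not integrable is 0 by convention, so a
    positive lower bound already gives integrability.\<close>
  have i: "integrable lborel (\<lambda>x. (F x)\<^sup>2)" using D den not_integrable_integral_eq by fastforce
  have nz: "F \<noteq> (\<lambda>_. 0)" using D den by auto
  have "dirichlet_bottom \<Omega> \<le> (\<integral>\<^sup>+x\<in>\<Omega>. ennreal ((norm (gradient F x))\<^sup>2) \<partial>lborel) / (\<integral>\<^sup>+x\<in>\<Omega>. ennreal (\<bar>F x\<bar>\<^sup>2) \<partial>lborel)"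
    unfolding dirichlet_bottom_def by (rule INF_lower) (use F nz in auto)
  also have "(\<integral>\<^sup>+x\<in>\<Omega>. ennreal ((norm (gradient F x))\<^sup>2) \<partial>lborel) = energy F"
    unfolding energy_def by (intro nn_integral_cong) (auto simp: indicator_def test_function_outside(2)[OF F])
  also have "(\<integral>\<^sup>+x\<in>\<Omega>. ennreal (\<bar>F x\<bar>\<^sup>2) \<partial>lborel) = (\<integral>\<^sup>+x. ennreal ((F x)\<^sup>2) \<partial>lborel)"
    by (intro nn_integral_cong) (auto simp: indicator_def test_function_outside(1)[OF F])
  also have "\<dots> = ennreal (\<integral>x. (F x)\<^sup>2 \<partial>lborel)" by (rule nn_integral_eq_integral[OF i]) simp
  also have "energy F / \<dots> \<le> ennreal M / ennreal (\<integral>x. (F x)\<^sup>2 \<partial>lborel)" by (rule divide_right_mono_ennreal[OF num])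
  also have "\<dots> = ennreal (M / (\<integral>x. (F x)\<^sup>2 \<partial>lborel))" using D den M by (intro divide_ennreal) auto
  also have "\<dots> \<le> ennreal (M / D)" using D den M by (intro ennreal_leI divide_left_mono) auto
  finally show ?thesis .
qed

text \<open>The set where \<open>f0 \<ge> d\<close> is a compact subset of \<open>\<Omega>\<close>,
  hence at positive distance from the complement. Subtracting \<open>d\<close> confines the support
  to it, and a mollification on a smaller scale stays in \<open>\<Omega>\<close>. The two operations
  cost at most \<open>d\<close> each.\<close>

lemma mollify_into_open:
  fixes f0 :: "'a::euclidean_space \<Rightarrow> real"
  assumes c: "lip_cs f0" and \<Omega>: "open \<Omega>" and d: "0 < d" and sub: "\<And>x. d \<le> f0 x \<Longrightarrow> x \<in> \<Omega>"
  obtains F where "F \<in> test_functions \<Omega>" "energy F \<le> energy (\<lambda>x. max 0 (f0 x - d))" "\<And>x. f0 x - 2 * d \<le> F x"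
    "integrable lborel (\<lambda>x. (F x)\<^sup>2)"
proof -
  let ?f = "\<lambda>x. max 0 (f0 x - d)" and ?K = "{x. d \<le> f0 x}"
  obtain L R where L: "L-lipschitz_on UNIV f0" and R: "\<And>x. R < norm x \<Longrightarrow> f0 x = 0" using lip_csE[OF c] by blast
  have cf0: "continuous_on UNIV f0" using L by (rule lipschitz_on_continuous_on)
  have f: "lip_cs ?f"
    by (rule lip_csI[of _ R]) (auto intro!: locally_lip_max locally_lip_minus lip_cs_locally_lip[OF c] simp: R d less_imp_le)
  have Kb: "norm x \<le> R" if "x \<in> ?K" for x using that R[of x] d by (cases "R < norm x") auto
  have "closed ?K" using cf0 by (intro closed_Collect_le) auto
  moreover have "bounded ?K" using Kb unfolding bounded_iff by blast
  ultimately have "compact ?K" by (simp add: compact_eq_bounded_closed)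
  moreover have "closed (- \<Omega>)" by (rule closed_Compl[OF \<Omega>])
  moreover have "?K \<inter> - \<Omega> = {}" using sub by auto
  ultimately obtain e0 where e0: "0 < e0" "\<And>x y. x \<in> ?K \<Longrightarrow> y \<in> - \<Omega> \<Longrightarrow> e0 \<le> dist x y"
    using separate_compact_closed by metis
  \<comment> \<open>A point in the closure of the support of \<open>F\<close> is reached from
    \<open>?K\<close> in two steps of length at most \<open>e\<close>; hence
    \<open>2 * e < e0\<close>.\<close>
  define e where "e = min d (e0 / 3)"
  have e: "0 < e" "e \<le> d" "2 * e < e0" using d e0(1) by (auto simp: e_def min_def)
  obtain F where F: "\<forall>k. C_k k F" "energy F \<le> energy ?f" "\<And>x. \<bar>F x - ?f x\<bar> \<le> e"
    "\<And>x. (\<And>y. dist x y \<le> e \<Longrightarrow> ?f y = 0) \<Longrightarrow> F x = 0"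
    using mollify[OF f e(1)] by metis
  have near: "\<exists>y\<in>?K. dist x y \<le> e" if "F x \<noteq> 0" for x
    using F(4)[of x] that by (force simp: max_def)
  have FR: "F x = 0" if "R + e < norm x" for x
  proof (rule ccontr)
    assume "F x \<noteq> 0"
    then obtain y where y: "y \<in> ?K" "dist x y \<le> e" using near by blast
    have "norm x \<le> norm y + norm (x - y)" using norm_triangle_sub[of x y] by simp
    then show False using y Kb[OF y(1)] that by (simp add: dist_norm)
  qed
  have "closure {x. F x \<noteq> 0} \<subseteq> \<Omega>"
  proof
    fix x assume "x \<in> closure {x. F x \<noteq> 0}"
    then obtain z where z: "F z \<noteq> 0" "dist z x < e" using e(1) unfolding closure_approachable by blast
    then obtain y where y: "y \<in> ?K" "dist z y \<le> e" using near by blast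
    have "dist y x < e0" using z y e dist_triangle[of y x z] by (simp add: dist_commute)
    then show "x \<in> \<Omega>" using e0(2)[OF y(1), of x] by fastforce
  qed
  moreover have "has_compact_support F" unfolding has_compact_support_iff using FR by blast
  ultimately have "F \<in> test_functions \<Omega>" using F(1) by (simp add: test_functions_def)
  moreover have "f0 x - 2 * d \<le> F x" for x using F(3)[of x] e(2) by (auto simp: max_def split: if_splits)
  moreover have "integrable lborel (\<lambda>x. (F x)\<^sup>2)"
  proof (rule integrable_continuous_compact_support[of _ "R + e"])
    have "continuous_on UNIV F" using F(1) C_k.simps(1) by blast
    then show "continuous_on UNIV (\<lambda>x. (F x)\<^sup>2)" by (intro continuous_intros)
  qed (simp add: FR)
  ultimately show thesis using that F(2) by blast
qed

lemma dirichlet_bottom_le: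
  fixes \<Omega> :: "'a::euclidean_space set"
  assumes n: "3 \<le> DIM('a)" and g: "0 < g" "g < 1" and \<Omega>: "open \<Omega>" and r: "0 < r"
    and neg: "negligible_in_cball g (cball p r - \<Omega>) p r"
  shows "dirichlet_bottom \<Omega> \<le> ennreal (upper_const g DIM('a) / r\<^sup>2)"
proof -
  let ?n = "real DIM('a)" and ?w = "unit_ball_vol (real DIM('a))" and ?F = "cball p r - \<Omega>"
  define k where "k = kappa g DIM('a)"
  have n3: "3 \<le> ?n" using n by simp
  note kap = kappa_bounds[OF n3 g k_def[unfolded kappa_def]]
  have w: "0 < ?w" by (simp add: unit_ball_vol_pos)
  define P where "P = r ^ (DIM('a) - 2)"
  have "2 + (DIM('a) - 2) = DIM('a)" using n by simp
  then have P: "0 < P" "r ^ DIM('a) = r\<^sup>2 * P"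
    using r power_add[of r 2 "DIM('a) - 2"] by (simp_all only: P_def zero_less_power)
  \<comment> \<open>The infimum in the capacity need not be attained, so \<open>g'\<close> leaves
    room for a competitor. Together \<open>g'\<close> and the truncation level \<open>d\<close> cost
    \<open>(1 - g) / 64\<close>: the ideal value \<open>(1 - g) / 4\<close> for the mean of the test
    function on the shell becomes \<open>15 / 64 * (1 - g)\<close>.\<close>
  define g' where "g' = g + (1 - g) / 128"
  have g': "g < g'" "0 < g'" "g' \<le> 1" using g by (auto simp: g'_def field_simps)
  define d where "d = (1 - g) / 256"
  have d: "0 < d" "d < 1" using g by (auto simp: d_def)
  define c where "c = ?n * (?n - 2) * ?w * P"
  have c: "0 < c" using n3 w P by (simp add: c_def)
  have "capacity ?F \<le> ennreal g * capacity (cball p r)" using neg by (simp add: negligible_in_cball_def)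
  also have "\<dots> \<le> ennreal g * ennreal c"
    using capacity_cball_le[OF n r, of p] by (intro mult_left_mono) (auto simp: c_def P_def)
  also have "\<dots> = ennreal (g * c)" using g c by (simp add: ennreal_mult)
  also have "\<dots> < ennreal (g' * c)" using g g' c by (intro ennreal_lessI) auto
  finally obtain \<phi> where \<phi>: "lip_cs \<phi>" "\<And>x. x \<in> ?F \<Longrightarrow> \<phi> x = 1" "energy \<phi> < ennreal (g' * c)"
    unfolding capacity_eq INF_less_iff by blast
  \<comment> \<open>The truncation ensures \<open>0 \<le> 1 - \<psi> x \<le> 1\<close>, which the
    increment estimate below uses, and does not increase increments.\<close>
  define \<psi> where "\<psi> x = min 1 (max 0 (\<phi> x))" for x
  have \<psi>: "lip_cs \<psi>" "\<And>x. 0 \<le> \<psi> x" "\<And>x. \<psi> x \<le> 1" "\<And>x. x \<in> ?F \<Longrightarrow> \<psi> x = 1"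
  proof -
    obtain R where R: "\<And>x. R < norm x \<Longrightarrow> \<phi> x = 0" using lip_csE[OF \<phi>(1)] by blast
    show "lip_cs \<psi>" unfolding \<psi>_def[abs_def]
      by (rule lip_csI[of _ R]) (auto intro!: locally_lip_max lip_cs_locally_lip[OF \<phi>(1)] simp: R)
  qed (use \<phi>(2) in \<open>auto simp: \<psi>_def\<close>)
  have \<psi>le: "\<bar>\<psi> y - \<psi> x\<bar> \<le> \<bar>\<phi> y - \<phi> x\<bar>" for x y by (auto simp: \<psi>_def)
  define \<eta> where "\<eta> = cutoff p r (k * r)"
  have kr: "0 < k * r" using kap(1) r by simp
  have \<eta>lip: "(1 / (k * r))-lipschitz_on UNIV \<eta>" unfolding \<eta>_def by (rule cutoff_lipschitz[OF kr])
  have \<eta>b: "0 \<le> \<eta> x" "\<eta> x \<le> 1" for x using cutoff_bounds by (auto simp: \<eta>_def)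
  have \<eta>1: "\<eta> x = 1" if "dist p x \<le> (1 - k) * r" for x
    using that kr by (simp add: \<eta>_def cutoff_def pos_le_divide_eq min_absorb1 algebra_simps)
  have \<eta>0: "\<eta> x = 0" if "r \<le> dist p x" for x
    using that kr by (simp add: \<eta>_def cutoff_def divide_nonpos_pos min.coboundedI2 max_absorb1)
  have far: "r < dist p x" if "norm p + r < norm x" for x
    using that norm_triangle_ineq2[of x p] by (simp add: dist_norm norm_minus_commute)
  have \<eta>cs: "lip_cs \<eta>"
    by (rule lip_csI[of _ "norm p + r"]) (auto intro: lipschitz_imp_locally_lip[OF \<eta>lip] \<eta>0 less_imp_le[OF far])
  define f0 where "f0 x = \<eta> x * (1 - \<psi> x)" for x
  have f0: "lip_cs f0" unfolding f0_def[abs_def]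
  proof (rule lip_csI[of _ "norm p + r"])
    show "locally_lip (\<lambda>x. \<eta> x * (1 - \<psi> x))"
      by (intro locally_lip_mult locally_lip_minus locally_lip_const lip_cs_locally_lip \<eta>cs \<psi>)
  qed (use \<eta>0 less_imp_le[OF far] in auto)
  have f0\<Omega>: "x \<in> \<Omega>" if "d \<le> f0 x" for x
  proof (rule ccontr)
    assume "x \<notin> \<Omega>"
    moreover have "dist p x < r" using that d \<eta>0[of x] by (cases "r \<le> dist p x") (auto simp: f0_def)
    ultimately have "\<psi> x = 1" using \<psi>(4)[of x] by simp
    then show False using that d by (simp add: f0_def)
  qed
  obtain F where F: "F \<in> test_functions \<Omega>" "energy F \<le> energy (\<lambda>x. max 0 (f0 x - d))" "\<And>x. f0 x - 2 * d \<le> F x"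
    "integrable lborel (\<lambda>x. (F x)\<^sup>2)"
    using mollify_into_open[OF f0 \<Omega> d(1) f0\<Omega>] by metis
  let ?f = "\<lambda>x. max 0 (f0 x - d)"
  have fcs: "lip_cs ?f"
  proof (rule lip_csI[of _ "norm p + r"])
    show "locally_lip ?f" by (intro locally_lip_max locally_lip_minus lip_cs_locally_lip[OF f0] locally_lip_const)
  qed (use \<eta>0 less_imp_le[OF far] d in \<open>auto simp: f0_def\<close>)
  have fle: "\<bar>?f y - ?f x\<bar> \<le> \<bar>\<phi> y - \<phi> x\<bar> + \<bar>\<eta> y - \<eta> x\<bar>" for x y
  proof -
    have "\<bar>?f y - ?f x\<bar> \<le> \<bar>f0 y - f0 x\<bar>" by auto
    \<comment> \<open>A product rule for increments, with both coefficients in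
      \<open>{0..1}\<close>.\<close>
    also have "f0 y - f0 x = (\<eta> y - \<eta> x) * (1 - \<psi> y) + \<eta> x * (\<psi> x - \<psi> y)" by (simp add: f0_def algebra_simps)
    also have "\<bar>\<dots>\<bar> \<le> \<bar>\<eta> y - \<eta> x\<bar> * 1 + 1 * \<bar>\<psi> y - \<psi> x\<bar>"
    proof (rule order_trans[OF abs_triangle_ineq], unfold abs_mult, rule add_mono)
      show "\<bar>\<eta> y - \<eta> x\<bar> * \<bar>1 - \<psi> y\<bar> \<le> \<bar>\<eta> y - \<eta> x\<bar> * 1" using \<psi>(2,3)[of y] by (intro mult_left_mono) auto
      show "\<bar>\<eta> x\<bar> * \<bar>\<psi> x - \<psi> y\<bar> \<le> 1 * \<bar>\<psi> y - \<psi> x\<bar>"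
        using \<eta>b[of x] by (subst abs_minus_commute) (intro mult_right_mono, auto)
    qed
    also have "\<dots> \<le> \<bar>\<phi> y - \<phi> x\<bar> + \<bar>\<eta> y - \<eta> x\<bar>" using \<psi>le[of y x] by simp
    finally show ?thesis .
  qed
  define M where "M = 2 * (g' * c) + 2 * ?n * (1 / (k * r))\<^sup>2 * (?w * (r\<^sup>2 * P * (?n * k)))"
  have k1: "(1 - k) * r \<le> r" "0 \<le> (1 - k) * r" using r kap(1,2) by (auto simp: mult_le_cancel_right1)
  have "energy F \<le> 2 * energy \<phi> + ennreal (2 * ?n * (1 / (k * r))\<^sup>2 * (?w * (r ^ DIM('a) - ((1 - k) * r) ^ DIM('a))))"
    by (rule order_trans[OF F(2)], rule energy_le_with_cutoff[where p=p, OF fcs \<phi>(1) \<eta>cs fle \<eta>lip k1(2,1)]) (auto intro: \<eta>1 \<eta>0)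
  also have "\<dots> \<le> ennreal (2 * (g' * c)) + ennreal (2 * ?n * (1 / (k * r))\<^sup>2 * (?w * (r\<^sup>2 * P * (?n * k))))"
  proof (intro add_mono ennreal_leI mult_left_mono)
    show "2 * energy \<phi> \<le> ennreal (2 * (g' * c))"
      using mult_left_mono[OF less_imp_le[OF \<phi>(3)], of 2] g' c by (simp add: ennreal_mult)
    \<comment> \<open>Bernoulli: a layer of relative width \<open>k\<close> takes up at most the
      fraction \<open>n * k\<close> of the volume of the ball.\<close>
    have "r ^ DIM('a) - ((1 - k) * r) ^ DIM('a) = r ^ DIM('a) * (1 - (1 - k) ^ DIM('a))"
      unfolding power_mult_distrib by (simp add: algebra_simps)
    also have "\<dots> \<le> r ^ DIM('a) * (?n * k)"
      using bernoulli_minus[of k "DIM('a)"] kap(2) r by (intro mult_left_mono) auto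
    finally show "r ^ DIM('a) - ((1 - k) * r) ^ DIM('a) \<le> r\<^sup>2 * P * (?n * k)" using P by simp
  qed (use w in auto)
  also have "\<dots> = ennreal M" unfolding M_def
    using g' c w P kap(1) by (intro ennreal_plus[symmetric]) (auto intro!: mult_nonneg_nonneg)
  finally have num: "energy F \<le> ennreal M" .
  have M0: "0 \<le> M" unfolding M_def using g' c w P kap(1) by (auto intro!: add_nonneg_nonneg mult_nonneg_nonneg)

  let ?a = "(1 - 2 * k) * r" and ?b = "(1 - k) * r"
  \<comment> \<open>This shell lies just inside the layer in which the cutoff decreases, so
    \<open>\<eta> = 1\<close> on it.\<close>
  let ?A = "{x. ?a < dist p x \<and> dist p x < ?b}"
  have ab: "0 < ?a" "?a < ?b" using kap(1,2) r by auto
  have A: "?A \<in> sets lborel"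
    by (simp add: borel_open open_Collect_conj open_Collect_less continuous_on_dist continuous_on_const continuous_on_id)
  have mA: "measure lborel ?A = ?w * (?b ^ DIM('a) - ?a ^ DIM('a))" by (rule emeasure_shell(1)[OF ab])
  define V where "V = measure lborel ?A"
  have Vge: "?w * (r\<^sup>2 * P * (?n * k / 2)) \<le> V"
  proof -
    have "?w * (r\<^sup>2 * P * (?n * k / 2)) \<le> ?w * (r\<^sup>2 * P * ((1 - k) ^ DIM('a) - (1 - 2 * k) ^ DIM('a)))"
      using inner_shell_volume[of k "DIM('a)"] kap w P r by (intro mult_left_mono) auto
    also have "\<dots> = V" unfolding V_def mA power_mult_distrib P(2)[symmetric] by (simp add: algebra_simps)
    finally show ?thesis .
  qed
  have V0: "0 < V" using Vge w P r kap(1) n3 by (intro less_le_trans[OF _ Vge]) simp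
  \<comment> \<open>The mean of the truncated potential. The shell estimate bounds its square by
    \<open>g'\<close> divided by \<open>(1 - 2 * k) ^ (n - 2)\<close>.\<close>
  define m where "m = (\<integral>x. \<psi> x * indicator ?A x \<partial>lborel) / V"
  have "(\<integral>x. \<psi> x * indicator ?A x \<partial>lborel) = m * (?w * (?b ^ DIM('a) - ?a ^ DIM('a)))"
    using V0 by (simp add: m_def flip: mA V_def)
  from shell_average_le_energy[OF n \<psi>(1) ab this]
  have "ennreal (m\<^sup>2 * (?n * (?n - 2) * ?w * ?a ^ (DIM('a) - 2))) \<le> energy \<psi>" .
  also have "\<dots> \<le> energy \<phi>" by (rule energy_contraction[OF \<psi>(1) \<phi>(1) \<psi>le])
  also have "\<dots> \<le> ennreal (g' * c)" using \<phi>(3) by simp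
  finally have "m\<^sup>2 * (?n * (?n - 2) * ?w * ?a ^ (DIM('a) - 2)) \<le> g' * c" using g' c by (simp add: ennreal_le_iff)
  then have "(m\<^sup>2 * (1 - 2 * k) ^ (DIM('a) - 2)) * c \<le> g' * c"
    by (simp add: c_def P_def power_mult_distrib mult_ac)
  then have m1: "m\<^sup>2 * (1 - 2 * k) ^ (DIM('a) - 2) \<le> g'" using c by simp
  \<comment> \<open>Bernoulli's lower bound for \<open>(1 - 2 * k) ^ (n - 2)\<close>. The choice of
    \<open>kappa\<close> makes \<open>g / T\<close> at most \<open>(1 + g) / 2\<close>, halfway
    between \<open>g\<close> and 1.\<close>
  define T where "T = 1 - 2 * (?n - 2) * k"
  have T: "1 / 2 \<le> T" "g \<le> T * ((1 + g) / 2)" using kap(3,4) by (auto simp: T_def)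
  have "m\<^sup>2 * T \<le> m\<^sup>2 * (1 - 2 * k) ^ (DIM('a) - 2)"
    using bernoulli_minus[of "2 * k" "DIM('a) - 2"] kap(2) n
    by (intro mult_left_mono) (auto simp: T_def of_nat_diff algebra_simps)
  then have "m\<^sup>2 * T \<le> g'" using m1 by simp
  also have "g' \<le> T * ((1 + g) / 2) + (1 - g) / 128" using T by (simp add: g'_def)
  also have "\<dots> \<le> T * ((1 + g) / 2) + T * ((1 - g) / 64)"
    using mult_right_mono[OF T(1), of "(1 - g) / 64"] g by simp
  finally have "m\<^sup>2 * T \<le> ((1 + g) / 2 + (1 - g) / 64) * T" by (simp add: algebra_simps)
  then have "m\<^sup>2 \<le> (1 + g) / 2 + (1 - g) / 64" using T(1) by (simp add: mult_le_cancel_right)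
  \<comment> \<open>This avoids a square root in passing from the bound on the square of
    \<open>m\<close> to one on \<open>m\<close>.\<close>
  moreover have "2 * m \<le> 1 + m\<^sup>2" using sum_squares_bound[of 1 m] by simp
  ultimately have m2: "m \<le> 1 / 2 + (1 + g) / 4 + (1 - g) / 128" by (simp add: field_simps)
  define q where "q = 1 - m - 2 * d"
  have q: "15 / 64 * (1 - g) \<le> q" using m2 by (simp add: q_def d_def field_simps)
  have "0 < 15 / 64 * (1 - g)" using g by simp
  then have q0: "0 < q" using q by (rule less_le_trans)
  have iA: "integrable lborel (\<lambda>x. indicator ?A x :: real)"
    using emeasure_shell(2)[OF ab, of p] A by (intro integrable_real_indicator) auto
  have \<psi>c: "continuous_on UNIV \<psi>" by (rule locally_lip_continuous[OF lip_cs_locally_lip[OF \<psi>(1)]])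
  have [measurable]: "\<psi> \<in> borel_measurable borel" by (rule borel_measurable_continuous_onI[OF \<psi>c])
  note [measurable] = A
  have i\<psi>: "integrable lborel (\<lambda>x. \<psi> x * indicator ?A x)"
    by (rule Bochner_Integration.integrable_bound[OF iA])
      (use \<psi>(2,3) A in \<open>auto simp: indicator_def\<close>)
  have ih: "integrable lborel (\<lambda>x. (1 - \<psi> x - 2 * d) * indicator ?A x)"
    "(\<integral>x. (1 - \<psi> x - 2 * d) * indicator ?A x \<partial>lborel) = q * V"
  proof -
    have eq: "(\<lambda>x. (1 - \<psi> x - 2 * d) * indicator ?A x) = (\<lambda>x. (1 - 2 * d) * indicator ?A x - \<psi> x * indicator ?A x)"
      by (auto simp: algebra_simps)
    show "integrable lborel (\<lambda>x. (1 - \<psi> x - 2 * d) * indicator ?A x)"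
      unfolding eq by (intro Bochner_Integration.integrable_diff integrable_mult_right iA i\<psi>)
    have "(\<integral>x. \<psi> x * indicator ?A x \<partial>lborel) = m * V" using V0 by (simp add: m_def)
    then show "(\<integral>x. (1 - \<psi> x - 2 * d) * indicator ?A x \<partial>lborel) = q * V"
      unfolding eq using iA i\<psi> by (simp add: V_def q_def algebra_simps)
  qed
  have "q\<^sup>2 * V \<le> (\<integral>x. (F x)\<^sup>2 \<partial>lborel)"
    unfolding V_def
  proof (rule integral_square_ge[OF A emeasure_shell(2)[OF ab] F(4) ih(1)])
    fix x assume "x \<in> ?A"
    then have "\<eta> x = 1" using \<eta>1[of x] by simp
    then show "1 - \<psi> x - 2 * d \<le> F x" using F(3)[of x] by (simp add: f0_def)
  qed (use q0 ih(2) in \<open>auto simp: V_def\<close>)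
  moreover have "q\<^sup>2 * (?w * (r\<^sup>2 * P * (?n * k / 2))) \<le> q\<^sup>2 * V" by (rule mult_left_mono[OF Vge]) simp
  ultimately have den: "q\<^sup>2 * (?w * (r\<^sup>2 * P * (?n * k / 2))) \<le> (\<integral>x. (F x)\<^sup>2 \<partial>lborel)" by simp
  have "dirichlet_bottom \<Omega> \<le> ennreal (M / (q\<^sup>2 * (?w * (r\<^sup>2 * P * (?n * k / 2)))))"
    by (rule dirichlet_bottom_le_quotient[OF F(1) num den _ M0]) (use q0 w P r kap(1) n3 in simp)
  also have "\<dots> \<le> ennreal (upper_const g DIM('a) / r\<^sup>2)"
    unfolding M_def c_def upper_const_def k_def[symmetric]
    by (intro ennreal_leI upper_ratio_arith n3 w r P kap q g) (use g' in auto)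
  finally show ?thesis .
qed

text \<open>Without admissible radii the capacitary radius is 0 and the right side is infinite.
  Otherwise, if the bottom \<open>l\<close> is positive, every admissible radius is at most
  \<open>sqrt (?C / l)\<close>; an infinite capacitary radius thus forces
  \<open>l = 0\<close>.\<close>

lemma upper_bound:
  fixes \<Omega> :: "'a::euclidean_space set"
  assumes n: "3 \<le> DIM('a)" and g: "0 < g" "g < 1" and \<Omega>: "open \<Omega>"
  shows "dirichlet_bottom \<Omega> \<le> ennreal (upper_const g DIM('a)) * inverse ((capacitary_radius \<Omega> g)\<^sup>2)"
proof -
  let ?C = "upper_const g DIM('a)"
  let ?S = "{r. r > 0 \<and> (\<exists>a. negligible_in_cball g (cball a r - \<Omega>) a r)}"
  have n3: "3 \<le> real DIM('a)" using n by simp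
  have "0 < kappa g DIM('a)" by (rule kappa_bounds(1)[OF n3 g kappa_def])
  then have C: "0 < ?C" using g by (simp add: upper_const_def)
  have le: "dirichlet_bottom \<Omega> \<le> ennreal (?C / r\<^sup>2)" if "r \<in> ?S" for r
    using dirichlet_bottom_le[OF n g \<Omega>] that by blast
  show ?thesis
  proof (cases "?S = {}")
    case True
    then have "capacitary_radius \<Omega> g = 0" unfolding capacitary_radius_def True by (simp add: bot_ennreal)
    then show ?thesis using C by (simp add: ennreal_mult_top)
  next
    case False
    then obtain r0 where r0: "r0 \<in> ?S" by blast
    have "dirichlet_bottom \<Omega> \<noteq> top" using le[OF r0] by (metis ennreal_neq_top top.extremum_uniqueI)
    then obtain l where l: "dirichlet_bottom \<Omega> = ennreal l" "0 \<le> l" by (metis ennreal_cases)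
    have R0: "0 < capacitary_radius \<Omega> g"
    proof -
      have "ennreal r0 \<le> capacitary_radius \<Omega> g" unfolding capacitary_radius_def using r0 by (intro SUP_upper) auto
      moreover have "0 < ennreal r0" using r0 by simp
      ultimately show ?thesis by (rule less_le_trans[rotated])
    qed
    show ?thesis
    proof (cases "l = 0")
      case False
      then have l0: "0 < l" using l by simp
      have "capacitary_radius \<Omega> g \<le> ennreal (sqrt (?C / l))"
        unfolding capacitary_radius_def
      proof (intro SUP_least ennreal_leI real_le_rsqrt)
        fix r assume r: "r \<in> ?S"
        then have "l \<le> ?C / r\<^sup>2" using le[OF r] l C by (simp add: ennreal_le_iff)
        then show "r\<^sup>2 \<le> ?C / l" using r l0 by (simp add: field_simps)
      qed
      then obtain R where R: "capacitary_radius \<Omega> g = ennreal R" "0 \<le> R" "R \<le> sqrt (?C / l)"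
        using C l0 by (cases "capacitary_radius \<Omega> g") (auto simp: top_unique ennreal_le_iff)
      have Rp: "0 < R" using R0 R by simp
      have "R\<^sup>2 \<le> (sqrt (?C / l))\<^sup>2" using R by (intro power_mono) auto
      then have "R\<^sup>2 \<le> ?C / l" using C l0 by simp
      then have "l \<le> ?C / R\<^sup>2" using Rp l0 by (simp add: field_simps)
      then have "ennreal l \<le> ennreal (?C / R\<^sup>2)" by (rule ennreal_leI)
      also have "\<dots> = ennreal ?C * inverse ((ennreal R)\<^sup>2)"
        using Rp C by (simp add: ennreal_power inverse_ennreal ennreal_mult[symmetric] divide_inverse)
      finally show ?thesis using l R by simp
    qed (simp add: l)
  qed
qed

text \<open>Integer points with balls of radius \<open>CARD('n)\<close>: rounding down moves a point
  by at most this much in the sum norm, and the centres near a point have bounded integer offsets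
  from its rounded coordinates.\<close>

lemma lattice_covering:
  obtains S :: "(real ^ 'n::finite) set" and \<rho> N where "0 < N" "ball_covering S \<rho> N"
proof -
  \<comment> \<open>The radius plus 1, since offsets are measured from the floor of each
    coordinate.\<close>
  define m where "m = int CARD('n) + 1"
  define e :: "(int ^ 'n) \<Rightarrow> ('n \<Rightarrow> int) \<Rightarrow> real ^ 'n" where "e c f = (\<chi> i. of_int (c $ i + f i))" for c f
  define T where "T = (PiE UNIV (\<lambda>_. {-m..m}) :: ('n \<Rightarrow> int) set)"
  have T: "finite T" "T \<noteq> {}" by (auto simp: T_def m_def PiE_eq_empty_iff intro!: finite_PiE)
  let ?S = "range (e 0)" and ?\<rho> = "real CARD('n)"
  have cover: "\<exists>a\<in>?S. x \<in> cball a ?\<rho>" for x :: "real ^ 'n"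
  proof (rule bexI)
    let ?a = "e 0 (\<lambda>i. \<lfloor>x $ i\<rfloor>)"
    have "norm (?a - x) \<le> (\<Sum>i\<in>UNIV. \<bar>(?a - x) $ i\<bar>)" by (rule norm_le_l1_cart)
    also have "\<dots> \<le> (\<Sum>i\<in>(UNIV::'n set). 1)"
      by (intro sum_mono) (auto simp: e_def abs_le_iff, linarith+)
    finally show "x \<in> cball ?a ?\<rho>" by (simp add: dist_norm)
  qed simp
  have mult: "{a \<in> ?S. x \<in> cball a ?\<rho>} \<subseteq> e (\<chi> i. \<lfloor>x $ i\<rfloor>) ` T" for x :: "real ^ 'n"
  proof
    fix a assume "a \<in> {a \<in> ?S. x \<in> cball a ?\<rho>}"
    then obtain f where f: "a = e 0 f" "norm (a - x) \<le> ?\<rho>" by (auto simp: dist_norm)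
    have "f i - \<lfloor>x $ i\<rfloor> \<in> {-m..m}" for i
    proof -
      have "\<bar>real_of_int (f i) - x $ i\<bar> \<le> ?\<rho>"
        using component_le_norm_cart[of "a - x" i] f by (simp add: e_def)
      then show ?thesis unfolding m_def atLeastAtMost_iff by linarith
    qed
    then have "(\<lambda>i. f i - \<lfloor>x $ i\<rfloor>) \<in> T" by (auto simp: T_def)
    moreover have "a = e (\<chi> i. \<lfloor>x $ i\<rfloor>) (\<lambda>i. f i - \<lfloor>x $ i\<rfloor>)" by (simp add: f e_def)
    ultimately show "a \<in> e (\<chi> i. \<lfloor>x $ i\<rfloor>) ` T" by blast
  qed
  have "ball_covering ?S ?\<rho> (card T)"
    unfolding ball_covering_def
  proof (intro conjI allI)
    show "(\<Union>a\<in>?S. cball a ?\<rho>) = UNIV" using cover by blast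
    fix x :: "real ^ 'n"
    show "finite {a \<in> ?S. x \<in> cball a ?\<rho>}" using finite_subset[OF mult] T by blast
    show "card {a \<in> ?S. x \<in> cball a ?\<rho>} \<le> card T"
      using card_mono[OF finite_imageI[OF T(1)] mult] card_image_le[OF T(1)] order_trans by blast
  qed (auto simp: uncountable_def)
  then show thesis using that T by (metis card_gt_0_iff)
qed

theorem theorem1p1:
  fixes \<gamma> :: real
  assumes "CARD('n::finite) \<ge> 3" and "0 < \<gamma>" and "\<gamma> < 1"
  shows
    "(\<exists>c>0. \<exists>C>0. \<forall>\<Omega> :: (real ^ 'n) set. open \<Omega> \<longrightarrow> two_sided_bound \<gamma> \<Omega> c C) \<and>
     (\<exists>N>0. \<exists>(S :: (real ^ 'n) set) \<rho>. ball_covering S \<rho> N) \<and>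
     (\<forall>N>0. (\<exists>(S :: (real ^ 'n) set) \<rho>. ball_covering S \<rho> N) \<longrightarrow>
        (\<forall>\<Omega> :: (real ^ 'n) set. open \<Omega> \<longrightarrow>
           two_sided_bound \<gamma> \<Omega> (lower_const \<gamma> CARD('n) N) (upper_const \<gamma> CARD('n))))"
proof -
  have n: "3 \<le> DIM(real ^ 'n)" using assms(1) by simp
  have bounds: "two_sided_bound \<gamma> \<Omega> (lower_const \<gamma> CARD('n) N) (upper_const \<gamma> CARD('n))"
    if "0 < N" "ball_covering S \<rho> N" "open \<Omega>" for N \<rho> and S \<Omega> :: "(real ^ 'n) set"
    unfolding two_sided_bound_def
    using lower_bound[OF n assms(2,3) that(3,1,2)] upper_bound[OF n assms(2,3) that(3)] by simp
  \<comment> \<open>One covering is enough for the existential constants: \<open>lower_const\<close>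
    for its multiplicity, and \<open>upper_const\<close>.\<close>
  obtain S :: "(real ^ 'n) set" and \<rho> N where S: "0 < N" "ball_covering S \<rho> N" by (rule lattice_covering)
  have n3: "3 \<le> real CARD('n)" using assms(1) by simp
  have "0 < kappa \<gamma> CARD('n)" by (rule kappa_bounds(1)[OF n3 assms(2,3) kappa_def])
  then have C: "0 < upper_const \<gamma> CARD('n)" using assms(3) by (simp add: upper_const_def)
  have "0 < (real CARD('n))\<^sup>2 - 2" using power_mono[OF n3, of 2] by simp
  then have c: "0 < lower_const \<gamma> CARD('n) N"
    unfolding lower_const_def using assms(2) n3 S(1) by (intro divide_pos_pos mult_pos_pos) auto
  show ?thesis using bounds S c C by blast
qed

end
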